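(* Let $\Phi\in M_1(\mathbf{k})$. For any parenthesized word $O$ with $n+1$ letters, the morphism $\tilde\mu_O:\mathrm{PB}_{n+1}\to\exp(\hat{\mathfrak t}_{n+1})$ restricts to a morphism $\mu_O:F_n\to\exp(\hat{\mathfrak f}_n)$, which extends to an isomorphism $\mu_O:F_n(\mathbf{k})\to\exp(\hat{\mathfrak f}_n)$. The composition of $\mu_O$ with the isomorphism $\exp(\hat{\mathfrak f}_n)\to F_n(\mathbf{k})$, $\exp(x_i)\mapsto X_i$, is a tangential automorphism of $\exp(\hat{\mathfrak f}_n)$, i.e. an element of $\mathrm{TAut}_n$.
   Context: $\mathbf{k}$ is a field of characteristic $0$. $\mathfrak t_m$ is the Lie algebra generated by $t_{ij}$ ($i\ne j$ in an index set of $m$ elements) with $t_{ji}=t_{ij}$, $[t_{ij},t_{ik}+t_{jk}]=0$ ($i,j,k$ distinct), $[t_{ij},t_{kl}]=0$ ($i,j,k,l$ distinct); $\hat{\mathfrak t}_m$ its degree completion; for disjoint index subsets $I_1,\dots,I_m$, $a\mapsto a^{I_1,\dots,I_m}$ is the morphism $t_{ij}\mapsto\sum_{i'\in I_i,j'\in I_j}t_{i'j'}$. $M_1(\mathbf{k})$ is the set of $\Phi=\Phi(t_{12},t_{23})\in\exp(\hat{\mathfrak t}_3)$ ($\Phi(a,b)$ in the exponential of the completed free Lie algebra on $a,b$) with $\Phi^{3,2,1}=\Phi^{-1}$, $e^{t_{23}/2}\Phi^{1,2,3}e^{t_{12}/2}\Phi^{3,1,2}e^{t_{31}/2}\Phi^{2,3,1}=e^{(t_{12}+t_{23}+t_{31})/2}$,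 $\Phi^{2,3,4}\Phi^{1,23,4}\Phi^{1,2,3}=\Phi^{1,2,34}\Phi^{12,3,4}$. $B_{n+1}$ is the braid group with Artin generators $\sigma_0,\dots,\sigma_{n-1}$, strands indexed by $0,\dots,n$; $\mathrm{PB}_{n+1}$ is the pure braid group, $x_{ij}=(\sigma_{j-2}\cdots\sigma_i)^{-1}\sigma_{j-1}^2(\sigma_{j-2}\cdots\sigma_i)$ for $0\le i<j\le n$. The elements $X_i:=x_{0i}$, $i=1,\dots,n$, freely generate a normal free subgroup $F_n\subset\mathrm{PB}_{n+1}$; with $\mathfrak t_{n+1}$ indexed by $0,\dots,n$, the elements $x_i:=t_{0i}$ freely generate a Lie ideal $\mathfrak f_n\subset\mathfrak t_{n+1}$, with degree completion $\hat{\mathfrak f}_n$. $F_n(\mathbf{k})$ is the prounipotent completion of $F_n$. $\mathrm{TAut}_n$ is the group of automorphisms of $\hat{\mathfrak f}_n$ (equivalently of $\exp(\hat{\mathfrak f}_n)$) of the form $x_k\mapsto U_kx_kU_k^{-1}$, $U_k\in\exp(\hat{\mathfrak f}_n)$. **The maps $\tilde\mu_O$.** For $O,O'$ parenthesized words of length $n+1$ (letters $0,\dots,n$), $\Phi_{O,O'}\in\exp(\hat{\mathfrak t}_{n+1})$ is the unique family with $\Phi_{O',O''}\Phi_{O,O'}=\Phi_{O,O''}$ and $\Phi_{O,O'}=\Phi^{I_1,I_2,I_3}$ if $O'$ is obtained from $O$ by replacing a sub-parenthesized word $(O_1O_2)O_3$ by $O_1(O_2O_3)$, $I_k$ being the set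 of letters of $O_k$. For the right parenthesization $R=\bullet(\bullet(\cdots(\bullet\bullet)))$, $\tilde\mu_R:B_{n+1}\to\exp(\hat{\mathfrak t}_{n+1})\rtimes S_{n+1}$ is the morphism $\sigma_i\mapsto\Phi^{i,i+1,i+2\dots n}e^{t_{i,i+1}/2}s_i(\Phi^{i,i+1,i+2\dots n})^{-1}$ ($s_i$ the transposition $(i,i+1)$, $st_{ij}s^{-1}=t_{s(i)s(j)}$; the factor $\Phi$ is $1$ for $i=n-1$), and $\tilde\mu_O(b)=\Phi_{R,O}\tilde\mu_R(b)\Phi_{R,O}^{-1}$. (Equivalently, $\tilde\mu_O$ is induced by the braided monoidal functor from parenthesized braids to parenthesized chord diagrams defined by $\Phi$.) It commutes with the projections to $S_{n+1}$, hence restricts to $\tilde\mu_O:\mathrm{PB}_{n+1}\to\exp(\hat{\mathfrak t}_{n+1})$. *)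

theory Defs
  imports
    "HOL-Algebra.Generated_Groups"
    "HOL-Library.Poly_Mapping"
    "HOL-Combinatorics.Permutations"
begin

section \<open>Noncommutative formal power series\<close>

typedef (overloaded) ('a, 'k) nc_series = "UNIV :: ('a list \<Rightarrow> 'k) set"
  morphisms coeff Nc_series by simp

setup_lifting type_definition_nc_series

lemma nc_series_eqI: "(\<And>w. coeff f w = coeff g w) \<Longrightarrow> f = g"
  by transfer auto

instantiation nc_series :: (type, comm_ring_1) ring_1
begin

lift_definition zero_nc_series :: "('a, 'b) nc_series" is "\<lambda>_. 0" .
lift_definition one_nc_series :: "('a, 'b) nc_series" is "\<lambda>w. if w = [] then 1 else 0" .
lift_definition plus_nc_series :: "('a, 'b) nc_series \<Rightarrow> ('a, 'b) nc_series \<Rightarrow> ('a, 'b) nc_series"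
  is "\<lambda>f g w. f w + g w" .
lift_definition minus_nc_series :: "('a, 'b) nc_series \<Rightarrow> ('a, 'b) nc_series \<Rightarrow> ('a, 'b) nc_series"
  is "\<lambda>f g w. f w - g w" .
lift_definition uminus_nc_series :: "('a, 'b) nc_series \<Rightarrow> ('a, 'b) nc_series"
  is "\<lambda>f w. - f w" .
lift_definition times_nc_series :: "('a, 'b) nc_series \<Rightarrow> ('a, 'b) nc_series \<Rightarrow> ('a, 'b) nc_series"
  is "\<lambda>f g w. \<Sum>i\<le>length w. f (take i w) * g (drop i w)" .

instance
proof
  fix a b c :: "('a, 'b) nc_series"
  show "a * b * c = a * (b * c)"
  proof (rule nc_series_eqI)
    fix w :: "'a list"
    let ?n = "length w"
    let ?h = "\<lambda>j l. coeff a (take j w) * coeff b (take l (drop j w)) * coeff c (drop (j + l) w)"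
    have "coeff (a * b * c) w = (\<Sum>i\<le>?n. \<Sum>j\<le>i. ?h j (i - j))"
      unfolding times_nc_series.rep_eq sum_distrib_right
      by (intro sum.cong refl) (auto simp: drop_take min_def)
    also have "\<dots> = (\<Sum>(i, j) \<in> (SIGMA i:{..?n}. {..i}). ?h j (i - j))"
      by (rule sum.Sigma) auto
    also have "\<dots> = (\<Sum>(j, l) \<in> (SIGMA j:{..?n}. {..?n - j}). ?h j l)"
      by (rule sum.reindex_bij_witness[where i = "\<lambda>(j, l). (j + l, j)" and j = "\<lambda>(i, j). (j, i - j)"])
        auto
    also have "\<dots> = (\<Sum>j\<le>?n. \<Sum>l\<le>?n - j. ?h j l)"
      by (rule sum.Sigma [symmetric]) auto
    also have "\<dots> = coeff (a * (b * c)) w"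
      by (simp add: times_nc_series.rep_eq sum_distrib_left mult.assoc add.commute)
    finally show "coeff (a * b * c) w = coeff (a * (b * c)) w" .
  qed
  show "1 * a = a"
  proof (rule nc_series_eqI)
    fix w :: "'a list"
    have "coeff (1 * a) w = (\<Sum>i\<in>{0}. (if take i w = [] then 1 else 0) * coeff a (drop i w))"
      unfolding times_nc_series.rep_eq one_nc_series.rep_eq
      by (rule sum.mono_neutral_right) auto
    then show "coeff (1 * a) w = coeff a w" by simp
  qed
  show "a * 1 = a"
  proof (rule nc_series_eqI)
    fix w
    have "coeff (a * 1) w = (\<Sum>i\<in>{length w}. coeff a (take i w) * (if drop i w = [] then 1 else 0))"
      unfolding times_nc_series.rep_eq one_nc_series.rep_eq
      by (rule sum.mono_neutral_right) auto
    then show "coeff (a * 1) w = coeff a w" by simp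
  qed
  show "(a + b) * c = a * c + b * c" "a * (b + c) = a * b + a * c"
    by (transfer, auto simp: algebra_simps sum.distrib)+
  show "a + b + c = a + (b + c)" "a + b = b + a" "0 + a = a" "- a + a = 0" "a - b = a + - b"
    by (transfer, auto simp: algebra_simps)+
  show "(0 :: ('a, 'b) nc_series) \<noteq> 1"
    by transfer (metis zero_neq_one)
qed

end

lift_definition nc_var :: "'a \<Rightarrow> ('a, 'k::field_char_0) nc_series"
  is "\<lambda>a w. if w = [a] then 1 else 0" .

lift_definition nc_scale :: "'k::field_char_0 \<Rightarrow> ('a, 'k) nc_series \<Rightarrow> ('a, 'k) nc_series"
  is "\<lambda>c f w. c * f w" .

lift_definition nc_part :: "nat \<Rightarrow> ('a, 'k::field_char_0) nc_series \<Rightarrow> ('a, 'k) nc_series"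
  is "\<lambda>d f w. if length w = d then f w else 0" .

text \<open>The truncations in the next three definitions are harmless when the series to which they
  are applied (\<open>f\<close> for the exponential, \<open>g - 1\<close> for the logarithm, every \<open>s a\<close> for the
  substitution) have no constant term; this is the only situation in which they are used.
  \<open>nc_subst A s\<close> is the continuous algebra morphism from series in a finite alphabet
  \<open>A\<close> that replaces each letter \<open>a\<close> by \<open>s a\<close>.\<close>

definition nc_exp :: "('a, 'k::field_char_0) nc_series \<Rightarrow> ('a, 'k) nc_series" where
  "nc_exp f = Nc_series (\<lambda>w. \<Sum>m\<le>length w. coeff (f ^ m) w / fact m)"

definition nc_log :: "('a, 'k::field_char_0) nc_series \<Rightarrow> ('a, 'k) nc_series" where
  "nc_log g = Nc_series (\<lambda>w. \<Sum>m=1..length w. (- 1) ^ (m + 1) / of_nat m * coeff ((g - 1) ^ m) w)"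

definition nc_subst ::
  "'a set \<Rightarrow> ('a \<Rightarrow> ('b, 'k::field_char_0) nc_series) \<Rightarrow> ('a, 'k) nc_series \<Rightarrow> ('b, 'k) nc_series" where
  "nc_subst A s f = Nc_series (\<lambda>w. \<Sum>v\<in>{v. set v \<subseteq> A \<and> length v \<le> length w}.
      coeff f v * coeff (prod_list (map s v)) w)"

definition commutator :: "('a, 'k::field_char_0) nc_series \<Rightarrow> ('a, 'k) nc_series \<Rightarrow> ('a, 'k) nc_series" where
  "commutator f g = f * g - g * f"

definition bch :: "('a, 'k::field_char_0) nc_series \<Rightarrow> ('a, 'k) nc_series \<Rightarrow> ('a, 'k) nc_series" where
  "bch u v = nc_log (nc_exp u * nc_exp v)"

text \<open>The free Lie algebra on \<open>A\<close>, realised inside the free associative algebra, and its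
  degree completion.\<close>

inductive_set lie_poly :: "'a set \<Rightarrow> ('a, 'k::field_char_0) nc_series set" for A where
  "0 \<in> lie_poly A"
| "a \<in> A \<Longrightarrow> nc_var a \<in> lie_poly A"
| "u \<in> lie_poly A \<Longrightarrow> v \<in> lie_poly A \<Longrightarrow> u + v \<in> lie_poly A"
| "u \<in> lie_poly A \<Longrightarrow> nc_scale c u \<in> lie_poly A"
| "u \<in> lie_poly A \<Longrightarrow> v \<in> lie_poly A \<Longrightarrow> commutator u v \<in> lie_poly A"

definition lie_series :: "'a set \<Rightarrow> ('a, 'k::field_char_0) nc_series set" where
  "lie_series A = {u. \<forall>d. nc_part d u \<in> lie_poly A}"


section \<open>The Lie algebras \<open>t\<close> and their degree completions\<close>

definition kd_gens :: "nat set \<Rightarrow> (nat \<times> nat) set" where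
  "kd_gens S = {(i, j). i \<in> S \<and> j \<in> S \<and> i \<noteq> j}"

definition tgen :: "nat \<Rightarrow> nat \<Rightarrow> (nat \<times> nat, 'k::field_char_0) nc_series" where
  "tgen i j = nc_var (i, j)"

inductive_set kd_ideal :: "nat set \<Rightarrow> (nat \<times> nat, 'k::field_char_0) nc_series set" for S where
  symm: "{i, j} \<subseteq> S \<Longrightarrow> distinct [i, j] \<Longrightarrow> tgen i j - tgen j i \<in> kd_ideal S"
| rel3: "{i, j, k} \<subseteq> S \<Longrightarrow> distinct [i, j, k] \<Longrightarrow>
    commutator (tgen i j) (tgen i k + tgen j k) \<in> kd_ideal S"
| rel4: "{i, j, k, l} \<subseteq> S \<Longrightarrow> distinct [i, j, k, l] \<Longrightarrow>
    commutator (tgen i j) (tgen k l) \<in> kd_ideal S"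
| zero: "0 \<in> kd_ideal S"
| add: "u \<in> kd_ideal S \<Longrightarrow> v \<in> kd_ideal S \<Longrightarrow> u + v \<in> kd_ideal S"
| scale: "u \<in> kd_ideal S \<Longrightarrow> nc_scale c u \<in> kd_ideal S"
| bracket: "u \<in> lie_poly (kd_gens S) \<Longrightarrow> v \<in> kd_ideal S \<Longrightarrow> commutator u v \<in> kd_ideal S"

definition kd_ideal_hat :: "nat set \<Rightarrow> (nat \<times> nat, 'k::field_char_0) nc_series set" where
  "kd_ideal_hat S = {u. \<forall>d. nc_part d u \<in> kd_ideal S}"

type_synonym 'k kd = "(nat \<times> nat, 'k) nc_series set"

definition kd_rel :: "nat set \<Rightarrow> ((nat \<times> nat, 'k::field_char_0) nc_series \<times> (nat \<times> nat, 'k) nc_series) set" where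
  "kd_rel S = {(u, v). u \<in> lie_series (kd_gens S) \<and> v \<in> lie_series (kd_gens S) \<and> u - v \<in> kd_ideal_hat S}"

definition kd_class :: "nat set \<Rightarrow> (nat \<times> nat, 'k::field_char_0) nc_series \<Rightarrow> 'k kd" where
  "kd_class S u = kd_rel S `` {u}"

text \<open>Elements of the degree completion of \<open>t\<close> on the index set \<open>S\<close> are residue classes of
  Lie series; operations on them are induced by operations on representatives.\<close>

definition kd_hat :: "nat set \<Rightarrow> 'k::field_char_0 kd set" where
  "kd_hat S = lie_series (kd_gens S) // kd_rel S"

definition kd_lift ::
  "nat set \<Rightarrow> ((nat \<times> nat, 'k::field_char_0) nc_series \<Rightarrow> (nat \<times> nat, 'k) nc_series) \<Rightarrow> 'k kd \<Rightarrow> 'k kd" where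
  "kd_lift S f X = (\<Union>u\<in>X. kd_class S (f u))"

definition kd_lift2 ::
  "nat set \<Rightarrow> ((nat \<times> nat, 'k::field_char_0) nc_series \<Rightarrow> (nat \<times> nat, 'k) nc_series \<Rightarrow> (nat \<times> nat, 'k) nc_series)
    \<Rightarrow> 'k kd \<Rightarrow> 'k kd \<Rightarrow> 'k kd" where
  "kd_lift2 S f X Y = (\<Union>u\<in>X. \<Union>v\<in>Y. kd_class S (f u v))"

text \<open>The morphism \<open>t\<^sub>i\<^sub>j \<mapsto> \<Sum> t\<^sub>i\<^sub>'\<^sub>j\<^sub>'\<close> (sum over \<open>i' \<in> I i\<close>, \<open>j' \<in> I j\<close>) from the index set \<open>S\<close>
  to the index set \<open>T\<close>.\<close>

definition kd_map :: "nat set \<Rightarrow> nat set \<Rightarrow> (nat \<Rightarrow> nat set) \<Rightarrow> 'k::field_char_0 kd \<Rightarrow> 'k kd" where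
  "kd_map S T I = kd_lift T (nc_subst (kd_gens S) (\<lambda>(i, j). \<Sum>i'\<in>I i. \<Sum>j'\<in>I j. tgen i' j'))"

text \<open>\<open>insertion T [I\<^sub>1, \<dots>, I\<^sub>m] a\<close> is \<open>a\<close> with upper indices \<open>I\<^sub>1, \<dots>, I\<^sub>m\<close>, for
  \<open>a\<close> with index set \<open>{1..m}\<close>.\<close>

definition insertion :: "nat set \<Rightarrow> nat set list \<Rightarrow> 'k::field_char_0 kd \<Rightarrow> 'k kd" where
  "insertion T Is = kd_map {1..length Is} T (\<lambda>i. Is ! (i - 1))"


section \<open>Prounipotent groups\<close>

text \<open>A prounipotent group is given by the group of its \<open>k\<close>-points, with the operations
  \<open>g \<mapsto> g\<^sup>c = exp (c log g)\<close> for \<open>c\<close> in \<open>k\<close> and a filtration by normal subgroups defining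
  its topology. Over a field of characteristic zero, the morphisms are the continuous group morphisms
  compatible with these operations: under the logarithm they correspond to the continuous \<open>k\<close>-linear
  morphisms of Lie algebras. (For \<open>k\<close> larger than the rationals, an abstract group
  morphism need not be \<open>k\<close>-linear on Lie algebras.)\<close>

record ('g, 'k) prounip = "'g monoid" +
  kpow :: "'k \<Rightarrow> 'g \<Rightarrow> 'g"
  fil :: "nat \<Rightarrow> 'g set"

definition prounip_hom :: "('g, 'k) prounip \<Rightarrow> ('h, 'k) prounip \<Rightarrow> ('g \<Rightarrow> 'h) set" where
  "prounip_hom G H = {f \<in> hom G H.
     (\<forall>c. \<forall>g\<in>carrier G. f (kpow G c g) = kpow H c (f g)) \<and>
     (\<forall>N. \<exists>M. f ` fil G M \<subseteq> fil H N)}"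

definition prounip_iso :: "('g, 'k) prounip \<Rightarrow> ('h, 'k) prounip \<Rightarrow> ('g \<Rightarrow> 'h) set" where
  "prounip_iso G H = {f \<in> prounip_hom G H.
     bij_betw f (carrier G) (carrier H) \<and> the_inv_into (carrier G) f \<in> prounip_hom H G}"

text \<open>The group \<open>exp\<close> of the completed Lie algebra: its elements are represented by their
  logarithms, with the Baker--Campbell--Hausdorff product. Thus \<open>kd_class S u\<close>, as an element of
  this group, is the exponential of the class of \<open>u\<close>; we write it \<open>kd_exp S u\<close>.\<close>

definition kd_exp :: "nat set \<Rightarrow> (nat \<times> nat, 'k::field_char_0) nc_series \<Rightarrow> 'k kd" where
  "kd_exp S u = kd_class S u"

definition exp_t :: "nat set \<Rightarrow> ('k::field_char_0 kd, 'k) prounip" where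
  "exp_t S = \<lparr>carrier = kd_hat S, monoid.mult = kd_lift2 S bch, one = kd_class S 0,
     kpow = (\<lambda>c. kd_lift S (nc_scale c)),
     fil = (\<lambda>N. {X \<in> kd_hat S. \<exists>u\<in>X. \<forall>d<N. nc_part d u = 0})\<rparr>"

definition f_hat :: "nat \<Rightarrow> 'k::field_char_0 kd set" where
  "f_hat n = kd_class {0..n} ` lie_series ((\<lambda>i. (0, i)) ` {1..n})"

definition exp_f :: "nat \<Rightarrow> ('k::field_char_0 kd, 'k) prounip" where
  "exp_f n = (exp_t {0..n})\<lparr>carrier := f_hat n, fil := (\<lambda>N. fil (exp_t {0..n}) N \<inter> f_hat n)\<rparr>"

text \<open>Since \<open>exp_f n\<close> has \<open>f_hat n\<close> as its carrier, an automorphism of \<open>f_hat n\<close> and the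
  automorphism of the group it induces are the same map. The last clause says
  \<open>x\<^sub>k \<mapsto> U\<^sub>k x\<^sub>k U\<^sub>k\<^sup>-\<^sup>1\<close> with \<open>U\<^sub>k\<close> the exponential of the class \<open>U\<close>.\<close>

definition TAut :: "nat \<Rightarrow> ('k::field_char_0 kd \<Rightarrow> 'k kd) set" where
  "TAut n = {\<theta>. bij_betw \<theta> (f_hat n) (f_hat n) \<and>
     (\<forall>X\<in>f_hat n. \<forall>Y\<in>f_hat n. \<theta> (kd_lift2 {0..n} (+) X Y) = kd_lift2 {0..n} (+) (\<theta> X) (\<theta> Y)) \<and>
     (\<forall>c. \<forall>X\<in>f_hat n. \<theta> (kd_lift {0..n} (nc_scale c) X) = kd_lift {0..n} (nc_scale c) (\<theta> X)) \<and>
     (\<forall>X\<in>f_hat n. \<forall>Y\<in>f_hat n.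
        \<theta> (kd_lift2 {0..n} commutator X Y) = kd_lift2 {0..n} commutator (\<theta> X) (\<theta> Y)) \<and>
     (\<forall>N. \<exists>M. \<theta> ` fil (exp_f n) M \<subseteq> fil (exp_f n) N) \<and>
     (\<forall>N. \<exists>M. the_inv_into (f_hat n) \<theta> ` fil (exp_f n) M \<subseteq> fil (exp_f n) N) \<and>
     (\<forall>k\<in>{1..n}. \<exists>U\<in>f_hat n. \<theta> (kd_class {0..n} (tgen 0 k)) =
        kd_lift2 {0..n} (\<lambda>u x. nc_exp u * x * nc_exp (- u)) U (kd_class {0..n} (tgen 0 k)))}"


section \<open>Prounipotent completion\<close>

text \<open>The prounipotent completion of a group \<open>G\<close> is the group of group-like elements of the
  completion of the Hopf algebra \<open>k[G]\<close> at its augmentation ideal \<open>I\<close>. Elements of \<open>k[G]\<close> are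
  finitely supported functions; an element of the completion is a compatible sequence \<open>X\<close> of
  residue classes \<open>X m\<close> modulo \<open>I\<^sup>m\<^sup>+\<^sup>1\<close>. The completed tensor square of \<open>k[G]\<close> is the completion of
  \<open>k[G \<times> G]\<close> at its own augmentation ideal.\<close>

definition galg :: "('g, 'b) monoid_scheme \<Rightarrow> ('g \<Rightarrow>\<^sub>0 'k::field_char_0) set" where
  "galg G = {f. Poly_Mapping.keys f \<subseteq> carrier G}"

definition gconv :: "('g, 'b) monoid_scheme \<Rightarrow> ('g \<Rightarrow>\<^sub>0 'k::field_char_0) \<Rightarrow> ('g \<Rightarrow>\<^sub>0 'k) \<Rightarrow> ('g \<Rightarrow>\<^sub>0 'k)" where
  "gconv G f h = (\<Sum>x\<in>Poly_Mapping.keys f. \<Sum>y\<in>Poly_Mapping.keys h.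
     Poly_Mapping.single (x \<otimes>\<^bsub>G\<^esub> y) (Poly_Mapping.lookup f x * Poly_Mapping.lookup h y))"

definition gone :: "('g, 'b) monoid_scheme \<Rightarrow> ('g \<Rightarrow>\<^sub>0 'k::field_char_0)" where
  "gone G = Poly_Mapping.single \<one>\<^bsub>G\<^esub> 1"

definition aug :: "('g \<Rightarrow>\<^sub>0 'k::field_char_0) \<Rightarrow> 'k" where
  "aug f = (\<Sum>x\<in>Poly_Mapping.keys f. Poly_Mapping.lookup f x)"

definition gtensor :: "('g \<Rightarrow>\<^sub>0 'k::field_char_0) \<Rightarrow> ('h \<Rightarrow>\<^sub>0 'k) \<Rightarrow> ('g \<times> 'h \<Rightarrow>\<^sub>0 'k)" where
  "gtensor f h = (\<Sum>x\<in>Poly_Mapping.keys f. \<Sum>y\<in>Poly_Mapping.keys h. Poly_Mapping.single (x, y) (Poly_Mapping.lookup f x * Poly_Mapping.lookup h y))"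

definition gcoprod :: "('g \<Rightarrow>\<^sub>0 'k::field_char_0) \<Rightarrow> ('g \<times> 'g \<Rightarrow>\<^sub>0 'k)" where
  "gcoprod f = (\<Sum>x\<in>Poly_Mapping.keys f. Poly_Mapping.single (x, x) (Poly_Mapping.lookup f x))"

inductive in_aug_pow :: "('g, 'b) monoid_scheme \<Rightarrow> nat \<Rightarrow> ('g \<Rightarrow>\<^sub>0 'k::field_char_0) \<Rightarrow> bool"
  for G where
  base: "f \<in> galg G \<Longrightarrow> in_aug_pow G 0 f"
| zero: "in_aug_pow G m 0"
| add: "in_aug_pow G m f \<Longrightarrow> in_aug_pow G m h \<Longrightarrow> in_aug_pow G m (f + h)"
| mult: "f \<in> galg G \<Longrightarrow> aug f = 0 \<Longrightarrow> in_aug_pow G m h \<Longrightarrow> in_aug_pow G (Suc m) (gconv G f h)"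

definition aug_pow :: "('g, 'b) monoid_scheme \<Rightarrow> nat \<Rightarrow> ('g \<Rightarrow>\<^sub>0 'k::field_char_0) set" where
  "aug_pow G m = {f. in_aug_pow G m f}"

definition gclass :: "('g, 'b) monoid_scheme \<Rightarrow> nat \<Rightarrow> ('g \<Rightarrow>\<^sub>0 'k::field_char_0) \<Rightarrow> ('g \<Rightarrow>\<^sub>0 'k) set" where
  "gclass G m f = {h \<in> galg G. h - f \<in> aug_pow G m}"

definition completion_carrier :: "('g, 'b) monoid_scheme \<Rightarrow> (nat \<Rightarrow> ('g \<Rightarrow>\<^sub>0 'k::field_char_0) set) set" where
  "completion_carrier G = {X.
     (\<forall>m. X m \<in> gclass G (Suc m) ` galg G) \<and> (\<forall>m. X (Suc m) \<subseteq> X m) \<and>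
     (\<forall>m. \<forall>f\<in>X m. aug f = 1 \<and> gcoprod f - gtensor f f \<in> aug_pow (G \<times>\<times> G) (Suc m))}"

text \<open>\<open>kpow\<close> is the binomial series \<open>X\<^sup>c = \<Sum>\<^sub>j (c gchoose j) (X - 1)\<^sup>j\<close>, whose terms with
  \<open>j > m\<close> vanish modulo \<open>I\<^sup>m\<^sup>+\<^sup>1\<close>.\<close>

definition completion :: "('g, 'b) monoid_scheme \<Rightarrow> (nat \<Rightarrow> ('g \<Rightarrow>\<^sub>0 'k::field_char_0) set, 'k) prounip" where
  "completion G = \<lparr>carrier = completion_carrier G,
     monoid.mult = (\<lambda>X Y m. \<Union>f\<in>X m. \<Union>h\<in>Y m. gclass G (Suc m) (gconv G f h)),
     one = (\<lambda>m. gclass G (Suc m) (gone G)),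
     kpow = (\<lambda>c X m. \<Union>f\<in>X m. gclass G (Suc m)
       (\<Sum>j\<le>m. Poly_Mapping.map ((*) (c gchoose j)) ((gconv G (f - gone G) ^^ j) (gone G)))),
     fil = (\<lambda>N. {X \<in> completion_carrier G. \<forall>m<N. X m = gclass G (Suc m) (gone G)})\<rparr>"

definition to_completion :: "('g, 'b) monoid_scheme \<Rightarrow> 'g \<Rightarrow> nat \<Rightarrow> ('g \<Rightarrow>\<^sub>0 'k::field_char_0) set" where
  "to_completion G g = (\<lambda>m. gclass G (Suc m) (Poly_Mapping.single g 1))"


section \<open>Braid groups\<close>

text \<open>Groups given by generators and relations: a word is a list of letters \<open>(a, True)\<close> for the
  generator \<open>a\<close> and \<open>(a, False)\<close> for its inverse.\<close>

inductive pres_eq :: "'a set \<Rightarrow> (('a \<times> bool) list \<times> ('a \<times> bool) list) set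
    \<Rightarrow> ('a \<times> bool) list \<Rightarrow> ('a \<times> bool) list \<Rightarrow> bool" for A R where
  refl: "u \<in> lists (A \<times> UNIV) \<Longrightarrow> pres_eq A R u u"
| sym: "pres_eq A R u v \<Longrightarrow> pres_eq A R v u"
| trans: "pres_eq A R u v \<Longrightarrow> pres_eq A R v w \<Longrightarrow> pres_eq A R u w"
| cancel: "u \<in> lists (A \<times> UNIV) \<Longrightarrow> v \<in> lists (A \<times> UNIV) \<Longrightarrow> a \<in> A \<Longrightarrow>
    pres_eq A R (u @ [(a, b), (a, \<not> b)] @ v) (u @ v)"
| rel: "u \<in> lists (A \<times> UNIV) \<Longrightarrow> v \<in> lists (A \<times> UNIV) \<Longrightarrow> (r, s) \<in> R \<Longrightarrow>
    r \<in> lists (A \<times> UNIV) \<Longrightarrow> s \<in> lists (A \<times> UNIV) \<Longrightarrow> pres_eq A R (u @ r @ v) (u @ s @ v)"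

definition pres_class :: "'a set \<Rightarrow> (('a \<times> bool) list \<times> ('a \<times> bool) list) set
    \<Rightarrow> ('a \<times> bool) list \<Rightarrow> ('a \<times> bool) list set" where
  "pres_class A R u = {v. pres_eq A R u v}"

definition presented_group :: "'a set \<Rightarrow> (('a \<times> bool) list \<times> ('a \<times> bool) list) set
    \<Rightarrow> ('a \<times> bool) list set monoid" where
  "presented_group A R = \<lparr>carrier = pres_class A R ` lists (A \<times> UNIV),
     monoid.mult = (\<lambda>X Y. \<Union>u\<in>X. \<Union>v\<in>Y. pres_class A R (u @ v)), one = pres_class A R []\<rparr>"

definition braid_rels :: "nat \<Rightarrow> ((nat \<times> bool) list \<times> (nat \<times> bool) list) set" where
  "braid_rels n =
     {([(i, True), (Suc i, True), (i, True)], [(Suc i, True), (i, True), (Suc i, True)]) | i. Suc i < n} \<union>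
     {([(i, True), (j, True)], [(j, True), (i, True)]) | i j. Suc i < j \<and> j < n}"

text \<open>The argument \<open>n\<close> below refers to braids on \<open>n + 1\<close> strands, numbered \<open>0, \<dots>, n\<close>.\<close>

type_synonym braid = "(nat \<times> bool) list set"

definition braid_group :: "nat \<Rightarrow> braid monoid" where
  "braid_group n = presented_group {0..<n} (braid_rels n)"

definition braid_class :: "nat \<Rightarrow> (nat \<times> bool) list \<Rightarrow> braid" where
  "braid_class n = pres_class {0..<n} (braid_rels n)"

definition sigma :: "nat \<Rightarrow> nat \<Rightarrow> braid" where
  "sigma n i = braid_class n [(i, True)]"

definition word_perm :: "(nat \<times> bool) list \<Rightarrow> nat \<Rightarrow> nat" where
  "word_perm w = foldr (\<lambda>(i, b) p. transpose i (Suc i) \<circ> p) w id"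

definition pure_braid_group :: "nat \<Rightarrow> braid monoid" where
  "pure_braid_group n =
     (braid_group n)\<lparr>carrier := {b \<in> carrier (braid_group n). \<forall>w\<in>b. word_perm w = id}\<rparr>"

definition pure_gen :: "nat \<Rightarrow> nat \<Rightarrow> nat \<Rightarrow> braid" where
  "pure_gen n i j =
     (let w = braid_class n (map (\<lambda>k. (k, True)) (rev [i..<j - 1]))
      in inv\<^bsub>braid_group n\<^esub> w \<otimes>\<^bsub>braid_group n\<^esub> (sigma n (j - 1) \<otimes>\<^bsub>braid_group n\<^esub> sigma n (j - 1))
           \<otimes>\<^bsub>braid_group n\<^esub> w)"

definition free_subgroup :: "nat \<Rightarrow> braid monoid" where
  "free_subgroup n =
     (pure_braid_group n)\<lparr>carrier := generate (pure_braid_group n) (pure_gen n 0 ` {1..n})\<rparr>"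


section \<open>Associators and the maps they define\<close>

definition M1 :: "'k::field_char_0 kd set" where
  "M1 = {\<Phi> \<in> carrier (exp_t {1..3}).
     (\<exists>\<phi>\<in>lie_series {(1, 2), (2, 3)}. \<Phi> = kd_exp {1..3} \<phi>) \<and>
     (let G = exp_t {1..3}; ins = (\<lambda>Is. insertion {1..3} Is \<Phi>);
          e = (\<lambda>i j. kd_exp {1..3} (nc_scale (1 / 2) (tgen i j)))
      in ins [{3}, {2}, {1}] = inv\<^bsub>G\<^esub> \<Phi> \<and>
         e 2 3 \<otimes>\<^bsub>G\<^esub> ins [{1}, {2}, {3}] \<otimes>\<^bsub>G\<^esub> e 1 2 \<otimes>\<^bsub>G\<^esub> ins [{3}, {1}, {2}] \<otimes>\<^bsub>G\<^esub> e 3 1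
           \<otimes>\<^bsub>G\<^esub> ins [{2}, {3}, {1}]
         = kd_exp {1..3} (nc_scale (1 / 2) (tgen 1 2 + tgen 2 3 + tgen 3 1))) \<and>
     (let G = exp_t {1..4}; ins = (\<lambda>Is. insertion {1..4} Is \<Phi>)
      in ins [{2}, {3}, {4}] \<otimes>\<^bsub>G\<^esub> ins [{1}, {2, 3}, {4}] \<otimes>\<^bsub>G\<^esub> ins [{1}, {2}, {3}]
         = ins [{1}, {2}, {3, 4}] \<otimes>\<^bsub>G\<^esub> ins [{1, 2}, {3}, {4}])}"

datatype pword = Letter nat | Pair pword pword

fun letters :: "pword \<Rightarrow> nat list" where
  "letters (Letter a) = [a]"
| "letters (Pair P Q) = letters P @ letters Q"

definition pwords :: "nat \<Rightarrow> pword set" where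
  "pwords n = {P. letters P = [0..<Suc n]}"

fun right_pword :: "nat \<Rightarrow> nat \<Rightarrow> pword" where
  "right_pword i 0 = Letter i"
| "right_pword i (Suc m) = Pair (Letter i) (right_pword (Suc i) m)"

inductive reassoc :: "pword \<Rightarrow> pword \<Rightarrow> nat set \<Rightarrow> nat set \<Rightarrow> nat set \<Rightarrow> bool" where
  "reassoc (Pair (Pair P1 P2) P3) (Pair P1 (Pair P2 P3))
     (set (letters P1)) (set (letters P2)) (set (letters P3))"
| "reassoc P P' I1 I2 I3 \<Longrightarrow> reassoc (Pair P Q) (Pair P' Q) I1 I2 I3"
| "reassoc P P' I1 I2 I3 \<Longrightarrow> reassoc (Pair Q P) (Pair Q P') I1 I2 I3"

definition assoc_family :: "nat \<Rightarrow> 'k::field_char_0 kd \<Rightarrow> (pword \<Rightarrow> pword \<Rightarrow> 'k kd) \<Rightarrow> bool" where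
  "assoc_family n \<Phi> F \<longleftrightarrow>
     (\<forall>P\<in>pwords n. \<forall>P'\<in>pwords n. F P P' \<in> carrier (exp_t {0..n})) \<and>
     (\<forall>P\<in>pwords n. \<forall>P'\<in>pwords n. \<forall>P''\<in>pwords n. F P' P'' \<otimes>\<^bsub>exp_t {0..n}\<^esub> F P P' = F P P'') \<and>
     (\<forall>P\<in>pwords n. \<forall>P'\<in>pwords n. \<forall>I1 I2 I3.
        reassoc P P' I1 I2 I3 \<longrightarrow> F P P' = insertion {0..n} [I1, I2, I3] \<Phi>)"

text \<open>The semidirect product of \<open>exp\<close> of the completion of \<open>t\<close> on \<open>{0..n}\<close> with the symmetric
  group of \<open>{0..n}\<close>; \<open>(g, s)\<close> stands for \<open>g s\<close>, and \<open>s\<close> acts by \<open>t\<^sub>i\<^sub>j \<mapsto> t\<^sub>s\<^sub>(\<^sub>i\<^sub>)\<^sub>s\<^sub>(\<^sub>j\<^sub>)\<close>.\<close>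

definition exp_t_sym :: "nat \<Rightarrow> ('k::field_char_0 kd \<times> (nat \<Rightarrow> nat)) monoid" where
  "exp_t_sym n = \<lparr>carrier = carrier (exp_t {0..n}) \<times> {s. s permutes {0..n}},
     monoid.mult = (\<lambda>(g, s) (h, r). (g \<otimes>\<^bsub>exp_t {0..n}\<^esub> kd_map {0..n} {0..n} (\<lambda>i. {s i}) h, s \<circ> r)),
     one = (\<one>\<^bsub>exp_t {0..n}\<^esub>, id)\<rparr>"

definition mu_R_morphism ::
  "nat \<Rightarrow> 'k::field_char_0 kd \<Rightarrow> (braid \<Rightarrow> 'k kd \<times> (nat \<Rightarrow> nat)) \<Rightarrow> bool" where
  "mu_R_morphism n \<Phi> \<mu>R \<longleftrightarrow> \<mu>R \<in> hom (braid_group n) (exp_t_sym n) \<and>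
     (\<forall>i<n. let g = (if Suc i = n then \<one>\<^bsub>exp_t {0..n}\<^esub>
                     else insertion {0..n} [{i}, {Suc i}, {i + 2..n}] \<Phi>)
            in \<mu>R (sigma n i) =
               (g, id) \<otimes>\<^bsub>exp_t_sym n\<^esub>
               (kd_exp {0..n} (nc_scale (1 / 2) (tgen i (Suc i))), transpose i (Suc i)) \<otimes>\<^bsub>exp_t_sym n\<^esub>
               inv\<^bsub>exp_t_sym n\<^esub> (g, id))"

definition mu_tilde ::
  "nat \<Rightarrow> (pword \<Rightarrow> pword \<Rightarrow> 'k::field_char_0 kd) \<Rightarrow> (braid \<Rightarrow> 'k kd \<times> (nat \<Rightarrow> nat)) \<Rightarrow> pword
    \<Rightarrow> braid \<Rightarrow> 'k kd \<times> (nat \<Rightarrow> nat)" where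
  "mu_tilde n F \<mu>R P b =
     (F (right_pword 0 n) P, id) \<otimes>\<^bsub>exp_t_sym n\<^esub> \<mu>R b \<otimes>\<^bsub>exp_t_sym n\<^esub>
     inv\<^bsub>exp_t_sym n\<^esub> (F (right_pword 0 n) P, id)"

text \<open>On pure braids the permutation component of \<open>mu_tilde\<close> is the identity.\<close>

definition mu_pure ::
  "nat \<Rightarrow> (pword \<Rightarrow> pword \<Rightarrow> 'k::field_char_0 kd) \<Rightarrow> (braid \<Rightarrow> 'k kd \<times> (nat \<Rightarrow> nat)) \<Rightarrow> pword
    \<Rightarrow> braid \<Rightarrow> 'k kd" where
  "mu_pure n F \<mu>R P b = fst (mu_tilde n F \<mu>R P b)"

end

theory Submission
  imports Defs "HOL-Computational_Algebra.Formal_Power_Series"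
begin

text \<open>The element \<open>X\<^sub>k\<close> is conjugate in the braid group to the square of \<open>\<sigma>\<^sub>k\<^sub>-\<^sub>1\<close>, whose image is a
  conjugate of \<open>exp (t\<^sub>k\<^sub>-\<^sub>1\<^sub>,\<^sub>k)\<close>; the permutation of the conjugating element moves the indices
  \<open>k - 1, k\<close> to \<open>0, k\<close>. Hence the image of \<open>X\<^sub>k\<close> is a conjugate of \<open>exp x\<^sub>k\<close> by an element of
  \<open>exp t\<close> (\<open>mu_tilde_pure_gen\<close>). The relation \<open>[x\<^sub>k, x\<^sub>j + t\<^sub>k\<^sub>j] = 0\<close> shows that \<open>t\<close> is the sum of the
  ideal \<open>f\<close> generated by the \<open>x\<^sub>i\<close> and the centralizer of \<open>x\<^sub>k\<close>, so an element \<open>U\<^sub>k\<close> of \<open>exp f\<close>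
  conjugates \<open>x\<^sub>k\<close> in the same way (\<open>tangential_conjugation\<close>). This puts the image of the free
  subgroup into \<open>exp f\<close>.

  The algebra \<open>t\<close> acts on the free algebra in the \<open>x\<^sub>i\<close>, where \<open>x\<^sub>i\<close> acts by left multiplication
  and the other \<open>t\<^sub>i\<^sub>j\<close> act by derivations. Looking at the image of \<open>1\<close> one sees that no nonzero Lie
  series in the \<open>x\<^sub>i\<close> vanishes in \<open>t\<close> (\<open>kd_free\<close>). So \<open>exp f\<close> is the group of Lie series with
  the Baker--Campbell--Hausdorff product (\<open>kd_class_prounip_iso\<close>), and the restricted map becomes
  a morphism \<open>\<rho>\<close> to exponentials of Lie series with \<open>\<rho> X\<^sub>k = 1 + x\<^sub>k + \<dots>\<close>, a Magnus expansion.

  For a finitely generated group with such an expansion, an element of the group algebra lies in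
  the \<open>m\<close>-th power of the augmentation ideal if and only if its expansion has order at least \<open>m\<close>,
  and the same is true for the square of the group (\<open>aug_pow_H_iff\<close>). The completed group
  algebra is therefore the algebra of series in the \<open>x\<^sub>i\<close>. Its group-like elements are the
  exponentials of Lie series (\<open>completion_iso\<close>): if \<open>a\<close> is group-like and \<open>N\<close> is the Euler
  derivation, then \<open>N a = D a\<close>, where \<open>D\<close> is a limit of linear combinations of the Lie series
  \<open>N(\<rho> g) (\<rho> g)\<^sup>-\<^sup>1\<close>, and \<open>log a\<close> is obtained from \<open>D\<close> by Lie operations, degree by degree. The
  same differential equation gives the Baker--Campbell--Hausdorff theorem (\<open>congr_bch\<close>).

  Under these identifications the map that sends \<open>exp x\<^sub>k\<close> to \<open>X\<^sub>k\<close>, composed with \<open>\<mu>\<close>, takes \<open>x\<^sub>k\<close>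
  to \<open>U\<^sub>k x\<^sub>k U\<^sub>k\<^sup>-\<^sup>1\<close>. Substituting these series for the letters defines an automorphism, because
  the substitution is the identity to first order (\<open>subst_prounip_iso\<close>). Every continuous
  morphism with the same values on the letters is equal to it, since brackets of letters are the
  leading terms of group commutators (\<open>prounip_hom_unique\<close>); being a substitution, it is an
  automorphism of the Lie algebra.\<close>

section \<open>Series, their degree filtration and convergent sums\<close>

lemma coeff_zero [simp]: "coeff 0 w = 0"
  and coeff_one: "coeff 1 w = (if w = [] then 1 else 0)"
  and coeff_add [simp]: "coeff (f + g) w = coeff f w + coeff g w"
  and coeff_diff [simp]: "coeff (f - g) w = coeff f w - coeff g w"
  and coeff_uminus [simp]: "coeff (- f) w = - coeff f w"
  and coeff_times: "coeff (f * g) w = (\<Sum>i\<le>length w. coeff f (take i w) * coeff g (drop i w))"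
  by (simp_all add: zero_nc_series.rep_eq one_nc_series.rep_eq plus_nc_series.rep_eq
      minus_nc_series.rep_eq uminus_nc_series.rep_eq times_nc_series.rep_eq)

lemma coeff_scale [simp]: "coeff (nc_scale c f) w = c * coeff f w"
  by (simp add: nc_scale.rep_eq)

lemma coeff_part: "coeff (nc_part d f) w = (if length w = d then coeff f w else 0)"
  by (simp add: nc_part.rep_eq)

lemma coeff_var: "coeff (nc_var a) w = (if w = [a] then 1 else 0)"
  by (simp add: nc_var.rep_eq)

lemma coeff_Nc_series [simp]: "coeff (Nc_series f) w = f w"
  by (simp add: Nc_series_inverse)

lemma coeff_sum: "coeff (sum F S) w = (\<Sum>s\<in>S. coeff (F s) w)"
  by (induction S rule: infinite_finite_induct) auto

interpretation nc: vector_space nc_scale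
  by unfold_locales (auto intro!: nc_series_eqI simp: algebra_simps)

lemma nc_scale_mult_left [simp]: "nc_scale c f * g = nc_scale c (f * g)"
  by (rule nc_series_eqI) (simp add: coeff_times sum_distrib_left mult.assoc)

lemma nc_scale_mult_right [simp]: "f * nc_scale c g = nc_scale c (f * g)"
  by (rule nc_series_eqI) (simp add: coeff_times sum_distrib_left algebra_simps)

lemma nc_scale_power: "nc_scale c f ^ m = nc_scale (c ^ m) (f ^ m)"
  by (induction m) (auto simp: nc.scale_scale mult.commute)

lemma coeff_times_Nil: "coeff (f * g) [] = coeff f [] * coeff g []"
  by (simp add: coeff_times)

lemma coeff_var_times: "coeff (nc_var a * g) w =
    (case w of [] \<Rightarrow> 0 | b # v \<Rightarrow> if a = b then coeff g v else 0)"
proof (cases w)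
  case Nil
  then show ?thesis by (simp add: coeff_times coeff_var)
next
  case (Cons b v)
  have "coeff (nc_var a * g) w = (\<Sum>i\<in>{1}. coeff (nc_var a) (take i w) * coeff g (drop i w))"
    unfolding coeff_times
  proof (rule sum.mono_neutral_right)
    show "\<forall>i\<in>{..length w} - {1}. coeff (nc_var a) (take i w) * coeff g (drop i w) = 0"
    proof
      fix i assume i: "i \<in> {..length w} - {1}"
      then have "length (take i w) \<noteq> 1" by auto
      then have "take i w \<noteq> [a]" by (metis length_Cons list.size(3) One_nat_def)
      then show "coeff (nc_var a) (take i w) * coeff g (drop i w) = 0" by (simp add: coeff_var)
    qed
  qed (use Cons in auto)
  then show ?thesis using Cons by (auto simp: coeff_var)
qed

definition order_ge :: "nat \<Rightarrow> ('a, 'k::field_char_0) nc_series \<Rightarrow> bool" where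
  "order_ge d f \<longleftrightarrow> (\<forall>w. length w < d \<longrightarrow> coeff f w = 0)"

definition eq_upto :: "nat \<Rightarrow> ('a, 'k::field_char_0) nc_series \<Rightarrow> ('a, 'k) nc_series \<Rightarrow> bool" where
  "eq_upto d f g \<longleftrightarrow> (\<forall>w. length w < d \<longrightarrow> coeff f w = coeff g w)"

lemma eq_upto_iff: "eq_upto d f g \<longleftrightarrow> order_ge d (f - g)"
  by (simp add: eq_upto_def order_ge_def)

lemma order_ge_iff: "order_ge d f \<longleftrightarrow> eq_upto d f 0"
  by (simp add: eq_upto_def order_ge_def)

lemma eq_upto_refl [simp]: "eq_upto d f f" by (simp add: eq_upto_def)
lemma eq_upto_sym: "eq_upto d f g \<Longrightarrow> eq_upto d g f" by (simp add: eq_upto_def)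
lemma eq_upto_trans [trans]: "eq_upto d f g \<Longrightarrow> eq_upto d g h \<Longrightarrow> eq_upto d f h"
  by (simp add: eq_upto_def)
lemma eq_upto_0 [simp]: "eq_upto 0 f g" by (simp add: eq_upto_def)
lemma eq_upto_mono: "eq_upto d f g \<Longrightarrow> e \<le> d \<Longrightarrow> eq_upto e f g"
  by (simp add: eq_upto_def)
lemma eq_upto_eqI: "(\<And>d. eq_upto d f g) \<Longrightarrow> f = g"
  by (rule nc_series_eqI) (use eq_upto_def lessI in blast)
lemma eq_upto_add: "eq_upto d f g \<Longrightarrow> eq_upto d f' g' \<Longrightarrow> eq_upto d (f + f') (g + g')"
  by (simp add: eq_upto_def)
lemma eq_upto_diff: "eq_upto d f g \<Longrightarrow> eq_upto d f' g' \<Longrightarrow> eq_upto d (f - f') (g - g')"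
  by (simp add: eq_upto_def)
lemma eq_upto_scale: "eq_upto d f g \<Longrightarrow> eq_upto d (nc_scale c f) (nc_scale c g)"
  by (simp add: eq_upto_def)
lemma eq_upto_sum: "(\<And>s. s \<in> S \<Longrightarrow> eq_upto d (f s) (g s)) \<Longrightarrow> eq_upto d (sum f S) (sum g S)"
  by (simp add: eq_upto_def coeff_sum)
lemma eq_upto_mult: "eq_upto d f g \<Longrightarrow> eq_upto d f' g' \<Longrightarrow> eq_upto d (f * f') (g * g')"
  by (auto simp: eq_upto_def coeff_times intro!: sum.cong)

lemma order_ge_0 [simp]: "order_ge 0 f" and order_ge_zero [simp]: "order_ge d 0"
  by (simp_all add: order_ge_def)
lemma order_ge_mono: "order_ge d f \<Longrightarrow> e \<le> d \<Longrightarrow> order_ge e f"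
  by (simp add: order_ge_def)
lemma order_ge_add: "order_ge d f \<Longrightarrow> order_ge d g \<Longrightarrow> order_ge d (f + g)"
  and order_ge_diff: "order_ge d f \<Longrightarrow> order_ge d g \<Longrightarrow> order_ge d (f - g)"
  and order_ge_minus: "order_ge d f \<Longrightarrow> order_ge d (- f)"
  and order_ge_scale: "order_ge d f \<Longrightarrow> order_ge d (nc_scale c f)"
  by (simp_all add: order_ge_def)
lemma order_ge_sum: "(\<And>s. s \<in> S \<Longrightarrow> order_ge d (f s)) \<Longrightarrow> order_ge d (sum f S)"
  by (simp add: order_ge_def coeff_sum)

lemma order_ge_mult:
  assumes "order_ge d f" "order_ge e g" shows "order_ge (d + e) (f * g)"
  unfolding order_ge_def
proof (intro allI impI)
  fix w :: "'a list" assume w: "length w < d + e"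
  have "coeff f (take i w) * coeff g (drop i w) = 0" if "i \<le> length w" for i
  proof (cases "i < d")
    case True
    then show ?thesis using assms(1) by (auto simp: order_ge_def)
  next
    case False
    then have "length (drop i w) < e" using w that by simp
    then show ?thesis using assms(2) by (auto simp: order_ge_def)
  qed
  then show "coeff (f * g) w = 0" unfolding coeff_times by (auto intro!: sum.neutral)
qed

lemma order_ge_mult': "order_ge d f \<Longrightarrow> order_ge e g \<Longrightarrow> m \<le> d + e \<Longrightarrow> order_ge m (f * g)"
  using order_ge_mult order_ge_mono by blast

lemma order_ge_mult_left: "order_ge d f \<Longrightarrow> order_ge d (g * f)"
  and order_ge_mult_right: "order_ge d f \<Longrightarrow> order_ge d (f * g)"
  using order_ge_mult[of 0 g d f] order_ge_mult[of d f 0 g] by simp_all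

lemma order_ge_power: "order_ge 1 f \<Longrightarrow> order_ge m (f ^ m)"
proof (induction m)
  case (Suc m)
  then show ?case using order_ge_mult[of 1 f m "f ^ m"] by simp
qed simp

lemma order_ge_1: "order_ge 1 f \<longleftrightarrow> coeff f [] = 0"
  by (simp add: order_ge_def)

lemma order_ge_commutator: "order_ge d f \<Longrightarrow> order_ge e g \<Longrightarrow> order_ge (d + e) (commutator f g)"
  unfolding commutator_def
  by (intro order_ge_diff) (auto intro: order_ge_mult order_ge_mult')

lemma order_ge_Suc: "order_ge (Suc d) f \<longleftrightarrow> order_ge d f \<and> nc_part d f = 0"
proof
  assume "order_ge (Suc d) f"
  then show "order_ge d f \<and> nc_part d f = 0"
    by (auto simp: order_ge_def coeff_part intro!: nc_series_eqI)
next
  assume *: "order_ge d f \<and> nc_part d f = 0"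
  show "order_ge (Suc d) f"
    unfolding order_ge_def
  proof (intro allI impI)
    fix w :: "'a list" assume "length w < Suc d"
    then consider "length w < d" | "length w = d" by linarith
    then show "coeff f w = 0"
    proof cases
      case 2
      then have "coeff f w = coeff (nc_part d f) w" by (simp add: coeff_part)
      then show ?thesis using * by simp
    qed (use * in \<open>auto simp: order_ge_def\<close>)
  qed
qed

lemma order_ge_parts: "order_ge N f \<longleftrightarrow> (\<forall>d<N. nc_part d f = 0)"
  by (induction N) (auto simp: order_ge_Suc less_Suc_eq)

text \<open>A family \<open>F\<close> with \<open>order_ge m (F m)\<close> for all \<open>m\<close> is summable in the degree topology;
  \<open>nc_sum F\<close> is its sum.\<close>

definition nc_sum :: "(nat \<Rightarrow> ('a, 'k::field_char_0) nc_series) \<Rightarrow> ('a, 'k) nc_series" where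
  "nc_sum F = Nc_series (\<lambda>w. \<Sum>m\<le>length w. coeff (F m) w)"

lemma nc_sum_upto:
  assumes "\<And>m. order_ge m (F m)"
  shows "eq_upto d (nc_sum F) (\<Sum>m<d. F m)"
  unfolding eq_upto_def
proof (intro allI impI)
  fix w :: "'a list" assume w: "length w < d"
  have "(\<Sum>m\<le>length w. coeff (F m) w) = (\<Sum>m<d. coeff (F m) w)"
    by (rule sum.mono_neutral_left) (use w assms in \<open>auto simp: order_ge_def\<close>)
  then show "coeff (nc_sum F) w = coeff (\<Sum>m<d. F m) w"
    by (simp add: nc_sum_def coeff_sum)
qed

lemma nc_sum_eqI:
  assumes "\<And>m. order_ge m (F m)" "\<And>d. eq_upto d f (\<Sum>m<d. F m)"
  shows "f = nc_sum F"
  using assms nc_sum_upto eq_upto_sym eq_upto_trans by (blast intro: eq_upto_eqI)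

lemma order_ge_nc_sum: "(\<And>m. order_ge d (F m)) \<Longrightarrow> order_ge d (nc_sum F)"
  by (simp add: order_ge_def nc_sum_def)

lemma nc_sum_add: "nc_sum F + nc_sum G = nc_sum (\<lambda>m. F m + G m)"
  by (rule nc_series_eqI) (simp add: nc_sum_def sum.distrib)

lemma nc_sum_split:
  assumes "\<And>m. order_ge m (F m)"
  shows "nc_sum F = F 0 + nc_sum (\<lambda>m. F (Suc m))"
proof (rule nc_series_eqI)
  fix w :: "'a list"
  have "(\<Sum>m\<le>length w. coeff (F m) w) = (\<Sum>m\<le>Suc (length w). coeff (F m) w)"
    using assms[of "Suc (length w)"] by (simp add: order_ge_def)
  then show "coeff (nc_sum F) w = coeff (F 0 + nc_sum (\<lambda>m. F (Suc m))) w"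
    by (simp add: nc_sum_def sum.atMost_Suc_shift del: sum.atMost_Suc)
qed

lemma nc_sum_linear:
  assumes F: "\<And>m. order_ge m (F m)"
    and add: "\<And>f g. T (f + g) = T f + T g"
    and ord: "\<And>d f. order_ge d f \<Longrightarrow> order_ge d (T f)"
  shows "T (nc_sum F) = nc_sum (\<lambda>m. T (F m))"
proof (rule nc_sum_eqI)
  show "order_ge m (T (F m))" for m using F ord by blast
  interpret Modules.additive T by unfold_locales (rule add)
  fix d
  have "order_ge d (T (nc_sum F - (\<Sum>m<d. F m)))"
    using ord nc_sum_upto[OF F] by (simp add: eq_upto_iff)
  then show "eq_upto d (T (nc_sum F)) (\<Sum>m<d. T (F m))"
    by (simp add: eq_upto_iff diff sum)
qed

lemma nc_sum_mult_left: "(\<And>m. order_ge m (F m)) \<Longrightarrow> g * nc_sum F = nc_sum (\<lambda>m. g * F m)"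
  by (rule nc_sum_linear) (auto simp: algebra_simps intro: order_ge_mult_left)

lemma nc_sum_mult_right: "(\<And>m. order_ge m (F m)) \<Longrightarrow> nc_sum F * g = nc_sum (\<lambda>m. F m * g)"
  by (rule nc_sum_linear[where T = "\<lambda>f. f * g"]) (auto simp: algebra_simps intro: order_ge_mult_right)

lemma nc_sum_mult:
  assumes F: "\<And>m. order_ge m (F m)" and G: "\<And>m. order_ge m (G m)"
  shows "nc_sum F * nc_sum G = nc_sum (\<lambda>k. \<Sum>i\<le>k. F i * G (k - i))"
proof (rule nc_sum_eqI)
  show "order_ge k (\<Sum>i\<le>k. F i * G (k - i))" for k
    by (rule order_ge_sum) (auto intro!: order_ge_mult'[OF F G])
  fix d
  have "eq_upto d (nc_sum F * nc_sum G) ((\<Sum>i<d. F i) * (\<Sum>j<d. G j))"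
    by (intro eq_upto_mult nc_sum_upto F G)
  also have "(\<Sum>i<d. F i) * (\<Sum>j<d. G j) = (\<Sum>(i, j)\<in>{..<d} \<times> {..<d}. F i * G j)"
    by (simp add: sum_product sum.cartesian_product)
  also have "eq_upto d \<dots> (\<Sum>(i, j)\<in>{(i, j). i + j < d}. F i * G j)"
  proof -
    have sub: "{(i, j). i + j < d} \<subseteq> {..<d} \<times> {..<d}" by auto
    have "(\<Sum>(i, j)\<in>{..<d} \<times> {..<d}. F i * G j) - (\<Sum>(i, j)\<in>{(i, j). i + j < d}. F i * G j)
      = (\<Sum>(i, j)\<in>{..<d} \<times> {..<d} - {(i, j). i + j < d}. F i * G j)"
      by (rule sum_diff[OF _ sub, symmetric]) simp
    moreover have "order_ge d \<dots>"
      by (rule order_ge_sum) (auto intro!: order_ge_mult'[OF F G])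
    ultimately show ?thesis by (simp add: eq_upto_iff)
  qed
  also have "(\<Sum>(i, j)\<in>{(i, j). i + j < d}. F i * G j) = (\<Sum>k<d. \<Sum>i\<le>k. F i * G (k - i))"
    by (rule sum.triangle_reindex)
  finally show "eq_upto d (nc_sum F * nc_sum G) (\<Sum>k<d. \<Sum>i\<le>k. F i * G (k - i))" .
qed

section \<open>Power series in one element, exponential and logarithm\<close>

definition ev :: "'k::field_char_0 fps \<Rightarrow> ('a, 'k) nc_series \<Rightarrow> ('a, 'k) nc_series" where
  "ev a z = nc_sum (\<lambda>m. nc_scale (fps_nth a m) (z ^ m))"

lemma order_ge_ev_term: "order_ge 1 z \<Longrightarrow> order_ge m (nc_scale c (z ^ m))"
  by (intro order_ge_scale order_ge_power)

lemma ev_upto: "order_ge 1 z \<Longrightarrow> eq_upto d (ev a z) (\<Sum>m<d. nc_scale (fps_nth a m) (z ^ m))"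
  unfolding ev_def by (intro nc_sum_upto order_ge_ev_term)

lemma ev_add: "ev (a + b) z = ev a z + ev b z"
  by (simp add: ev_def nc_sum_add nc.scale_left_distrib)

lemma ev_const: "ev (fps_const c) z = nc_scale c 1"
  by (rule nc_series_eqI) (simp add: ev_def nc_sum_def sum.atMost_shift)

lemma ev_1: "ev 1 z = 1"
  using ev_const[of 1 z] by simp

lemma ev_mult:
  assumes z: "order_ge 1 z" shows "ev (a * b) z = ev a z * ev b z"
proof -
  have "nc_scale (fps_nth (a * b) k) (z ^ k) =
    (\<Sum>i\<le>k. nc_scale (fps_nth a i) (z ^ i) * nc_scale (fps_nth b (k - i)) (z ^ (k - i)))" for k
    by (simp add: fps_mult_nth atLeast0AtMost nc.scale_sum_left nc.scale_scale mult.commute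
        flip: power_add)
  then show ?thesis
    unfolding ev_def by (subst nc_sum_mult) (simp_all only: order_ge_ev_term[OF z])
qed

lemma ev_power: "order_ge 1 z \<Longrightarrow> ev (a ^ m) z = ev a z ^ m"
  by (induction m) (auto simp: ev_mult ev_1)

lemma ev_X: "order_ge 1 z \<Longrightarrow> ev fps_X z = z"
proof -
  assume z: "order_ge 1 z"
  have "nc_scale (fps_nth fps_X m) (z ^ m) = (if m = 1 then z else 0)" for m
    by simp
  moreover have "(\<Sum>m\<le>n. coeff (if m = Suc 0 then z else 0) w) = (\<Sum>m\<le>n. if m = Suc 0 then coeff z w else 0)"
    for n w by (rule sum.cong) auto
  ultimately show ?thesis
    unfolding ev_def using z by (intro nc_series_eqI) (auto simp: nc_sum_def order_ge_def Suc_le_eq)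
qed

lemma order_ge_ev:
  assumes z: "order_ge e z" "1 \<le> e" and a: "fps_nth a 0 = 0"
  shows "order_ge e (ev a z)"
  unfolding ev_def
proof (rule order_ge_nc_sum)
  fix m
  show "order_ge e (nc_scale (fps_nth a m) (z ^ m))"
  proof (cases m)
    case (Suc k)
    then show ?thesis using z by (auto intro!: order_ge_scale order_ge_mult'[where d = e and e = 0])
  qed (use a in simp)
qed

text \<open>Evaluation is compatible with substitution of formal power series. The usual identities
  between exponential, logarithm and binomial series are thereby inherited from those of formal power
  series in one variable.\<close>

lemma ev_compose:
  assumes z: "order_ge 1 z" and b: "fps_nth b 0 = 0"
  shows "ev (a oo b) z = ev a (ev b z)"
proof (rule eq_upto_eqI)
  fix d
  have "eq_upto d (ev a (ev b z)) (\<Sum>m<d. nc_scale (fps_nth a m) (ev b z ^ m))"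
    by (intro ev_upto order_ge_ev z b) simp
  also have "(\<Sum>m<d. nc_scale (fps_nth a m) (ev b z ^ m)) =
      (\<Sum>m<d. nc_scale (fps_nth a m) (ev (b ^ m) z))"
    by (simp only: ev_power[OF z])
  also have "eq_upto d \<dots> (\<Sum>m<d. nc_scale (fps_nth a m)
      (\<Sum>k<d. nc_scale (fps_nth (b ^ m) k) (z ^ k)))"
    by (intro eq_upto_sum eq_upto_scale ev_upto z)
  also have "\<dots> = (\<Sum>m<d. \<Sum>k<d. nc_scale (fps_nth a m * fps_nth (b ^ m) k) (z ^ k))"
    by (simp add: nc.scale_sum_right nc.scale_scale)
  also have "\<dots> = (\<Sum>k<d. \<Sum>m<d. nc_scale (fps_nth a m * fps_nth (b ^ m) k) (z ^ k))"
    by (rule sum.swap)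
  also have "\<dots> = (\<Sum>k<d. nc_scale (fps_nth (a oo b) k) (z ^ k))"
  proof (rule sum.cong)
    fix k assume k: "k \<in> {..<d}"
    have "(\<Sum>m<d. fps_nth a m * fps_nth (b ^ m) k) = (\<Sum>m=0..k. fps_nth a m * fps_nth (b ^ m) k)"
      by (rule sum.mono_neutral_right) (use k b in \<open>auto simp: startsby_zero_power_prefix\<close>)
    then show "(\<Sum>m<d. nc_scale (fps_nth a m * fps_nth (b ^ m) k) (z ^ k)) =
        nc_scale (fps_nth (a oo b) k) (z ^ k)"
      by (simp add: fps_compose_nth nc.scale_sum_left[symmetric])
  qed simp
  also have "eq_upto d \<dots> (ev (a oo b) z)" by (intro eq_upto_sym[OF ev_upto] z)
  finally show "eq_upto d (ev (a oo b) z) (ev a (ev b z))" by (rule eq_upto_sym)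
qed

lemma nc_exp_ev: "nc_exp z = ev (fps_exp 1) z"
  by (rule nc_series_eqI) (simp add: nc_exp_def ev_def nc_sum_def)

lemma nc_exp_sum: "nc_exp z = nc_sum (\<lambda>m. nc_scale (1 / fact m) (z ^ m))"
  by (simp add: nc_exp_ev ev_def)

lemma nc_exp_scale: "nc_exp (nc_scale c z) = ev (fps_exp c) z"
  by (simp add: nc_exp_ev ev_def nc_scale_power nc.scale_scale)

lemma nc_log_ev: "nc_log g = ev (fps_ln 1) (g - 1)"
proof (rule nc_series_eqI)
  fix w
  have "(\<Sum>m=1..length w. (- 1) ^ (m + 1) / of_nat m * coeff ((g - 1) ^ m) w) =
        (\<Sum>m\<le>length w. fps_nth (fps_ln 1) m * coeff ((g - 1) ^ m) w)"
  proof (rule sum.mono_neutral_cong_left)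
    fix m assume "m \<in> {1..length w}"
    then show "(- 1) ^ (m + 1) / of_nat m * coeff ((g - 1) ^ m) w =
        fps_nth (fps_ln 1) m * coeff ((g - 1) ^ m) w"
      by (cases m) (auto simp: fps_ln_nth)
  qed (auto simp: Suc_le_eq)
  then show "coeff (nc_log g) w = coeff (ev (fps_ln 1) (g - 1)) w"
    by (simp add: nc_log_def ev_def nc_sum_def)
qed

lemma fps_exp_ln: "fps_exp 1 oo fps_ln (1 :: 'k::field_char_0) = 1 + fps_X"
proof -
  have "(fps_exp 1 - 1 :: 'k fps) oo fps_ln 1 = fps_X"
    using fps_ln_fps_exp_inv[of "1::'k"] by (simp add: fps_inv_right)
  then show ?thesis by (simp add: fps_compose_sub_distrib algebra_simps)
qed

lemma fps_ln_exp: "fps_ln (1 :: 'k::field_char_0) oo (fps_exp 1 - 1) = fps_X"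
  using fps_ln_fps_exp_inv[of "1::'k"] by (simp add: fps_inv)

lemma order_ge_exp: "order_ge e z \<Longrightarrow> 1 \<le> e \<Longrightarrow> order_ge e (nc_exp z - 1)"
proof -
  assume *: "order_ge e z" "1 \<le> e"
  have "ev (fps_exp 1) z = ev (1 + (fps_exp 1 - 1)) z" by simp
  also have "\<dots> = 1 + ev (fps_exp 1 - 1) z" by (simp only: ev_add ev_1)
  finally show ?thesis using order_ge_ev[OF *, of "fps_exp 1 - 1"] by (simp add: nc_exp_ev)
qed

lemma order_ge_log: "order_ge e (g - 1) \<Longrightarrow> 1 \<le> e \<Longrightarrow> order_ge e (nc_log g)"
  unfolding nc_log_ev by (rule order_ge_ev) auto

lemma nc_exp_log: "order_ge 1 (g - 1) \<Longrightarrow> nc_exp (nc_log g) = g"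
  by (simp add: nc_exp_ev nc_log_ev ev_compose[symmetric, of "g - 1"] fps_exp_ln ev_add ev_1 ev_X[of "g - 1"])

lemma nc_log_exp: "order_ge 1 z \<Longrightarrow> nc_log (nc_exp z) = z"
proof -
  assume z: "order_ge 1 z"
  have "ev (fps_exp 1) z = ev (1 + (fps_exp 1 - 1)) z" by simp
  also have "\<dots> = 1 + ev (fps_exp 1 - 1) z" by (simp only: ev_add ev_1)
  finally have "nc_exp z - 1 = ev (fps_exp 1 - 1) z" by (simp add: nc_exp_ev)
  then show ?thesis
    using z by (simp add: nc_log_ev ev_compose[symmetric] fps_ln_exp ev_X)
qed

lemma nc_exp_0 [simp]: "nc_exp 0 = 1"
  using nc_exp_scale[of 0 0] by (simp add: ev_1)

lemma nc_log_1 [simp]: "nc_log 1 = 0"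
  using nc_log_exp[of 0] by simp

lemma nc_exp_scale_add:
  "order_ge 1 z \<Longrightarrow> nc_exp (nc_scale (c + d) z) = nc_exp (nc_scale c z) * nc_exp (nc_scale d z)"
  by (simp add: nc_exp_scale ev_mult[symmetric] fps_exp_add_mult)

lemma nc_exp_minus:
  assumes "order_ge 1 z"
  shows "nc_exp z * nc_exp (- z) = 1" "nc_exp (- z) * nc_exp z = 1"
  using nc_exp_scale_add[OF assms, of 1 "-1"] nc_exp_scale_add[OF assms, of "-1" 1]
  by (simp_all add: nc.scale_minus_left)

lemma nc_exp_inj: "order_ge 1 u \<Longrightarrow> order_ge 1 v \<Longrightarrow> nc_exp u = nc_exp v \<Longrightarrow> u = v"
  by (metis nc_log_exp)

lemma nc_exp_conj:
  assumes z: "order_ge 1 z" and "g' * g = 1" "g * g' = 1"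
  shows "nc_exp (g * z * g') = g * nc_exp z * g'"
proof -
  have pow: "(g * z * g') ^ m = g * z ^ m * g'" for m
  proof (induction m)
    case (Suc m)
    have "(g * z * g') ^ Suc m = (g * z * g') * (g * z ^ m * g')" by (simp only: power_Suc Suc)
    also have "\<dots> = g * z * (g' * g) * z ^ m * g'" by (simp only: mult.assoc)
    finally show ?case by (simp add: assms mult.assoc)
  qed (simp add: assms)
  have "nc_exp (g * z * g') = nc_sum (\<lambda>m. g * nc_scale (1 / fact m) (z ^ m) * g')"
    by (simp add: nc_exp_sum pow)
  also have "\<dots> = g * nc_exp z * g'"
    unfolding nc_exp_sum
    by (simp only: nc_sum_mult_left[OF order_ge_ev_term[OF z]]
        nc_sum_mult_right[OF order_ge_mult_left[OF order_ge_ev_term[OF z]]])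
  finally show ?thesis .
qed

text \<open>\<open>g\<^sup>c = exp (c log g)\<close> is the binomial series, since both satisfy the same differential equation.\<close>

lemma fps_exp_ln_binomial: "fps_exp c oo fps_ln (1 :: 'k::field_char_0) = fps_binomial c"
proof -
  have "fps_deriv (fps_exp c oo fps_ln (1::'k)) =
      fps_const c * (fps_exp c oo fps_ln 1) * inverse (1 + fps_X)"
    by (simp add: fps_compose_deriv fps_ln_deriv fps_const_mult_apply_left)
  then have "fps_deriv (fps_exp c oo fps_ln (1::'k)) =
      fps_const c * (fps_exp c oo fps_ln 1) / (1 + fps_X)"
    by (simp add: fps_divide_unit)
  then have "fps_exp c oo fps_ln (1::'k) =
      fps_const (fps_nth (fps_exp c oo fps_ln (1::'k)) 0) * fps_binomial c"
    using fps_binomial_ODE_unique by blast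
  then show ?thesis by (simp add: fps_compose_nth)
qed

lemma nc_pow_binomial:
  assumes "order_ge 1 (g - 1)"
  shows "nc_exp (nc_scale c (nc_log g)) = ev (fps_binomial c) (g - 1)"
  using assms by (simp add: nc_exp_scale nc_log_ev ev_compose[symmetric] fps_exp_ln_binomial)

section \<open>The adjoint action and the logarithmic derivative of the exponential\<close>

text \<open>The Euler derivation. It turns statements about exponentials into linear differential
  equations, which determine a series degree by degree.\<close>

definition nc_euler :: "('a, 'k::field_char_0) nc_series \<Rightarrow> ('a, 'k) nc_series" where
  "nc_euler f = Nc_series (\<lambda>w. of_nat (length w) * coeff f w)"

lemma coeff_euler [simp]: "coeff (nc_euler f) w = of_nat (length w) * coeff f w"
  by (simp add: nc_euler_def)

lemma nc_euler_add: "nc_euler (f + g) = nc_euler f + nc_euler g"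
  and nc_euler_diff: "nc_euler (f - g) = nc_euler f - nc_euler g"
  and nc_euler_scale: "nc_euler (nc_scale c f) = nc_scale c (nc_euler f)"
  and nc_euler_1 [simp]: "nc_euler 1 = 0"
  by (auto intro!: nc_series_eqI simp: algebra_simps coeff_one)

lemma order_ge_euler: "order_ge d f \<Longrightarrow> order_ge d (nc_euler f)"
  by (simp add: order_ge_def)

lemma nc_euler_mult: "nc_euler (f * g) = nc_euler f * g + f * nc_euler g"
proof (rule nc_series_eqI)
  fix w :: "'a list"
  have "of_nat (length w) * (coeff f (take i w) * coeff g (drop i w)) =
    of_nat i * coeff f (take i w) * coeff g (drop i w)
    + coeff f (take i w) * (of_nat (length w - i) * coeff g (drop i w))" if "i \<le> length w" for i
    using that by (simp add: of_nat_diff algebra_simps)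
  note * = this
  show "coeff (nc_euler (f * g)) w = coeff (nc_euler f * g + f * nc_euler g) w"
    unfolding coeff_euler coeff_add coeff_times sum_distrib_left sum.distrib[symmetric]
    by (rule sum.cong) (simp_all add: * min_absorb2)
qed

abbreviation ad_pow :: "('a, 'k::field_char_0) nc_series \<Rightarrow> nat \<Rightarrow> ('a, 'k) nc_series \<Rightarrow> ('a, 'k) nc_series"
  where "ad_pow u i x \<equiv> (commutator u ^^ i) x"

text \<open>The operator \<open>exp (ad u)\<close>.\<close>

definition nc_Ad :: "('a, 'k::field_char_0) nc_series \<Rightarrow> ('a, 'k) nc_series \<Rightarrow> ('a, 'k) nc_series" where
  "nc_Ad u x = nc_sum (\<lambda>i. nc_scale (1 / fact i) (ad_pow u i x))"

text \<open>With \<open>N\<close> the Euler derivation, this is \<open>(exp (ad z) - 1) / ad z\<close> applied to \<open>N z\<close>; it is the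
  logarithmic derivative \<open>N(exp z) (exp z)\<^sup>-\<^sup>1\<close>.\<close>

definition nc_dexp :: "('a, 'k::field_char_0) nc_series \<Rightarrow> ('a, 'k) nc_series" where
  "nc_dexp z = nc_sum (\<lambda>i. nc_scale (1 / fact (Suc i)) (ad_pow z i (nc_euler z)))"

lemma order_ge_ad_pow: "order_ge 1 u \<Longrightarrow> order_ge d x \<Longrightarrow> order_ge (i + d) (ad_pow u i x)"
proof (induction i)
  case (Suc i)
  then show ?case using order_ge_commutator[of 1 u "i + d"] by simp
qed simp

lemma mult_eq_commutator: "u * x = commutator u x + x * u"
  by (simp add: commutator_def)

lemma one_plus_of_nat_neq_0 [simp]: "(1 + of_nat k :: 'k::field_char_0) \<noteq> 0"
  by (metis of_nat_Suc of_nat_neq_0)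

lemma nc_scale_eqD: "nc_scale (1 + of_nat k) x = nc_scale (1 + of_nat k) y \<Longrightarrow> x = y"
  by simp

lemma exp_mult_eq_Ad:
  assumes u: "order_ge 1 u"
  shows "nc_exp u * x = nc_Ad u x * nc_exp u"
proof -
  define A where "A i = nc_scale (1 / fact i) (ad_pow u i x)" for i
  define E where "E i = nc_scale (1 / fact i) (u ^ i)" for i
  have oA: "order_ge i (A i)" and oE: "order_ge i (E i)" for i
    unfolding A_def E_def using order_ge_ad_pow[OF u, of 0 x i] order_ge_ev_term[OF u]
    by (auto intro: order_ge_scale)
  have uE: "u * E k = nc_scale (1 + of_nat k) (E (Suc k))"
    and Eu: "E k * u = nc_scale (1 + of_nat k) (E (Suc k))" for k
    by (simp_all add: E_def power_commutes nc.scale_scale)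
  have uA: "u * A i = nc_scale (1 + of_nat i) (A (Suc i)) + A i * u" for i
    unfolding A_def by (subst mult_eq_commutator) (simp add: commutator_def nc.scale_right_diff_distrib)
  have key: "E k * x = (\<Sum>i\<le>k. A i * E (k - i))" for k
  proof (induction k)
    case 0
    then show ?case by (simp add: A_def E_def)
  next
    case (Suc k)
    have "nc_scale (1 + of_nat k) (E (Suc k) * x) = u * (E k * x)"
      by (metis uE mult.assoc nc_scale_mult_left)
    also have "\<dots> = (\<Sum>i\<le>k. u * A i * E (k - i))"
      by (simp add: Suc sum_distrib_left mult.assoc)
    also have "\<dots> = (\<Sum>i\<le>k. nc_scale (of_nat (Suc i)) (A (Suc i) * E (Suc k - Suc i)))
        + (\<Sum>i\<le>k. nc_scale (of_nat (Suc k - i)) (A i * E (Suc k - i)))"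
      by (auto simp: uA algebra_simps uE sum.distrib[symmetric] Suc_diff_le
          nc.scale_left_distrib mult.assoc intro!: sum.cong)
    also have "(\<Sum>i\<le>k. nc_scale (of_nat (Suc i)) (A (Suc i) * E (Suc k - Suc i))) =
        (\<Sum>i\<le>Suc k. nc_scale (of_nat i) (A i * E (Suc k - i)))"
      by (subst sum.atMost_Suc_shift) simp
    also have "(\<Sum>i\<le>k. nc_scale (of_nat (Suc k - i)) (A i * E (Suc k - i))) =
        (\<Sum>i\<le>Suc k. nc_scale (of_nat (Suc k - i)) (A i * E (Suc k - i)))" by simp
    also have "(\<Sum>i\<le>Suc k. nc_scale (of_nat i) (A i * E (Suc k - i)))
        + (\<Sum>i\<le>Suc k. nc_scale (of_nat (Suc k - i)) (A i * E (Suc k - i))) =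
        (\<Sum>i\<le>Suc k. nc_scale (1 + of_nat k) (A i * E (Suc k - i)))"
      by (subst sum.distrib[symmetric])
        (auto intro!: sum.cong simp: nc.scale_left_distrib[symmetric] of_nat_diff)
    also have "\<dots> = nc_scale (1 + of_nat k) (\<Sum>i\<le>Suc k. A i * E (Suc k - i))"
      by (simp only: nc.scale_sum_right)
    finally show ?case by (rule nc_scale_eqD)
  qed
  have "nc_exp u * x = nc_sum (\<lambda>k. E k * x)"
    unfolding nc_exp_sum E_def[symmetric] by (rule nc_sum_mult_right) (rule oE)
  also have "\<dots> = nc_Ad u x * nc_exp u"
    unfolding nc_exp_sum nc_Ad_def E_def[symmetric] A_def[symmetric] nc_sum_mult[OF oA oE] key ..
  finally show ?thesis .
qed

lemma exp_conj_eq_Ad: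
  assumes u: "order_ge 1 u"
  shows "nc_exp u * x * nc_exp (- u) = nc_Ad u x"
  using exp_mult_eq_Ad[OF u] nc_exp_minus[OF u] by (simp add: mult.assoc)

lemma euler_exp_eq_dexp:
  fixes z :: "('a, 'k::field_char_0) nc_series"
  assumes z: "order_ge 1 z"
  shows "nc_euler (nc_exp z) = nc_dexp z * nc_exp z"
proof -
  define Q where "Q i = nc_scale (1 / fact (Suc i)) (ad_pow z i (nc_euler z))" for i
  define E where "E i = nc_scale (1 / fact i) (z ^ i)" for i
  have oQ: "order_ge (Suc i) (Q i)" and oE: "order_ge i (E i)" for i
    unfolding Q_def E_def
    using order_ge_ad_pow[OF z, of 1 "nc_euler z" i] order_ge_ev_term[OF z] order_ge_euler[OF z]
    by (auto intro: order_ge_scale)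
  have oQ': "order_ge i (Q i)" for i
    using oQ order_ge_mono by (metis Suc_leD order_refl)
  have zE: "z * E k = nc_scale (1 + of_nat k) (E (Suc k))" for k
    by (simp add: E_def nc.scale_scale)
  have zQ: "z * Q i = nc_scale (2 + of_nat i) (Q (Suc i)) + Q i * z" for i
  proof -
    have "(2 + of_nat i :: 'k) = of_nat (Suc (Suc i))" by simp
    then have c: "(2 + of_nat i :: 'k) * (1 / fact (Suc (Suc i))) = 1 / fact (Suc i)"
      by (metis (no_types, lifting) fact_Suc mult.right_neutral nonzero_mult_divide_mult_cancel_left
          of_nat_neq_0 times_divide_eq_right)
    have "nc_scale (2 + of_nat i) (Q (Suc i)) =
        nc_scale (1 / fact (Suc i)) (commutator z (ad_pow z i (nc_euler z)))"
      unfolding Q_def nc.scale_scale c by simp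
    then show ?thesis
      unfolding Q_def
      by (simp add: commutator_def nc.scale_right_diff_distrib del: fact_Suc)
  qed
  have key: "nc_euler (E (Suc k)) = (\<Sum>i\<le>k. Q i * E (k - i))" for k
  proof (induction k)
    case 0
    then show ?case by (simp add: Q_def E_def)
  next
    case (Suc k)
    have zQE: "z * (Q i * E (k - i)) = nc_scale (of_nat (Suc (Suc i))) (Q (Suc i) * E (Suc k - Suc i))
       + nc_scale (of_nat (Suc k - i)) (Q i * E (Suc k - i))" if "i \<le> k" for i
    proof -
      have "z * (Q i * E (k - i)) = (z * Q i) * E (k - i)" by (simp add: mult.assoc)
      also have "\<dots> = nc_scale (2 + of_nat i) (Q (Suc i) * E (k - i)) + Q i * (z * E (k - i))"
        by (simp add: zQ distrib_right mult.assoc)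
      finally show ?thesis using that by (simp add: zE Suc_diff_le)
    qed
    have "nc_scale (1 + of_nat (Suc k)) (nc_euler (E (Suc (Suc k)))) = nc_euler (z * E (Suc k))"
      by (simp only: zE nc_euler_scale)
    also have "\<dots> = Q 0 * E (Suc k) + (\<Sum>i\<le>k. z * (Q i * E (k - i)))"
      by (simp add: nc_euler_mult Suc sum_distrib_left Q_def)
    also have "(\<Sum>i\<le>k. z * (Q i * E (k - i))) =
        (\<Sum>i\<le>k. nc_scale (of_nat (Suc (Suc i))) (Q (Suc i) * E (Suc k - Suc i)))
         + (\<Sum>i\<le>k. nc_scale (of_nat (Suc k - i)) (Q i * E (Suc k - i)))"
      unfolding sum.distrib[symmetric] by (rule sum.cong) (simp_all only: zQE atMost_iff)
    also have "(\<Sum>i\<le>k. nc_scale (of_nat (Suc k - i)) (Q i * E (Suc k - i))) =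
        (\<Sum>i\<le>Suc k. nc_scale (of_nat (Suc k - i)) (Q i * E (Suc k - i)))" by simp
    also have "Q 0 * E (Suc k)
         + ((\<Sum>i\<le>k. nc_scale (of_nat (Suc (Suc i))) (Q (Suc i) * E (Suc k - Suc i)))
         + (\<Sum>i\<le>Suc k. nc_scale (of_nat (Suc k - i)) (Q i * E (Suc k - i)))) = (Q 0 * E (Suc k)
         + (\<Sum>i\<le>k. nc_scale (of_nat (Suc (Suc i))) (Q (Suc i) * E (Suc k - Suc i))))
         + (\<Sum>i\<le>Suc k. nc_scale (of_nat (Suc k - i)) (Q i * E (Suc k - i)))"
      by (simp only: add.assoc)
    also have "Q 0 * E (Suc k)
         + (\<Sum>i\<le>k. nc_scale (of_nat (Suc (Suc i))) (Q (Suc i) * E (Suc k - Suc i))) =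
         (\<Sum>i\<le>Suc k. nc_scale (of_nat (Suc i)) (Q i * E (Suc k - i)))"
      by (subst sum.atMost_Suc_shift) simp
    also have "(\<Sum>i\<le>Suc k. nc_scale (of_nat (Suc i)) (Q i * E (Suc k - i)))
        + (\<Sum>i\<le>Suc k. nc_scale (of_nat (Suc k - i)) (Q i * E (Suc k - i))) =
        (\<Sum>i\<le>Suc k. nc_scale (1 + of_nat (Suc k)) (Q i * E (Suc k - i)))"
      by (subst sum.distrib[symmetric])
        (auto intro!: sum.cong simp: nc.scale_left_distrib[symmetric] of_nat_diff)
    also have "\<dots> = nc_scale (1 + of_nat (Suc k)) (\<Sum>i\<le>Suc k. Q i * E (Suc k - i))"
      by (simp only: nc.scale_sum_right)
    finally show ?case by (rule nc_scale_eqD)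
  qed
  have "nc_euler (nc_exp z) = nc_sum (\<lambda>k. nc_euler (E k))"
    unfolding nc_exp_sum E_def[symmetric]
    by (rule nc_sum_linear) (auto simp: oE nc_euler_add order_ge_euler)
  also have "\<dots> = nc_euler (E 0) + nc_sum (\<lambda>k. nc_euler (E (Suc k)))"
    by (rule nc_sum_split) (auto intro: order_ge_euler oE)
  also have "nc_euler (E 0) = 0" by (simp add: E_def)
  also have "0 + nc_sum (\<lambda>k. nc_euler (E (Suc k))) = nc_dexp z * nc_exp z"
    unfolding nc_exp_sum nc_dexp_def E_def[symmetric] Q_def[symmetric] nc_sum_mult[OF oQ' oE] key
    by simp
  finally show ?thesis .
qed

declare One_nat_def [simp del]

section \<open>Graded completions and Lie ideals\<close>

lemma part_add: "nc_part d (f + g) = nc_part d f + nc_part d g"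
  and part_diff: "nc_part d (f - g) = nc_part d f - nc_part d g"
  and part_scale: "nc_part d (nc_scale c f) = nc_scale c (nc_part d f)"
  and part_zero [simp]: "nc_part d 0 = 0"
  and part_part: "nc_part d (nc_part e f) = (if d = e then nc_part e f else 0)"
  and part_euler: "nc_part d (nc_euler f) = nc_scale (of_nat d) (nc_part d f)"
  by (auto intro!: nc_series_eqI simp: coeff_part)

lemma part_sum: "nc_part d (sum F S) = (\<Sum>s\<in>S. nc_part d (F s))"
  by (rule nc_series_eqI) (simp add: coeff_part coeff_sum)

lemma part_eq_upto: "eq_upto e f g \<Longrightarrow> d < e \<Longrightarrow> nc_part d f = nc_part d g"
  by (rule nc_series_eqI) (auto simp: coeff_part eq_upto_def)

lemma eq_upto_parts: "eq_upto e f g \<longleftrightarrow> (\<forall>d<e. nc_part d f = nc_part d g)"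
  unfolding eq_upto_iff order_ge_parts by (simp add: part_diff)

lemma parts_eqI: "(\<And>d. nc_part d f = nc_part d g) \<Longrightarrow> f = g"
  by (rule eq_upto_eqI) (simp add: eq_upto_parts)

lemma part_mult: "nc_part d (f * g) = (\<Sum>i\<le>d. nc_part i f * nc_part (d - i) g)"
proof (rule nc_series_eqI)
  fix w :: "'a list"
  have "coeff (\<Sum>i\<le>d. nc_part i f * nc_part (d - i) g) w =
    (\<Sum>i\<le>d. \<Sum>j\<le>length w. (if j = i \<and> length w = d then coeff f (take j w) * coeff g (drop j w) else 0))"
    by (auto simp: coeff_sum coeff_times coeff_part intro!: sum.cong)
  also have "\<dots> = (\<Sum>j\<le>length w. \<Sum>i\<le>d. (if j = i \<and> length w = d then coeff f (take j w) * coeff g (drop j w) else 0))"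
    by (rule sum.swap)
  also have "\<dots> = coeff (nc_part d (f * g)) w"
    by (auto simp: coeff_part coeff_times intro!: sum.cong)
  finally show "coeff (nc_part d (f * g)) w = coeff (\<Sum>i\<le>d. nc_part i f * nc_part (d - i) g) w" ..
qed

lemma commutator_add_left: "commutator (f + f') g = commutator f g + commutator f' g"
  and commutator_add_right: "commutator f (g + g') = commutator f g + commutator f g'"
  and commutator_diff_left: "commutator (f - f') g = commutator f g - commutator f' g"
  and commutator_diff_right: "commutator f (g - g') = commutator f g - commutator f g'"
  and commutator_scale_left: "commutator (nc_scale c f) g = nc_scale c (commutator f g)"
  and commutator_scale_right: "commutator f (nc_scale c g) = nc_scale c (commutator f g)"
  and commutator_swap: "commutator g f = - commutator f g"
  and commutator_zero [simp]: "commutator 0 f = 0" "commutator f 0 = 0"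
  by (simp_all add: commutator_def algebra_simps nc.scale_right_diff_distrib)

lemma part_commutator:
  "nc_part d (commutator f g) = (\<Sum>i\<le>d. commutator (nc_part i f) (nc_part (d - i) g))"
proof -
  have "nc_part d (g * f) = (\<Sum>i\<le>d. nc_part (d - i) g * nc_part i f)"
    unfolding part_mult
    by (rule sum.reindex_bij_witness[where i = "\<lambda>i. d - i" and j = "\<lambda>i. d - i"]) auto
  then show ?thesis by (simp add: commutator_def part_diff part_mult sum_subtractf)
qed

lemma commutator_minus_left: "commutator (- f) g = - commutator f g"
  by (simp_all add: commutator_def)

definition graded_hat :: "('a, 'k::field_char_0) nc_series set \<Rightarrow> ('a, 'k) nc_series set" where
  "graded_hat V = {u. \<forall>d. nc_part d u \<in> V}"

lemma lie_series_hat: "lie_series A = graded_hat (lie_poly A)"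
  and kd_ideal_hat_hat: "kd_ideal_hat S = graded_hat (kd_ideal S)"
  by (simp_all add: lie_series_def kd_ideal_hat_def graded_hat_def)

lemma subspace_hat: "nc.subspace V \<Longrightarrow> nc.subspace (graded_hat V)"
  by (auto simp: graded_hat_def nc.subspace_def part_add part_scale)

lemma subspace_minus: "nc.subspace V \<Longrightarrow> u \<in> V \<Longrightarrow> - u \<in> V"
  by (metis nc.subspace_neg)

lemma hat_commutator:
  assumes "nc.subspace Z" "\<And>u v. u \<in> V \<Longrightarrow> v \<in> W \<Longrightarrow> commutator u v \<in> Z"
    and "u \<in> graded_hat V" "v \<in> graded_hat W"
  shows "commutator u v \<in> graded_hat Z"
  using assms by (auto simp: graded_hat_def part_commutator intro!: nc.subspace_sum)

lemma part_nc_sum: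
  assumes "\<And>m. order_ge m (F m)" shows "nc_part d (nc_sum F) = (\<Sum>m\<le>d. nc_part d (F m))"
  using part_eq_upto[OF nc_sum_upto[OF assms], of d "Suc d"]
  by (simp add: part_sum lessThan_Suc_atMost)

lemma hat_nc_sum:
  assumes "nc.subspace V" "\<And>m. order_ge m (F m)" "\<And>m. F m \<in> graded_hat V"
  shows "nc_sum F \<in> graded_hat V"
  using assms by (auto simp: graded_hat_def part_nc_sum intro!: nc.subspace_sum)

definition trunc :: "nat \<Rightarrow> ('a, 'k::field_char_0) nc_series \<Rightarrow> ('a, 'k) nc_series" where
  "trunc d f = (\<Sum>e<d. nc_part e f)"

lemma part_trunc: "nc_part e (trunc d f) = (if e < d then nc_part e f else 0)"
  by (simp add: trunc_def part_sum part_part)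

lemma trunc_upto: "eq_upto d f (trunc d f)"
  by (simp add: eq_upto_parts part_trunc)

lemma eq_upto_Suc_mult:
  assumes "eq_upto d f g" "eq_upto d f' g'" "order_ge 1 g" "order_ge 1 f'"
  shows "eq_upto (Suc d) (f * f') (g * g')"
proof -
  have "f * f' - g * g' = (f - g) * f' + g * (f' - g')" by (simp add: algebra_simps)
  then show ?thesis
    using assms order_ge_mult'[of d "f - g" 1 f' "Suc d"] order_ge_mult'[of 1 g d "f' - g'" "Suc d"]
    by (simp add: eq_upto_iff order_ge_add)
qed

lemma eq_upto_Suc_commutator:
  assumes "eq_upto d f g" "eq_upto d f' g'" "order_ge 1 f" "order_ge 1 g" "order_ge 1 f'" "order_ge 1 g'"
  shows "eq_upto (Suc d) (commutator f f') (commutator g g')"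
  unfolding commutator_def by (intro eq_upto_diff eq_upto_Suc_mult assms)

lemma eq_upto_nc_sum: "(\<And>m. eq_upto d (F m) (G m)) \<Longrightarrow> eq_upto d (nc_sum F) (nc_sum G)"
  by (simp add: eq_upto_def nc_sum_def)

section \<open>The Baker--Campbell--Hausdorff theorem modulo a Lie ideal\<close>

locale lie_ideal =
  fixes L J :: "('a, 'k::field_char_0) nc_series set"
  assumes L: "nc.subspace L" and J: "nc.subspace J" and JL: "J \<subseteq> L"
    and LL: "u \<in> L \<Longrightarrow> v \<in> L \<Longrightarrow> commutator u v \<in> L"
    and LJ: "u \<in> L \<Longrightarrow> v \<in> J \<Longrightarrow> commutator u v \<in> J"
    and const: "u \<in> L \<Longrightarrow> coeff u [] = 0"
begin

definition congr :: "('a, 'k) nc_series \<Rightarrow> ('a, 'k) nc_series \<Rightarrow> bool" where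
  "congr u v \<longleftrightarrow> u \<in> graded_hat L \<and> v \<in> graded_hat L \<and> u - v \<in> graded_hat J"

lemmas hat_L = subspace_hat[OF L] and hat_J = subspace_hat[OF J]

lemma hat_LJ: "u \<in> graded_hat L \<Longrightarrow> v \<in> graded_hat J \<Longrightarrow> commutator u v \<in> graded_hat J"
  using J LJ by (rule hat_commutator)

lemma hat_LL: "u \<in> graded_hat L \<Longrightarrow> v \<in> graded_hat L \<Longrightarrow> commutator u v \<in> graded_hat L"
  using L LL by (rule hat_commutator)

lemma hat_order: "u \<in> graded_hat L \<Longrightarrow> order_ge 1 u"
proof -
  assume "u \<in> graded_hat L"
  then have "nc_part 0 u \<in> L" by (simp add: graded_hat_def)
  from const[OF this] show ?thesis by (simp add: order_ge_def coeff_part)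
qed

lemma congr_refl: "u \<in> graded_hat L \<Longrightarrow> congr u u"
  using nc.subspace_0[OF hat_J] by (simp add: congr_def)

lemma congr_sym: "congr u v \<Longrightarrow> congr v u"
  unfolding congr_def by (metis minus_diff_eq subspace_minus[OF hat_J])

lemma congr_trans: "congr u v \<Longrightarrow> congr v w \<Longrightarrow> congr u w"
  unfolding congr_def using nc.subspace_add[OF hat_J, of "u - v" "v - w"] by simp

lemma congr_add: "congr u v \<Longrightarrow> congr u' v' \<Longrightarrow> congr (u + u') (v + v')"
  using nc.subspace_add[OF hat_L] nc.subspace_add[OF hat_J, of "u - v" "u' - v'"]
  by (simp add: congr_def add_diff_add)

lemma congr_scale: "congr u v \<Longrightarrow> congr (nc_scale c u) (nc_scale c v)"
  using nc.subspace_scale[OF hat_L] nc.subspace_scale[OF hat_J]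
  by (auto simp: congr_def nc.scale_right_diff_distrib[symmetric])

lemma congr_minus: "congr u v \<Longrightarrow> congr (- u) (- v)"
  using congr_scale[of u v "-1"] by simp

lemma congr_diff: "congr u v \<Longrightarrow> congr u' v' \<Longrightarrow> congr (u - u') (v - v')"
  using congr_add[of u v "- u'" "- v'"] congr_minus by simp

lemma congr_commutator:
  assumes "congr u v" "congr u' v'" shows "congr (commutator u u') (commutator v v')"
proof -
  have "commutator u u' - commutator v v' = commutator v (u' - v') - commutator u' (u - v)"
    by (simp add: commutator_def algebra_simps)
  moreover have "commutator v (u' - v') - commutator u' (u - v) \<in> graded_hat J"
    using assms hat_LJ[of v "u' - v'"] hat_LJ[of u' "u - v"]
    by (simp add: congr_def nc.subspace_diff[OF hat_J])
  ultimately show ?thesis using assms hat_LL by (simp add: congr_def)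
qed

lemma congr_ad_pow: "congr u v \<Longrightarrow> congr x y \<Longrightarrow> congr (ad_pow u i x) (ad_pow v i y)"
  by (induction i) (auto intro: congr_commutator)

lemma congr_nc_sum:
  assumes "\<And>m. order_ge m (F m)" "\<And>m. order_ge m (G m)" "\<And>m. congr (F m) (G m)"
  shows "congr (nc_sum F) (nc_sum G)"
proof -
  have eq: "nc_sum F - nc_sum G = nc_sum (\<lambda>m. F m - G m)"
    by (rule nc_series_eqI) (simp add: nc_sum_def sum_subtractf)
  show ?thesis
    unfolding congr_def eq using assms
    by (auto intro!: hat_nc_sum L J order_ge_diff simp: congr_def)
qed

lemma congr_order: "congr u v \<Longrightarrow> order_ge 1 u \<and> order_ge 1 v"
  using hat_order by (auto simp: congr_def)

lemma order_ge_ad_pow': "order_ge 1 u \<Longrightarrow> order_ge i (ad_pow u i x)"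
  using order_ge_ad_pow[of u 0 x i] by simp

lemma congr_Ad:
  assumes "congr u v" "congr x y" shows "congr (nc_Ad u x) (nc_Ad v y)"
  unfolding nc_Ad_def using congr_order[OF assms(1)]
  by (intro congr_nc_sum order_ge_scale order_ge_ad_pow' congr_scale congr_ad_pow assms) auto

lemma congr_euler: "congr u v \<Longrightarrow> congr (nc_euler u) (nc_euler v)"
  using nc.subspace_scale[OF L] nc.subspace_scale[OF J]
  by (auto simp: congr_def graded_hat_def part_euler part_diff nc.scale_right_diff_distrib[symmetric])

lemma congr_dexp:
  assumes "congr u v" shows "congr (nc_dexp u) (nc_dexp v)"
  unfolding nc_dexp_def using congr_order[OF assms]
  by (intro congr_nc_sum order_ge_scale order_ge_ad_pow' congr_scale congr_ad_pow congr_euler assms) auto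

text \<open>The logarithmic derivative \<open>nc_dexp z\<close> determines \<open>z\<close> degree by degree through Lie
  operations: in degree \<open>d\<close>, it equals \<open>d\<close> times the degree \<open>d\<close> part of \<open>z\<close> plus brackets of
  parts of \<open>z\<close> of lower degree. As \<open>d\<close> is invertible, membership in the Lie algebra and
  congruence modulo the ideal pass from \<open>nc_dexp z\<close> to \<open>z\<close>.\<close>

lemma congr_dexp_imp:
  assumes z: "order_ge 1 z" and z': "order_ge 1 z'" and c: "congr (nc_dexp z) (nc_dexp z')"
  shows "congr z z'"
proof -
  define R where "R y = nc_sum (\<lambda>i. nc_scale (1 / fact (Suc (Suc i))) (ad_pow y (Suc i) (nc_euler y)))"
    for y :: "('a, 'k) nc_series"
  have dexp: "nc_dexp y = nc_euler y + R y" if "order_ge 1 y" for y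
    unfolding nc_dexp_def R_def
    by (subst nc_sum_split) (auto intro!: order_ge_scale order_ge_ad_pow'[OF that])
  have R_upto: "eq_upto (Suc d) (R y) (R (trunc d y))" if y: "order_ge 1 y" for d y
    unfolding R_def
  proof (intro eq_upto_nc_sum eq_upto_scale)
    fix i
    have o: "order_ge 1 (trunc d y)"
      using y by (simp add: order_ge_parts part_trunc)
    have oe: "order_ge 1 (nc_euler y)" "order_ge 1 (nc_euler (trunc d y))"
      using y o by (auto intro: order_ge_euler)
    have ee: "eq_upto d (nc_euler y) (nc_euler (trunc d y))"
      using trunc_upto[of d y] by (auto simp: eq_upto_def)
    have oa: "order_ge 1 (ad_pow y i (nc_euler y))" "order_ge 1 (ad_pow (trunc d y) i (nc_euler (trunc d y)))" for i
      using order_ge_ad_pow[OF y oe(1), of i] order_ge_ad_pow[OF o oe(2), of i]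
      by (auto intro: order_ge_mono)
    have "eq_upto (Suc d) (ad_pow y (Suc i) (nc_euler y)) (ad_pow (trunc d y) (Suc i) (nc_euler (trunc d y)))"
    proof (induction i)
      case 0
      then show ?case using eq_upto_Suc_commutator[OF trunc_upto ee y o oe] by simp
    next
      case (Suc i)
      have "eq_upto d (ad_pow y (Suc i) (nc_euler y)) (ad_pow (trunc d y) (Suc i) (nc_euler (trunc d y)))"
        using Suc by (rule eq_upto_mono) simp
      from eq_upto_Suc_commutator[OF trunc_upto this y o oa] show ?case by simp
    qed
    then show "eq_upto (Suc d) (ad_pow y (Suc i) (nc_euler y)) (ad_pow (trunc d y) (Suc i) (nc_euler (trunc d y)))" .
  qed
  have congr_R: "congr (R u) (R v)" if "congr u v" for u v
    unfolding R_def using congr_order[OF that]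
    by (intro congr_nc_sum order_ge_scale congr_scale congr_ad_pow congr_euler that
        order_ge_mono[OF order_ge_ad_pow'[of _ "Suc _"]]) auto
  have "nc_part d z \<in> L \<and> nc_part d z' \<in> L \<and> nc_part d z - nc_part d z' \<in> J" for d
  proof (induction d rule: less_induct)
    case (less d)
    show ?case
    proof (cases "d = 0")
      case True
      then show ?thesis
        using z z' nc.subspace_0[OF L] nc.subspace_0[OF J] by (simp add: order_ge_parts)
    next
      case False
      have "congr (trunc d z) (trunc d z')"
        using less nc.subspace_0[OF L] nc.subspace_0[OF J]
        by (simp add: congr_def graded_hat_def part_diff part_trunc)
      then have "congr (nc_dexp z - R (trunc d z)) (nc_dexp z' - R (trunc d z'))"
        by (intro congr_diff c congr_R)
      then have "nc_part d (nc_dexp z - R (trunc d z)) \<in> L" "nc_part d (nc_dexp z' - R (trunc d z')) \<in> L"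
        "nc_part d (nc_dexp z - R (trunc d z)) - nc_part d (nc_dexp z' - R (trunc d z')) \<in> J"
        by (auto simp: congr_def graded_hat_def part_diff[of _ "nc_dexp z - _" "nc_dexp z' - _"])
      moreover have "nc_part d (nc_dexp y - R (trunc d y)) = nc_scale (of_nat d) (nc_part d y)"
        if y: "order_ge 1 y" for y
        using part_eq_upto[OF R_upto[OF y], of d d] by (simp add: dexp[OF y] part_add part_diff part_euler)
      ultimately have *: "nc_scale (of_nat d) (nc_part d z) \<in> L" "nc_scale (of_nat d) (nc_part d z') \<in> L"
        "nc_scale (of_nat d) (nc_part d z) - nc_scale (of_nat d) (nc_part d z') \<in> J"
        using z z' by simp_all
      then have "nc_scale (1 / of_nat d) (nc_scale (of_nat d) (nc_part d z)) \<in> L"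
        "nc_scale (1 / of_nat d) (nc_scale (of_nat d) (nc_part d z')) \<in> L"
        "nc_scale (1 / of_nat d) (nc_scale (of_nat d) (nc_part d z) - nc_scale (of_nat d) (nc_part d z')) \<in> J"
        using nc.subspace_scale[OF L] nc.subspace_scale[OF J] by blast+
      then show ?thesis using False by (simp add: nc.scale_right_diff_distrib)
    qed
  qed
  then show ?thesis by (simp add: congr_def graded_hat_def part_diff)
qed

end

lemma exp_bch:
  assumes "order_ge 1 u" "order_ge 1 v"
  shows "order_ge 1 (bch u v)" "nc_exp (bch u v) = nc_exp u * nc_exp v"
proof -
  have "order_ge 1 (nc_exp u * nc_exp v - 1)"
  proof -
    have "nc_exp u * nc_exp v - 1 = (nc_exp u - 1) * nc_exp v + (nc_exp v - 1)"
      by (simp add: algebra_simps)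
    then show ?thesis
      using order_ge_add[OF order_ge_mult_right[OF order_ge_exp[OF assms(1)], of "nc_exp v"]
          order_ge_exp[OF assms(2)]]
      by (simp only: order_refl)
  qed
  then show "order_ge 1 (bch u v)" "nc_exp (bch u v) = nc_exp u * nc_exp v"
    by (simp_all add: bch_def order_ge_log nc_exp_log)
qed

lemma exp_cancel_right:
  assumes "order_ge 1 z" "a * nc_exp z = b * nc_exp z" shows "a = b"
proof -
  have "a * nc_exp z * nc_exp (- z) = b * nc_exp z * nc_exp (- z)" using assms by simp
  then show ?thesis using nc_exp_minus[OF assms(1)] by (simp add: mult.assoc)
qed

lemma dexp_bch:
  assumes "order_ge 1 u" "order_ge 1 v"
  shows "nc_dexp (bch u v) = nc_dexp u + nc_Ad u (nc_dexp v)"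
proof (rule exp_cancel_right)
  show o: "order_ge 1 (bch u v)" by (rule exp_bch(1)[OF assms])
  have "nc_dexp (bch u v) * nc_exp (bch u v) = nc_euler (nc_exp u * nc_exp v)"
    using euler_exp_eq_dexp[OF o] by (simp add: exp_bch(2)[OF assms])
  also have "\<dots> = nc_dexp u * nc_exp u * nc_exp v + nc_Ad u (nc_dexp v) * nc_exp u * nc_exp v"
    unfolding exp_mult_eq_Ad[OF assms(1), symmetric]
    by (simp add: nc_euler_mult euler_exp_eq_dexp assms mult.assoc)
  also have "\<dots> = (nc_dexp u + nc_Ad u (nc_dexp v)) * nc_exp (bch u v)"
    by (simp add: exp_bch assms algebra_simps)
  finally show "nc_dexp (bch u v) * nc_exp (bch u v) = (nc_dexp u + nc_Ad u (nc_dexp v)) * nc_exp (bch u v)" .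
qed

context lie_ideal
begin

text \<open>It suffices to compare logarithmic derivatives, and the logarithmic derivative of a product is
  obtained from those of the factors by Lie operations. For the ideal equal to the whole Lie algebra this
  is the Baker--Campbell--Hausdorff theorem.\<close>

theorem congr_bch:
  assumes "congr u v" "congr u' v'" shows "congr (bch u u') (bch v v')"
proof (rule congr_dexp_imp)
  show "order_ge 1 (bch u u')" "order_ge 1 (bch v v')"
    using congr_order[OF assms(1)] congr_order[OF assms(2)] by (auto intro: exp_bch(1))
  show "congr (nc_dexp (bch u u')) (nc_dexp (bch v v'))"
    using congr_order[OF assms(1)] congr_order[OF assms(2)]
    by (simp add: dexp_bch assms congr_add congr_Ad congr_dexp)
qed

lemma hat_bch: "u \<in> graded_hat L \<Longrightarrow> v \<in> graded_hat L \<Longrightarrow> bch u v \<in> graded_hat L"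
  using congr_bch[OF congr_refl congr_refl] by (simp add: congr_def)

lemma hat_Ad: "u \<in> graded_hat L \<Longrightarrow> x \<in> graded_hat L \<Longrightarrow> nc_Ad u x \<in> graded_hat L"
  using congr_Ad[OF congr_refl congr_refl] by (simp add: congr_def)

lemma hat_log:
  assumes "order_ge 1 z" "Y \<in> graded_hat L" "nc_euler (nc_exp z) = Y * nc_exp z"
  shows "z \<in> graded_hat L"
proof -
  have "nc_dexp z = Y"
    by (rule exp_cancel_right[OF assms(1)]) (simp add: assms(3)[symmetric] euler_exp_eq_dexp[OF assms(1)])
  then have "congr z z" using congr_dexp_imp[OF assms(1,1)] congr_refl[OF assms(2)] by simp
  then show ?thesis by (simp add: congr_def)
qed

end

lemma subspace_lie_poly: "nc.subspace (lie_poly A)"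
  by (auto simp: nc.subspace_def intro: lie_poly.intros)

lemma lie_poly_const: "u \<in> lie_poly A \<Longrightarrow> coeff u [] = 0"
  by (induction rule: lie_poly.induct) (auto simp: coeff_var commutator_def coeff_times_Nil)

lemma lie_ideal_lie_poly: "lie_ideal (lie_poly A) (lie_poly A)"
  by unfold_locales (simp_all add: subspace_lie_poly lie_poly.intros(5) lie_poly_const)

interpretation free_lie: lie_ideal "lie_poly A" "lie_poly A" for A
  by (rule lie_ideal_lie_poly)

lemma lie_poly_part:
  fixes u :: "('a, 'k::field_char_0) nc_series"
  shows "u \<in> lie_poly A \<Longrightarrow> nc_part d u \<in> lie_poly A"
proof (induction arbitrary: d rule: lie_poly.induct)
  case (2 a)
  have "nc_part d (nc_var a :: ('a, 'k) nc_series) = (if d = 1 then nc_var a else 0)"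
    by (rule nc_series_eqI) (auto simp: coeff_part coeff_var)
  then show ?case using 2 by (auto simp: lie_poly.intros(1,2))
next
  case (5 u v)
  then show ?case
    unfolding part_commutator by (intro nc.subspace_sum[OF subspace_lie_poly] lie_poly.intros) auto
qed (auto simp: part_add part_scale intro: lie_poly.intros)

lemma lie_poly_subset_series: "lie_poly A \<subseteq> lie_series A"
  by (auto simp: lie_series_def lie_poly_part)

lemma lie_poly_mono:
  assumes "A \<subseteq> B" "u \<in> lie_poly A" shows "u \<in> lie_poly B"
  using assms(2)
proof induction
  case (2 a)
  then show ?case using assms(1) by (blast intro: lie_poly.intros(2))
qed (simp_all add: lie_poly.intros)

lemma lie_series_mono: "A \<subseteq> B \<Longrightarrow> u \<in> lie_series A \<Longrightarrow> u \<in> lie_series B"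
  unfolding lie_series_def using lie_poly_mono[of A B] by blast

lemma subspace_lie_series: "nc.subspace (lie_series A)"
  unfolding lie_series_hat by (rule subspace_hat[OF subspace_lie_poly])

lemmas lie_series_add = nc.subspace_add[OF subspace_lie_series]
  and lie_series_scale = nc.subspace_scale[OF subspace_lie_series]
  and lie_series_0 [simp] = nc.subspace_0[OF subspace_lie_series]
  and lie_series_minus = subspace_minus[OF subspace_lie_series]
  and lie_series_diff = nc.subspace_diff[OF subspace_lie_series]
  and lie_series_sum = nc.subspace_sum[OF subspace_lie_series]
  and lie_series_commutator = free_lie.hat_LL[folded lie_series_hat]
  and lie_series_bch = free_lie.hat_bch[folded lie_series_hat]
  and lie_series_Ad = free_lie.hat_Ad[folded lie_series_hat]
  and lie_series_order = free_lie.hat_order[folded lie_series_hat]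

lemma lie_series_var: "a \<in> A \<Longrightarrow> nc_var a \<in> lie_series A"
  by (rule subsetD[OF lie_poly_subset_series lie_poly.intros(2)])

definition supported :: "'a set \<Rightarrow> ('a, 'k::field_char_0) nc_series \<Rightarrow> bool" where
  "supported A f \<longleftrightarrow> (\<forall>w. \<not> set w \<subseteq> A \<longrightarrow> coeff f w = 0)"

lemma supported_mult: "supported A f \<Longrightarrow> supported A g \<Longrightarrow> supported A (f * g)"
  unfolding supported_def
proof (intro allI impI)
  fix w assume *: "\<forall>w. \<not> set w \<subseteq> A \<longrightarrow> coeff f w = 0" "\<forall>w. \<not> set w \<subseteq> A \<longrightarrow> coeff g w = 0" "\<not> set w \<subseteq> A"
  have "coeff f (take i w) * coeff g (drop i w) = 0" for i
  proof -
    have "set (take i w) \<union> set (drop i w) = set w" by (simp flip: set_append)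
    then have "\<not> set (take i w) \<subseteq> A \<or> \<not> set (drop i w) \<subseteq> A" using *(3) by blast
    then have "coeff f (take i w) = 0 \<or> coeff g (drop i w) = 0"
      using *(1)[rule_format, of "take i w"] *(2)[rule_format, of "drop i w"] by argo
    then show ?thesis by (rule disjE) simp_all
  qed
  then show "coeff (f * g) w = 0" unfolding coeff_times by (intro sum.neutral ballI)
qed

lemma supported_power: "supported A f \<Longrightarrow> supported A (f ^ m)"
proof (induction m)
  case 0
  then show ?case by (auto simp: supported_def coeff_one)
next
  case (Suc m)
  then show ?case unfolding power_Suc by (intro supported_mult)
qed

lemma supported_exp: "supported A f \<Longrightarrow> supported A (nc_exp f)"
proof -
  assume f: "supported A f"
  have "coeff (f ^ m) w = 0" if "\<not> set w \<subseteq> A" for m w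
    using supported_power[OF f] that by (simp add: supported_def)
  then show ?thesis by (simp add: supported_def nc_exp_def)
qed

lemma supported_lie_poly: "u \<in> lie_poly A \<Longrightarrow> supported A u"
proof (induction rule: lie_poly.induct)
  case (5 u v)
  then have "supported A (u * v)" "supported A (v * u)" by (auto intro: supported_mult)
  then show ?case by (simp add: supported_def commutator_def)
qed (auto simp: supported_def coeff_var)

lemma supported_lie_series: "u \<in> lie_series A \<Longrightarrow> supported A u"
proof -
  assume u: "u \<in> lie_series A"
  have "coeff u w = coeff (nc_part (length w) u) w" for w by (simp add: coeff_part)
  moreover have "supported A (nc_part d u)" for d
    using u supported_lie_poly by (auto simp: lie_series_def)
  ultimately show ?thesis unfolding supported_def by metis
qed

section \<open>Substitution\<close>

abbreviation word_prod :: "('a \<Rightarrow> ('b, 'k::field_char_0) nc_series) \<Rightarrow> 'a list \<Rightarrow> ('b, 'k) nc_series" where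
  "word_prod s v \<equiv> prod_list (map s v)"

lemma finite_words: "finite A \<Longrightarrow> finite {v. set v \<subseteq> A \<and> length v < d}"
  by (rule finite_subset[OF _ finite_lists_length_le[of A d]]) auto

text \<open>Operators \<open>op a\<close>, one for each letter, that raise the order make the space on which they act
  a module over the algebra of series.\<close>

locale letter_action =
  fixes A :: "'a set" and op :: "'a \<Rightarrow> ('b, 'k::field_char_0) nc_series \<Rightarrow> ('b, 'k) nc_series"
  assumes fin_letters: "finite A"
    and op_add: "op a (p + q) = op a p + op a q"
    and op_scale: "op a (nc_scale c p) = nc_scale c (op a p)"
    and op_order: "a \<in> A \<Longrightarrow> order_ge d p \<Longrightarrow> order_ge (Suc d) (op a p)"
begin

definition act :: "('a, 'k) nc_series \<Rightarrow> ('b, 'k) nc_series \<Rightarrow> ('b, 'k) nc_series" where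
  "act f p = Nc_series (\<lambda>w. \<Sum>v\<in>{v. set v \<subseteq> A \<and> length v \<le> length w}.
      coeff f v * coeff (foldr op v p) w)"

lemma foldr_add: "foldr op v (p + q) = foldr op v p + foldr op v q"
  by (induction v) (simp_all add: op_add)

lemma foldr_scale: "foldr op v (nc_scale c p) = nc_scale c (foldr op v p)"
  by (induction v) (simp_all add: op_scale)

lemma foldr_0: "foldr op v 0 = 0"
  using foldr_scale[of v 0 0] by simp

lemma foldr_diff: "foldr op v (p - q) = foldr op v p - foldr op v q"
  using foldr_add[of v "p - q" q] by simp

lemma foldr_sum: "foldr op v (sum F I) = (\<Sum>i\<in>I. foldr op v (F i))"
  by (induction I rule: infinite_finite_induct) (simp_all add: foldr_0 foldr_add)

lemma foldr_order: "set v \<subseteq> A \<Longrightarrow> order_ge d p \<Longrightarrow> order_ge (length v + d) (foldr op v p)"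
  by (induction v) (simp_all add: op_order)

lemma act_upto: "eq_upto d (act f p)
    (\<Sum>v\<in>{v. set v \<subseteq> A \<and> length v < d}. nc_scale (coeff f v) (foldr op v p))"
  unfolding eq_upto_def
proof (intro allI impI)
  fix w :: "'b list" assume w: "length w < d"
  have *: "coeff (foldr op v p) w = 0" if "set v \<subseteq> A" "\<not> length v \<le> length w" for v
    using foldr_order[OF that(1), of 0 p] that(2) by (simp add: order_ge_def)
  have "(\<Sum>v\<in>{v. set v \<subseteq> A \<and> length v \<le> length w}. coeff f v * coeff (foldr op v p) w) =
      (\<Sum>v\<in>{v. set v \<subseteq> A \<and> length v < d}. coeff f v * coeff (foldr op v p) w)"
    by (rule sum.mono_neutral_left) (use w finite_words[OF fin_letters] * in auto)
  then show "coeff (act f p) w =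
      coeff (\<Sum>v\<in>{v. set v \<subseteq> A \<and> length v < d}. nc_scale (coeff f v) (foldr op v p)) w"
    by (simp add: act_def coeff_sum)
qed

lemma act_add_left: "act (f + g) p = act f p + act g p"
  and act_diff_left: "act (f - g) p = act f p - act g p"
  and act_scale_left: "act (nc_scale c f) p = nc_scale c (act f p)"
  and act_0_left: "act 0 p = 0"
  and act_0_right: "act f 0 = 0"
  by (auto intro!: nc_series_eqI sum.cong simp: act_def sum.distrib[symmetric] foldr_0
      sum_subtractf[symmetric] sum_distrib_left algebra_simps)

lemma act_var: "a \<in> A \<Longrightarrow> act (nc_var a) p = op a p"
proof (rule eq_upto_eqI)
  fix d assume a: "a \<in> A"
  have "eq_upto (Suc (Suc d)) (act (nc_var a) p)
      (\<Sum>v\<in>{v. set v \<subseteq> A \<and> length v < Suc (Suc d)}. nc_scale (coeff (nc_var a) v) (foldr op v p))"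
    by (rule act_upto)
  also have "(\<Sum>v\<in>{v. set v \<subseteq> A \<and> length v < Suc (Suc d)}. nc_scale (coeff (nc_var a) v) (foldr op v p)) =
      (\<Sum>v\<in>{[a]}. nc_scale (coeff (nc_var a) v) (foldr op v p))"
    by (rule sum.mono_neutral_right) (use finite_words[OF fin_letters] a in \<open>auto simp: coeff_var\<close>)
  finally have "eq_upto (Suc (Suc d)) (act (nc_var a) p) (op a p)"
    by (simp add: coeff_var)
  then show "eq_upto d (act (nc_var a) p) (op a p)" by (rule eq_upto_mono) simp
qed

lemma act_mult: "act (f * g) p = act f (act g p)"
proof (rule eq_upto_eqI)
  fix d
  define W where "W = {v. set v \<subseteq> A \<and> length v < d}"
  have finW: "finite W" using finite_words[OF fin_letters] by (simp add: W_def)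
  define t where "t v1 v2 = nc_scale (coeff f v1) (foldr op v1 (nc_scale (coeff g v2) (foldr op v2 p)))"
    for v1 v2
  define D where "D = {(v1, v2) \<in> W \<times> W. length v1 + length v2 < d}"
  have "eq_upto d (act (f * g) p) (\<Sum>v\<in>W. nc_scale (coeff (f * g) v) (foldr op v p))"
    unfolding W_def by (rule act_upto)
  also have "(\<Sum>v\<in>W. nc_scale (coeff (f * g) v) (foldr op v p)) =
      (\<Sum>v\<in>W. \<Sum>i\<le>length v. t (take i v) (drop i v))"
  proof (rule sum.cong)
    fix v
    have "foldr op (take i v) (foldr op (drop i v) p) = foldr op v p" for i
      by (metis append_take_drop_id foldr_append comp_apply)
    then show "nc_scale (coeff (f * g) v) (foldr op v p) = (\<Sum>i\<le>length v. t (take i v) (drop i v))"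
      by (simp add: t_def coeff_times nc.scale_sum_left foldr_scale mult.commute)
  qed simp
  also have "\<dots> = (\<Sum>(v, i)\<in>(SIGMA v:W. {..length v}). t (take i v) (drop i v))"
    by (rule sum.Sigma) (use finW in auto)
  also have "\<dots> = (\<Sum>(v1, v2)\<in>D. t v1 v2)"
    by (rule sum.reindex_bij_witness[where i = "\<lambda>(v1, v2). (v1 @ v2, length v1)"
          and j = "\<lambda>(v, i). (take i v, drop i v)"])
      (auto simp: W_def D_def dest: in_set_takeD in_set_dropD)
  \<comment> \<open>pairs of words of total length at least \<open>d\<close> contribute only terms of order \<open>d\<close>\<close>
  also have "eq_upto d \<dots> (\<Sum>(v1, v2)\<in>W \<times> W. t v1 v2)"
  proof (rule eq_upto_sym)
    have sub: "D \<subseteq> W \<times> W" by (auto simp: D_def)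
    have "(\<Sum>(v1, v2)\<in>W \<times> W. t v1 v2) - (\<Sum>(v1, v2)\<in>D. t v1 v2) = (\<Sum>(v1, v2)\<in>W \<times> W - D. t v1 v2)"
      by (rule sum_diff[OF _ sub, symmetric]) (use finW in simp)
    moreover have "order_ge d (t v1 v2)" if "v1 \<in> W" "v2 \<in> W" "(v1, v2) \<notin> D" for v1 v2
    proof -
      have "order_ge (length v1 + (length v2 + 0)) (foldr op v1 (foldr op v2 p))"
        using that by (intro foldr_order) (simp_all add: W_def)
      moreover have "d \<le> length v1 + (length v2 + 0)" using that by (simp add: D_def)
      ultimately show ?thesis
        unfolding t_def foldr_scale by (intro order_ge_scale) (rule order_ge_mono)
    qed
    ultimately show "eq_upto d (\<Sum>(v1, v2)\<in>W \<times> W. t v1 v2) (\<Sum>(v1, v2)\<in>D. t v1 v2)"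
      by (auto simp: eq_upto_iff intro!: order_ge_sum)
  qed
  also have "(\<Sum>(v1, v2)\<in>W \<times> W. t v1 v2) =
      (\<Sum>v1\<in>W. nc_scale (coeff f v1) (foldr op v1 (\<Sum>v2\<in>W. nc_scale (coeff g v2) (foldr op v2 p))))"
    by (simp add: t_def sum.cartesian_product[symmetric] foldr_sum nc.scale_sum_right)
  also have "eq_upto d \<dots> (\<Sum>v\<in>W. nc_scale (coeff f v) (foldr op v (act g p)))"
  proof (intro eq_upto_sum eq_upto_scale)
    fix v assume v: "v \<in> W"
    have "order_ge d (act g p - (\<Sum>v2\<in>W. nc_scale (coeff g v2) (foldr op v2 p)))"
      using act_upto[of d g p] by (simp add: eq_upto_iff W_def)
    then have "order_ge (length v + d) (foldr op v (act g p - (\<Sum>v2\<in>W. nc_scale (coeff g v2) (foldr op v2 p))))"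
      using v by (intro foldr_order) (simp_all add: W_def)
    then have "eq_upto d (foldr op v (act g p)) (foldr op v (\<Sum>v2\<in>W. nc_scale (coeff g v2) (foldr op v2 p)))"
      unfolding eq_upto_iff foldr_diff by (rule order_ge_mono) simp
    then show "eq_upto d (foldr op v (\<Sum>v2\<in>W. nc_scale (coeff g v2) (foldr op v2 p))) (foldr op v (act g p))"
      by (rule eq_upto_sym)
  qed
  also have "eq_upto d \<dots> (act f (act g p))"
    unfolding W_def by (rule eq_upto_sym[OF act_upto])
  finally show "eq_upto d (act (f * g) p) (act f (act g p))" .
qed

end

locale substitution =
  fixes A :: "'a set" and s :: "'a \<Rightarrow> ('b, 'k::field_char_0) nc_series"
  assumes fin: "finite A" and ord: "a \<in> A \<Longrightarrow> order_ge 1 (s a)"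
begin

lemma order_ge_word_prod: "set v \<subseteq> A \<Longrightarrow> order_ge (length v) (word_prod s v)"
  by (induction v) (auto intro!: order_ge_mult'[where d = 1] ord)

lemma subst_upto: "eq_upto d (nc_subst A s f)
    (\<Sum>v\<in>{v. set v \<subseteq> A \<and> length v < d}. nc_scale (coeff f v) (word_prod s v))"
  unfolding eq_upto_def
proof (intro allI impI)
  fix w :: "'b list" assume w: "length w < d"
  have "coeff (word_prod s v) w = 0" if "set v \<subseteq> A" "\<not> length v \<le> length w" for v
    using order_ge_word_prod[OF that(1)] that(2) by (simp add: order_ge_def)
  note * = this
  have "(\<Sum>v\<in>{v. set v \<subseteq> A \<and> length v \<le> length w}. coeff f v * coeff (word_prod s v) w) =
      (\<Sum>v\<in>{v. set v \<subseteq> A \<and> length v < d}. coeff f v * coeff (word_prod s v) w)"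
    by (rule sum.mono_neutral_left)
      (use w finite_words[OF fin] * in auto)
  then show "coeff (nc_subst A s f) w =
      coeff (\<Sum>v\<in>{v. set v \<subseteq> A \<and> length v < d}. nc_scale (coeff f v) (word_prod s v)) w"
    by (simp add: nc_subst_def coeff_sum)
qed

lemma subst_add: "nc_subst A s (f + g) = nc_subst A s f + nc_subst A s g"
  and subst_diff: "nc_subst A s (f - g) = nc_subst A s f - nc_subst A s g"
  and subst_scale: "nc_subst A s (nc_scale c f) = nc_scale c (nc_subst A s f)"
  and subst_0: "nc_subst A s 0 = 0"
  by (auto intro!: nc_series_eqI sum.cong simp: nc_subst_def sum.distrib[symmetric]
      sum_subtractf[symmetric] sum_distrib_left algebra_simps)

lemma subst_order: "order_ge d f \<Longrightarrow> order_ge d (nc_subst A s f)"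
  by (auto simp: order_ge_def nc_subst_def intro!: sum.neutral)

lemma subst_cong_upto: "eq_upto d f g \<Longrightarrow> eq_upto d (nc_subst A s f) (nc_subst A s g)"
  using subst_order by (simp add: eq_upto_iff subst_diff[symmetric])

lemma subst_sum: "nc_subst A s (sum F I) = (\<Sum>i\<in>I. nc_subst A s (F i))"
  by (induction I rule: infinite_finite_induct) (auto simp: subst_0 subst_add)

lemma subst_mult: "nc_subst A s (f * g) = nc_subst A s f * nc_subst A s g"
proof -
  interpret letter_action A "\<lambda>a p. s a * p"
    by unfold_locales
      (use fin in \<open>auto simp: algebra_simps intro!: order_ge_mult'[where d = 1] ord\<close>)
  have foldr: "foldr (\<lambda>a p. s a * p) v p = word_prod s v * p" for v p
    by (induction v) (simp_all add: mult.assoc)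
  have act: "act f p = nc_subst A s f * p" for f p
  proof (rule eq_upto_eqI)
    fix d
    have "eq_upto d (act f p) ((\<Sum>v\<in>{v. set v \<subseteq> A \<and> length v < d}. nc_scale (coeff f v) (word_prod s v)) * p)"
      using act_upto[of d f p] by (simp add: foldr sum_distrib_right)
    also have "eq_upto d \<dots> (nc_subst A s f * p)"
      by (intro eq_upto_mult eq_upto_sym[OF subst_upto] eq_upto_refl)
    finally show "eq_upto d (act f p) (nc_subst A s f * p)" .
  qed
  show ?thesis using act_mult[of f g 1] by (simp add: act)
qed

lemma subst_1: "nc_subst A s 1 = 1"
proof (rule nc_series_eqI)
  fix w :: "'b list"
  have "(\<Sum>v\<in>{v. set v \<subseteq> A \<and> length v \<le> length w}. coeff 1 v * coeff (word_prod s v) w) =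
      (\<Sum>v\<in>{[]}. coeff 1 v * coeff (word_prod s v) w)"
    by (rule sum.mono_neutral_right)
      (use finite_lists_length_le[OF fin] in \<open>auto simp: coeff_one\<close>)
  then show "coeff (nc_subst A s 1) w = coeff 1 w"
    by (simp add: nc_subst_def coeff_one)
qed

lemma subst_var: "a \<in> A \<Longrightarrow> nc_subst A s (nc_var a) = s a"
proof (rule eq_upto_eqI)
  fix d assume a: "a \<in> A"
  have "eq_upto (Suc (Suc d)) (nc_subst A s (nc_var a))
      (\<Sum>v\<in>{v. set v \<subseteq> A \<and> length v < Suc (Suc d)}. nc_scale (coeff (nc_var a) v) (word_prod s v))"
    by (rule subst_upto)
  also have "(\<Sum>v\<in>{v. set v \<subseteq> A \<and> length v < Suc (Suc d)}. nc_scale (coeff (nc_var a) v) (word_prod s v)) =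
      (\<Sum>v\<in>{[a]}. nc_scale (coeff (nc_var a) v) (word_prod s v))"
    by (rule sum.mono_neutral_right) (use finite_words[OF fin] a in \<open>auto simp: coeff_var\<close>)
  finally have "eq_upto (Suc (Suc d)) (nc_subst A s (nc_var a)) (s a)"
    by (simp add: coeff_var)
  then show "eq_upto d (nc_subst A s (nc_var a)) (s a)" by (rule eq_upto_mono) simp
qed

lemma subst_power: "nc_subst A s (f ^ m) = nc_subst A s f ^ m"
  by (induction m) (auto simp: subst_1 subst_mult)

lemma subst_commutator: "nc_subst A s (commutator f g) = commutator (nc_subst A s f) (nc_subst A s g)"
  by (simp add: commutator_def subst_diff subst_mult)

lemma subst_ev: "order_ge 1 z \<Longrightarrow> nc_subst A s (ev a z) = ev a (nc_subst A s z)"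
  unfolding ev_def
  by (subst nc_sum_linear)
    (auto simp: subst_add subst_scale subst_power intro: order_ge_ev_term subst_order)

lemma subst_exp: "order_ge 1 z \<Longrightarrow> nc_subst A s (nc_exp z) = nc_exp (nc_subst A s z)"
  unfolding nc_exp_ev by (rule subst_ev)

lemma subst_bch:
  assumes "order_ge 1 u" "order_ge 1 v"
  shows "nc_subst A s (bch u v) = bch (nc_subst A s u) (nc_subst A s v)"
proof (rule nc_exp_inj)
  show "order_ge 1 (nc_subst A s (bch u v))" "order_ge 1 (bch (nc_subst A s u) (nc_subst A s v))"
    using assms by (auto intro!: subst_order exp_bch)
  show "nc_exp (nc_subst A s (bch u v)) = nc_exp (bch (nc_subst A s u) (nc_subst A s v))"
    using assms by (simp add: exp_bch subst_order flip: subst_exp) (simp add: subst_mult subst_exp)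
qed

lemma subst_hat:
  assumes V: "nc.subspace V" "\<And>u. u \<in> V \<Longrightarrow> nc_subst A s u \<in> graded_hat W" and W: "nc.subspace W"
    and u: "u \<in> graded_hat V"
  shows "nc_subst A s u \<in> graded_hat W"
  unfolding graded_hat_def
proof (intro CollectI allI)
  fix d
  have "nc_subst A s (trunc (Suc d) u) \<in> graded_hat W"
    using u unfolding trunc_def subst_sum
    by (intro nc.subspace_sum[OF subspace_hat[OF W]] V) (auto simp: graded_hat_def)
  moreover have "nc_part d (nc_subst A s u) = nc_part d (nc_subst A s (trunc (Suc d) u))"
    by (rule part_eq_upto[OF subst_cong_upto[OF trunc_upto]]) simp
  ultimately show "nc_part d (nc_subst A s u) \<in> W" by (simp add: graded_hat_def)
qed

lemma subst_lie_poly: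
  assumes s: "\<And>a. a \<in> A \<Longrightarrow> s a \<in> lie_series B" and u: "u \<in> lie_poly A"
  shows "nc_subst A s u \<in> lie_series B"
  using u
  by induction (auto simp: subst_0 subst_var subst_add subst_scale subst_commutator s
      intro: lie_series_add lie_series_scale lie_series_commutator)

lemma subst_lie_series:
  assumes s: "\<And>a. a \<in> A \<Longrightarrow> s a \<in> lie_series B" and u: "u \<in> lie_series A"
  shows "nc_subst A s u \<in> lie_series B"
  using subst_hat[OF subspace_lie_poly _ subspace_lie_poly, of A B u] subst_lie_poly[OF s] u
  unfolding lie_series_hat by blast

lemma subst_compose:
  assumes t: "substitution B t"
  shows "nc_subst B t (nc_subst A s f) = nc_subst A (\<lambda>a. nc_subst B t (s a)) f"
proof (rule eq_upto_eqI)
  interpret t: substitution B t by (rule t)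
  interpret st: substitution A "\<lambda>a. nc_subst B t (s a)"
    by unfold_locales (auto intro: fin t.subst_order ord)
  fix d
  have prod: "nc_subst B t (word_prod s v) = word_prod (\<lambda>a. nc_subst B t (s a)) v" for v
    by (induction v) (auto simp: t.subst_1 t.subst_mult)
  have "eq_upto d (nc_subst B t (nc_subst A s f))
     (nc_subst B t (\<Sum>v\<in>{v. set v \<subseteq> A \<and> length v < d}. nc_scale (coeff f v) (word_prod s v)))"
    by (intro t.subst_cong_upto subst_upto)
  also have "\<dots> = (\<Sum>v\<in>{v. set v \<subseteq> A \<and> length v < d}. nc_scale (coeff f v) (word_prod (\<lambda>a. nc_subst B t (s a)) v))"
    by (simp add: t.subst_sum t.subst_scale prod)
  also have "eq_upto d \<dots> (nc_subst A (\<lambda>a. nc_subst B t (s a)) f)"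
    by (rule eq_upto_sym[OF st.subst_upto])
  finally show "eq_upto d (nc_subst B t (nc_subst A s f)) (nc_subst A (\<lambda>a. nc_subst B t (s a)) f)" .
qed

end

lemma subst_cong: "(\<And>a. a \<in> A \<Longrightarrow> s a = t a) \<Longrightarrow> nc_subst A s f = nc_subst A t f"
proof (rule nc_series_eqI)
  fix w assume *: "\<And>a. a \<in> A \<Longrightarrow> s a = t a"
  have "word_prod s v = word_prod t v" if "set v \<subseteq> A" for v
    by (intro arg_cong[where f = prod_list] map_cong) (use * that in auto)
  then show "coeff (nc_subst A s f) w = coeff (nc_subst A t f) w"
    unfolding nc_subst_def by (auto intro!: sum.cong)
qed

lemma coeff_word: "coeff (word_prod nc_var v) w = (if v = w then 1 else 0)"
proof (induction v arbitrary: w)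
  case Nil
  then show ?case by (auto simp: coeff_one)
next
  case (Cons a v)
  then show ?case by (auto simp: coeff_var_times split: list.splits)
qed

lemma order_ge_var: "order_ge 1 (nc_var a)"
  by (simp add: order_ge_def coeff_var)

lemma subst_ident:
  assumes "finite A" "supported A f" shows "nc_subst A nc_var f = f"
proof (rule nc_series_eqI)
  fix w
  have "coeff (nc_subst A nc_var f) w = (\<Sum>v\<in>{v. set v \<subseteq> A \<and> length v \<le> length w}. if v = w then coeff f v else 0)"
    unfolding nc_subst_def by (auto simp: coeff_word intro!: sum.cong)
  also have "\<dots> = coeff f w"
    using assms finite_lists_length_le[of A "length w"] by (auto simp: supported_def sum.delta)
  finally show "coeff (nc_subst A nc_var f) w = coeff f w" .
qed

lemma word_prod_upto:
  assumes "\<And>a. a \<in> A \<Longrightarrow> eq_upto 2 (s a) (nc_var a)"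
  shows "set v \<subseteq> A \<Longrightarrow> order_ge (length v) (word_prod s v) \<and>
    eq_upto (Suc (length v)) (word_prod s v) (word_prod nc_var v)"
proof (induction v)
  case (Cons a v)
  have s: "eq_upto 2 (s a) (nc_var a)" using Cons assms by auto
  have o: "order_ge 1 (s a)" using s by (simp add: eq_upto_def order_ge_def coeff_var)
  have on: "order_ge (length v) (word_prod nc_var v)" by (auto simp: order_ge_def coeff_word)
  have IH: "order_ge (length v) (word_prod s v)" "eq_upto (Suc (length v)) (word_prod s v) (word_prod nc_var v)"
    using Cons by auto
  have "s a * word_prod s v - nc_var a * word_prod nc_var v =
      s a * (word_prod s v - word_prod nc_var v) + (s a - nc_var a) * word_prod nc_var v"
    by (simp add: algebra_simps)
  moreover have "order_ge (Suc (Suc (length v))) (s a * (word_prod s v - word_prod nc_var v))"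
    by (rule order_ge_mult'[OF o IH(2)[unfolded eq_upto_iff]]) simp
  moreover have "order_ge (Suc (Suc (length v))) ((s a - nc_var a) * word_prod nc_var v)"
    by (rule order_ge_mult'[OF s[unfolded eq_upto_iff] on]) simp
  ultimately have "eq_upto (Suc (Suc (length v))) (s a * word_prod s v) (nc_var a * word_prod nc_var v)"
    by (simp add: eq_upto_iff order_ge_add)
  moreover have "order_ge (Suc (length v)) (s a * word_prod s v)"
    by (rule order_ge_mult'[OF o IH(1)]) simp
  ultimately show ?case by simp
qed simp

lemma subst_leading:
  assumes A: "finite A" and s: "\<And>a. a \<in> A \<Longrightarrow> eq_upto 2 (s a) (nc_var a)"
    and f: "supported A f" "order_ge d f"
  shows "eq_upto (Suc d) (nc_subst A s f) f"
proof -
  have o: "order_ge 1 (s a)" if "a \<in> A" for a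
    using s[OF that] order_ge_var[of a] by (auto simp: eq_upto_def order_ge_def)
  interpret s: substitution A s
    using A o by unfold_locales
  interpret v: substitution A nc_var
    using A order_ge_var by unfold_locales
  have "eq_upto (Suc d) (nc_subst A s f) (\<Sum>v\<in>{v. set v \<subseteq> A \<and> length v < Suc d}. nc_scale (coeff f v) (word_prod s v))"
    by (rule s.subst_upto)
  also have "eq_upto (Suc d) \<dots> (\<Sum>v\<in>{v. set v \<subseteq> A \<and> length v < Suc d}. nc_scale (coeff f v) (word_prod nc_var v))"
  proof (rule eq_upto_sum)
    fix v assume v: "v \<in> {v. set v \<subseteq> A \<and> length v < Suc d}"
    show "eq_upto (Suc d) (nc_scale (coeff f v) (word_prod s v)) (nc_scale (coeff f v) (word_prod nc_var v))"
    proof (cases "length v < d")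
      case True
      then show ?thesis using f by (simp add: order_ge_def)
    next
      case False
      then have "length v = d" using v by auto
      then show ?thesis using word_prod_upto[of A s v] s v by (auto intro: eq_upto_scale)
    qed
  qed
  also have "eq_upto (Suc d) \<dots> (nc_subst A nc_var f)" by (rule eq_upto_sym[OF v.subst_upto])
  also have "nc_subst A nc_var f = f" by (rule subst_ident[OF A f(1)])
  finally show ?thesis .
qed

section \<open>Residue classes modulo the relations of \<open>t\<close> and the group \<open>exp\<close>\<close>

lemma tgen_lie_poly: "(i, j) \<in> kd_gens S \<Longrightarrow> tgen i j \<in> lie_poly (kd_gens S)"
  unfolding tgen_def by (rule lie_poly.intros)

lemma tgen_lie_series: "(i, j) \<in> kd_gens S \<Longrightarrow> tgen i j \<in> lie_series (kd_gens S)"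
  unfolding tgen_def by (rule lie_series_var)

lemma kd_gens_iff: "(i, j) \<in> kd_gens S \<longleftrightarrow> i \<in> S \<and> j \<in> S \<and> i \<noteq> j"
  by (simp add: kd_gens_def)

lemma subspace_kd_ideal: "nc.subspace (kd_ideal S)"
  by (simp add: nc.subspace_def kd_ideal.intros)

lemma lie_poly_diff: "u \<in> lie_poly A \<Longrightarrow> v \<in> lie_poly A \<Longrightarrow> u - v \<in> lie_poly A"
  by (rule nc.subspace_diff[OF subspace_lie_poly])

lemma kd_ideal_lie_poly: "u \<in> kd_ideal S \<Longrightarrow> u \<in> lie_poly (kd_gens S)"
  by (induction rule: kd_ideal.induct)
    (auto intro!: lie_poly.intros(1,3,4,5) lie_poly_diff tgen_lie_poly simp: kd_gens_iff)

lemma lie_ideal_kd: "lie_ideal (lie_poly (kd_gens S)) (kd_ideal S)"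
  by unfold_locales
    (auto simp: subspace_lie_poly subspace_kd_ideal lie_poly.intros(5) lie_poly_const
      kd_ideal.bracket kd_ideal_lie_poly)

interpretation kd: lie_ideal "lie_poly (kd_gens S)" "kd_ideal S" for S
  by (rule lie_ideal_kd)

abbreviation lie_t :: "nat set \<Rightarrow> (nat \<times> nat, 'k::field_char_0) nc_series set" where
  "lie_t S \<equiv> lie_series (kd_gens S)"

lemma kd_congr_iff: "kd.congr S u v \<longleftrightarrow> u \<in> lie_t S \<and> v \<in> lie_t S \<and> u - v \<in> kd_ideal_hat S"
  by (simp add: kd.congr_def lie_series_hat kd_ideal_hat_hat)

lemma kd_rel_iff: "(u, v) \<in> kd_rel S \<longleftrightarrow> kd.congr S u v"
  by (simp add: kd_congr_iff kd_rel_def)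

lemma kd_congr_refl: "u \<in> lie_t S \<Longrightarrow> kd.congr S u u"
  by (rule kd.congr_refl) (simp add: lie_series_hat)

lemma kd_congr_lie: "kd.congr S u v \<Longrightarrow> u \<in> lie_t S \<and> v \<in> lie_t S"
  by (simp add: kd_congr_iff)

lemma mem_kd_class: "v \<in> kd_class S u \<longleftrightarrow> kd.congr S u v"
  by (simp add: kd_class_def kd_rel_iff)

lemma kd_class_eq: "u \<in> lie_t S \<Longrightarrow> kd_class S u = kd_class S v \<longleftrightarrow> kd.congr S u v"
proof
  assume u: "u \<in> lie_t S" and "kd_class S u = kd_class S v"
  moreover have "u \<in> kd_class S u" using kd_congr_refl[OF u] by (simp add: mem_kd_class)
  ultimately have "u \<in> kd_class S v" by blast
  then show "kd.congr S u v" by (simp add: mem_kd_class kd.congr_sym)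
next
  assume c: "kd.congr S u v"
  show "kd_class S u = kd_class S v"
    using kd.congr_trans[OF c] kd.congr_trans[OF kd.congr_sym[OF c]]
    by (auto simp: set_eq_iff mem_kd_class)
qed

lemma kd_class_eqI: "kd.congr S u v \<Longrightarrow> kd_class S u = kd_class S v"
  using kd_class_eq kd_congr_lie by blast

lemma kd_hat_eq: "kd_hat S = kd_class S ` lie_t S"
  by (auto simp: kd_hat_def kd_class_def quotient_def)

lemma kd_class_mem [simp]: "u \<in> lie_t S \<Longrightarrow> kd_class S u \<in> kd_hat S"
  by (simp add: kd_hat_eq)

lemma kd_lift_class:
  assumes u: "u \<in> lie_t S" and f: "\<And>v. kd.congr S u v \<Longrightarrow> kd.congr T (f u) (f v)"
  shows "kd_lift T f (kd_class S u) = kd_class T (f u)"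
proof -
  have "kd_class T (f v) = kd_class T (f u)" if "v \<in> kd_class S u" for v
    using kd_class_eqI[OF f] that by (simp add: mem_kd_class)
  moreover have "u \<in> kd_class S u" using kd_congr_refl[OF u] by (simp add: mem_kd_class)
  ultimately show ?thesis unfolding kd_lift_def by blast
qed

lemma kd_lift2_class:
  assumes u: "u \<in> lie_t S" "u' \<in> lie_t S"
    and f: "\<And>v v'. kd.congr S u v \<Longrightarrow> kd.congr S u' v' \<Longrightarrow> kd.congr S (f u u') (f v v')"
  shows "kd_lift2 S f (kd_class S u) (kd_class S u') = kd_class S (f u u')"
proof -
  have "kd_class S (f v v') = kd_class S (f u u')" if "v \<in> kd_class S u" "v' \<in> kd_class S u'" for v v'
    using kd_class_eqI[OF f] that by (simp add: mem_kd_class)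
  moreover have "u \<in> kd_class S u" "u' \<in> kd_class S u'"
    using kd_congr_refl u by (simp_all add: mem_kd_class)
  ultimately show ?thesis unfolding kd_lift2_def by blast
qed

lemma bch_0_left [simp]: "order_ge 1 v \<Longrightarrow> bch 0 v = v"
  and bch_0_right [simp]: "order_ge 1 v \<Longrightarrow> bch v 0 = v"
  by (simp_all add: bch_def nc_log_exp)

lemma bch_minus: "order_ge 1 v \<Longrightarrow> bch (- v) v = 0" "order_ge 1 v \<Longrightarrow> bch v (- v) = 0"
  by (simp_all add: bch_def nc_exp_minus)

lemma bch_assoc:
  assumes "order_ge 1 u" "order_ge 1 v" "order_ge 1 w"
  shows "bch (bch u v) w = bch u (bch v w)"
proof (rule nc_exp_inj)
  note uv = exp_bch[OF assms(1,2)] and vw = exp_bch[OF assms(2,3)]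
  note uv_w = exp_bch[OF uv(1) assms(3)] and u_vw = exp_bch[OF assms(1) vw(1)]
  show "order_ge 1 (bch (bch u v) w)" "order_ge 1 (bch u (bch v w))" by (fact uv_w(1) u_vw(1))+
  show "nc_exp (bch (bch u v) w) = nc_exp (bch u (bch v w))"
    unfolding uv_w(2) u_vw(2) uv(2) vw(2) by (simp only: mult.assoc)
qed

lemma bch_scale: "order_ge 1 z \<Longrightarrow> bch (nc_scale c z) (nc_scale d z) = nc_scale (c + d) z"
  by (simp add: bch_def nc_exp_scale_add[symmetric] nc_log_exp order_ge_scale)

lemma bch_conj:
  assumes u: "order_ge 1 u" and x: "order_ge 1 x"
  shows "bch (bch u x) (- u) = nc_Ad u x"
proof (rule nc_exp_inj)
  have m: "order_ge 1 (- u)" using u by (rule order_ge_minus)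
  show "order_ge 1 (bch (bch u x) (- u))" by (intro exp_bch u x m)
  show "order_ge 1 (nc_Ad u x)"
    unfolding exp_conj_eq_Ad[OF u, symmetric] by (intro order_ge_mult_right order_ge_mult_left x)
  show "nc_exp (bch (bch u x) (- u)) = nc_exp (nc_Ad u x)"
    unfolding exp_bch(2)[OF exp_bch(1)[OF u x] m] exp_bch(2)[OF u x] exp_conj_eq_Ad[OF u, symmetric]
    by (rule nc_exp_conj[symmetric]) (use x nc_exp_minus[OF u] in auto)
qed

lemma exp_t_simps [simp]:
  "carrier (exp_t S) = kd_hat S" "\<one>\<^bsub>exp_t S\<^esub> = kd_class S 0"
  by (simp_all add: exp_t_def)

lemma exp_t_mult:
  assumes "u \<in> lie_t S" "v \<in> lie_t S"
  shows "kd_class S u \<otimes>\<^bsub>exp_t S\<^esub> kd_class S v = kd_class S (bch u v)"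
  unfolding exp_t_def by (simp add: kd_lift2_class[OF assms kd.congr_bch])

lemma exp_t_kpow: "u \<in> lie_t S \<Longrightarrow> kpow (exp_t S) c (kd_class S u) = kd_class S (nc_scale c u)"
  unfolding exp_t_def by (simp add: kd_lift_class kd.congr_scale)

lemma exp_t_fil:
  "fil (exp_t S) N = {X \<in> kd_hat S. \<exists>u\<in>X. order_ge N u}"
  by (simp add: exp_t_def order_ge_parts)

lemma group_exp_t: "group (exp_t S :: ('k::field_char_0 kd, 'k) prounip)"
proof (rule groupI)
  fix X Y Z :: "'k kd" assume "X \<in> carrier (exp_t S)" "Y \<in> carrier (exp_t S)" "Z \<in> carrier (exp_t S)"
  then obtain u v w where *: "X = kd_class S u" "Y = kd_class S v" "Z = kd_class S w"
    "u \<in> lie_t S" "v \<in> lie_t S" "w \<in> lie_t S" by (auto simp: kd_hat_eq)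
  then show "X \<otimes>\<^bsub>exp_t S\<^esub> Y \<in> carrier (exp_t S)" by (simp add: exp_t_mult lie_series_bch)
  show "X \<otimes>\<^bsub>exp_t S\<^esub> Y \<otimes>\<^bsub>exp_t S\<^esub> Z = X \<otimes>\<^bsub>exp_t S\<^esub> (Y \<otimes>\<^bsub>exp_t S\<^esub> Z)"
    using * by (simp add: exp_t_mult lie_series_bch bch_assoc lie_series_order)
next
  fix X :: "'k kd" assume "X \<in> carrier (exp_t S)"
  then obtain u where *: "X = kd_class S u" "u \<in> lie_t S" by (auto simp: kd_hat_eq)
  then show "\<one>\<^bsub>exp_t S\<^esub> \<otimes>\<^bsub>exp_t S\<^esub> X = X"
    by (simp add: exp_t_mult lie_series_order)
  have "kd_class S (- u) \<otimes>\<^bsub>exp_t S\<^esub> X = \<one>\<^bsub>exp_t S\<^esub>"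
    using * by (simp add: exp_t_mult lie_series_minus bch_minus lie_series_order)
  then show "\<exists>Y\<in>carrier (exp_t S). Y \<otimes>\<^bsub>exp_t S\<^esub> X = \<one>\<^bsub>exp_t S\<^esub>"
    using * by (intro bexI[of _ "kd_class S (- u)"]) (simp_all add: lie_series_minus)
qed simp

interpretation exp_t: group "exp_t S" for S
  by (rule group_exp_t)

lemma exp_t_inv:
  assumes "u \<in> lie_t S" shows "inv\<^bsub>exp_t S\<^esub> (kd_class S u) = kd_class S (- u)"
  by (rule exp_t.inv_equality)
    (use assms in \<open>simp_all add: exp_t_mult lie_series_minus bch_minus lie_series_order\<close>)

lemma exp_t_conj:
  assumes "u \<in> lie_t S" "x \<in> lie_t S"
  shows "kd_class S u \<otimes>\<^bsub>exp_t S\<^esub> kd_class S x \<otimes>\<^bsub>exp_t S\<^esub> inv\<^bsub>exp_t S\<^esub> (kd_class S u) = kd_class S (nc_Ad u x)"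
  using assms
  by (simp add: exp_t_inv exp_t_mult lie_series_bch lie_series_minus bch_conj lie_series_order)

section \<open>Functoriality in the index set\<close>

lemma part_tgen: "nc_part d (tgen i j) = (if d = 1 then tgen i j else 0)"
  by (rule nc_series_eqI) (auto simp: coeff_part tgen_def coeff_var)

lemma part_commutator_tgen:
  "nc_part d (commutator (tgen i j) (tgen k l)) = (if d = 2 then commutator (tgen i j) (tgen k l) else 0)"
  by (rule nc_series_eqI)
    (auto simp: coeff_part commutator_def tgen_def coeff_var_times coeff_var split: list.splits)

definition cable :: "(nat \<Rightarrow> nat set) \<Rightarrow> nat \<times> nat \<Rightarrow> (nat \<times> nat, 'k::field_char_0) nc_series" where
  "cable I = (\<lambda>(i, j). \<Sum>i'\<in>I i. \<Sum>j'\<in>I j. tgen i' j')"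

lemma finite_kd_gens: "finite S \<Longrightarrow> finite (kd_gens S)"
  by (rule finite_subset[of _ "S \<times> S"]) (auto simp: kd_gens_def)

lemma commutator_sum_left: "commutator (sum f A) g = (\<Sum>a\<in>A. commutator (f a) g)"
  and commutator_sum_right: "commutator g (sum f A) = (\<Sum>a\<in>A. commutator g (f a))"
  by (simp_all add: commutator_def sum_distrib_left sum_distrib_right sum_subtractf)

text \<open>The morphism of the algebras \<open>t\<close> that replaces strand \<open>i\<close> by the strands in \<open>I i\<close>; its values
  on generators are given by \<open>cable\<close>.\<close>

locale cabling =
  fixes S T :: "nat set" and I :: "nat \<Rightarrow> nat set"
  assumes finS: "finite S" and finT: "finite T" and sub: "i \<in> S \<Longrightarrow> I i \<subseteq> T"
    and disj: "i \<in> S \<Longrightarrow> j \<in> S \<Longrightarrow> i \<noteq> j \<Longrightarrow> I i \<inter> I j = {}"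
begin

lemma fin_I: "i \<in> S \<Longrightarrow> finite (I i)"
  using sub finT finite_subset by blast

lemma cable_lie: "a \<in> kd_gens S \<Longrightarrow> cable I a \<in> lie_t T"
proof -
  assume "a \<in> kd_gens S"
  then obtain i j where a: "a = (i, j)" "i \<in> S" "j \<in> S" "i \<noteq> j" by (auto simp: kd_gens_def)
  show ?thesis
    unfolding a cable_def prod.case
  proof (intro lie_series_sum tgen_lie_series)
    fix i' j' assume "i' \<in> I i" "j' \<in> I j"
    then show "(i', j') \<in> kd_gens T"
      using sub[OF a(2)] sub[OF a(3)] disj[OF a(2-4)] by (auto simp: kd_gens_iff)
  qed
qed

sublocale substitution "kd_gens S" "cable I"
  by unfold_locales (auto simp: finite_kd_gens finS intro: lie_series_order cable_lie)

text \<open>The image of a relation is a sum of relations: for three indices, each bracket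
  \<open>[t\<^sub>a\<^sub>b, t\<^sub>a\<^sub>c + t\<^sub>b\<^sub>c]\<close> is a relation, and the remaining brackets have four distinct indices.\<close>

lemma cable_ideal:
  fixes u :: "(nat \<times> nat, 'k::field_char_0) nc_series"
  shows "u \<in> kd_ideal S \<Longrightarrow> nc_subst (kd_gens S) (cable I) u \<in> kd_ideal_hat T"
proof (induction rule: kd_ideal.induct)
  note J = subspace_hat[OF subspace_kd_ideal, of T, folded kd_ideal_hat_hat]
  have base: "u \<in> kd_ideal_hat T" if "\<And>d. nc_part d u = (if d = e then u else 0)" "u \<in> kd_ideal T"
    for u :: "(nat \<times> nat, 'k) nc_series" and e
    using that by (auto simp: kd_ideal_hat_def kd_ideal.zero)
  have S2: "tgen i j - tgen j i \<in> (kd_ideal_hat T :: (nat \<times> nat, 'k) nc_series set)"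
    if "{i, j} \<subseteq> T" "distinct [i, j]" for i j
    by (rule base[of _ 1]) (use that in \<open>auto simp: part_diff part_tgen intro: kd_ideal.symm\<close>)
  have R3: "commutator (tgen i j) (tgen i k + tgen j k) \<in> (kd_ideal_hat T :: (nat \<times> nat, 'k) nc_series set)"
    if "{i, j, k} \<subseteq> T" "distinct [i, j, k]" for i j k
    by (rule base[of _ 2], unfold commutator_add_right)
      (use that kd_ideal.rel3[OF that] in \<open>auto simp: part_add part_commutator_tgen commutator_add_right\<close>)
  have R4: "commutator (tgen i j) (tgen k l) \<in> (kd_ideal_hat T :: (nat \<times> nat, 'k) nc_series set)"
    if "{i, j, k, l} \<subseteq> T" "distinct [i, j, k, l]" for i j k l
    by (rule base[of _ 2]) (use that in \<open>auto simp: part_commutator_tgen intro: kd_ideal.rel4\<close>)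
  {
    case (symm i j)
    have "cable I (i, j) - cable I (j, i) =
        (\<Sum>a\<in>I i. \<Sum>b\<in>I j. tgen a b - tgen b a :: (nat \<times> nat, 'k) nc_series)"
      unfolding cable_def prod.case by (subst (2) sum.swap) (simp add: sum_subtractf)
    also have "\<dots> \<in> kd_ideal_hat T"
      using symm sub[of i] sub[of j] disj[of i j] by (intro nc.subspace_sum[OF J] S2) auto
    finally show ?case
      using symm by (simp add: subst_diff tgen_def subst_var kd_gens_iff)
  next
    case (rel3 i j k)
    have *: "a \<in> T" "b \<in> T" "c \<in> T" "a \<noteq> b" "a \<noteq> c" "b \<noteq> c" if "a \<in> I i" "b \<in> I j" "c \<in> I k" for a b c
      using that rel3 sub[of i] sub[of j] sub[of k] disj[of i j] disj[of i k] disj[of j k] by auto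
    have "commutator (cable I (i, j) :: (nat \<times> nat, 'k) nc_series) (cable I (i, k) + cable I (j, k)) =
      (\<Sum>a\<in>I i. \<Sum>b\<in>I j. \<Sum>c\<in>I k.
        (\<Sum>a'\<in>I i. commutator (tgen a b) (tgen a' c)) + (\<Sum>b'\<in>I j. commutator (tgen a b) (tgen b' c)))"
      unfolding cable_def prod.case commutator_add_right commutator_sum_left sum.distrib[symmetric]
    proof (intro sum.cong[OF HOL.refl])
      fix a b
      have "commutator (tgen a b :: (nat \<times> nat, 'k) nc_series) (\<Sum>i'\<in>I j. \<Sum>j'\<in>I k. tgen i' j') =
          (\<Sum>c\<in>I k. \<Sum>b'\<in>I j. commutator (tgen a b) (tgen b' c))"
        "commutator (tgen a b :: (nat \<times> nat, 'k) nc_series) (\<Sum>i'\<in>I i. \<Sum>j'\<in>I k. tgen i' j') =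
          (\<Sum>c\<in>I k. \<Sum>a'\<in>I i. commutator (tgen a b) (tgen a' c))"
        by (simp_all add: commutator_sum_right sum.swap[of _ "I k"])
      then show "commutator (tgen a b :: (nat \<times> nat, 'k) nc_series) (\<Sum>i'\<in>I i. \<Sum>j'\<in>I k. tgen i' j')
          + commutator (tgen a b) (\<Sum>i'\<in>I j. \<Sum>j'\<in>I k. tgen i' j') =
        (\<Sum>c\<in>I k. (\<Sum>a'\<in>I i. commutator (tgen a b) (tgen a' c))
          + (\<Sum>b'\<in>I j. commutator (tgen a b) (tgen b' c)))"
        by (simp add: sum.distrib)
    qed
    also have "\<dots> \<in> (kd_ideal_hat T :: (nat \<times> nat, 'k) nc_series set)"
    proof (intro nc.subspace_sum[OF J])
      fix a b c assume abc: "a \<in> I i" "b \<in> I j" "c \<in> I k"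
      have "(\<Sum>a'\<in>I i. commutator (tgen a b) (tgen a' c)) + (\<Sum>b'\<in>I j. commutator (tgen a b) (tgen b' c)) =
         (commutator (tgen a b) (tgen a c + tgen b c) :: (nat \<times> nat, 'k) nc_series)
         + (\<Sum>a'\<in>I i - {a}. commutator (tgen a b) (tgen a' c))
         + (\<Sum>b'\<in>I j - {b}. commutator (tgen a b) (tgen b' c))"
        using rel3 fin_I[of i] fin_I[of j] abc
        by (simp add: sum.remove[of "I i" a "\<lambda>a'. commutator (tgen a b) (tgen a' c)"]
            sum.remove[of "I j" b "\<lambda>b'. commutator (tgen a b) (tgen b' c)"] commutator_add_right)
      also have "\<dots> \<in> kd_ideal_hat T"
      proof (intro nc.subspace_add[OF J] nc.subspace_sum[OF J] R3 R4)
        show "{a, b, c} \<subseteq> T" "distinct [a, b, c]" using *[OF abc] by auto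
        fix a' assume "a' \<in> I i - {a}"
        then show "{a, b, a', c} \<subseteq> T" "distinct [a, b, a', c]"
          using *[OF abc] *[of a' b c] abc by auto
      next
        fix b' assume "b' \<in> I j - {b}"
        then show "{a, b, b', c} \<subseteq> T" "distinct [a, b, b', c]"
          using *[OF abc] *[of a b' c] abc by auto
      qed
      finally show "(\<Sum>a'\<in>I i. commutator (tgen a b) (tgen a' c)) +
         (\<Sum>b'\<in>I j. commutator (tgen a b) (tgen b' c)) \<in> (kd_ideal_hat T :: (nat \<times> nat, 'k) nc_series set)" .
    qed
    finally show ?case
      using rel3 by (simp add: subst_commutator subst_add tgen_def subst_var kd_gens_iff)
  next
    case (rel4 i j k l)
    have "commutator (cable I (i, j)) (cable I (k, l)) \<in> (kd_ideal_hat T :: (nat \<times> nat, 'k) nc_series set)"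
      unfolding cable_def prod.case commutator_sum_left commutator_sum_right
    proof (intro nc.subspace_sum[OF J] R4)
      fix a b c d assume *: "a \<in> I i" "b \<in> I j" "c \<in> I k" "d \<in> I l"
      show "{a, b, c, d} \<subseteq> T" using * rel4 sub[of i] sub[of j] sub[of k] sub[of l] by auto
      show "distinct [a, b, c, d]"
        using * rel4 disj[of i j] disj[of i k] disj[of i l] disj[of j k] disj[of j l] disj[of k l] by auto
    qed
    then show ?case
      using rel4 by (simp add: subst_commutator tgen_def subst_var kd_gens_iff)
  next
    case zero
    show ?case using nc.subspace_0[OF J] by (simp add: subst_0)
  next
    case (add u v)
    then show ?case by (simp add: subst_add nc.subspace_add[OF J])
  next
    case (scale u c)
    then show ?case by (simp add: subst_scale nc.subspace_scale[OF J])
  next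
    case (bracket u v)
    have "nc_subst (kd_gens S) (cable I) u \<in> lie_t T"
      by (rule subst_lie_poly[OF cable_lie bracket(1)])
    then show ?case
      using kd.hat_LJ[of "nc_subst (kd_gens S) (cable I) u" T] bracket(3)
      by (simp add: subst_commutator lie_series_hat kd_ideal_hat_hat)
  }
qed

lemma cable_lie_series: "u \<in> lie_t S \<Longrightarrow> nc_subst (kd_gens S) (cable I) u \<in> lie_t T"
  by (rule subst_lie_series[OF cable_lie])

lemma cable_congr:
  assumes "kd.congr S u v"
  shows "kd.congr T (nc_subst (kd_gens S) (cable I) u) (nc_subst (kd_gens S) (cable I) v)"
proof -
  have "nc_subst (kd_gens S) (cable I) (u - v) \<in> graded_hat (kd_ideal T)"
    by (rule subst_hat[OF subspace_kd_ideal _ subspace_kd_ideal])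
      (use assms cable_ideal in \<open>auto simp: kd_congr_iff kd_ideal_hat_hat\<close>)
  then show ?thesis
    using assms by (simp add: kd_congr_iff kd_ideal_hat_hat subst_diff cable_lie_series)
qed

lemma kd_map_class: "u \<in> lie_t S \<Longrightarrow> kd_map S T I (kd_class S u) = kd_class T (nc_subst (kd_gens S) (cable I) u)"
  unfolding kd_map_def cable_def[symmetric] by (rule kd_lift_class) (simp_all add: cable_congr)

lemma kd_map_closed: "X \<in> kd_hat S \<Longrightarrow> kd_map S T I X \<in> kd_hat T"
  by (auto simp: kd_hat_eq kd_map_class cable_lie_series)

lemma kd_map_mult:
  assumes "X \<in> kd_hat S" "Y \<in> kd_hat S"
  shows "kd_map S T I (X \<otimes>\<^bsub>exp_t S\<^esub> Y) = kd_map S T I X \<otimes>\<^bsub>exp_t T\<^esub> kd_map S T I Y"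
proof -
  obtain u v where "X = kd_class S u" "Y = kd_class S v" "u \<in> lie_t S" "v \<in> lie_t S"
    using assms by (auto simp: kd_hat_eq)
  then show ?thesis
    by (simp add: exp_t_mult kd_map_class cable_lie_series lie_series_bch subst_bch lie_series_order)
qed

end

lemma insertion_closed:
  assumes "\<Phi> \<in> kd_hat {1..3}" "finite T" "I1 \<subseteq> T" "I2 \<subseteq> T" "I3 \<subseteq> T"
    "I1 \<inter> I2 = {}" "I1 \<inter> I3 = {}" "I2 \<inter> I3 = {}"
  shows "insertion T [I1, I2, I3] \<Phi> \<in> kd_hat T"
proof -
  have set: "{1..3} = {1, 2, 3 :: nat}"
    unfolding set_eq_iff atLeastAtMost_iff insert_iff empty_iff by presburger
  have disj: "I2 \<inter> I1 = {}" "I3 \<inter> I1 = {}" "I3 \<inter> I2 = {}" using assms(6-8) by blast+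
  have "cabling {1, 2, 3} T (\<lambda>i. [I1, I2, I3] ! (i - 1))"
  proof
    fix i j :: nat assume i: "i \<in> {1, 2, 3}"
    then show "[I1, I2, I3] ! (i - 1) \<subseteq> T" using assms(3-5) by (elim insertE) simp_all
    assume "j \<in> {1, 2, 3}" "i \<noteq> j"
    then show "[I1, I2, I3] ! (i - 1) \<inter> [I1, I2, I3] ! (j - 1) = {}"
      using i assms(6-8) disj by (elim insertE) simp_all
  qed (use assms(2) in simp_all)
  then have "kd_map {1..3} T (\<lambda>i. [I1, I2, I3] ! (i - 1)) \<Phi> \<in> kd_hat T"
    unfolding set[symmetric] by (rule cabling.kd_map_closed[OF _ assms(1)])
  moreover have "length [I1, I2, I3] = 3" by simp
  ultimately show ?thesis unfolding insertion_def by (simp only:)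
qed

abbreviation perm_act :: "nat set \<Rightarrow> (nat \<Rightarrow> nat) \<Rightarrow> 'k::field_char_0 kd \<Rightarrow> 'k kd" where
  "perm_act S s \<equiv> kd_map S S (\<lambda>i. {s i})"

lemma cable_perm: "cable (\<lambda>i. {s i}) (i, j) = tgen (s i) (s j)"
  by (simp add: cable_def)

lemma cabling_perm: "finite S \<Longrightarrow> s permutes S \<Longrightarrow> cabling S S (\<lambda>i. {s i})"
  by unfold_locales (simp_all add: permutes_in_image permutes_inj[THEN inj_eq])

lemma perm_act_tgen:
  assumes "finite S" "s permutes S" "(i, j) \<in> kd_gens S"
  shows "perm_act S s (kd_class S (nc_scale c (tgen i j))) = kd_class S (nc_scale c (tgen (s i) (s j)))"
proof -
  interpret cabling S S "\<lambda>i. {s i}" by (rule cabling_perm[OF assms(1,2)])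
  have "nc_subst (kd_gens S) (cable (\<lambda>i. {s i})) (nc_scale c (tgen i j)) =
      nc_scale c (cable (\<lambda>i. {s i}) (i, j))"
    unfolding subst_scale tgen_def subst_var[OF assms(3)] ..
  then show ?thesis
    using kd_map_class[OF lie_series_scale[OF tgen_lie_series[OF assms(3)]], of c] by (simp add: cable_perm)
qed

lemma perm_act_id: "finite S \<Longrightarrow> X \<in> kd_hat S \<Longrightarrow> perm_act S id X = X"
proof -
  assume S: "finite S" and "X \<in> kd_hat S"
  then obtain u where u: "X = kd_class S u" "u \<in> lie_t S" by (auto simp: kd_hat_eq)
  interpret cabling S S "\<lambda>i. {id i}" by (rule cabling_perm[OF S permutes_id])
  have "nc_subst (kd_gens S) (cable (\<lambda>i. {id i})) u = nc_subst (kd_gens S) nc_var u"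
    by (rule subst_cong) (auto simp: cable_def tgen_def)
  also have "\<dots> = u" by (rule subst_ident[OF finite_kd_gens[OF S] supported_lie_series[OF u(2)]])
  finally show ?thesis unfolding u(1) kd_map_class[OF u(2)] by (rule arg_cong)
qed

lemma perm_act_comp:
  assumes S: "finite S" and s: "s permutes S" "r permutes S" and X: "X \<in> kd_hat S"
  shows "perm_act S (s \<circ> r) X = perm_act S s (perm_act S r X)"
proof -
  obtain u where u: "X = kd_class S u" "u \<in> lie_t S" using X by (auto simp: kd_hat_eq)
  interpret s: cabling S S "\<lambda>i. {s i}" by (rule cabling_perm[OF S s(1)])
  interpret r: cabling S S "\<lambda>i. {r i}" by (rule cabling_perm[OF S s(2)])
  interpret sr: cabling S S "\<lambda>i. {(s \<circ> r) i}" by (rule cabling_perm[OF S permutes_compose[OF s(2,1)]])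
  have "nc_subst (kd_gens S) (cable (\<lambda>i. {(s \<circ> r) i})) u =
      nc_subst (kd_gens S) (\<lambda>a. nc_subst (kd_gens S) (cable (\<lambda>i. {s i})) (cable (\<lambda>i. {r i}) a)) u"
  proof (rule subst_cong)
    fix a assume "a \<in> kd_gens S"
    then obtain i j where a: "a = (i, j)" "(i, j) \<in> kd_gens S" by (cases a) auto
    then have "(r i, r j) \<in> kd_gens S"
      using s(2) by (simp add: kd_gens_iff permutes_in_image permutes_inj[THEN inj_eq])
    then show "cable (\<lambda>i. {(s \<circ> r) i}) a = nc_subst (kd_gens S) (cable (\<lambda>i. {s i})) (cable (\<lambda>i. {r i}) a)"
      unfolding a by (simp only: cable_perm tgen_def s.subst_var comp_def)
  qed
  also have "\<dots> = nc_subst (kd_gens S) (cable (\<lambda>i. {s i})) (nc_subst (kd_gens S) (cable (\<lambda>i. {r i})) u)"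
    by (rule r.subst_compose[OF s.substitution_axioms, symmetric])
  finally show ?thesis using u
    by (simp add: sr.kd_map_class[unfolded comp_def] r.kd_map_class s.kd_map_class r.cable_lie_series comp_def)
qed

section \<open>Braid groups and the semidirect product\<close>

lemma pres_eq_lists: "pres_eq A R u v \<Longrightarrow> u \<in> lists (A \<times> UNIV) \<and> v \<in> lists (A \<times> UNIV)"
  by (induction rule: pres_eq.induct) auto

lemma pres_eq_context:
  assumes "pres_eq A R u v" "x \<in> lists (A \<times> UNIV)" "y \<in> lists (A \<times> UNIV)"
  shows "pres_eq A R (x @ u @ y) (x @ v @ y)"
  using assms(1)
proof induction
  case (refl u)
  then show ?case using assms by (intro pres_eq.refl) simp
next
  case (sym u v)
  then show ?case by (blast intro: pres_eq.sym)
next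
  case (trans u v w)
  then show ?case by (blast intro: pres_eq.trans)
next
  case (cancel u v a b)
  then show ?case using assms pres_eq.cancel[of "x @ u" A "v @ y" a R b] by simp
next
  case (rel u v r s)
  then show ?case using assms pres_eq.rel[of "x @ u" A "v @ y" r s R] by simp
qed

lemma pres_eq_append:
  assumes "pres_eq A R u u'" "pres_eq A R v v'" shows "pres_eq A R (u @ v) (u' @ v')"
proof -
  have "pres_eq A R (u @ v) (u' @ v)"
    using pres_eq_context[OF assms(1), of "[]" v] pres_eq_lists[OF assms(2)] by simp
  moreover have "pres_eq A R (u' @ v) (u' @ v')"
    using pres_eq_context[OF assms(2), of u' "[]"] pres_eq_lists[OF assms(1)] by simp
  ultimately show ?thesis by (rule pres_eq.trans)
qed

lemma pres_class_eq:
  assumes "u \<in> lists (A \<times> UNIV)"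
  shows "pres_class A R u = pres_class A R v \<longleftrightarrow> pres_eq A R u v"
proof
  assume "pres_class A R u = pres_class A R v"
  moreover have "u \<in> pres_class A R u" using pres_eq.refl[OF assms] by (simp add: pres_class_def)
  ultimately have "u \<in> pres_class A R v" by blast
  then show "pres_eq A R u v" by (simp add: pres_class_def pres_eq.sym)
next
  assume c: "pres_eq A R u v"
  show "pres_class A R u = pres_class A R v"
    using pres_eq.trans[OF c] pres_eq.trans[OF pres_eq.sym[OF c]]
    by (auto simp: set_eq_iff pres_class_def)
qed

lemma pres_class_eqI: "pres_eq A R u v \<Longrightarrow> pres_class A R u = pres_class A R v"
  using pres_class_eq pres_eq_lists by metis

lemma presented_group_simps [simp]:
  "carrier (presented_group A R) = pres_class A R ` lists (A \<times> UNIV)"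
  "\<one>\<^bsub>presented_group A R\<^esub> = pres_class A R []"
  by (simp_all add: presented_group_def)

lemma presented_group_mult:
  assumes "u \<in> lists (A \<times> UNIV)" "v \<in> lists (A \<times> UNIV)"
  shows "pres_class A R u \<otimes>\<^bsub>presented_group A R\<^esub> pres_class A R v = pres_class A R (u @ v)"
proof -
  have "pres_class A R (u' @ v') = pres_class A R (u @ v)"
    if "u' \<in> pres_class A R u" "v' \<in> pres_class A R v" for u' v'
    using pres_class_eqI[OF pres_eq_append, of A R u u' v v'] that by (simp add: pres_class_def)
  moreover have "u \<in> pres_class A R u" "v \<in> pres_class A R v"
    using assms by (simp_all add: pres_class_def pres_eq.refl)
  ultimately show ?thesis unfolding presented_group_def monoid.simps partial_object.simps by blast
qed

definition word_inv :: "('a \<times> bool) list \<Rightarrow> ('a \<times> bool) list" where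
  "word_inv u = rev (map (\<lambda>(a, b). (a, \<not> b)) u)"

lemma word_inv_lists: "u \<in> lists (A \<times> UNIV) \<Longrightarrow> word_inv u \<in> lists (A \<times> UNIV)"
  by (auto simp: word_inv_def)

lemma pres_eq_word_inv: "u \<in> lists (A \<times> UNIV) \<Longrightarrow> pres_eq A R (word_inv u @ u) []"
proof (induction u)
  case Nil
  then show ?case by (simp add: word_inv_def pres_eq.refl)
next
  case (Cons p u)
  obtain a b where p: "p = (a, b)" by (cases p)
  have "pres_eq A R (word_inv u @ [(a, \<not> b), (a, \<not> \<not> b)] @ u) (word_inv u @ u)"
    by (rule pres_eq.cancel) (use Cons p in \<open>auto intro!: word_inv_lists\<close>)
  moreover have "word_inv (p # u) @ p # u = word_inv u @ [(a, \<not> b), (a, \<not> \<not> b)] @ u"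
    by (simp add: word_inv_def p)
  ultimately show ?case using Cons by (metis Cons_in_lists_iff pres_eq.trans)
qed

lemma group_presented_group: "group (presented_group A R)"
proof (rule groupI)
  fix X Y Z assume "X \<in> carrier (presented_group A R)" "Y \<in> carrier (presented_group A R)"
    "Z \<in> carrier (presented_group A R)"
  then obtain u v w where *: "X = pres_class A R u" "Y = pres_class A R v" "Z = pres_class A R w"
    "u \<in> lists (A \<times> UNIV)" "v \<in> lists (A \<times> UNIV)" "w \<in> lists (A \<times> UNIV)" by auto
  then show "X \<otimes>\<^bsub>presented_group A R\<^esub> Y \<in> carrier (presented_group A R)"
    by (simp add: presented_group_mult)
  show "X \<otimes>\<^bsub>presented_group A R\<^esub> Y \<otimes>\<^bsub>presented_group A R\<^esub> Z =
      X \<otimes>\<^bsub>presented_group A R\<^esub> (Y \<otimes>\<^bsub>presented_group A R\<^esub> Z)"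
    using * by (simp add: presented_group_mult)
next
  fix X assume "X \<in> carrier (presented_group A R)"
  then obtain u where *: "X = pres_class A R u" "u \<in> lists (A \<times> UNIV)" by auto
  then show "\<one>\<^bsub>presented_group A R\<^esub> \<otimes>\<^bsub>presented_group A R\<^esub> X = X"
    by (simp add: presented_group_mult)
  have "pres_class A R (word_inv u) \<otimes>\<^bsub>presented_group A R\<^esub> X = \<one>\<^bsub>presented_group A R\<^esub>"
    using * pres_class_eqI[OF pres_eq_word_inv[OF *(2)]] by (simp add: presented_group_mult word_inv_lists)
  then show "\<exists>Y\<in>carrier (presented_group A R). Y \<otimes>\<^bsub>presented_group A R\<^esub> X = \<one>\<^bsub>presented_group A R\<^esub>"
    using word_inv_lists[OF *(2)] by (intro bexI[of _ "pres_class A R (word_inv u)"]) simp_all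
qed simp

lemma group_braid: "group (braid_group n)"
  unfolding braid_group_def by (rule group_presented_group)

interpretation braid: group "braid_group n" for n
  by (rule group_braid)

lemma word_perm_append: "word_perm (u @ v) = word_perm u \<circ> word_perm v"
  by (induction u) (auto simp: word_perm_def comp_assoc split: prod.splits)

lemma word_perm_pres_eq:
  assumes "pres_eq {0..<n} (braid_rels n) u v" shows "word_perm u = word_perm v"
  using assms
proof induction
  case (cancel u v a b)
  have "word_perm [(a, b), (a, \<not> b)] = id" by (simp add: word_perm_def)
  then show ?case by (simp only: word_perm_append) simp
next
  case (rel u v r s)
  then have "word_perm r = word_perm s"
    by (auto simp: braid_rels_def word_perm_def fun_eq_iff transpose_def)
  then show ?case by (simp add: word_perm_append)
qed simp_all

lemma pure_subgroup: "subgroup {b \<in> carrier (braid_group n). \<forall>w\<in>b. word_perm w = id} (braid_group n)"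
  (is "subgroup ?H _")
proof -
  let ?L = "lists ({0..<n} \<times> UNIV)" and ?c = "pres_class {0..<n} (braid_rels n)"
  have mem: "?c u \<in> ?H \<longleftrightarrow> word_perm u = id" if "u \<in> ?L" for u
  proof -
    have "u \<in> ?c u" using that by (simp add: pres_class_def pres_eq.refl)
    moreover have "word_perm w = word_perm u" if "w \<in> ?c u" for w
      using word_perm_pres_eq[of n u w] that by (simp add: pres_class_def)
    ultimately have "(\<forall>w\<in>?c u. word_perm w = id) \<longleftrightarrow> word_perm u = id" by metis
    moreover have "?c u \<in> carrier (braid_group n)" using that by (simp add: braid_group_def)
    ultimately show ?thesis by blast
  qed
  have perm_inv: "word_perm (word_inv u) \<circ> word_perm u = id" if "u \<in> ?L" for u
    using word_perm_pres_eq[OF pres_eq_word_inv[OF that, of "braid_rels n"]]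
    by (simp add: word_perm_append) (simp add: word_perm_def)
  have repr: "\<exists>u\<in>?L. b = ?c u \<and> word_perm u = id" if b: "b \<in> ?H" for b
  proof -
    obtain u where "u \<in> ?L" "b = ?c u" using b by (auto simp: braid_group_def)
    then show ?thesis using mem b by blast
  qed
  show ?thesis
  proof (rule braid.subgroupI)
    show "?H \<subseteq> carrier (braid_group n)" by blast
    have "?c [] \<in> ?H" by (subst mem) (simp_all add: word_perm_def)
    then show "?H \<noteq> {}" by blast
  next
    fix a assume "a \<in> ?H"
    from repr[OF this] obtain u where u: "u \<in> ?L" "a = ?c u" "word_perm u = id" by blast
    have "inv\<^bsub>braid_group n\<^esub> a = ?c (word_inv u)"
      using u pres_class_eqI[OF pres_eq_word_inv[OF u(1)]]
      by (intro braid.inv_equality)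
        (simp_all add: braid_group_def presented_group_mult word_inv_lists)
    then show "inv\<^bsub>braid_group n\<^esub> a \<in> ?H"
      using mem[OF word_inv_lists[OF u(1)]] perm_inv[OF u(1)] u(3) by simp
  next
    fix a b assume ab: "a \<in> ?H" "b \<in> ?H"
    from repr[OF ab(1)] obtain u where u: "u \<in> ?L" "a = ?c u" "word_perm u = id" by blast
    from repr[OF ab(2)] obtain v where v: "v \<in> ?L" "b = ?c v" "word_perm v = id" by blast
    have "a \<otimes>\<^bsub>braid_group n\<^esub> b = ?c (u @ v)"
      using u v by (simp add: braid_group_def presented_group_mult)
    then show "a \<otimes>\<^bsub>braid_group n\<^esub> b \<in> ?H"
      using mem[of "u @ v"] u v by (simp add: word_perm_append)
  qed
qed

lemma braid_class_carrier: "u \<in> lists ({0..<n} \<times> UNIV) \<Longrightarrow> braid_class n u \<in> carrier (braid_group n)"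
  by (simp add: braid_class_def braid_group_def)

lemma braid_class_mult:
  "u \<in> lists ({0..<n} \<times> UNIV) \<Longrightarrow> v \<in> lists ({0..<n} \<times> UNIV) \<Longrightarrow>
    braid_class n u \<otimes>\<^bsub>braid_group n\<^esub> braid_class n v = braid_class n (u @ v)"
  by (simp add: braid_class_def braid_group_def presented_group_mult)

lemma exp_t_sym_simps [simp]:
  "carrier (exp_t_sym n) = kd_hat {0..n} \<times> {s. s permutes {0..n}}"
  "\<one>\<^bsub>exp_t_sym n\<^esub> = (kd_class {0..n} 0, id)"
  "(g, s) \<otimes>\<^bsub>exp_t_sym n\<^esub> (h, r) = (g \<otimes>\<^bsub>exp_t {0..n}\<^esub> perm_act {0..n} s h, s \<circ> r)"
  by (simp_all add: exp_t_sym_def)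

lemma snd_exp_t_sym_mult: "snd (x \<otimes>\<^bsub>exp_t_sym n\<^esub> y) = snd x \<circ> snd y"
  by (cases x; cases y) simp

lemma perm_act_closed: "s permutes {0..n} \<Longrightarrow> X \<in> kd_hat {0..n} \<Longrightarrow> perm_act {0..n} s X \<in> kd_hat {0..n}"
  using cabling.kd_map_closed[OF cabling_perm, of "{0..n}" s X] by simp

lemma perm_act_mult:
  "s permutes {0..n} \<Longrightarrow> X \<in> kd_hat {0..n} \<Longrightarrow> Y \<in> kd_hat {0..n} \<Longrightarrow>
    perm_act {0..n} s (X \<otimes>\<^bsub>exp_t {0..n}\<^esub> Y) = perm_act {0..n} s X \<otimes>\<^bsub>exp_t {0..n}\<^esub> perm_act {0..n} s Y"
  using cabling.kd_map_mult[OF cabling_perm, of "{0..n}" s X Y] by simp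

lemmas perm_act_comp' = perm_act_comp[unfolded comp_apply]
  and perm_act_id' = perm_act_id[unfolded id_apply]

lemma perm_act_one: "s permutes {0..n} \<Longrightarrow> perm_act {0..n} s (kd_class {0..n} 0) = kd_class {0..n} 0"
proof -
  assume s: "s permutes {0..n}"
  interpret cabling "{0..n}" "{0..n}" "\<lambda>i. {s i}" using s by (intro cabling_perm) simp_all
  show ?thesis using kd_map_class[of 0] by (simp add: subst_0)
qed

lemma group_exp_t_sym: "group (exp_t_sym n :: ('k::field_char_0 kd \<times> (nat \<Rightarrow> nat)) monoid)"
proof (rule groupI)
  let ?G = "exp_t {0..n} :: ('k kd, 'k) prounip" and ?A = "exp_t_sym n :: ('k kd \<times> (nat \<Rightarrow> nat)) monoid"
  have G: "group ?G" by (rule group_exp_t)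
  have closed: "X \<otimes>\<^bsub>?G\<^esub> Y \<in> kd_hat {0..n}" if "X \<in> kd_hat {0..n}" "Y \<in> kd_hat {0..n}" for X Y
    using monoid.m_closed[OF group.is_monoid[OF G], of X Y] that by simp
  fix x y z assume "x \<in> carrier ?A" "y \<in> carrier ?A" "z \<in> carrier ?A"
  then show "x \<otimes>\<^bsub>?A\<^esub> y \<in> carrier ?A"
    by (auto simp: closed perm_act_closed intro: permutes_compose)
  obtain g s h r k t where *: "x = (g, s)" "y = (h, r)" "z = (k, t)" by (cases x; cases y; cases z)
  then have mem: "g \<in> kd_hat {0..n}" "h \<in> kd_hat {0..n}" "k \<in> kd_hat {0..n}"
    "s permutes {0..n}" "r permutes {0..n}"
    using \<open>x \<in> carrier ?A\<close> \<open>y \<in> carrier ?A\<close> \<open>z \<in> carrier ?A\<close> by auto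
  show "x \<otimes>\<^bsub>?A\<^esub> y \<otimes>\<^bsub>?A\<^esub> z = x \<otimes>\<^bsub>?A\<^esub> (y \<otimes>\<^bsub>?A\<^esub> z)"
    using mem monoid.m_assoc[OF group.is_monoid[OF G], of g "perm_act {0..n} s h" "perm_act {0..n} s (perm_act {0..n} r k)"]
    by (simp add: * perm_act_mult perm_act_closed perm_act_comp' comp_assoc)
next
  let ?G = "exp_t {0..n} :: ('k kd, 'k) prounip" and ?A = "exp_t_sym n :: ('k kd \<times> (nat \<Rightarrow> nat)) monoid"
  have G: "group ?G" by (rule group_exp_t)
  show "\<one>\<^bsub>?A\<^esub> \<in> carrier ?A" by (simp add: permutes_id)
  fix x assume "x \<in> carrier ?A"
  then obtain g s where x: "x = (g, s)" "g \<in> kd_hat {0..n}" "s permutes {0..n}" by (cases x) auto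
  have g1: "kd_class {0..n} 0 \<otimes>\<^bsub>?G\<^esub> g = g" using monoid.l_one[OF group.is_monoid[OF G], of g] x by simp
  show "\<one>\<^bsub>?A\<^esub> \<otimes>\<^bsub>?A\<^esub> x = x" using x g1 by (simp add: perm_act_id')
  let ?r = "inv_into UNIV s"
  have r: "?r permutes {0..n}" "?r \<circ> s = id" using x(3) by (simp_all add: permutes_inv permutes_inv_o)
  have gi: "inv\<^bsub>?G\<^esub> g \<in> kd_hat {0..n}" "inv\<^bsub>?G\<^esub> g \<otimes>\<^bsub>?G\<^esub> g = kd_class {0..n} 0"
    using group.inv_closed[OF G, of g] group.l_inv[OF G, of g] x by simp_all
  have "(perm_act {0..n} ?r (inv\<^bsub>?G\<^esub> g), ?r) \<otimes>\<^bsub>?A\<^esub> x = \<one>\<^bsub>?A\<^esub>"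
    using x r gi perm_act_mult[OF r(1) gi(1) x(2)] by (simp add: perm_act_one)
  then show "\<exists>y\<in>carrier ?A. y \<otimes>\<^bsub>?A\<^esub> x = \<one>\<^bsub>?A\<^esub>"
    using r(1) gi(1) by (intro bexI[of _ "(perm_act {0..n} ?r (inv\<^bsub>?G\<^esub> g), ?r)"]) (auto simp: perm_act_closed)
qed

interpretation exp_t_sym: group "exp_t_sym n" for n
  by (rule group_exp_t_sym)

section \<open>The image of a generator of the free group\<close>

lemma letters_right_pword: "letters (right_pword i m) = [i..<Suc (i + m)]"
  by (induction m arbitrary: i) (auto simp: upt_rec)

lemma right_pword_pwords: "right_pword 0 n \<in> pwords n"
  by (simp add: pwords_def letters_right_pword)

text \<open>Conjugating a pure element lets the permutation of the conjugating element act on its indices.\<close>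

lemma exp_t_sym_conj:
  assumes "c \<in> kd_hat {0..n}" "r permutes {0..n}" "e \<in> kd_hat {0..n}"
  shows "(c, r) \<otimes>\<^bsub>exp_t_sym n\<^esub> (e, id) \<otimes>\<^bsub>exp_t_sym n\<^esub> inv\<^bsub>exp_t_sym n\<^esub> (c, r) =
    (c \<otimes>\<^bsub>exp_t {0..n}\<^esub> perm_act {0..n} r e \<otimes>\<^bsub>exp_t {0..n}\<^esub> inv\<^bsub>exp_t {0..n}\<^esub> c, id)"
proof -
  have re: "perm_act {0..n} r e \<in> carrier (exp_t {0..n})" using assms perm_act_closed by simp
  have c: "c \<in> carrier (exp_t {0..n})" using assms by simp
  let ?d = "c \<otimes>\<^bsub>exp_t {0..n}\<^esub> perm_act {0..n} r e \<otimes>\<^bsub>exp_t {0..n}\<^esub> inv\<^bsub>exp_t {0..n}\<^esub> c"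
  have d: "?d \<in> carrier (exp_t {0..n})" using re c by (intro exp_t.m_closed exp_t.inv_closed)
  have "?d \<otimes>\<^bsub>exp_t {0..n}\<^esub> c = c \<otimes>\<^bsub>exp_t {0..n}\<^esub> perm_act {0..n} r e"
    using re c by (simp only: exp_t.m_assoc exp_t.m_closed exp_t.inv_closed exp_t.l_inv exp_t.r_one)
  then have "(?d, id) \<otimes>\<^bsub>exp_t_sym n\<^esub> (c, r) = (c, r) \<otimes>\<^bsub>exp_t_sym n\<^esub> (e, id)"
    using assms by (simp add: perm_act_id')
  moreover have "(?d, id) \<in> carrier (exp_t_sym n)" using d by (simp add: permutes_id)
  moreover have "(c, r) \<in> carrier (exp_t_sym n)" "(e, id) \<in> carrier (exp_t_sym n)"
    using assms by (simp_all add: permutes_id)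
  ultimately show ?thesis
    by (metis exp_t_sym.inv_solve_right exp_t_sym.m_closed)
qed

locale braid_representation =
  fixes \<Phi> :: "'k::field_char_0 kd" and n :: nat and P :: pword
    and F :: "pword \<Rightarrow> pword \<Rightarrow> 'k kd" and \<mu>R :: "braid \<Rightarrow> 'k kd \<times> (nat \<Rightarrow> nat)"
  assumes \<Phi>: "\<Phi> \<in> kd_hat {1..3}" and P: "P \<in> pwords n"
    and F: "assoc_family n \<Phi> F" and \<mu>R: "mu_R_morphism n \<Phi> \<mu>R"
begin

abbreviation \<Gamma> :: "('k kd \<times> (nat \<Rightarrow> nat)) monoid" where "\<Gamma> \<equiv> exp_t_sym n"
abbreviation E :: "('k kd, 'k) prounip" where "E \<equiv> exp_t {0..n}"

lemma F_closed: "(F (right_pword 0 n) P, id) \<in> carrier \<Gamma>"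
  using F P right_pword_pwords by (auto simp: assoc_family_def permutes_id)

lemma \<mu>R_hom: "\<mu>R \<in> hom (braid_group n) \<Gamma>"
  using \<mu>R by (simp add: mu_R_morphism_def)

sublocale \<mu>R: group_hom "braid_group n" \<Gamma> \<mu>R
  by unfold_locales (rule \<mu>R_hom)

lemma mu_tilde_hom: "mu_tilde n F \<mu>R P \<in> hom (braid_group n) \<Gamma>"
proof (rule homI)
  fix b c assume b: "b \<in> carrier (braid_group n)" and c: "c \<in> carrier (braid_group n)"
  let ?f = "(F (right_pword 0 n) P, id)"
  have *: "?f \<in> carrier \<Gamma>" "\<mu>R b \<in> carrier \<Gamma>" "\<mu>R c \<in> carrier \<Gamma>" by (fact F_closed \<mu>R.hom_closed[OF b] \<mu>R.hom_closed[OF c])+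
  show "mu_tilde n F \<mu>R P b \<in> carrier \<Gamma>"
    unfolding mu_tilde_def using * by (intro exp_t_sym.m_closed exp_t_sym.inv_closed)
  have "?f \<otimes>\<^bsub>\<Gamma>\<^esub> \<mu>R b \<otimes>\<^bsub>\<Gamma>\<^esub> inv\<^bsub>\<Gamma>\<^esub> ?f \<otimes>\<^bsub>\<Gamma>\<^esub> (?f \<otimes>\<^bsub>\<Gamma>\<^esub> \<mu>R c \<otimes>\<^bsub>\<Gamma>\<^esub> inv\<^bsub>\<Gamma>\<^esub> ?f) =
    ?f \<otimes>\<^bsub>\<Gamma>\<^esub> \<mu>R b \<otimes>\<^bsub>\<Gamma>\<^esub> (inv\<^bsub>\<Gamma>\<^esub> ?f \<otimes>\<^bsub>\<Gamma>\<^esub> ?f) \<otimes>\<^bsub>\<Gamma>\<^esub> \<mu>R c \<otimes>\<^bsub>\<Gamma>\<^esub> inv\<^bsub>\<Gamma>\<^esub> ?f"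
    using * by (simp only: exp_t_sym.m_assoc exp_t_sym.m_closed exp_t_sym.inv_closed)
  also have "\<dots> = ?f \<otimes>\<^bsub>\<Gamma>\<^esub> \<mu>R (b \<otimes>\<^bsub>braid_group n\<^esub> c) \<otimes>\<^bsub>\<Gamma>\<^esub> inv\<^bsub>\<Gamma>\<^esub> ?f"
    using * \<mu>R.hom_mult[OF b c]
    by (simp only: exp_t_sym.l_inv exp_t_sym.r_one exp_t_sym.m_closed exp_t_sym.m_assoc exp_t_sym.inv_closed)
  finally show "mu_tilde n F \<mu>R P (b \<otimes>\<^bsub>braid_group n\<^esub> c) =
      mu_tilde n F \<mu>R P b \<otimes>\<^bsub>\<Gamma>\<^esub> mu_tilde n F \<mu>R P c"
    unfolding mu_tilde_def ..
qed

lemma sigma_closed: "i < n \<Longrightarrow> sigma n i \<in> carrier (braid_group n)"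
  unfolding sigma_def by (rule braid_class_carrier) simp

lemma \<mu>R_sigma:
  assumes i: "i < n"
  obtains g where "g \<in> kd_hat {0..n}"
    "\<mu>R (sigma n i) = (g, id) \<otimes>\<^bsub>\<Gamma>\<^esub>
       (kd_class {0..n} (nc_scale (1 / 2) (tgen i (Suc i))), transpose i (Suc i)) \<otimes>\<^bsub>\<Gamma>\<^esub> inv\<^bsub>\<Gamma>\<^esub> (g, id)"
proof -
  define g where "g = (if Suc i = n then \<one>\<^bsub>E\<^esub> else insertion {0..n} [{i}, {Suc i}, {i + 2..n}] \<Phi>)"
  have "g \<in> kd_hat {0..n}"
    unfolding g_def using i by (auto intro!: insertion_closed \<Phi>)
  moreover have "\<mu>R (sigma n i) = (g, id) \<otimes>\<^bsub>\<Gamma>\<^esub>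
       (kd_class {0..n} (nc_scale (1 / 2) (tgen i (Suc i))), transpose i (Suc i)) \<otimes>\<^bsub>\<Gamma>\<^esub> inv\<^bsub>\<Gamma>\<^esub> (g, id)"
    using \<mu>R i unfolding mu_R_morphism_def Let_def g_def kd_exp_def by blast
  ultimately show ?thesis by (rule that)
qed

lemma snd_inv: "x \<in> carrier \<Gamma> \<Longrightarrow> snd (inv\<^bsub>\<Gamma>\<^esub> x) \<circ> snd x = id"
proof -
  assume "x \<in> carrier \<Gamma>"
  then have "inv\<^bsub>\<Gamma>\<^esub> x \<otimes>\<^bsub>\<Gamma>\<^esub> x = \<one>\<^bsub>\<Gamma>\<^esub>" by (rule exp_t_sym.l_inv)
  then have "snd (inv\<^bsub>\<Gamma>\<^esub> x \<otimes>\<^bsub>\<Gamma>\<^esub> x) = id" by simp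
  then show ?thesis by (simp only: snd_exp_t_sym_mult)
qed

lemma snd_\<mu>R_sigma: "i < n \<Longrightarrow> snd (\<mu>R (sigma n i)) = transpose i (Suc i)"
proof -
  assume "i < n"
  from \<mu>R_sigma[OF this] obtain g where g: "g \<in> kd_hat {0..n}" "\<mu>R (sigma n i) = (g, id) \<otimes>\<^bsub>\<Gamma>\<^esub>
       (kd_class {0..n} (nc_scale (1 / 2) (tgen i (Suc i))), transpose i (Suc i)) \<otimes>\<^bsub>\<Gamma>\<^esub> inv\<^bsub>\<Gamma>\<^esub> (g, id)" .
  have "snd (inv\<^bsub>\<Gamma>\<^esub> (g, id)) = id" using snd_inv[of "(g, id)"] g by (simp add: permutes_id)
  then show ?thesis unfolding g(2) by (simp add: snd_exp_t_sym_mult del: exp_t_sym_simps)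
qed

lemma tgen_mem: "i \<le> n \<Longrightarrow> j \<le> n \<Longrightarrow> i \<noteq> j \<Longrightarrow> (i, j) \<in> kd_gens {0..n}"
  by (simp add: kd_gens_iff)

lemma tgen_swap_congr:
  "i \<le> n \<Longrightarrow> j \<le> n \<Longrightarrow> i \<noteq> j \<Longrightarrow> kd.congr {0..n} (tgen i j) (tgen j i :: (nat \<times> nat, 'k) nc_series)"
proof -
  assume ij: "i \<le> n" "j \<le> n" "i \<noteq> j"
  have "tgen i j - tgen j i \<in> (kd_ideal {0..n} :: (nat \<times> nat, 'k) nc_series set)"
    using ij by (intro kd_ideal.symm) auto
  then have "tgen i j - tgen j i \<in> (kd_ideal_hat {0..n} :: (nat \<times> nat, 'k) nc_series set)"
    by (simp add: kd_ideal_hat_def part_diff part_tgen kd_ideal.zero)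
  then show ?thesis
    using ij by (simp add: kd_congr_iff tgen_lie_series tgen_mem)
qed

text \<open>The permutation \<open>s\<^sub>i\<close> fixes \<open>t\<^sub>i\<^sub>,\<^sub>i\<^sub>+\<^sub>1\<close>, so the two half twists \<open>exp (t/2) s\<^sub>i\<close> multiply to \<open>exp t\<close>.\<close>

lemma \<mu>R_sigma_square:
  assumes i: "i < n"
  obtains g where "g \<in> kd_hat {0..n}"
    "\<mu>R (sigma n i \<otimes>\<^bsub>braid_group n\<^esub> sigma n i) =
      (g, id) \<otimes>\<^bsub>\<Gamma>\<^esub> (kd_class {0..n} (tgen i (Suc i)), id) \<otimes>\<^bsub>\<Gamma>\<^esub> inv\<^bsub>\<Gamma>\<^esub> (g, id)"
proof -
  let ?t = "tgen i (Suc i) :: (nat \<times> nat, 'k) nc_series" and ?s = "transpose i (Suc i)"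
  let ?e = "kd_class {0..n} (nc_scale (1 / 2) ?t)"
  from \<mu>R_sigma[OF i] obtain g where g: "g \<in> kd_hat {0..n}"
    "\<mu>R (sigma n i) = (g, id) \<otimes>\<^bsub>\<Gamma>\<^esub> (?e, ?s) \<otimes>\<^bsub>\<Gamma>\<^esub> inv\<^bsub>\<Gamma>\<^esub> (g, id)" .
  have s: "?s permutes {0..n}" using i by (intro permutes_swap_id) auto
  have t: "?t \<in> lie_t {0..n}" using i by (intro tgen_lie_series tgen_mem) auto
  have "perm_act {0..n} ?s ?e = kd_class {0..n} (nc_scale (1 / 2) (tgen (?s i) (?s (Suc i))))"
    using s i by (intro perm_act_tgen) (auto simp: tgen_mem)
  also have "\<dots> = ?e"
    using i by (intro kd_class_eqI) (auto intro!: kd.congr_scale tgen_swap_congr)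
  finally have "perm_act {0..n} ?s ?e = ?e" .
  moreover have "?e \<otimes>\<^bsub>E\<^esub> ?e = kd_class {0..n} ?t"
    using t by (simp add: exp_t_mult lie_series_scale bch_scale lie_series_order)
  ultimately have sq: "(?e, ?s) \<otimes>\<^bsub>\<Gamma>\<^esub> (?e, ?s) = (kd_class {0..n} ?t, id)" by simp
  have mem: "(g, id) \<in> carrier \<Gamma>" "(?e, ?s) \<in> carrier \<Gamma>"
    using g s t by (simp_all add: permutes_id lie_series_scale)
  have "\<mu>R (sigma n i \<otimes>\<^bsub>braid_group n\<^esub> sigma n i) =
     (g, id) \<otimes>\<^bsub>\<Gamma>\<^esub> (?e, ?s) \<otimes>\<^bsub>\<Gamma>\<^esub> (inv\<^bsub>\<Gamma>\<^esub> (g, id) \<otimes>\<^bsub>\<Gamma>\<^esub> (g, id)) \<otimes>\<^bsub>\<Gamma>\<^esub> (?e, ?s) \<otimes>\<^bsub>\<Gamma>\<^esub> inv\<^bsub>\<Gamma>\<^esub> (g, id)"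
    unfolding \<mu>R.hom_mult[OF sigma_closed[OF i] sigma_closed[OF i]] g(2)
    using mem by (simp only: exp_t_sym.m_assoc exp_t_sym.m_closed exp_t_sym.inv_closed)
  also have "\<dots> = (g, id) \<otimes>\<^bsub>\<Gamma>\<^esub> ((?e, ?s) \<otimes>\<^bsub>\<Gamma>\<^esub> (?e, ?s)) \<otimes>\<^bsub>\<Gamma>\<^esub> inv\<^bsub>\<Gamma>\<^esub> (g, id)"
    using mem
    by (simp only: exp_t_sym.l_inv exp_t_sym.r_one exp_t_sym.m_assoc exp_t_sym.m_closed exp_t_sym.inv_closed)
  finally show ?thesis using that[OF g(1)] unfolding sq by blast
qed

text \<open>The braid \<open>\<sigma>\<^sub>m\<^sub>-\<^sub>1 \<dots> \<sigma>\<^sub>0\<close> carries strand \<open>0\<close> past the strands \<open>1, \<dots>, m\<close>.\<close>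

lemma snd_\<mu>R_shift:
  assumes "m \<le> n"
  defines "w \<equiv> \<lambda>m. braid_class n (map (\<lambda>k. (k, True)) (rev [0..<m]))"
  shows "w m \<in> carrier (braid_group n) \<and> snd (\<mu>R (w m)) 0 = m \<and> (\<forall>j. m < j \<longrightarrow> snd (\<mu>R (w m)) j = j)"
  using assms(1)
proof (induction m)
  case 0
  have "w 0 = \<one>\<^bsub>braid_group n\<^esub>" by (simp add: w_def braid_class_def braid_group_def)
  then show ?case using \<mu>R.hom_one by simp
next
  case (Suc m)
  have l: "map (\<lambda>k. (k, True)) (rev [0..<m]) \<in> lists ({0..<n} \<times> UNIV)" using Suc by auto
  have "w (Suc m) = sigma n m \<otimes>\<^bsub>braid_group n\<^esub> w m"
    unfolding w_def sigma_def using Suc l by (subst braid_class_mult) auto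
  moreover have "sigma n m \<in> carrier (braid_group n)" using Suc by (intro sigma_closed) simp
  ultimately show ?case
    using Suc by (auto simp: \<mu>R.hom_mult snd_exp_t_sym_mult snd_\<mu>R_sigma transpose_def)
qed

text \<open>The generator is a conjugate of the square of \<open>\<sigma>\<^sub>k\<^sub>-\<^sub>1\<close>. All conjugating elements are collected in
  one element \<open>C\<close>, whose permutation sends \<open>k - 1, k\<close> to \<open>0, k\<close>.\<close>

lemma mu_tilde_pure_gen:
  assumes k: "k \<in> {1..n}"
  shows "pure_gen n 0 k \<in> carrier (braid_group n)"
    and "\<exists>v\<in>lie_t {0..n}. mu_tilde n F \<mu>R P (pure_gen n 0 k) = (kd_class {0..n} (nc_Ad v (tgen 0 k)), id)"
proof -
  define w where "w = braid_class n (map (\<lambda>k. (k, True)) (rev [0..<k - 1]))"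
  define q where "q = sigma n (k - 1) \<otimes>\<^bsub>braid_group n\<^esub> sigma n (k - 1)"
  have pg: "pure_gen n 0 k = inv\<^bsub>braid_group n\<^esub> w \<otimes>\<^bsub>braid_group n\<^esub> q \<otimes>\<^bsub>braid_group n\<^esub> w"
    unfolding pure_gen_def Let_def w_def q_def ..
  have k1: "k - 1 \<le> n" "k - 1 < n" "Suc (k - 1) = k" using k by auto
  have w: "w \<in> carrier (braid_group n)" "snd (\<mu>R w) 0 = k - 1" "snd (\<mu>R w) k = k"
    using snd_\<mu>R_shift[OF k1(1)] k by (auto simp: w_def)
  have q: "q \<in> carrier (braid_group n)"
    unfolding q_def by (intro braid.m_closed sigma_closed k1(2))
  show pgc: "pure_gen n 0 k \<in> carrier (braid_group n)"
    unfolding pg by (intro braid.m_closed braid.inv_closed w(1) q)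
  obtain g where g: "g \<in> kd_hat {0..n}"
    "\<mu>R q = (g, id) \<otimes>\<^bsub>\<Gamma>\<^esub> (kd_class {0..n} (tgen (k - 1) k), id) \<otimes>\<^bsub>\<Gamma>\<^esub> inv\<^bsub>\<Gamma>\<^esub> (g, id)"
    using \<mu>R_sigma_square[OF k1(2)] unfolding q_def k1(3) by metis
  let ?f = "(F (right_pword 0 n) P, id)" and ?e = "(kd_class {0..n} (tgen (k - 1) k), id)"
  define C where "C = ?f \<otimes>\<^bsub>\<Gamma>\<^esub> inv\<^bsub>\<Gamma>\<^esub> \<mu>R w \<otimes>\<^bsub>\<Gamma>\<^esub> (g, id)"
  have tm: "(k - 1, k) \<in> kd_gens {0..n}" "(0, k) \<in> kd_gens {0..n}" using k by (auto intro!: tgen_mem)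
  have mem: "?f \<in> carrier \<Gamma>" "\<mu>R w \<in> carrier \<Gamma>" "(g, id) \<in> carrier \<Gamma>" "?e \<in> carrier \<Gamma>"
    using F_closed \<mu>R.hom_closed[OF w(1)] g(1) tm by (auto simp: permutes_id tgen_lie_series)
  have C: "C \<in> carrier \<Gamma>"
    unfolding C_def using mem by (intro exp_t_sym.m_closed exp_t_sym.inv_closed)
  have "mu_tilde n F \<mu>R P (pure_gen n 0 k) =
    ?f \<otimes>\<^bsub>\<Gamma>\<^esub> (inv\<^bsub>\<Gamma>\<^esub> \<mu>R w \<otimes>\<^bsub>\<Gamma>\<^esub> ((g, id) \<otimes>\<^bsub>\<Gamma>\<^esub> ?e \<otimes>\<^bsub>\<Gamma>\<^esub> inv\<^bsub>\<Gamma>\<^esub> (g, id)) \<otimes>\<^bsub>\<Gamma>\<^esub> \<mu>R w) \<otimes>\<^bsub>\<Gamma>\<^esub> inv\<^bsub>\<Gamma>\<^esub> ?f"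
    unfolding mu_tilde_def pg g(2)[symmetric] using w(1) q
    by (simp only: \<mu>R.hom_mult \<mu>R.hom_inv braid.m_closed braid.inv_closed)
  also have "\<dots> = C \<otimes>\<^bsub>\<Gamma>\<^esub> ?e \<otimes>\<^bsub>\<Gamma>\<^esub> inv\<^bsub>\<Gamma>\<^esub> C"
    unfolding C_def using mem
    by (simp only: exp_t_sym.inv_mult_group exp_t_sym.m_assoc exp_t_sym.m_closed exp_t_sym.inv_closed
        exp_t_sym.inv_inv)
  finally have mu: "mu_tilde n F \<mu>R P (pure_gen n 0 k) = C \<otimes>\<^bsub>\<Gamma>\<^esub> ?e \<otimes>\<^bsub>\<Gamma>\<^esub> inv\<^bsub>\<Gamma>\<^esub> C" .
  obtain c r where cr: "C = (c, r)" by (cases C)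
  have crm: "c \<in> kd_hat {0..n}" "r permutes {0..n}" using C by (simp_all add: cr)
  have "r = snd (inv\<^bsub>\<Gamma>\<^esub> \<mu>R w)"
    using arg_cong[OF cr, of snd] unfolding C_def snd_exp_t_sym_mult by simp
  then have rs: "r \<circ> snd (\<mu>R w) = id" using snd_inv[OF mem(2)] by simp
  have r: "r (k - 1) = 0" "r k = k" using fun_cong[OF rs, of 0] fun_cong[OF rs, of k] w(2,3) by simp_all
  have "perm_act {0..n} r (kd_class {0..n} (tgen (k - 1) k)) = kd_class {0..n} (tgen 0 k :: (nat \<times> nat, 'k) nc_series)"
    using perm_act_tgen[OF _ crm(2) tm(1), of 1] by (simp add: r)
  then have mu': "mu_tilde n F \<mu>R P (pure_gen n 0 k) =
      (c \<otimes>\<^bsub>E\<^esub> kd_class {0..n} (tgen 0 k) \<otimes>\<^bsub>E\<^esub> inv\<^bsub>E\<^esub> c, id)"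
    unfolding mu cr using crm tm by (subst exp_t_sym_conj) (auto simp: tgen_lie_series)
  obtain v where v: "c = kd_class {0..n} v" "v \<in> lie_t {0..n}" using crm by (auto simp: kd_hat_eq)
  show "\<exists>v\<in>lie_t {0..n}. mu_tilde n F \<mu>R P (pure_gen n 0 k) = (kd_class {0..n} (nc_Ad v (tgen 0 k)), id)"
    using mu' v tm by (auto simp: exp_t_conj tgen_lie_series)
qed

end

section \<open>The elements \<open>x\<^sub>i\<close> generate a free Lie algebra\<close>

definition lder :: "'a \<Rightarrow> ('a, 'k::field_char_0) nc_series \<Rightarrow> ('a, 'k) nc_series" where
  "lder a f = Nc_series (\<lambda>w. coeff f (a # w))"

lemma coeff_Cons_lder: "coeff f (a # w) = coeff (lder a f) w"
  by (simp add: lder_def)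

lemma lder_add: "lder a (f + g) = lder a f + lder a g"
  and lder_diff: "lder a (f - g) = lder a f - lder a g"
  and lder_zero: "lder a 0 = 0"
  by (auto intro!: nc_series_eqI simp: lder_def)

lemma lder_var_mult: "lder a (nc_var b * f) = (if a = b then f else 0)"
  by (rule nc_series_eqI) (simp add: lder_def coeff_var_times)

lemma lder_eqI: "coeff f [] = coeff g [] \<Longrightarrow> (\<And>a. lder a f = lder a g) \<Longrightarrow> f = g"
proof (rule nc_series_eqI)
  fix w assume *: "coeff f [] = coeff g []" "\<And>a. lder a f = lder a g"
  show "coeff f w = coeff g w"
    by (cases w) (simp_all add: * coeff_Cons_lder)
qed

text \<open>For letters \<open>x \<noteq> y\<close>, \<open>swap_der x y\<close> is the derivation that sends \<open>x\<close> to \<open>[x, y]\<close>, \<open>y\<close> to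
  \<open>[y, x]\<close> and the other letters to \<open>0\<close>; the recursion computes its coefficients. It is the
  action of \<open>t\<^sub>i\<^sub>j\<close> on the free algebra with letters \<open>x = x\<^sub>i\<close> and \<open>y = x\<^sub>j\<close>.\<close>

definition swap_corr :: "'a \<Rightarrow> 'a \<Rightarrow> ('a list \<Rightarrow> 'k::field_char_0) \<Rightarrow> 'a \<Rightarrow> 'a \<Rightarrow> 'a list \<Rightarrow> 'k" where
  "swap_corr x y f a b w = (if a = x \<and> b = y then f (x # w) - f (y # w)
     else if a = y \<and> b = x then f (y # w) - f (x # w) else 0)"

fun swap_der_coeff :: "'a \<Rightarrow> 'a \<Rightarrow> ('a list \<Rightarrow> 'k::field_char_0) \<Rightarrow> 'a list \<Rightarrow> 'k" where
  "swap_der_coeff x y f [] = 0"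
| "swap_der_coeff x y f [a] = 0"
| "swap_der_coeff x y f (a # b # w) = swap_der_coeff x y (\<lambda>s. f (a # s)) (b # w) + swap_corr x y f a b w"

definition swap_der :: "'a \<Rightarrow> 'a \<Rightarrow> ('a, 'k::field_char_0) nc_series \<Rightarrow> ('a, 'k) nc_series" where
  "swap_der x y f = Nc_series (swap_der_coeff x y (coeff f))"

lemma swap_der_Nil: "coeff (swap_der x y f) [] = 0"
  by (simp add: swap_der_def)

lemma swap_der_commute:
  fixes f :: "('a, 'k::field_char_0) nc_series"
  assumes "x \<noteq> y" shows "swap_der x y f = swap_der y x f"
proof -
  have "swap_der_coeff x y g w = swap_der_coeff y x g w" for g :: "'a list \<Rightarrow> 'k" and w
    using assms by (induction x y g w rule: swap_der_coeff.induct) (auto simp: swap_corr_def)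
  then have "swap_der_coeff x y (coeff f) = swap_der_coeff y x (coeff f)" by (intro ext)
  then show ?thesis by (simp add: swap_der_def)
qed

lemma
  fixes f g :: "('a, 'k::field_char_0) nc_series"
  shows swap_der_add: "swap_der x y (f + g) = swap_der x y f + swap_der x y g"
  and swap_der_scale: "swap_der x y (nc_scale c f) = nc_scale c (swap_der x y f)"
proof -
  have if_add: "(if p then u + u' else if q then v + v' else 0) =
      (if p then u else if q then v else 0) + (if p then u' else if q then v' else 0)"
    and if_mult: "(if p then c * u else if q then c * v else 0) = c * (if p then u else if q then v else 0)"
    for p q and u u' v v' :: 'k
    by simp_all
  have add: "swap_der_coeff x y (\<lambda>s. h s + h' s) w = swap_der_coeff x y h w + swap_der_coeff x y h' w"
    for h h' :: "'a list \<Rightarrow> 'k" and w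
  proof (induction x y h w arbitrary: h' rule: swap_der_coeff.induct)
    case (3 x y h a b w h')
    have corr: "swap_corr x y (\<lambda>s. h s + h' s) a b w = swap_corr x y h a b w + swap_corr x y h' a b w"
      unfolding swap_corr_def add_diff_add by (rule if_add)
    show ?case
      unfolding swap_der_coeff.simps(3) corr 3 by (simp only: ac_simps)
  qed simp_all
  show "swap_der x y (f + g) = swap_der x y f + swap_der x y g"
    unfolding swap_der_def plus_nc_series.rep_eq
    by (rule nc_series_eqI) (simp only: coeff_Nc_series coeff_add add)
  have scale: "swap_der_coeff x y (\<lambda>s. c * h s) w = c * swap_der_coeff x y h w"
    for h :: "'a list \<Rightarrow> 'k" and w
  proof (induction x y h w rule: swap_der_coeff.induct)
    case (3 x y h a b w)
    have corr: "swap_corr x y (\<lambda>s. c * h s) a b w = c * swap_corr x y h a b w"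
      unfolding swap_corr_def right_diff_distrib[symmetric] by (rule if_mult)
    show ?case
      unfolding swap_der_coeff.simps(3) corr 3 by (simp only: distrib_left)
  qed simp_all
  show "swap_der x y (nc_scale c f) = nc_scale c (swap_der x y f)"
    unfolding swap_der_def nc_scale.rep_eq
    by (rule nc_series_eqI) (simp only: coeff_Nc_series coeff_scale scale)
qed

lemma swap_der_zero: "swap_der x y 0 = 0"
  using swap_der_scale[of x y 0 0] by simp

lemma swap_der_diff: "swap_der x y (f - g) = swap_der x y f - swap_der x y g"
  using swap_der_add[of x y "f - g" g] by simp

lemma swap_der_order:
  fixes f :: "('a, 'k::field_char_0) nc_series"
  shows "order_ge d f \<Longrightarrow> order_ge (Suc d) (swap_der x y f)"
proof -
  have "swap_der_coeff x y h w = 0" if "\<forall>s. length s < d \<longrightarrow> h s = 0" "length w < Suc d"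
    for h :: "'a list \<Rightarrow> 'k" and w
    using that
  proof (induction x y h w arbitrary: d rule: swap_der_coeff.induct)
    case (3 x y h a b w)
    then obtain e where d: "d = Suc e" by (cases d) auto
    have "swap_der_coeff x y (\<lambda>s. h (a # s)) (b # w) = 0"
      using 3 by (intro "3.IH"[of e]) (auto simp: d)
    moreover have "h (x # w) = 0" "h (y # w) = 0" using 3(2,3) by simp_all
    ultimately show ?case by (simp add: swap_corr_def)
  qed simp_all
  then show "order_ge d f \<Longrightarrow> order_ge (Suc d) (swap_der x y f)"
    by (simp add: order_ge_def swap_der_def)
qed

lemma lder_swap_der:
  assumes "x \<noteq> y"
  shows "lder a (swap_der x y f) = swap_der x y (lder a f)
    + (if a = x then nc_var y * (lder x f - lder y f)
       else if a = y then nc_var x * (lder y f - lder x f) else 0)"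
proof (rule nc_series_eqI)
  fix w
  show "coeff (lder a (swap_der x y f)) w = coeff (swap_der x y (lder a f)
    + (if a = x then nc_var y * (lder x f - lder y f)
       else if a = y then nc_var x * (lder y f - lder x f) else 0)) w"
    using assms by (cases w) (auto simp: lder_def swap_der_def swap_corr_def coeff_var_times Nc_series_inverse)
qed

lemma swap_der_var_mult:
  assumes "x \<noteq> y"
  shows "swap_der x y (nc_var c * f) = nc_var c * swap_der x y f
    + (if c = x then commutator (nc_var x) (nc_var y) * f
       else if c = y then commutator (nc_var y) (nc_var x) * f else 0)"
proof (rule lder_eqI)
  show "coeff (swap_der x y (nc_var c * f)) [] = coeff (nc_var c * swap_der x y f
    + (if c = x then commutator (nc_var x) (nc_var y) * f
       else if c = y then commutator (nc_var y) (nc_var x) * f else 0)) []"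
    by (simp add: swap_der_Nil coeff_times_Nil coeff_var commutator_def)
  fix a
  show "lder a (swap_der x y (nc_var c * f)) = lder a (nc_var c * swap_der x y f
    + (if c = x then commutator (nc_var x) (nc_var y) * f
       else if c = y then commutator (nc_var y) (nc_var x) * f else 0))"
    using assms
    by (simp add: lder_swap_der[OF assms] lder_var_mult commutator_def left_diff_distrib mult.assoc
        lder_add lder_diff lder_zero swap_der_zero)
qed

lemma zero_by_lder:
  assumes "\<And>f. coeff (T f) [] = 0" "\<And>a f. lder a (T f) = T (lder a f)"
  shows "T f = 0"
proof (rule nc_series_eqI)
  fix w
  show "coeff (T f) w = coeff 0 w"
    by (induction w arbitrary: f) (simp_all add: assms coeff_Cons_lder lder_zero)
qed

text \<open>Both relations below say that a derivation vanishes; it suffices that it commutes with all left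
  derivatives.\<close>

lemma swap_der_rel3:
  fixes f :: "('a, 'k::field_char_0) nc_series"
  assumes "x \<noteq> y" "x \<noteq> z" "y \<noteq> z"
  shows "swap_der x y (swap_der x z f + swap_der y z f) =
    swap_der x z (swap_der x y f) + swap_der y z (swap_der x y f)"
proof -
  define T where "T f = swap_der x y (swap_der x z f + swap_der y z f)
    - (swap_der x z (swap_der x y f) + swap_der y z (swap_der x y f))" for f :: "('a, 'k) nc_series"
  have "T f = 0"
  proof (rule zero_by_lder[of T])
    fix f :: "('a, 'k) nc_series" and a
    show "coeff (T f) [] = 0" by (simp add: T_def swap_der_Nil)
    show "lder a (T f) = T (lder a f)"
    proof -
      note rules = T_def lder_swap_der swap_der_var_mult lder_add lder_diff swap_der_add
        swap_der_diff commutator_def distrib_left distrib_right left_diff_distrib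
        right_diff_distrib mult.assoc
      consider "a = x" | "a = y" | "a = z" | "a \<noteq> x" "a \<noteq> y" "a \<noteq> z" by blast
      then show ?thesis
        by cases (use assms assms[symmetric] in \<open>simp_all add: rules\<close>)
    qed
  qed
  then show ?thesis unfolding T_def by (rule eq_iff_diff_eq_0[THEN iffD2])
qed

lemma swap_der_rel4:
  fixes f :: "('a, 'k::field_char_0) nc_series"
  assumes "distinct [x, y, z, w]"
  shows "swap_der x y (swap_der z w f) = swap_der z w (swap_der x y f)"
proof -
  define T where "T f = swap_der x y (swap_der z w f) - swap_der z w (swap_der x y f)"
    for f :: "('a, 'k) nc_series"
  have "T f = 0"
  proof (rule zero_by_lder[of T])
    fix f :: "('a, 'k) nc_series" and a
    show "coeff (T f) [] = 0" by (simp add: T_def swap_der_Nil)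
    show "lder a (T f) = T (lder a f)"
    proof -
      note rules = T_def lder_swap_der swap_der_var_mult lder_add lder_diff swap_der_add
        swap_der_diff distrib_left distrib_right left_diff_distrib right_diff_distrib mult.assoc
      have ne: "x \<noteq> y" "x \<noteq> z" "x \<noteq> w" "y \<noteq> z" "y \<noteq> w" "z \<noteq> w" using assms by simp_all
      consider "a = x" | "a = y" | "a = z" | "a = w" | "a \<noteq> x" "a \<noteq> y" "a \<noteq> z" "a \<noteq> w" by blast
      then show ?thesis
        by cases (use ne ne[symmetric] in \<open>simp_all add: rules\<close>)
    qed
  qed
  then show ?thesis unfolding T_def by (rule eq_iff_diff_eq_0[THEN iffD2])
qed

abbreviation fgens :: "nat \<Rightarrow> (nat \<times> nat) set" where
  "fgens n \<equiv> (\<lambda>i. (0, i)) ` {1..n}"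

text \<open>The algebra \<open>t\<close> acts on the free algebra in the letters \<open>x\<^sub>i\<close>: the element \<open>x\<^sub>i\<close> by left
  multiplication, the other generators by the derivations above. The subalgebra generated by the
  \<open>x\<^sub>i\<close> acts faithfully, already on \<open>1\<close>.\<close>

definition free_op :: "nat \<times> nat \<Rightarrow> (nat \<times> nat, 'k::field_char_0) nc_series \<Rightarrow> (nat \<times> nat, 'k) nc_series" where
  "free_op = (\<lambda>(i, j) p. if i = 0 then nc_var (0, j) * p else if j = 0 then nc_var (0, i) * p
     else swap_der (0, i) (0, j) p)"

interpretation free: letter_action "kd_gens {0..n}" free_op for n
proof
  show "finite (kd_gens {0..n})" by (simp add: finite_kd_gens)
  fix a :: "nat \<times> nat" and p q :: "(nat \<times> nat, 'k::field_char_0) nc_series" and c d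
  show "free_op a (p + q) = free_op a p + free_op a q"
    by (cases a) (simp add: free_op_def distrib_left swap_der_add)
  show "free_op a (nc_scale c p) = nc_scale c (free_op a p)"
    by (cases a) (simp add: free_op_def swap_der_scale)
  assume "order_ge d p"
  then show "order_ge (Suc d) (free_op a p)"
    by (cases a) (auto simp: free_op_def intro: swap_der_order order_ge_mult'[OF order_ge_var])
qed

lemma kd_ideal_acts_0: "u \<in> kd_ideal {0..n} \<Longrightarrow> free.act n u p = 0"
proof (induction arbitrary: p rule: kd_ideal.induct)
  case (symm i j)
  then have "(i, j) \<in> kd_gens {0..n}" "(j, i) \<in> kd_gens {0..n}" by (auto simp: kd_gens_iff)
  moreover have "free_op (i, j) p = free_op (j, i) p"
    using symm by (auto simp: free_op_def swap_der_commute)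
  ultimately show ?case by (simp add: free.act_diff_left tgen_def free.act_var)
next
  case (rel3 i j k)
  then have g: "(i, j) \<in> kd_gens {0..n}" "(i, k) \<in> kd_gens {0..n}" "(j, k) \<in> kd_gens {0..n}"
    by (auto simp: kd_gens_iff)
  have "free_op (i, j) (free_op (i, k) p + free_op (j, k) p) =
      free_op (i, k) (free_op (i, j) p) + free_op (j, k) (free_op (i, j) p)"
  proof (cases "i = 0 \<or> j = 0 \<or> k = 0")
    case True
    then show ?thesis
      using rel3 by (auto simp: free_op_def swap_der_var_mult swap_der_add commutator_def algebra_simps)
  next
    case False
    then show ?thesis using rel3 by (simp add: free_op_def swap_der_rel3)
  qed
  then show ?case
    unfolding commutator_def free.act_diff_left free.act_mult tgen_def free.act_add_left
    by (simp add: free.act_var g)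
next
  case (rel4 i j k l)
  then have g: "(i, j) \<in> kd_gens {0..n}" "(k, l) \<in> kd_gens {0..n}"
    by (auto simp: kd_gens_iff)
  have "free_op (i, j) (free_op (k, l) p) = free_op (k, l) (free_op (i, j) p)"
    using rel4 by (auto simp: free_op_def swap_der_rel4 swap_der_var_mult)
  then show ?case
    unfolding commutator_def free.act_diff_left free.act_mult tgen_def
    by (simp add: free.act_var g)
next
  case zero
  then show ?case by (rule free.act_0_left)
next
  case (add u v)
  then show ?case by (simp add: free.act_add_left)
next
  case (scale u c)
  then show ?case by (simp add: free.act_scale_left)
next
  case (bracket u v)
  then show ?case
    by (simp add: commutator_def free.act_diff_left free.act_mult free.act_0_right)
qed

lemma fgens_subset: "fgens n \<subseteq> kd_gens {0..n}"
  by (auto simp: kd_gens_def)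

lemma free_act_1:
  assumes "supported (fgens n) u" shows "free.act n u 1 = u"
proof (rule nc_series_eqI)
  fix w
  have fold: "foldr free_op v 1 = (word_prod nc_var v :: (nat \<times> nat, 'a) nc_series)" if "set v \<subseteq> fgens n" for v
    using that by (induction v) (auto simp: free_op_def)
  have "coeff (free.act n u 1) w = (\<Sum>v\<in>{v. set v \<subseteq> kd_gens {0..n} \<and> length v \<le> length w}.
      if v = w then coeff u w else 0)"
    unfolding free.act_def coeff_Nc_series
  proof (rule sum.cong[OF HOL.refl])
    fix v
    show "coeff u v * coeff (foldr free_op v 1) w = (if v = w then coeff u w else 0)"
      using assms fold[of v] by (cases "set v \<subseteq> fgens n") (auto simp: supported_def coeff_word)
  qed
  also have "\<dots> = coeff u w"
  proof -
    have "coeff u w = 0" if "\<not> set w \<subseteq> kd_gens {0..n}"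
      using assms that fgens_subset[of n] unfolding supported_def by blast
    then show ?thesis
      using finite_lists_length_le[OF free.fin_letters, of n "length w"] by (auto simp: sum.delta)
  qed
  finally show "coeff (free.act n u 1) w = coeff u w" .
qed

text \<open>The ideal of relations acts by zero, whereas a Lie polynomial in the \<open>x\<^sub>i\<close> sends \<open>1\<close> to itself.\<close>

theorem kd_free:
  assumes "u \<in> lie_series (fgens n)" "u \<in> kd_ideal_hat {0..n}" shows "u = 0"
proof (rule parts_eqI)
  fix d
  have "nc_part d u \<in> lie_poly (fgens n)" "nc_part d u \<in> kd_ideal {0..n}"
    using assms by (auto simp: lie_series_def kd_ideal_hat_def)
  then have "nc_part d u = 0"
    using free_act_1[OF supported_lie_poly] kd_ideal_acts_0 by metis
  then show "nc_part d u = nc_part d 0" by simp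
qed

section \<open>The ideal generated by the \<open>x\<^sub>i\<close> and tangential conjugation\<close>

lemma jacobi: "commutator (commutator u v) w = commutator u (commutator v w) - commutator v (commutator u w)"
  by (simp add: commutator_def algebra_simps)

lemma kd_ideal_part:
  fixes u :: "(nat \<times> nat, 'k::field_char_0) nc_series"
  shows "u \<in> kd_ideal S \<Longrightarrow> nc_part d u \<in> kd_ideal S"
proof (induction arbitrary: d rule: kd_ideal.induct)
  {
    case (symm i j)
    then show ?case by (simp add: part_diff part_tgen kd_ideal.intros)
  next
    case (rel3 i j k)
    then have "commutator (tgen i j) (tgen i k + tgen j k) \<in> (kd_ideal S :: (nat \<times> nat, 'k) nc_series set)"
      by (rule kd_ideal.rel3)
    then show ?case by (simp add: commutator_add_right part_add part_commutator_tgen kd_ideal.zero)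
  next
    case (rel4 i j k l)
    then show ?case by (simp add: part_commutator_tgen kd_ideal.intros)
  next
    case (bracket u v)
    then show ?case
      unfolding part_commutator
      by (intro nc.subspace_sum[OF subspace_kd_ideal] kd_ideal.bracket lie_poly_part)
  next
    case zero
    then show ?case by (simp add: kd_ideal.zero)
  next
    case (add u v)
    then show ?case by (simp add: part_add kd_ideal.add)
  next
    case (scale u c)
    then show ?case by (simp add: part_scale kd_ideal.scale)
  }
qed

text \<open>Decompositions of all homogeneous parts add up to a decomposition of a series, once each summand is
  replaced by its part of the right degree.\<close>

lemma assemble_parts:
  assumes V: "nc.subspace V" "\<And>d u. u \<in> V \<Longrightarrow> nc_part d u \<in> V"
    and W: "\<And>d u. u \<in> W \<Longrightarrow> nc_part d u \<in> W"
    and u: "\<And>d. \<exists>c\<in>V. nc_part d u - c \<in> W"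
  shows "\<exists>c\<in>graded_hat V. u - c \<in> graded_hat W"
proof -
  obtain C where C: "\<And>d. C d \<in> V" "\<And>d. nc_part d u - C d \<in> W" using u by metis
  define c where "c = nc_sum (\<lambda>d. nc_part d (C d))"
  have "nc_part d c = (\<Sum>m\<le>d. nc_part d (nc_part m (C m)))" for d
    unfolding c_def by (rule part_nc_sum) (simp add: order_ge_def coeff_part)
  then have c: "nc_part d c = nc_part d (C d)" for d
    by (simp add: part_part)
  have "nc_part d (u - c) \<in> W" for d
    using W[OF C(2)[of d], of d] by (simp add: part_diff part_part c)
  then have "u - c \<in> graded_hat W" by (simp add: graded_hat_def)
  moreover have "c \<in> graded_hat V" by (simp add: graded_hat_def c C(1) V(2))
  ultimately show ?thesis by blast
qed

text \<open>The preimage, in the free Lie algebra on the \<open>t\<^sub>i\<^sub>j\<close>, of the subalgebra of \<open>t\<close> generated by the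
  \<open>x\<^sub>i\<close>.\<close>

definition f_ideal :: "nat \<Rightarrow> (nat \<times> nat, 'k::field_char_0) nc_series set" where
  "f_ideal n = {u + r | u r. u \<in> lie_poly (fgens n) \<and> r \<in> kd_ideal {0..n}}"

lemma f_idealI: "u \<in> lie_poly (fgens n) \<Longrightarrow> r \<in> kd_ideal {0..n} \<Longrightarrow> u + r \<in> f_ideal n"
  by (auto simp: f_ideal_def)

lemma f_ideal_lie: "u \<in> lie_poly (fgens n) \<Longrightarrow> u \<in> f_ideal n"
  and f_ideal_kd: "r \<in> kd_ideal {0..n} \<Longrightarrow> r \<in> f_ideal n"
  using f_idealI[of u n 0] f_idealI[of 0 n r] by (simp_all add: kd_ideal.zero lie_poly.intros)

lemma subspace_f_ideal: "nc.subspace (f_ideal n)"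
  unfolding f_ideal_def by (intro nc.subspace_sums subspace_lie_poly subspace_kd_ideal)

lemma f_ideal_subset: "u \<in> f_ideal n \<Longrightarrow> u \<in> lie_poly (kd_gens {0..n})"
proof -
  assume "u \<in> f_ideal n"
  then obtain v r where "u = v + r" "v \<in> lie_poly (fgens n)" "r \<in> kd_ideal {0..n}"
    by (auto simp: f_ideal_def)
  then show ?thesis
    by (simp add: lie_poly.intros(3) lie_poly_mono[OF fgens_subset] kd_ideal_lie_poly)
qed

lemma f_ideal_part: "u \<in> f_ideal n \<Longrightarrow> nc_part d u \<in> f_ideal n"
proof -
  assume "u \<in> f_ideal n"
  then obtain v r where "u = v + r" "v \<in> lie_poly (fgens n)" "r \<in> kd_ideal {0..n}"
    by (auto simp: f_ideal_def)
  then show ?thesis by (simp add: part_add f_idealI lie_poly_part kd_ideal_part)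
qed

lemma tgen_swap: "(i, j) \<in> kd_gens S \<Longrightarrow> tgen i j - tgen j i \<in> kd_ideal S"
  by (rule kd_ideal.symm) (auto simp: kd_gens_iff)

lemma commutator_kd_right: "u \<in> kd_ideal S \<Longrightarrow> v \<in> lie_poly (kd_gens S) \<Longrightarrow> commutator u v \<in> kd_ideal S"
  unfolding commutator_swap[of u v] by (intro subspace_minus[OF subspace_kd_ideal] kd_ideal.bracket)

text \<open>This is the relation \<open>[x\<^sub>i, x\<^sub>j + t\<^sub>i\<^sub>j] = 0\<close>.\<close>

lemma commutator_tgen_x:
  assumes "i \<in> {1..n}" "j \<in> {1..n}" "i \<noteq> j"
  shows "commutator (tgen i j) (tgen 0 i) - commutator (tgen 0 i) (tgen 0 j) \<in> kd_ideal {0..n}"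
proof -
  have "commutator (tgen 0 i) (tgen 0 j + tgen i j) \<in> kd_ideal {0..n}"
    using assms by (intro kd_ideal.rel3) auto
  then have "- commutator (tgen 0 i) (tgen 0 j + tgen i j) \<in> kd_ideal {0..n}"
    by (rule subspace_minus[OF subspace_kd_ideal])
  then show ?thesis by (simp add: commutator_def algebra_simps)
qed

lemma f_ideal_commutator_gen:
  assumes a: "(i, j) \<in> kd_gens {0..n}" and k: "k \<in> {1..n}"
  shows "(commutator (tgen i j) (tgen 0 k) :: (nat \<times> nat, 'k::field_char_0) nc_series) \<in> f_ideal n"
proof -
  have x: "(tgen 0 k :: (nat \<times> nat, 'k) nc_series) \<in> lie_poly (fgens n)" if "k \<in> {1..n}" for k
    using that by (auto simp: tgen_def intro!: lie_poly.intros(2))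
  have x': "(tgen 0 k :: (nat \<times> nat, 'k) nc_series) \<in> lie_poly (kd_gens {0..n})" using k by (intro tgen_lie_poly) (auto simp: kd_gens_iff)
  have swap: "(commutator (tgen i j) (tgen 0 k) :: (nat \<times> nat, 'k) nc_series) \<in> f_ideal n"
    if "(commutator (tgen j i) (tgen 0 k) :: (nat \<times> nat, 'k) nc_series) \<in> f_ideal n" "(i, j) \<in> kd_gens {0..n}" for i j
    using nc.subspace_add[OF subspace_f_ideal f_ideal_kd[OF commutator_kd_right[OF tgen_swap[OF that(2)] x']] that(1)]
    by (simp add: commutator_diff_left)
  have main: "(commutator (tgen k j) (tgen 0 k) :: (nat \<times> nat, 'k) nc_series) \<in> f_ideal n" if "j \<in> {1..n}" "j \<noteq> k" for j
    using f_idealI[OF lie_poly.intros(5)[OF x x] commutator_tgen_x, of k j k j] k that by simp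
  consider "i = 0" | "j = 0" | "i \<noteq> 0" "j \<noteq> 0" "i = k" | "i \<noteq> 0" "j \<noteq> 0" "j = k"
    | "i \<noteq> 0" "j \<noteq> 0" "i \<noteq> k" "j \<noteq> k" by blast
  then show ?thesis
  proof cases
    case 1
    then show ?thesis using a k
      by (simp only:, intro f_ideal_lie lie_poly.intros(5) x) (auto simp: kd_gens_iff)
  next
    case 2
    then show ?thesis using a k
      by (intro swap[OF _ a], simp only:, intro f_ideal_lie lie_poly.intros(5) x) (auto simp: kd_gens_iff)
  next
    case 3
    then have "j \<in> {1..n}" "j \<noteq> k" using a by (auto simp: kd_gens_iff)
    then show ?thesis unfolding 3(3) by (rule main)
  next
    case 4
    then have "i \<in> {1..n}" "i \<noteq> k" using a by (auto simp: kd_gens_iff)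
    then have "(commutator (tgen j i) (tgen 0 k) :: (nat \<times> nat, 'k) nc_series) \<in> f_ideal n" unfolding 4(3) by (rule main)
    then show ?thesis by (rule swap[OF _ a])
  next
    case 5
    then show ?thesis using a k by (intro f_ideal_kd kd_ideal.rel4) (auto simp: kd_gens_iff)
  qed
qed

text \<open>The subalgebra generated by the \<open>x\<^sub>i\<close> is an ideal. The generators \<open>t\<^sub>i\<^sub>j\<close> map each \<open>x\<^sub>k\<close> into it, and
  by the Jacobi identity this propagates first to brackets of the \<open>x\<^sub>k\<close> and then to brackets of the
  \<open>t\<^sub>i\<^sub>j\<close>.\<close>

lemma f_ideal_commutator_lie:
  fixes u v :: "(nat \<times> nat, 'k::field_char_0) nc_series"
  assumes "u \<in> lie_poly (kd_gens {0..n})" "v \<in> lie_poly (fgens n)"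
  shows "commutator u v \<in> f_ideal n"
  using assms
proof (induction arbitrary: v rule: lie_poly.induct)
  note fi = subspace_f_ideal[of n]
  note lie = lie_poly_mono[OF fgens_subset]
  case 1
  then show ?case using nc.subspace_0[OF fi] by simp
next
  note fi = subspace_f_ideal[of n]
  note lie = lie_poly_mono[OF fgens_subset]
  case (2 a)
  obtain i j where a: "a = (i, j)" "(i, j) \<in> kd_gens {0..n}" using 2 by (cases a) auto
  have ta: "(nc_var a :: (nat \<times> nat, 'k) nc_series) \<in> lie_poly (kd_gens {0..n})"
    by (rule lie_poly.intros(2)) (rule 2(1))
  from 2(2) show ?case
  proof induction
    case 1
    then show ?case using nc.subspace_0[OF fi] by simp
  next
    case (2 b)
    then obtain k where "b = (0, k)" "k \<in> {1..n}" by auto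
    then show ?case using f_ideal_commutator_gen[OF a(2)] by (simp add: a tgen_def)
  next
    case (3 v v')
    then show ?case by (simp add: commutator_add_right nc.subspace_add[OF fi])
  next
    case (4 v c)
    then show ?case by (simp add: commutator_scale_right nc.subspace_scale[OF fi])
  next
    case (5 v v')
    have bra: "commutator y z \<in> f_ideal n" if "y \<in> f_ideal n" "z \<in> lie_poly (fgens n)" for y z :: "(nat \<times> nat, 'k) nc_series"
    proof -
      obtain u r where y: "y = u + r" "u \<in> lie_poly (fgens n)" "r \<in> kd_ideal {0..n}"
        using \<open>y \<in> f_ideal n\<close> by (auto simp: f_ideal_def)
      show ?thesis
        unfolding y(1) commutator_add_left
        by (intro f_idealI lie_poly.intros(5) y(2) that(2) commutator_kd_right y(3) lie[OF that(2)])
    qed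
    have "commutator (nc_var a) (commutator v v') =
      commutator (commutator (nc_var a) v) v' - commutator (commutator (nc_var a) v') v"
      by (simp add: commutator_def algebra_simps)
    then show ?case
      using bra[OF 5(3) 5(2)] bra[OF 5(4) 5(1)] by (simp add: nc.subspace_diff[OF fi])
  qed
next
  case (3 u u')
  then show ?case by (simp add: commutator_add_left nc.subspace_add[OF subspace_f_ideal])
next
  case (4 u c)
  then show ?case by (simp add: commutator_scale_left nc.subspace_scale[OF subspace_f_ideal])
next
  case (5 u u')
  have bra: "commutator y z \<in> f_ideal n"
    if "z \<in> f_ideal n" "y \<in> lie_poly (kd_gens {0..n})" "\<And>v. v \<in> lie_poly (fgens n) \<Longrightarrow> commutator y v \<in> f_ideal n"
    for y z :: "(nat \<times> nat, 'k) nc_series"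
  proof -
    obtain u r where z: "z = u + r" "u \<in> lie_poly (fgens n)" "r \<in> kd_ideal {0..n}"
      using \<open>z \<in> f_ideal n\<close> by (auto simp: f_ideal_def)
    show ?thesis
      unfolding z(1) commutator_add_right
      by (intro nc.subspace_add[OF subspace_f_ideal] that(3) f_ideal_kd kd_ideal.bracket z(2,3) that(2))
  qed
  show ?case
    unfolding jacobi
    by (rule nc.subspace_diff[OF subspace_f_ideal bra[OF 5(4)[OF 5(5)] 5(1) 5(3)]
          bra[OF 5(3)[OF 5(5)] 5(2) 5(4)]])
qed

lemma lie_ideal_f:
  "lie_ideal (lie_poly (kd_gens {0..n})) (f_ideal n :: (nat \<times> nat, 'k::field_char_0) nc_series set)"
proof
  fix u v :: "(nat \<times> nat, 'k) nc_series"
  assume u: "u \<in> lie_poly (kd_gens {0..n})" and "v \<in> f_ideal n"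
  then obtain w r where v: "v = w + r" "w \<in> lie_poly (fgens n)" "r \<in> kd_ideal {0..n}"
    by (auto simp: f_ideal_def)
  show "commutator u v \<in> f_ideal n"
    unfolding v(1) commutator_add_right
    by (intro nc.subspace_add[OF subspace_f_ideal] f_ideal_commutator_lie f_ideal_kd kd_ideal.bracket u v)
qed (auto simp: subspace_lie_poly subspace_f_ideal lie_poly.intros(5) lie_poly_const intro: f_ideal_subset)

interpretation f_ideal: lie_ideal "lie_poly (kd_gens {0..n})" "f_ideal n" for n
  by (rule lie_ideal_f)

lemma f_ideal_repr:
  assumes "u \<in> graded_hat (f_ideal n)"
  shows "\<exists>w\<in>lie_series (fgens n). u - w \<in> kd_ideal_hat {0..n}"
  unfolding lie_series_hat kd_ideal_hat_hat
proof (rule assemble_parts[OF subspace_lie_poly lie_poly_part kd_ideal_part])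
  fix d
  have "nc_part d u \<in> f_ideal n" using assms by (simp add: graded_hat_def)
  then obtain w r where "nc_part d u = w + r" "w \<in> lie_poly (fgens n)" "r \<in> kd_ideal {0..n}"
    by (auto simp: f_ideal_def)
  then show "\<exists>c\<in>lie_poly (fgens n). nc_part d u - c \<in> kd_ideal {0..n}"
    by (intro bexI[of _ w]) simp_all
qed

definition x_centralizer :: "nat \<Rightarrow> nat \<Rightarrow> (nat \<times> nat, 'k::field_char_0) nc_series set" where
  "x_centralizer n k = {c \<in> lie_poly (kd_gens {0..n}). commutator c (tgen 0 k) \<in> kd_ideal {0..n}}"

lemma subspace_x_centralizer: "nc.subspace (x_centralizer n k)"
  unfolding x_centralizer_def nc.subspace_def
  by (auto simp: commutator_add_left commutator_scale_left lie_poly.intros kd_ideal.intros)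

lemma x_centralizer_part:
  assumes "c \<in> x_centralizer n k" shows "nc_part d c \<in> x_centralizer n k"
proof -
  have "nc_part (Suc d) (commutator c (tgen 0 k)) =
      (\<Sum>i\<le>Suc d. if i = d then commutator (nc_part i c) (tgen 0 k) else 0)"
    unfolding part_commutator by (rule sum.cong) (auto simp: part_tgen)
  then have "nc_part (Suc d) (commutator c (tgen 0 k)) = commutator (nc_part d c) (tgen 0 k)"
    by simp
  then show ?thesis
    using assms kd_ideal_part[of "commutator c (tgen 0 k)" "{0..n}" "Suc d"]
    by (auto simp: x_centralizer_def lie_poly_part)
qed

text \<open>Every element of \<open>t\<close> is the sum of an element of the ideal generated by the \<open>x\<^sub>i\<close> and of one that
  commutes with \<open>x\<^sub>k\<close>: for a generator \<open>t\<^sub>k\<^sub>j\<close>, the defining relation \<open>[x\<^sub>k, x\<^sub>j + t\<^sub>k\<^sub>j] = 0\<close> supplies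
  the correction \<open>x\<^sub>j\<close>.\<close>

lemma x_centralizer_complement:
  fixes u :: "(nat \<times> nat, 'k::field_char_0) nc_series"
  assumes k: "k \<in> {1..n}" and u: "u \<in> lie_poly (kd_gens {0..n})"
  shows "\<exists>c\<in>x_centralizer n k. u - c \<in> f_ideal n"
  using u
proof induction
  case 1
  then show ?case
    by (intro bexI[OF _ nc.subspace_0[OF subspace_x_centralizer]]) (simp add: nc.subspace_0[OF subspace_f_ideal])
next
  case (2 a)
  obtain i j where a: "a = (i, j)" "(i, j) \<in> kd_gens {0..n}" using 2 by (cases a) auto
  have x: "(tgen 0 k :: (nat \<times> nat, 'k) nc_series) \<in> lie_poly (fgens n)" if "k \<in> {1..n}" for k
    using that by (auto simp: tgen_def intro!: lie_poly.intros(2))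
  have xk: "(tgen 0 k :: (nat \<times> nat, 'k) nc_series) \<in> lie_poly (kd_gens {0..n})" using lie_poly_mono[OF fgens_subset x[OF k]] .
  have kj: "(tgen k j + tgen 0 j :: (nat \<times> nat, 'k) nc_series) \<in> x_centralizer n k" if j: "j \<in> {1..n}" "j \<noteq> k" for j
  proof -
    have "(commutator (tgen 0 k) (tgen 0 j + tgen k j) :: (nat \<times> nat, 'k) nc_series) \<in> kd_ideal {0..n}"
      using j k by (intro kd_ideal.rel3) auto
    from subspace_minus[OF subspace_kd_ideal this]
    have "(commutator (tgen k j + tgen 0 j) (tgen 0 k) :: (nat \<times> nat, 'k) nc_series) \<in> kd_ideal {0..n}"
      by (simp add: commutator_def algebra_simps)
    moreover have "(tgen k j + tgen 0 j :: (nat \<times> nat, 'k) nc_series) \<in> lie_poly (kd_gens {0..n})"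
      using j k by (intro lie_poly.intros(3) tgen_lie_poly) (auto simp: kd_gens_iff)
    ultimately show ?thesis by (simp add: x_centralizer_def)
  qed
  have main: "\<exists>c\<in>x_centralizer n k. (tgen i j :: (nat \<times> nat, 'k) nc_series) - c \<in> f_ideal n"
  proof -
    consider "i = 0" | "j = 0" | "i \<noteq> 0" "j \<noteq> 0" "i = k" | "i \<noteq> 0" "j \<noteq> 0" "j = k"
      | "i \<noteq> 0" "j \<noteq> 0" "i \<noteq> k" "j \<noteq> k" by blast
    then show ?thesis
    proof cases
      case 1
      then have "(tgen i j :: (nat \<times> nat, 'k) nc_series) - 0 \<in> f_ideal n" using a by (simp only: diff_zero 1, intro f_ideal_lie x) (auto simp: kd_gens_iff)
      then show ?thesis by (rule bexI[OF _ nc.subspace_0[OF subspace_x_centralizer]])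
    next
      case 2
      then have "(tgen 0 i :: (nat \<times> nat, 'k) nc_series) + (tgen i 0 - tgen 0 i) \<in> f_ideal n"
        using a by (intro f_idealI x tgen_swap) (auto simp: kd_gens_iff)
      then have "(tgen i j :: (nat \<times> nat, 'k) nc_series) - 0 \<in> f_ideal n" using 2 by simp
      then show ?thesis by (rule bexI[OF _ nc.subspace_0[OF subspace_x_centralizer]])
    next
      case 3
      then have j: "j \<in> {1..n}" "j \<noteq> k" using a by (auto simp: kd_gens_iff)
      have "(tgen i j :: (nat \<times> nat, 'k) nc_series) - (tgen k j + tgen 0 j) \<in> f_ideal n"
        using subspace_minus[OF subspace_f_ideal f_ideal_lie[OF x[OF j(1)]]] 3 by simp
      then show ?thesis using kj[OF j] by blast
    next
      case 4
      then have i: "i \<in> {1..n}" "i \<noteq> k" using a by (auto simp: kd_gens_iff)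
      have "- (tgen 0 i :: (nat \<times> nat, 'k) nc_series) + (tgen i k - tgen k i) \<in> f_ideal n"
        using 4 a by (intro f_idealI subspace_minus[OF subspace_lie_poly] x i tgen_swap) simp
      then have "(tgen i j :: (nat \<times> nat, 'k) nc_series) - (tgen k i + tgen 0 i) \<in> f_ideal n" using 4 by (simp add: algebra_simps)
      then show ?thesis using kj[OF i] by blast
    next
      case 5
      then have "(tgen i j :: (nat \<times> nat, 'k) nc_series) \<in> x_centralizer n k"
        using a k unfolding x_centralizer_def
        by (intro CollectI conjI tgen_lie_poly kd_ideal.rel4) (auto simp: kd_gens_iff)
      then show ?thesis by (intro bexI[of _ "tgen i j"]) (simp_all add: nc.subspace_0[OF subspace_f_ideal])
    qed
  qed
  then show ?case by (simp add: a tgen_def)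
next
  case (3 u u')
  then obtain c c' where "c \<in> x_centralizer n k" "c' \<in> x_centralizer n k"
    "u - c \<in> f_ideal n" "u' - c' \<in> f_ideal n" by blast
  then show ?case
    using nc.subspace_add[OF subspace_x_centralizer, of c n k c'] nc.subspace_add[OF subspace_f_ideal, of "u - c" n "u' - c'"]
    by (intro bexI[of _ "c + c'"]) (simp_all add: add_diff_add)
next
  case (4 u a)
  then obtain c where "c \<in> x_centralizer n k" "u - c \<in> f_ideal n" by blast
  then show ?case
    using nc.subspace_scale[OF subspace_x_centralizer, of c n k a] nc.subspace_scale[OF subspace_f_ideal, of "u - c" n a]
    by (intro bexI[of _ "nc_scale a c"]) (simp_all add: nc.scale_right_diff_distrib)
next
  case (5 u u')
  then obtain c c' where c: "c \<in> x_centralizer n k" "c' \<in> x_centralizer n k"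
    "u - c \<in> f_ideal n" "u' - c' \<in> f_ideal n" by blast
  have cl: "c \<in> lie_poly (kd_gens {0..n})" "c' \<in> lie_poly (kd_gens {0..n})"
    "commutator c (tgen 0 k) \<in> kd_ideal {0..n}" "commutator c' (tgen 0 k) \<in> kd_ideal {0..n}"
    using c by (auto simp: x_centralizer_def)
  have "commutator (commutator c c') (tgen 0 k) \<in> kd_ideal {0..n}"
    unfolding jacobi
    by (rule nc.subspace_diff[OF subspace_kd_ideal kd_ideal.bracket[OF cl(1) cl(4)] kd_ideal.bracket[OF cl(2) cl(3)]])
  then have "commutator c c' \<in> x_centralizer n k"
    using cl by (simp add: x_centralizer_def lie_poly.intros(5))
  moreover have "commutator u u' - commutator c c' = commutator c (u' - c') - commutator u' (u - c)"
    by (simp add: commutator_def algebra_simps)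
  moreover have "commutator c (u' - c') - commutator u' (u - c) \<in> f_ideal n"
    by (rule nc.subspace_diff[OF subspace_f_ideal f_ideal.LJ[OF cl(1) c(4)] f_ideal.LJ[OF 5(2) c(3)]])
  ultimately show ?case by (intro bexI[of _ "commutator c c'"]) simp_all
qed

lemma Ad_bch:
  assumes "order_ge 1 u" "order_ge 1 v" shows "nc_Ad (bch u v) x = nc_Ad u (nc_Ad v x)"
proof -
  have m: "order_ge 1 (- u)" "order_ge 1 (- v)" using assms by (auto intro: order_ge_minus)
  have uv: "order_ge 1 (bch u v)" "nc_exp (bch u v) = nc_exp u * nc_exp v"
    using exp_bch[OF assms] by auto
  have "nc_exp (bch u v) * (nc_exp (- v) * nc_exp (- u)) =
      nc_exp u * (nc_exp v * nc_exp (- v)) * nc_exp (- u)"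
    unfolding uv(2) by (simp only: mult.assoc)
  then have one: "nc_exp (bch u v) * (nc_exp (- v) * nc_exp (- u)) = 1"
    by (simp add: nc_exp_minus[OF assms(1)] nc_exp_minus[OF assms(2)])
  have "nc_exp (- bch u v) = nc_exp (- bch u v) * (nc_exp (bch u v) * (nc_exp (- v) * nc_exp (- u)))"
    unfolding one by simp
  also have "\<dots> = nc_exp (- v) * nc_exp (- u)"
    unfolding mult.assoc[symmetric] nc_exp_minus(2)[OF uv(1)] by simp
  finally have "nc_exp (- bch u v) = nc_exp (- v) * nc_exp (- u)" .
  then show ?thesis
    unfolding exp_conj_eq_Ad[OF uv(1), symmetric] exp_conj_eq_Ad[OF assms(1), symmetric]
      exp_conj_eq_Ad[OF assms(2), symmetric] uv(2) by (simp add: mult.assoc)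
qed

text \<open>An element of \<open>exp t\<close> is the product of an element of \<open>exp f\<close> and, on the right, of one that
  commutes with \<open>x\<^sub>k\<close>, by the decomposition above.\<close>

theorem tangential_conjugation:
  fixes v :: "(nat \<times> nat, 'k::field_char_0) nc_series"
  assumes k: "k \<in> {1..n}" and v: "v \<in> lie_t {0..n}"
  shows "\<exists>u\<in>lie_series (fgens n). kd.congr {0..n} (nc_Ad v (tgen 0 k)) (nc_Ad u (tgen 0 k))"
proof -
  let ?x = "tgen 0 k :: (nat \<times> nat, 'k) nc_series"
  have x: "?x \<in> lie_t {0..n}" using k by (intro tgen_lie_series) (auto simp: kd_gens_iff)
  have "\<exists>c\<in>graded_hat (x_centralizer n k). v - c \<in> graded_hat (f_ideal n)"
  proof (rule assemble_parts[OF subspace_x_centralizer x_centralizer_part f_ideal_part])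
    fix d
    show "\<exists>c\<in>x_centralizer n k. nc_part d v - c \<in> f_ideal n"
      using v by (intro x_centralizer_complement k) (simp add: lie_series_def)
  qed
  then obtain c where c: "c \<in> graded_hat (x_centralizer n k)" "v - c \<in> graded_hat (f_ideal n)" by blast
  have cl: "c \<in> lie_t {0..n}" using c(1) by (auto simp: lie_series_hat graded_hat_def x_centralizer_def)
  have xs: "?x \<in> graded_hat {0, ?x}" by (simp add: graded_hat_def part_tgen)
  have cx: "commutator c ?x \<in> kd_ideal_hat {0..n}"
    unfolding kd_ideal_hat_hat
    by (rule hat_commutator[OF subspace_kd_ideal _ c(1) xs])
      (auto simp: x_centralizer_def kd_ideal.zero)
  have ord: "order_ge 1 v" "order_ge 1 c" "order_ge 1 (- c)"
    using v cl by (auto intro: lie_series_order order_ge_minus)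
  \<comment> \<open>\<open>exp v = exp U exp c\<close>, where \<open>exp c\<close> fixes \<open>x\<^sub>k\<close> and \<open>U\<close> lies in the ideal\<close>
  let ?U = "bch v (- c)"
  have "f_ideal.congr n v c" using v cl c by (simp add: f_ideal.congr_def lie_series_hat)
  moreover have "f_ideal.congr n (- c) (- c)"
    using cl by (intro f_ideal.congr_refl) (simp add: lie_series_hat[symmetric] lie_series_minus)
  ultimately have "f_ideal.congr n ?U (bch c (- c))" by (rule f_ideal.congr_bch)
  then have U: "?U \<in> graded_hat (f_ideal n)" "?U \<in> lie_t {0..n}"
    by (simp_all add: bch_minus ord f_ideal.congr_def lie_series_hat)
  obtain w where w: "w \<in> lie_series (fgens n)" "?U - w \<in> kd_ideal_hat {0..n}"
    using f_ideal_repr[OF U(1)] by blast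
  have wl: "w \<in> lie_t {0..n}" using w(1) lie_series_mono[OF fgens_subset] by blast
  have Uw: "kd.congr {0..n} ?U w" using U w wl by (simp add: kd_congr_iff)
  have ad: "ad_pow (- c) (Suc i) ?x \<in> kd_ideal_hat {0..n}" for i
  proof (induction i)
    case 0
    then show ?case
      using subspace_minus[OF subspace_hat[OF subspace_kd_ideal], folded kd_ideal_hat_hat, OF cx]
      by (simp add: commutator_minus_left)
  next
    case (Suc i)
    then show ?case
      using kd.hat_LJ[of "- c" "{0..n}" "ad_pow (- c) (Suc i) ?x"] lie_series_minus[OF cl]
      by (simp add: lie_series_hat kd_ideal_hat_hat)
  qed
  have o: "order_ge i (ad_pow (- c) i ?x)" for i
    by (rule f_ideal.order_ge_ad_pow'[OF ord(3)])
  have "nc_Ad (- c) ?x = ?x + nc_sum (\<lambda>i. nc_scale (1 / fact (Suc i)) (ad_pow (- c) (Suc i) ?x))"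
    unfolding nc_Ad_def by (subst nc_sum_split) (auto intro!: order_ge_scale o)
  moreover have "nc_sum (\<lambda>i. nc_scale (1 / fact (Suc i)) (ad_pow (- c) (Suc i) ?x)) \<in> kd_ideal_hat {0..n}"
    unfolding kd_ideal_hat_hat using ad
    by (intro hat_nc_sum subspace_kd_ideal order_ge_scale order_ge_mono[OF o[of "Suc _"]]
        nc.subspace_scale[OF subspace_hat[OF subspace_kd_ideal]]) (auto simp: kd_ideal_hat_hat)
  ultimately have "kd.congr {0..n} (nc_Ad (- c) ?x) ?x"
    using x lie_series_Ad[OF lie_series_minus[OF cl] x] by (simp add: kd_congr_iff)
  moreover have "kd.congr {0..n} v v" using v by (rule kd_congr_refl)
  ultimately have "kd.congr {0..n} (nc_Ad v (nc_Ad (- c) ?x)) (nc_Ad v ?x)" by (intro kd.congr_Ad)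
  moreover have "nc_Ad v (nc_Ad (- c) ?x) = nc_Ad ?U ?x" by (rule Ad_bch[OF ord(1,3), symmetric])
  moreover have "kd.congr {0..n} (nc_Ad ?U ?x) (nc_Ad w ?x)"
    by (intro kd.congr_Ad Uw kd_congr_refl x)
  ultimately have "kd.congr {0..n} (nc_Ad v ?x) (nc_Ad w ?x)"
    using kd.congr_sym kd.congr_trans by metis
  then show ?thesis using w(1) by blast
qed

section \<open>Group algebras\<close>

abbreviation supp :: "('g \<Rightarrow>\<^sub>0 'k::zero) \<Rightarrow> 'g set" where "supp \<equiv> Poly_Mapping.keys"
abbreviation gcoeff :: "('g \<Rightarrow>\<^sub>0 'k::zero) \<Rightarrow> 'g \<Rightarrow> 'k" where "gcoeff \<equiv> Poly_Mapping.lookup"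
abbreviation gmon :: "'g \<Rightarrow> 'k::zero \<Rightarrow> ('g \<Rightarrow>\<^sub>0 'k)" where "gmon \<equiv> Poly_Mapping.single"
definition gscale :: "'k::field_char_0 \<Rightarrow> ('g \<Rightarrow>\<^sub>0 'k) \<Rightarrow> ('g \<Rightarrow>\<^sub>0 'k)" where
  "gscale c = Poly_Mapping.map ((*) c)"

text \<open>The linear extension of a function on a group to the group algebra. An element of the group
  algebra is determined by its values under all such extensions, and they turn products,
  coproducts and tensor products into operations on functions.\<close>

definition ext :: "('g \<Rightarrow> 'k::field_char_0) \<Rightarrow> ('g \<Rightarrow>\<^sub>0 'k) \<Rightarrow> 'k" where
  "ext T f = (\<Sum>x\<in>supp f. gcoeff f x * T x)"

lemma ext_superset: "finite S \<Longrightarrow> supp f \<subseteq> S \<Longrightarrow> ext T f = (\<Sum>x\<in>S. gcoeff f x * T x)"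
  unfolding ext_def by (rule sum.mono_neutral_left) (auto simp: in_keys_iff)

lemma ext_add: "ext T (f + g) = ext T f + ext T g"
proof -
  let ?S = "supp f \<union> supp g"
  have "ext T (f + g) = (\<Sum>x\<in>?S. gcoeff (f + g) x * T x)"
    by (rule ext_superset) (simp_all add: Poly_Mapping.keys_add)
  moreover have "ext T f = (\<Sum>x\<in>?S. gcoeff f x * T x)" "ext T g = (\<Sum>x\<in>?S. gcoeff g x * T x)"
    by (rule ext_superset; simp)+
  ultimately show ?thesis by (simp add: lookup_add distrib_right sum.distrib)
qed

lemma lookup_gscale: "gcoeff (gscale c f) x = c * gcoeff f x"
  by (simp add: gscale_def map.rep_eq when_def)

lemma ext_zero [simp]: "ext T 0 = 0"
  by (simp add: ext_def)

lemma ext_scale: "ext T (gscale c f) = c * ext T f"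
proof -
  have "ext T (gscale c f) = (\<Sum>x\<in>supp f. gcoeff (gscale c f) x * T x)"
    by (rule ext_superset) (auto simp: in_keys_iff lookup_gscale)
  then show ?thesis by (simp add: lookup_gscale ext_def sum_distrib_left mult.assoc)
qed

lemma ext_uminus: "ext T (- f) = - ext T f"
  using ext_add[of T f "- f"] by (simp add: eq_neg_iff_add_eq_0 add.commute)

lemma ext_diff: "ext T (f - g) = ext T f - ext T g"
  using ext_add[of T "f - g" g] by simp

lemma ext_mon: "ext T (gmon x c) = c * T x"
  using ext_superset[of "{x}" "gmon x c" T] by simp

lemma ext_sum: "ext T (sum F I) = (\<Sum>i\<in>I. ext T (F i))"
  by (induction I rule: infinite_finite_induct) (simp_all add: ext_add)

lemma ext_fun_add: "ext (\<lambda>x. T x + T' x) f = ext T f + ext T' f"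
  and ext_fun_diff: "ext (\<lambda>x. T x - T' x) f = ext T f - ext T' f"
  and ext_fun_mult: "ext (\<lambda>x. c * T x) f = c * ext T f"
  and ext_fun_mult_right: "ext (\<lambda>x. T x * c) f = ext T f * c"
  by (simp_all add: ext_def algebra_simps sum.distrib sum_subtractf sum_distrib_left)

lemma ext_fun_sum: "ext (\<lambda>x. \<Sum>i\<in>I. T i x) f = (\<Sum>i\<in>I. ext (T i) f)"
  unfolding ext_def sum_distrib_left by (rule sum.swap)

lemma ext_eqI:
  assumes "\<And>T. ext T f = ext T g" shows "f = g"
proof (rule poly_mapping_eqI)
  fix x
  have "gcoeff f x = ext (\<lambda>y. if y = x then 1 else 0) f" for f :: "'a \<Rightarrow>\<^sub>0 'b"
    using ext_superset[of "insert x (supp f)" f "\<lambda>y. if y = x then 1 else 0", OF _ subset_insertI]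
    by (auto simp: if_distrib[of "(*) _"] sum.delta' cong: if_cong)
  then show "gcoeff f x = gcoeff g x" using assms by simp
qed

lemma aug_eq_ext: "aug f = ext (\<lambda>_. 1) f"
  by (simp add: aug_def ext_def)

lemma ext_gconv: "ext T (gconv G f h) = ext (\<lambda>x. ext (\<lambda>y. T (x \<otimes>\<^bsub>G\<^esub> y)) h) f"
  unfolding gconv_def ext_sum ext_mon by (simp add: ext_def sum_distrib_left mult.assoc)

lemma ext_gone: "ext T (gone G) = T \<one>\<^bsub>G\<^esub>"
  by (simp add: gone_def ext_mon)

lemma ext_gcoprod: "ext T (gcoprod f) = ext (\<lambda>x. T (x, x)) f"
  unfolding gcoprod_def ext_sum ext_mon by (simp add: ext_def)

lemma ext_gtensor: "ext T (gtensor f h) = ext (\<lambda>x. ext (\<lambda>y. T (x, y)) h) f"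
  unfolding gtensor_def ext_sum ext_mon by (simp add: ext_def sum_distrib_left mult.assoc)

definition gpush :: "('g \<Rightarrow> 'h) \<Rightarrow> ('g \<Rightarrow>\<^sub>0 'k::field_char_0) \<Rightarrow> ('h \<Rightarrow>\<^sub>0 'k)" where
  "gpush \<phi> f = (\<Sum>x\<in>supp f. gmon (\<phi> x) (gcoeff f x))"

lemma ext_gpush: "ext T (gpush \<phi> f) = ext (\<lambda>x. T (\<phi> x)) f"
  unfolding gpush_def ext_sum ext_mon by (simp add: ext_def)

lemma ext_cong: "f \<in> galg G \<Longrightarrow> (\<And>x. x \<in> carrier G \<Longrightarrow> T x = T' x) \<Longrightarrow> ext T f = ext T' f"
  unfolding ext_def galg_def by (auto intro!: sum.cong)

lemma galg_zero: "0 \<in> galg G"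
  by (simp add: galg_def)

lemma galg_add: "f \<in> galg G \<Longrightarrow> g \<in> galg G \<Longrightarrow> f + g \<in> galg G"
  using Poly_Mapping.keys_add[of f g] by (auto simp: galg_def)

lemma galg_scale: "f \<in> galg G \<Longrightarrow> gscale c f \<in> galg G"
  by (auto simp: galg_def in_keys_iff lookup_gscale)

lemma gscale_minus_one: "gscale (- 1) f = - f"
  by (rule ext_eqI) (simp add: ext_scale ext_uminus)

lemma gscale_0_left [simp]: "gscale 0 f = 0"
  and gscale_1_left [simp]: "gscale 1 f = f"
  and gscale_add_left: "gscale (c + d) f = gscale c f + gscale d f"
  and gscale_diff_right: "gscale c (f - g) = gscale c f - gscale c g"
  and gscale_gscale: "gscale c (gscale d f) = gscale (c * d) f"
  by (rule ext_eqI; simp add: ext_scale ext_add ext_diff algebra_simps)+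

lemma gscale_sum_right: "gscale c (sum F I) = (\<Sum>i\<in>I. gscale c (F i))"
  by (rule ext_eqI) (simp add: ext_scale ext_sum sum_distrib_left)

lemma galg_uminus: "f \<in> galg G \<Longrightarrow> - f \<in> galg G"
  using galg_scale[of f G "- 1"] by (simp add: gscale_minus_one)

lemma galg_diff: "f \<in> galg G \<Longrightarrow> g \<in> galg G \<Longrightarrow> f - g \<in> galg G"
  using galg_add[of f G "- g"] galg_uminus by force

lemma galg_mon: "x \<in> carrier G \<Longrightarrow> gmon x c \<in> galg G"
  by (simp add: galg_def)

lemma galg_sum: "(\<And>i. i \<in> I \<Longrightarrow> F i \<in> galg G) \<Longrightarrow> sum F I \<in> galg G"
  by (induction I rule: infinite_finite_induct) (simp_all add: galg_zero galg_add)

lemma galg_supp: "f \<in> galg G \<Longrightarrow> x \<in> supp f \<Longrightarrow> x \<in> carrier G"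
  by (auto simp: galg_def)

lemma galg_gcoprod: "f \<in> galg G \<Longrightarrow> gcoprod f \<in> galg (G \<times>\<times> G)"
  unfolding gcoprod_def by (intro galg_sum galg_mon) (auto simp: DirProd_def dest: galg_supp)

lemma galg_gtensor: "f \<in> galg G \<Longrightarrow> h \<in> galg K \<Longrightarrow> gtensor f h \<in> galg (G \<times>\<times> K)"
  unfolding gtensor_def by (intro galg_sum galg_mon) (auto simp: DirProd_def dest: galg_supp)

lemma galg_gpush: "f \<in> galg G \<Longrightarrow> (\<And>x. x \<in> carrier G \<Longrightarrow> \<phi> x \<in> carrier K) \<Longrightarrow> gpush \<phi> f \<in> galg K"
  unfolding gpush_def by (intro galg_sum galg_mon) (auto dest: galg_supp)

context group
begin

lemma galg_gone: "gone G \<in> galg G"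
  by (simp add: gone_def galg_mon)

lemma galg_gconv: "f \<in> galg G \<Longrightarrow> h \<in> galg G \<Longrightarrow> gconv G f h \<in> galg G"
  unfolding gconv_def by (intro galg_sum galg_mon m_closed) (auto dest: galg_supp)

lemma in_aug_pow_galg: "in_aug_pow G m f \<Longrightarrow> f \<in> galg G"
  by (induction rule: in_aug_pow.induct) (simp_all add: galg_zero galg_add galg_gconv)

lemma in_aug_pow_mono: "in_aug_pow G m f \<Longrightarrow> k \<le> m \<Longrightarrow> in_aug_pow G k f"
proof (induction arbitrary: k rule: in_aug_pow.induct)
  case (mult f m h)
  show ?case
  proof (cases k)
    case 0
    then show ?thesis
      using mult in_aug_pow_galg[of m h] by (simp add: in_aug_pow.base galg_gconv)
  next
    case (Suc l)
    then show ?thesis using mult by (simp add: in_aug_pow.mult)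
  qed
qed (simp_all add: in_aug_pow.base in_aug_pow.zero in_aug_pow.add)

lemma gconv_one_right: "f \<in> galg G \<Longrightarrow> gconv G f (gone G) = f"
  by (rule ext_eqI) (auto simp: ext_gconv ext_gone intro: ext_cong)

lemma gconv_scale_left: "gconv G (gscale c f) h = gscale c (gconv G f h)"
  by (rule ext_eqI) (simp add: ext_gconv ext_scale)

lemma in_aug_pow_scale:
  assumes "in_aug_pow G m f" shows "in_aug_pow G m (gscale c f)"
  using assms
proof (induction rule: in_aug_pow.induct)
  case (base f)
  then show ?case by (simp add: in_aug_pow.base galg_scale)
next
  case (zero m)
  have "gscale c 0 = (0 :: 'a \<Rightarrow>\<^sub>0 'c)" by (rule ext_eqI) (simp add: ext_scale)
  then show ?case by (simp add: in_aug_pow.zero)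
next
  case (add m f h)
  have "gscale c (f + h) = gscale c f + gscale c h"
    by (rule ext_eqI) (simp add: ext_scale ext_add distrib_left)
  then show ?case using add by (simp add: in_aug_pow.add)
next
  case (mult f m h)
  have "in_aug_pow G (Suc m) (gconv G (gscale c f) h)"
    using mult by (intro in_aug_pow.mult) (simp_all add: galg_scale aug_eq_ext ext_scale)
  then show ?case by (simp add: gconv_scale_left)
qed

text \<open>Left multiplication by \<open>x - 1\<close>. On the dual side it is the difference operator.\<close>

definition gdiff :: "'a \<Rightarrow> ('a \<Rightarrow>\<^sub>0 'k::field_char_0) \<Rightarrow> ('a \<Rightarrow>\<^sub>0 'k)" where
  "gdiff x f = gconv G (gmon x 1 - gone G) f"

lemma ext_gdiff:
  assumes "f \<in> galg G"
  shows "ext T (gdiff x f) = ext (\<lambda>y. T (x \<otimes> y) - T y) f"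
proof -
  have "ext (\<lambda>y. T (\<one> \<otimes> y)) f = ext T f" by (rule ext_cong[OF assms]) simp
  then show ?thesis
    by (simp add: gdiff_def ext_gconv ext_diff ext_mon ext_gone ext_fun_diff)
qed

lemma gdiff_closed: "x \<in> carrier G \<Longrightarrow> f \<in> galg G \<Longrightarrow> gdiff x f \<in> galg G"
  unfolding gdiff_def by (intro galg_gconv galg_diff galg_mon galg_gone)

lemma in_aug_pow_gdiff: "x \<in> carrier G \<Longrightarrow> in_aug_pow G m f \<Longrightarrow> in_aug_pow G (Suc m) (gdiff x f)"
  unfolding gdiff_def
  by (intro in_aug_pow.mult galg_diff galg_mon galg_gone) (simp_all add: aug_eq_ext ext_diff ext_mon ext_gone)

lemma gdiff_add: "gdiff x (f + h) = gdiff x f + gdiff x h"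
  and gdiff_scale: "gdiff x (gscale c f) = gscale c (gdiff x f)"
  by (rule ext_eqI; simp add: gdiff_def ext_gconv ext_diff ext_mon ext_gone ext_add ext_scale algebra_simps)+

lemma gdiff_mult:
  assumes "x \<in> carrier G" "y \<in> carrier G" "f \<in> galg G"
  shows "gdiff (x \<otimes> y) f = gdiff x f + gdiff y f + gdiff x (gdiff y f)"
proof (rule ext_eqI)
  fix T :: "'a \<Rightarrow> 'c"
  have "ext (\<lambda>z. T (x \<otimes> y \<otimes> z)) f = ext (\<lambda>z. T (x \<otimes> (y \<otimes> z))) f"
    by (rule ext_cong[OF assms(3)]) (use assms m_assoc in simp)
  then show "ext T (gdiff (x \<otimes> y) f) = ext T (gdiff x f + gdiff y f + gdiff x (gdiff y f))"
    using assms by (simp add: ext_gdiff ext_add gdiff_closed ext_fun_diff)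
qed

lemma gdiff_one: "f \<in> galg G \<Longrightarrow> gdiff \<one> f = 0"
proof (rule ext_eqI)
  fix T :: "'a \<Rightarrow> 'c" assume f: "f \<in> galg G"
  have "ext (\<lambda>z. T (\<one> \<otimes> z)) f = ext T f" by (rule ext_cong[OF f]) simp
  then show "ext T (gdiff \<one> f) = ext T 0" using f by (simp add: ext_gdiff ext_fun_diff)
qed

lemma gdiff_commute:
  assumes "x \<in> carrier G" "y \<in> carrier G" "x \<otimes> y = y \<otimes> x" "f \<in> galg G"
  shows "gdiff x (gdiff y f) = gdiff y (gdiff x f)"
  using gdiff_mult[OF assms(1,2,4)] gdiff_mult[OF assms(2,1,4)] assms(3) by (simp add: add.commute)

lemma gconv_aug_0_eq_sum:
  assumes f: "f \<in> galg G" "aug f = 0" and h: "h \<in> galg G"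
  shows "gconv G f h = (\<Sum>x\<in>supp f. gscale (gcoeff f x) (gdiff x h))"
proof (rule ext_eqI)
  fix T :: "'a \<Rightarrow> 'c"
  have "ext T (\<Sum>x\<in>supp f. gscale (gcoeff f x) (gdiff x h)) =
      (\<Sum>x\<in>supp f. gcoeff f x * (ext (\<lambda>y. T (x \<otimes> y)) h - ext T h))"
    by (simp add: ext_sum ext_scale ext_gdiff[OF h] ext_fun_diff)
  also have "\<dots> = ext T (gconv G f h) - aug f * ext T h"
    by (simp add: ext_gconv ext_def[of "\<lambda>x. ext (\<lambda>y. T (x \<otimes> y)) h"] aug_def right_diff_distrib
        sum_subtractf sum_distrib_right)
  finally show "ext T (gconv G f h) = ext T (\<Sum>x\<in>supp f. gscale (gcoeff f x) (gdiff x h))"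
    using f by simp
qed

lemma galg_minus_aug:
  assumes "f \<in> galg G" shows "in_aug_pow G 1 (f - gscale (aug f) (gone G))"
proof -
  let ?f = "f - gscale (aug f) (gone G)"
  have g: "?f \<in> galg G" by (intro galg_diff galg_scale galg_gone assms)
  moreover have "aug ?f = 0" by (simp add: aug_eq_ext ext_diff ext_scale ext_gone)
  ultimately have "in_aug_pow G (Suc 0) (gconv G ?f (gone G))"
    by (intro in_aug_pow.mult in_aug_pow.base galg_gone)
  then show ?thesis by (simp add: gconv_one_right[OF g] One_nat_def)
qed

end

lemma gpush_in_aug_pow:
  assumes G: "group G" and K: "group K" and \<phi>: "\<phi> \<in> hom G K" and f: "in_aug_pow G m f"
  shows "in_aug_pow K m (gpush \<phi> f)"
  using f
proof (induction rule: in_aug_pow.induct)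
  case (base f)
  then show ?case using \<phi> by (intro in_aug_pow.base galg_gpush) (auto simp: hom_def)
next
  case (zero m)
  have "gpush \<phi> 0 = (0 :: _ \<Rightarrow>\<^sub>0 'e)" by (simp add: gpush_def)
  then show ?case by (simp add: in_aug_pow.zero)
next
  case (add m f h)
  have "gpush \<phi> (f + h) = gpush \<phi> f + gpush \<phi> h"
    by (rule ext_eqI) (simp add: ext_gpush ext_add)
  then show ?case using add by (simp add: in_aug_pow.add)
next
  case (mult f m h)
  have h: "h \<in> galg G" using group.in_aug_pow_galg[OF G mult(3)] .
  have "gpush \<phi> (gconv G f h) = gconv K (gpush \<phi> f) (gpush \<phi> h)"
  proof (rule ext_eqI)
    fix T :: "'c \<Rightarrow> 'e"
    have "ext (\<lambda>x. ext (\<lambda>y. T (\<phi> (x \<otimes>\<^bsub>G\<^esub> y))) h) f = ext (\<lambda>x. ext (\<lambda>y. T (\<phi> x \<otimes>\<^bsub>K\<^esub> \<phi> y)) h) f"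
      by (intro ext_cong[OF mult(1)] ext_cong[OF h]) (simp add: hom_mult[OF \<phi>])
    then show "ext T (gpush \<phi> (gconv G f h)) = ext T (gconv K (gpush \<phi> f) (gpush \<phi> h))"
      by (simp add: ext_gpush ext_gconv)
  qed
  moreover have "gpush \<phi> f \<in> galg K" using \<phi> mult(1) by (intro galg_gpush) (auto simp: hom_def)
  moreover have "aug (gpush \<phi> f) = 0" using mult(2) by (simp add: aug_eq_ext ext_gpush)
  ultimately show ?case using mult by (simp add: in_aug_pow.mult)
qed

section \<open>Powers of the augmentation ideal and a Magnus expansion\<close>

text \<open>A generalised Magnus expansion: \<open>\<rho>\<close> takes values in exponentials of Lie series and agrees
  with \<open>X\<^sub>b \<mapsto> 1 + b\<close> to first order.\<close>

locale magnus = group G for G :: "('g, 'b) monoid_scheme" (structure) +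
  fixes B :: "'a set" and X :: "'a \<Rightarrow> 'g" and \<rho> :: "'g \<Rightarrow> ('a, 'k::field_char_0) nc_series"
  assumes finB: "finite B" and X_closed: "b \<in> B \<Longrightarrow> X b \<in> carrier G"
    and gen: "carrier G = generate G (X ` B)"
    and \<rho>_mult: "x \<in> carrier G \<Longrightarrow> y \<in> carrier G \<Longrightarrow> \<rho> (x \<otimes> y) = \<rho> x * \<rho> y"
    and \<rho>_exp: "x \<in> carrier G \<Longrightarrow> \<exists>u\<in>lie_series B. \<rho> x = nc_exp u"
    and \<rho>_X: "b \<in> B \<Longrightarrow> eq_upto 2 (\<rho> (X b)) (1 + nc_var b)"
begin

abbreviation H :: "('g \<times> 'g) monoid" where "H \<equiv> G \<times>\<times> G"

sublocale H: group H
  by (rule DirProd_group) (rule is_group)+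

lemma \<rho>_const: "x \<in> carrier G \<Longrightarrow> order_ge 1 (\<rho> x - 1)"
  using \<rho>_exp[of x] lie_series_order order_ge_exp by fastforce

lemma \<rho>_Nil: "x \<in> carrier G \<Longrightarrow> coeff (\<rho> x) [] = 1"
  using \<rho>_const[of x] by (simp add: order_ge_1 coeff_one)

lemma \<rho>_one: "\<rho> \<one> = 1"
proof -
  obtain u where u: "u \<in> lie_series B" "\<rho> \<one> = nc_exp u" using \<rho>_exp[OF one_closed] by blast
  have "nc_exp u * nc_exp u = 1 * nc_exp u" using \<rho>_mult[of \<one> \<one>] u by simp
  from exp_cancel_right[OF lie_series_order[OF u(1)] this] show ?thesis using u by simp
qed

lemma \<rho>_supported: "x \<in> carrier G \<Longrightarrow> supported B (\<rho> x)"
  using \<rho>_exp[of x] supported_exp supported_lie_series by metis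

text \<open>The coefficient at \<open>w \<otimes> v\<close> of the linear extension of \<open>(x, y) \<mapsto> \<rho> x \<otimes> \<rho> y\<close>. That
  \<open>F\<close> vanishes to order \<open>m\<close> means that this extension maps it to a series of order at least \<open>m\<close>.\<close>

definition \<tau> :: "'a list \<Rightarrow> 'a list \<Rightarrow> ('g \<times> 'g \<Rightarrow>\<^sub>0 'k) \<Rightarrow> 'k" where
  "\<tau> w v F = ext (\<lambda>(x, y). coeff (\<rho> x) w * coeff (\<rho> y) v) F"

definition vanish :: "nat \<Rightarrow> ('g \<times> 'g \<Rightarrow>\<^sub>0 'k) \<Rightarrow> bool" where
  "vanish m F \<longleftrightarrow> (\<forall>w v. length w + length v < m \<longrightarrow> \<tau> w v F = 0)"

lemma \<tau>_add: "\<tau> w v (F + F') = \<tau> w v F + \<tau> w v F'"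
  and \<tau>_scale: "\<tau> w v (gscale c F) = c * \<tau> w v F"
  and \<tau>_diff: "\<tau> w v (F - F') = \<tau> w v F - \<tau> w v F'"
  and \<tau>_sum: "\<tau> w v (sum FF I) = (\<Sum>i\<in>I. \<tau> w v (FF i))"
  and \<tau>_zero: "\<tau> w v 0 = 0"
  by (simp_all add: \<tau>_def ext_add ext_scale ext_diff ext_sum)

lemma \<tau>_gdiff_left:
  assumes g: "g \<in> carrier G" and F: "F \<in> galg H"
  shows "\<tau> w v (H.gdiff (g, \<one>) F) = (\<Sum>i\<le>length w. coeff (\<rho> g - 1) (take i w) * \<tau> (drop i w) v F)"
proof -
  have "ext (\<lambda>z. (\<lambda>(x, y). coeff (\<rho> x) w * coeff (\<rho> y) v) ((g, \<one>) \<otimes>\<^bsub>H\<^esub> z)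
      - (\<lambda>(x, y). coeff (\<rho> x) w * coeff (\<rho> y) v) z) F =
    ext (\<lambda>z. \<Sum>i\<le>length w. coeff (\<rho> g - 1) (take i w) * (\<lambda>(x, y). coeff (\<rho> x) (drop i w) * coeff (\<rho> y) v) z) F"
  proof (rule ext_cong[OF F])
    fix z assume "z \<in> carrier H"
    then obtain x y where z: "z = (x, y)" "x \<in> carrier G" "y \<in> carrier G" by auto
    have "coeff (\<rho> g * \<rho> x) w * coeff (\<rho> y) v - coeff (\<rho> x) w * coeff (\<rho> y) v =
        coeff ((\<rho> g - 1) * \<rho> x) w * coeff (\<rho> y) v"
      by (simp add: left_diff_distrib)
    also have "\<dots> = (\<Sum>i\<le>length w. coeff (\<rho> g - 1) (take i w) * (coeff (\<rho> x) (drop i w) * coeff (\<rho> y) v))"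
      by (simp only: coeff_times sum_distrib_right mult.assoc)
    finally show "(\<lambda>(x, y). coeff (\<rho> x) w * coeff (\<rho> y) v) ((g, \<one>) \<otimes>\<^bsub>H\<^esub> z)
      - (\<lambda>(x, y). coeff (\<rho> x) w * coeff (\<rho> y) v) z =
      (\<Sum>i\<le>length w. coeff (\<rho> g - 1) (take i w) * (\<lambda>(x, y). coeff (\<rho> x) (drop i w) * coeff (\<rho> y) v) z)"
      using g z by (simp only: mult_DirProd prod.case \<rho>_mult l_one)
  qed
  then show ?thesis
    unfolding \<tau>_def H.ext_gdiff[OF F] ext_fun_sum ext_fun_mult .
qed

lemma \<tau>_gdiff_right:
  assumes g: "g \<in> carrier G" and F: "F \<in> galg H"
  shows "\<tau> w v (H.gdiff (\<one>, g) F) = (\<Sum>i\<le>length v. coeff (\<rho> g - 1) (take i v) * \<tau> w (drop i v) F)"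
proof -
  have "ext (\<lambda>z. (\<lambda>(x, y). coeff (\<rho> x) w * coeff (\<rho> y) v) ((\<one>, g) \<otimes>\<^bsub>H\<^esub> z)
      - (\<lambda>(x, y). coeff (\<rho> x) w * coeff (\<rho> y) v) z) F =
    ext (\<lambda>z. \<Sum>i\<le>length v. coeff (\<rho> g - 1) (take i v) * (\<lambda>(x, y). coeff (\<rho> x) w * coeff (\<rho> y) (drop i v)) z) F"
  proof (rule ext_cong[OF F])
    fix z assume "z \<in> carrier H"
    then obtain x y where z: "z = (x, y)" "x \<in> carrier G" "y \<in> carrier G" by auto
    have "coeff (\<rho> x) w * coeff (\<rho> g * \<rho> y) v - coeff (\<rho> x) w * coeff (\<rho> y) v =
        coeff (\<rho> x) w * coeff ((\<rho> g - 1) * \<rho> y) v"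
      by (simp add: left_diff_distrib right_diff_distrib)
    also have "\<dots> = (\<Sum>i\<le>length v. coeff (\<rho> g - 1) (take i v) * (coeff (\<rho> x) w * coeff (\<rho> y) (drop i v)))"
      by (simp only: coeff_times sum_distrib_left mult.left_commute)
    finally show "(\<lambda>(x, y). coeff (\<rho> x) w * coeff (\<rho> y) v) ((\<one>, g) \<otimes>\<^bsub>H\<^esub> z)
      - (\<lambda>(x, y). coeff (\<rho> x) w * coeff (\<rho> y) v) z =
      (\<Sum>i\<le>length v. coeff (\<rho> g - 1) (take i v) * (\<lambda>(x, y). coeff (\<rho> x) w * coeff (\<rho> y) (drop i v)) z)"
      using g z by (simp only: mult_DirProd prod.case \<rho>_mult l_one)
  qed
  then show ?thesis
    unfolding \<tau>_def H.ext_gdiff[OF F] ext_fun_sum ext_fun_mult .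
qed

text \<open>As \<open>\<rho> g - 1\<close> has no constant term, only proper suffixes contribute.\<close>

lemma vanish_gdiff:
  assumes g: "g \<in> carrier G" and F: "F \<in> galg H" "vanish m F"
  shows "vanish (Suc m) (H.gdiff (g, \<one>) F)" "vanish (Suc m) (H.gdiff (\<one>, g) F)"
proof -
  have 0: "coeff (\<rho> g - 1) (take 0 w) = 0" for w using \<rho>_const[OF g] by (simp add: order_ge_1)
  have "coeff (\<rho> g - 1) (take i w) * \<tau> (drop i w) v F = 0"
    if "length w + length v < Suc m" "i \<le> length w" for i w v
  proof (cases "i = 0")
    case False
    then have "length (drop i w) + length v < m" using that by auto
    then show ?thesis using F(2) by (simp add: vanish_def)
  qed (simp add: 0[simplified])
  then show "vanish (Suc m) (H.gdiff (g, \<one>) F)"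
    unfolding vanish_def \<tau>_gdiff_left[OF g F(1)] by (auto intro!: sum.neutral)
  have "coeff (\<rho> g - 1) (take i v) * \<tau> w (drop i v) F = 0"
    if "length w + length v < Suc m" "i \<le> length v" for i w v
  proof (cases "i = 0")
    case False
    then have "length w + length (drop i v) < m" using that by auto
    then show ?thesis using F(2) by (simp add: vanish_def)
  qed (simp add: 0[simplified])
  then show "vanish (Suc m) (H.gdiff (\<one>, g) F)"
    unfolding vanish_def \<tau>_gdiff_right[OF g F(1)] by (auto intro!: sum.neutral)
qed

lemma \<rho>_X_letter: "b \<in> B \<Longrightarrow> coeff (\<rho> (X b) - 1) [c] = (if b = c then 1 else 0)"
  using \<rho>_X[of b] by (auto simp: eq_upto_def coeff_var)

text \<open>In the lowest degree only the first letter is split off, and \<open>\<rho> (X b) - 1\<close> begins with \<open>b\<close>.\<close>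

lemma \<tau>_gdiff_X:
  assumes b: "b \<in> B" and F: "F \<in> galg H" "vanish m F" and l: "length w + length v = Suc m"
  shows "\<tau> w v (H.gdiff (X b, \<one>) F) = (case w of [] \<Rightarrow> 0 | c # w' \<Rightarrow> if b = c then \<tau> w' v F else 0)"
    and "\<tau> w v (H.gdiff (\<one>, X b) F) = (case v of [] \<Rightarrow> 0 | c # v' \<Rightarrow> if b = c then \<tau> w v' F else 0)"
proof -
  note Xb = X_closed[OF b]
  have 0: "coeff (\<rho> (X b) - 1) [] = 0" using \<rho>_const[OF Xb] by (simp add: order_ge_1)
  show "\<tau> w v (H.gdiff (X b, \<one>) F) = (case w of [] \<Rightarrow> 0 | c # w' \<Rightarrow> if b = c then \<tau> w' v F else 0)"
  proof (cases w)
    case Nil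
    then show ?thesis unfolding \<tau>_gdiff_left[OF Xb F(1)] using 0 by simp
  next
    case (Cons c w')
    have "\<tau> w v (H.gdiff (X b, \<one>) F) = (\<Sum>i\<in>{1}. coeff (\<rho> (X b) - 1) (take i w) * \<tau> (drop i w) v F)"
      unfolding \<tau>_gdiff_left[OF Xb F(1)]
    proof (rule sum.mono_neutral_right)
      show "\<forall>i\<in>{..length w} - {1}. coeff (\<rho> (X b) - 1) (take i w) * \<tau> (drop i w) v F = 0"
      proof
        fix i assume i: "i \<in> {..length w} - {1}"
        then consider "i = 0" | "length (drop i w) + length v < m" using l by fastforce
        then show "coeff (\<rho> (X b) - 1) (take i w) * \<tau> (drop i w) v F = 0"
          using 0 F(2) by cases (simp_all add: vanish_def del: coeff_diff)
      qed
    qed (use Cons in auto)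
    then show ?thesis using \<rho>_X_letter[OF b, of c] by (simp add: Cons take_Cons' drop_Cons' del: coeff_diff)
  qed
  show "\<tau> w v (H.gdiff (\<one>, X b) F) = (case v of [] \<Rightarrow> 0 | c # v' \<Rightarrow> if b = c then \<tau> w v' F else 0)"
  proof (cases v)
    case Nil
    then show ?thesis unfolding \<tau>_gdiff_right[OF Xb F(1)] using 0 by simp
  next
    case (Cons c v')
    have "\<tau> w v (H.gdiff (\<one>, X b) F) = (\<Sum>i\<in>{1}. coeff (\<rho> (X b) - 1) (take i v) * \<tau> w (drop i v) F)"
      unfolding \<tau>_gdiff_right[OF Xb F(1)]
    proof (rule sum.mono_neutral_right)
      show "\<forall>i\<in>{..length v} - {1}. coeff (\<rho> (X b) - 1) (take i v) * \<tau> w (drop i v) F = 0"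
      proof
        fix i assume i: "i \<in> {..length v} - {1}"
        then consider "i = 0" | "length w + length (drop i v) < m" using l by fastforce
        then show "coeff (\<rho> (X b) - 1) (take i v) * \<tau> w (drop i v) F = 0"
          using 0 F(2) by cases (simp_all add: vanish_def del: coeff_diff)
      qed
    qed (use Cons in auto)
    then show ?thesis using \<rho>_X_letter[OF b, of c] by (simp add: Cons take_Cons' drop_Cons' del: coeff_diff)
  qed
qed

text \<open>The products \<open>Y w v\<close> of the elements \<open>(X\<^sub>b, 1) - 1\<close> along \<open>w\<close> and \<open>(1, X\<^sub>b) - 1\<close> along \<open>v\<close> are
  dual, in lowest degree, to the functionals \<open>\<tau> w v\<close>.\<close>

definition Y :: "'a list \<Rightarrow> 'a list \<Rightarrow> ('g \<times> 'g \<Rightarrow>\<^sub>0 'k)" where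
  "Y w v = foldr (\<lambda>b. H.gdiff (X b, \<one>)) w (foldr (\<lambda>b. H.gdiff (\<one>, X b)) v (gone H))"

lemma Y_simps: "Y [] [] = gone H" "Y [] (b # v) = H.gdiff (\<one>, X b) (Y [] v)"
  "Y (b # w) v = H.gdiff (X b, \<one>) (Y w v)"
  by (simp_all add: Y_def)

lemma Y_aug: "set w \<subseteq> B \<Longrightarrow> set v \<subseteq> B \<Longrightarrow> in_aug_pow H (length w + length v) (Y w v)"
proof (induction w)
  case Nil
  then show ?case
    by (induction v) (auto simp: Y_simps X_closed intro!: in_aug_pow.base H.galg_gone H.in_aug_pow_gdiff)
next
  case (Cons b w)
  then show ?case by (auto simp: Y_simps X_closed intro!: H.in_aug_pow_gdiff)
qed

lemma Y_galg: "set w \<subseteq> B \<Longrightarrow> set v \<subseteq> B \<Longrightarrow> Y w v \<in> galg H"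
  using Y_aug H.in_aug_pow_galg by blast

lemma gdiff_right_Y:
  assumes "set w \<subseteq> B" "set v \<subseteq> B" "b \<in> B"
  shows "H.gdiff (\<one>, X b) (Y w v) = Y w (b # v)"
  using assms
proof (induction w)
  case (Cons c w)
  then have "H.gdiff (\<one>, X b) (H.gdiff (X c, \<one>) (Y w v)) = H.gdiff (X c, \<one>) (H.gdiff (\<one>, X b) (Y w v))"
    by (intro H.gdiff_commute Y_galg) (simp_all add: X_closed)
  then show ?case using Cons by (simp add: Y_simps)
qed (simp add: Y_simps)

lemma vanish_Y: "set w \<subseteq> B \<Longrightarrow> set v \<subseteq> B \<Longrightarrow> vanish (length w + length v) (Y w v)"
proof (induction w)
  case Nil
  show ?case using Nil(2)
  proof (induction v)
    case (Cons b v)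
    then show ?case
      using vanish_gdiff(2)[OF X_closed Y_galg, of b "[]" v "length v"] by (simp add: Y_simps)
  qed (simp add: vanish_def)
next
  case (Cons b w)
  then show ?case
    using vanish_gdiff(1)[OF X_closed Y_galg, of b w v "length w + length v"] by (simp add: Y_simps)
qed

lemma \<tau>_Y:
  assumes "set w \<subseteq> B" "set v \<subseteq> B" "length w' + length v' = length w + length v"
  shows "\<tau> w' v' (Y w v) = (if w = w' \<and> v = v' then 1 else 0)"
  using assms
proof (induction w arbitrary: w')
  case Nil
  then show ?case
  proof (induction v arbitrary: v')
    case Nil
    then show ?case by (simp add: Y_simps \<tau>_def ext_gone \<rho>_one coeff_one)
  next
    case (Cons b v)
    have "\<tau> w' v' (Y [] (b # v)) = (case v' of [] \<Rightarrow> 0 | c # v'' \<Rightarrow> if b = c then \<tau> w' v'' (Y [] v) else 0)"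
      unfolding Y_simps(2)
      by (rule \<tau>_gdiff_X(2)[where m = "length v"]) (use Cons vanish_Y[of "[]" v] in \<open>simp_all add: Y_galg\<close>)
    then show ?case using Cons by (auto split: list.splits)
  qed
next
  case (Cons b w)
  have "\<tau> w' v' (Y (b # w) v) = (case w' of [] \<Rightarrow> 0 | c # w'' \<Rightarrow> if b = c then \<tau> w'' v' (Y w v) else 0)"
    unfolding Y_simps(3)
    by (rule \<tau>_gdiff_X(1)[where m = "length w + length v"]) (use Cons vanish_Y[of w v] in \<open>simp_all add: Y_galg\<close>)
  then show ?case using Cons by (auto split: list.splits)
qed

text \<open>The span of the products \<open>Y w v\<close> of length \<open>m\<close>, modulo the next power of the augmentation ideal. It
  turns out to be the \<open>m\<close>-th power: the elements \<open>x\<close> for which \<open>x - 1\<close> maps \<open>Sp m\<close> to \<open>Sp (m + 1)\<close>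
  (predicate \<open>good\<close>) form a subgroup that contains the generators.\<close>

inductive_set Sp :: "nat \<Rightarrow> ('g \<times> 'g \<Rightarrow>\<^sub>0 'k) set" for m where
  higher: "in_aug_pow H (Suc m) f \<Longrightarrow> f \<in> Sp m"
| prods: "set w \<subseteq> B \<Longrightarrow> set v \<subseteq> B \<Longrightarrow> length w + length v = m \<Longrightarrow> Y w v \<in> Sp m"
| sums: "f \<in> Sp m \<Longrightarrow> h \<in> Sp m \<Longrightarrow> f + h \<in> Sp m"
| scales: "f \<in> Sp m \<Longrightarrow> gscale c f \<in> Sp m"

lemma Sp_aug: "f \<in> Sp m \<Longrightarrow> in_aug_pow H m f"
proof (induction rule: Sp.induct)
  case (higher f)
  then show ?case by (rule H.in_aug_pow_mono) simp
next
  case (prods w v)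
  then show ?case using Y_aug by blast
qed (simp_all add: in_aug_pow.add H.in_aug_pow_scale)

lemma Sp_galg: "f \<in> Sp m \<Longrightarrow> f \<in> galg H"
  using Sp_aug H.in_aug_pow_galg by blast

lemma Sp_gdiff_X:
  assumes b: "b \<in> B" and "f \<in> Sp m"
  shows "H.gdiff (X b, \<one>) f \<in> Sp (Suc m)" "H.gdiff (\<one>, X b) f \<in> Sp (Suc m)"
proof -
  show "H.gdiff (X b, \<one>) f \<in> Sp (Suc m)"
    using assms(2)
  proof (induction rule: Sp.induct)
    case (higher f)
    then show ?case by (intro Sp.higher H.in_aug_pow_gdiff) (simp_all add: X_closed b)
  next
    case (prods w v)
    then show ?case unfolding Y_simps(3)[symmetric] by (intro Sp.prods) (simp_all add: b)
  qed (simp_all add: H.gdiff_add H.gdiff_scale Sp.sums Sp.scales)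
  show "H.gdiff (\<one>, X b) f \<in> Sp (Suc m)"
    using assms(2)
  proof (induction rule: Sp.induct)
    case (higher f)
    then show ?case by (intro Sp.higher H.in_aug_pow_gdiff) (simp_all add: X_closed b)
  next
    case (prods w v)
    then show ?case unfolding gdiff_right_Y[OF prods(1,2) b] by (intro Sp.prods) (simp_all add: b)
  qed (simp_all add: H.gdiff_add H.gdiff_scale Sp.sums Sp.scales)
qed

definition good :: "'g \<times> 'g \<Rightarrow> bool" where
  "good x \<longleftrightarrow> (\<forall>m. \<forall>f\<in>Sp m. H.gdiff x f \<in> Sp (Suc m))"

lemma Sp_gdiff_gdiff:
  "x \<in> carrier H \<Longrightarrow> y \<in> carrier H \<Longrightarrow> f \<in> Sp m \<Longrightarrow> H.gdiff x (H.gdiff y f) \<in> Sp (Suc m)"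
  by (rule Sp.higher[OF H.in_aug_pow_gdiff[OF _ H.in_aug_pow_gdiff[OF _ Sp_aug]]])

lemma good_mult:
  assumes "x \<in> carrier H" "y \<in> carrier H" "good x" "good y" shows "good (x \<otimes>\<^bsub>H\<^esub> y)"
  unfolding good_def
proof (intro allI ballI)
  fix m f assume f: "f \<in> Sp m"
  show "H.gdiff (x \<otimes>\<^bsub>H\<^esub> y) f \<in> Sp (Suc m)"
    unfolding H.gdiff_mult[OF assms(1,2) Sp_galg[OF f]]
    using assms f by (intro Sp.sums Sp_gdiff_gdiff) (simp_all add: good_def)
qed

lemma good_inv:
  assumes x: "x \<in> carrier H" "good x" shows "good (inv\<^bsub>H\<^esub> x)"
  unfolding good_def
proof (intro allI ballI)
  fix m f assume f: "f \<in> Sp m"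
  have ix: "inv\<^bsub>H\<^esub> x \<in> carrier H" using x by (intro H.inv_closed)
  have "H.gdiff (inv\<^bsub>H\<^esub> x) f + H.gdiff x f + H.gdiff (inv\<^bsub>H\<^esub> x) (H.gdiff x f) = 0"
    using H.gdiff_mult[OF ix x(1) Sp_galg[OF f]] H.gdiff_one[OF Sp_galg[OF f]] H.l_inv[OF x(1)] by simp
  then have "H.gdiff (inv\<^bsub>H\<^esub> x) f = gscale (- 1) (H.gdiff x f + H.gdiff (inv\<^bsub>H\<^esub> x) (H.gdiff x f))"
    unfolding gscale_minus_one eq_neg_iff_add_eq_0 by (simp only: add.assoc)
  moreover have "H.gdiff x f + H.gdiff (inv\<^bsub>H\<^esub> x) (H.gdiff x f) \<in> Sp (Suc m)"
    using x f ix by (intro Sp.sums Sp_gdiff_gdiff) (simp_all add: good_def)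
  ultimately show "H.gdiff (inv\<^bsub>H\<^esub> x) f \<in> Sp (Suc m)" by (simp add: Sp.scales)
qed

lemma good_one: "good \<one>\<^bsub>H\<^esub>"
  unfolding good_def
proof (intro allI ballI)
  fix m f assume "f \<in> Sp m"
  then have "H.gdiff \<one>\<^bsub>H\<^esub> f = 0" by (intro H.gdiff_one Sp_galg)
  then show "H.gdiff \<one>\<^bsub>H\<^esub> f \<in> Sp (Suc m)" by (simp add: Sp.higher in_aug_pow.zero)
qed

lemma good_X: "b \<in> B \<Longrightarrow> good (X b, \<one>)" "b \<in> B \<Longrightarrow> good (\<one>, X b)"
  by (simp_all add: good_def Sp_gdiff_X)

lemma good_embed: "x \<in> carrier G \<Longrightarrow> good (x, \<one>) \<and> good (\<one>, x)"
proof -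
  assume "x \<in> carrier G"
  then have "x \<in> generate G (X ` B)" using gen by simp
  then show ?thesis
  proof induction
    case one
    then show ?case using good_one by simp
  next
    case (incl h)
    then show ?case using good_X by blast
  next
    case (inv h)
    then obtain b where b: "b \<in> B" "h = X b" by blast
    have "good (inv\<^bsub>H\<^esub> (h, \<one>))" "good (inv\<^bsub>H\<^esub> (\<one>, h))"
      unfolding b(2) by (rule good_inv; simp add: good_X b(1) X_closed)+
    then show ?case using b by (simp add: inv_DirProd[OF is_group is_group] X_closed)
  next
    case (eng g h)
    then have gh: "g \<in> carrier G" "h \<in> carrier G" using gen by simp_all
    then have "good ((g, \<one>) \<otimes>\<^bsub>H\<^esub> (h, \<one>))" "good ((\<one>, g) \<otimes>\<^bsub>H\<^esub> (\<one>, h))"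
      using eng by (simp_all only: good_mult carrier_DirProd mem_Times_iff fst_conv snd_conv one_closed simp_thms)
    then show ?case by simp
  qed
qed

lemma good_all: "z \<in> carrier H \<Longrightarrow> good z"
proof -
  assume "z \<in> carrier H"
  then obtain x y where z: "z = (x, y)" "x \<in> carrier G" "y \<in> carrier G" by auto
  then have "good ((x, \<one>) \<otimes>\<^bsub>H\<^esub> (\<one>, y))"
    by (intro good_mult good_embed[THEN conjunct1] good_embed[THEN conjunct2]) simp_all
  then show ?thesis using z by simp
qed

lemma aug_pow_subset_Sp: "in_aug_pow H m f \<Longrightarrow> f \<in> Sp m"
proof (induction rule: in_aug_pow.induct)
  case (base f)
  have "f - gscale (aug f) (gone H) \<in> Sp 0"
    using H.galg_minus_aug[OF base] by (intro Sp.higher) (simp add: One_nat_def)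
  moreover have "gscale (aug f) (gone H) \<in> Sp 0"
    using Sp.prods[of "[]" "[]" 0] by (intro Sp.scales) (simp add: Y_simps)
  ultimately have "f - gscale (aug f) (gone H) + gscale (aug f) (gone H) \<in> Sp 0" by (rule Sp.sums)
  then show ?case by simp
next
  case (zero m)
  then show ?case by (intro Sp.higher in_aug_pow.zero)
next
  case (add m f h)
  then show ?case by (intro Sp.sums)
next
  case (mult f m h)
  have "(\<Sum>x\<in>I. gscale (gcoeff f x) (H.gdiff x h)) \<in> Sp (Suc m)" if "finite I" "I \<subseteq> supp f" for I
    using that
  proof (induction I)
    case empty
    show ?case by (simp add: Sp.higher in_aug_pow.zero)
  next
    case (insert x I)
    then have x: "x \<in> carrier H" using galg_supp[OF mult(1)] by blast
    have "H.gdiff x h \<in> Sp (Suc m)" using good_all[OF x] mult(4) unfolding good_def by blast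
    then show ?case using insert by (simp add: Sp.sums Sp.scales)
  qed
  then show ?case
    unfolding H.gconv_aug_0_eq_sum[OF mult(1,2) Sp_galg[OF mult(4)]] by simp
qed

lemma aug_pow_vanish: "in_aug_pow H m f \<Longrightarrow> vanish m f"
proof (induction rule: in_aug_pow.induct)
  case (mult f m h)
  have h: "h \<in> galg H" using H.in_aug_pow_galg[OF mult(3)] .
  have "vanish (Suc m) (H.gdiff z h)" if z: "z \<in> carrier H" for z
  proof -
    obtain x y where xy: "z = (x, \<one>) \<otimes>\<^bsub>H\<^esub> (\<one>, y)" "x \<in> carrier G" "y \<in> carrier G"
      using z by auto
    have v: "vanish (Suc m) (H.gdiff (x, \<one>) h)" "vanish (Suc m) (H.gdiff (\<one>, y) h)"
      by (rule vanish_gdiff(1)[OF xy(2) h mult(4)], rule vanish_gdiff(2)[OF xy(3) h mult(4)])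
    moreover have "vanish (Suc (Suc m)) (H.gdiff (x, \<one>) (H.gdiff (\<one>, y) h))"
      by (rule vanish_gdiff(1)[OF xy(2) H.gdiff_closed[OF _ h] v(2)]) (simp add: xy)
    moreover have "H.gdiff z h = H.gdiff (x, \<one>) h + H.gdiff (\<one>, y) h + H.gdiff (x, \<one>) (H.gdiff (\<one>, y) h)"
      unfolding xy(1) using xy(2,3) h by (intro H.gdiff_mult) simp_all
    ultimately show ?thesis by (simp add: vanish_def \<tau>_add)
  qed
  then have "vanish (Suc m) (H.gdiff x h)" if "x \<in> supp f" for x
    using galg_supp[OF mult(1) that] by blast
  then show ?case
    unfolding H.gconv_aug_0_eq_sum[OF mult(1,2) h] by (simp add: vanish_def \<tau>_sum \<tau>_scale)
qed (simp_all add: vanish_def \<tau>_add \<tau>_zero)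

text \<open>The coefficients of the products \<open>Y w v\<close> are read off by the dual functionals \<open>\<tau> w v\<close>.\<close>

lemma Sp_expansion:
  assumes "f \<in> Sp m"
  shows "in_aug_pow H (Suc m) (f - (\<Sum>(w, v)\<in>{(w, v). set w \<subseteq> B \<and> set v \<subseteq> B \<and> length w + length v = m}.
    gscale (\<tau> w v f) (Y w v)))"
  using assms
proof (induction rule: Sp.induct)
  let ?W = "{(w, v). set w \<subseteq> B \<and> set v \<subseteq> B \<and> length w + length v = m}"
  have fin: "finite ?W"
    by (rule finite_subset[OF _ finite_cartesian_product[OF finite_lists_length_le[OF finB, of m]
          finite_lists_length_le[OF finB, of m]]]) auto
  {
    case (higher f)
    have "\<tau> w v f = 0" if "length w + length v = m" for w v
      using aug_pow_vanish[OF higher] that by (simp add: vanish_def)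
    then have "(\<Sum>(w, v)\<in>?W. gscale (\<tau> w v f) (Y w v)) = (\<Sum>(w, v)\<in>?W. gscale 0 (Y w v))"
      by (intro sum.cong) auto
    also have "\<dots> = 0"
      by (intro sum.neutral ballI ext_eqI) (auto simp: ext_scale)
    finally show ?case using higher by simp
  next
    case (prods w v)
    have "(\<Sum>(w', v')\<in>?W. gscale (\<tau> w' v' (Y w v)) (Y w' v')) = (\<Sum>(w', v')\<in>{(w, v)}. gscale (\<tau> w' v' (Y w v)) (Y w' v'))"
    proof (rule sum.mono_neutral_right[OF fin])
      show "\<forall>i\<in>?W - {(w, v)}. (case i of (w', v') \<Rightarrow> gscale (\<tau> w' v' (Y w v)) (Y w' v')) = 0"
      proof
        fix i assume i: "i \<in> ?W - {(w, v)}"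
        then obtain w' v' where i': "i = (w', v')" by (cases i)
        then have "\<tau> w' v' (Y w v) = 0" using i \<tau>_Y[OF prods(1,2), of w' v'] prods(3) by auto
        then show "(case i of (w', v') \<Rightarrow> gscale (\<tau> w' v' (Y w v)) (Y w' v')) = 0" by (simp add: i')
      qed
    qed (use prods in auto)
    also have "\<dots> = Y w v" using \<tau>_Y[OF prods(1,2)] by simp
    finally show ?case by (simp add: in_aug_pow.zero)
  next
    case (sums f h)
    have "(\<Sum>(w, v)\<in>?W. gscale (\<tau> w v (f + h)) (Y w v)) =
      (\<Sum>(w, v)\<in>?W. gscale (\<tau> w v f) (Y w v)) + (\<Sum>(w, v)\<in>?W. gscale (\<tau> w v h) (Y w v))"
      unfolding sum.distrib[symmetric] by (rule sum.cong) (auto simp: \<tau>_add gscale_add_left)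
    then have "f + h - (\<Sum>(w, v)\<in>?W. gscale (\<tau> w v (f + h)) (Y w v)) =
      (f - (\<Sum>(w, v)\<in>?W. gscale (\<tau> w v f) (Y w v))) + (h - (\<Sum>(w, v)\<in>?W. gscale (\<tau> w v h) (Y w v)))"
      by (simp only: add_diff_add)
    then show ?case using in_aug_pow.add[OF sums(3,4)] by (simp only:)
  next
    case (scales f c)
    have "(\<Sum>(w, v)\<in>?W. gscale (\<tau> w v (gscale c f)) (Y w v)) =
      gscale c (\<Sum>(w, v)\<in>?W. gscale (\<tau> w v f) (Y w v))"
      unfolding gscale_sum_right by (rule sum.cong) (auto simp: \<tau>_scale gscale_gscale)
    then have "gscale c f - (\<Sum>(w, v)\<in>?W. gscale (\<tau> w v (gscale c f)) (Y w v)) =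
      gscale c (f - (\<Sum>(w, v)\<in>?W. gscale (\<tau> w v f) (Y w v)))"
      by (simp add: gscale_diff_right)
    then show ?case using H.in_aug_pow_scale[OF scales(2), of c] by (simp only:)
  }
qed

text \<open>Differences \<open>x - 1\<close> raise the order of the expansion. Conversely, if an element of the \<open>m\<close>-th power
  vanishes to order \<open>m + 1\<close>, all its coefficients in \<open>Sp_expansion\<close> are zero, and it lies in the next
  power.\<close>

theorem aug_pow_H_iff: "in_aug_pow H m f \<longleftrightarrow> f \<in> galg H \<and> vanish m f"
proof (intro iffI conjI)
  assume "f \<in> galg H \<and> vanish m f"
  then have f: "f \<in> galg H" "vanish m f" by auto
  show "in_aug_pow H m f"
    using f(2)
  proof (induction m)
    case 0
    then show ?case using f by (simp add: in_aug_pow.base)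
  next
    case (Suc m)
    have "vanish m f" using Suc(2) by (simp add: vanish_def)
    then have "f \<in> Sp m" using Suc aug_pow_subset_Sp by blast
    note exp = Sp_expansion[OF this]
    have "\<tau> w v f = 0" if "length w + length v = m" for w v using Suc(2) that by (simp add: vanish_def)
    then have "(\<Sum>(w, v)\<in>{(w, v). set w \<subseteq> B \<and> set v \<subseteq> B \<and> length w + length v = m}. gscale (\<tau> w v f) (Y w v)) = 0"
      by (intro sum.neutral ballI ext_eqI) (auto simp: ext_scale)
    then show ?case using exp by simp
  qed
qed (use H.in_aug_pow_galg aug_pow_vanish in blast)+

end

section \<open>Shuffles and exponentials of Lie series\<close>

text \<open>\<open>shuffle_coeff f w v\<close> is the sum of the coefficients of \<open>f\<close> at all shuffles of \<open>w\<close> and \<open>v\<close>,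
  that is, the coefficient at \<open>w \<otimes> v\<close> of the coproduct of \<open>f\<close> for which the letters are
  primitive.\<close>

fun shuffle_coeff :: "('a, 'k::field_char_0) nc_series \<Rightarrow> 'a list \<Rightarrow> 'a list \<Rightarrow> 'k" where
  "shuffle_coeff f [] v = coeff f v"
| "shuffle_coeff f (x # w) [] = coeff f (x # w)"
| "shuffle_coeff f (x # w) (y # v) =
    shuffle_coeff (lder x f) w (y # v) + shuffle_coeff (lder y f) (x # w) v"

lemma shuffle_coeff_Nil_right [simp]: "shuffle_coeff f w [] = coeff f w"
  by (cases w) simp_all

lemma lder_scale: "lder a (nc_scale c f) = nc_scale c (lder a f)"
  by (rule nc_series_eqI) (simp add: lder_def)

lemma lder_mult: "lder a (f * g) = lder a f * g + nc_scale (coeff f []) (lder a g)"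
  by (rule nc_series_eqI)
    (simp add: lder_def coeff_times sum.atMost_Suc_shift del: sum.atMost_Suc)

lemma shuffle_coeff_add: "shuffle_coeff (f + g) w v = shuffle_coeff f w v + shuffle_coeff g w v"
  by (induction f w v arbitrary: g rule: shuffle_coeff.induct) (simp_all add: lder_add)

lemma shuffle_coeff_scale: "shuffle_coeff (nc_scale c f) w v = c * shuffle_coeff f w v"
  by (induction f w v rule: shuffle_coeff.induct) (simp_all add: lder_scale distrib_left)

lemma shuffle_coeff_zero: "shuffle_coeff 0 w v = 0"
  using shuffle_coeff_scale[of 0 0 w v] by simp

lemma shuffle_coeff_diff: "shuffle_coeff (f - g) w v = shuffle_coeff f w v - shuffle_coeff g w v"
  using shuffle_coeff_add[of "f - g" g w v] by simp

lemma shuffle_coeff_sum: "shuffle_coeff (sum F I) w v = (\<Sum>i\<in>I. shuffle_coeff (F i) w v)"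
  by (induction I rule: infinite_finite_induct) (simp_all add: shuffle_coeff_zero shuffle_coeff_add)

lemma shuffle_coeff_cong:
  "(\<And>s. length s = length w + length v \<Longrightarrow> coeff f s = coeff g s) \<Longrightarrow> shuffle_coeff f w v = shuffle_coeff g w v"
proof (induction f w v arbitrary: g rule: shuffle_coeff.induct)
  case (3 f x w y v)
  have "shuffle_coeff (lder x f) w (y # v) = shuffle_coeff (lder x g) w (y # v)"
    by (rule 3(1)) (use 3(3) in \<open>simp add: lder_def\<close>)
  moreover have "shuffle_coeff (lder y f) (x # w) v = shuffle_coeff (lder y g) (x # w) v"
    by (rule 3(2)) (use 3(3) in \<open>simp add: lder_def\<close>)
  ultimately show ?case by simp
qed simp_all

text \<open>This is the multiplicativity of the coproduct.\<close>

lemma shuffle_coeff_mult: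
  "shuffle_coeff (f * g) w v = (\<Sum>i\<le>length w. \<Sum>j\<le>length v.
     shuffle_coeff f (take i w) (take j v) * shuffle_coeff g (drop i w) (drop j v))"
proof (induction f w v rule: shuffle_coeff.induct)
  case (3 f x w y v)
  let ?g = "\<lambda>i j. shuffle_coeff g (drop i w) (drop j v)"
  define A where "A i j = shuffle_coeff (lder x f) (take i w) (take j (y # v)) * shuffle_coeff g (drop i w) (drop j (y # v))" for i j
  define C where "C i j = shuffle_coeff (lder y f) (take i (x # w)) (take j v) * shuffle_coeff g (drop i (x # w)) (drop j v)" for i j
  define S where "S i j = shuffle_coeff f (take i (x # w)) (take j (y # v)) * shuffle_coeff g (drop i (x # w)) (drop j (y # v))" for i j
  let ?n = "length w" and ?m = "length v"
  have A0: "A i 0 = S (Suc i) 0" for i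
    by (simp add: A_def S_def coeff_Cons_lder)
  have C0: "C 0 = (\<lambda>j. S 0 (Suc j))"
    by (simp add: fun_eq_iff C_def S_def coeff_Cons_lder)
  have AC: "S (Suc i) (Suc j) = A i (Suc j) + C (Suc i) j" for i j
    by (simp add: A_def C_def S_def distrib_right)
  have "shuffle_coeff (f * g) (x # w) (y # v) =
      shuffle_coeff (lder x f * g) w (y # v) + shuffle_coeff (lder y f * g) (x # w) v
      + coeff f [] * shuffle_coeff g (x # w) (y # v)"
    by (simp add: lder_mult shuffle_coeff_add shuffle_coeff_scale distrib_left)
  also have "shuffle_coeff (lder x f * g) w (y # v) = (\<Sum>i\<le>?n. \<Sum>j\<le>Suc ?m. A i j)"
    using 3(1) by (simp add: A_def del: sum.atMost_Suc)
  also have "\<dots> = (\<Sum>i\<le>?n. S (Suc i) 0) + (\<Sum>i\<le>?n. \<Sum>j\<le>?m. A i (Suc j))"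
    by (simp only: sum.atMost_Suc_shift A0 sum.distrib)
  also have "shuffle_coeff (lder y f * g) (x # w) v = (\<Sum>i\<le>Suc ?n. \<Sum>j\<le>?m. C i j)"
    using 3(2) by (simp add: C_def del: sum.atMost_Suc)
  also have "\<dots> = (\<Sum>j\<le>?m. S 0 (Suc j)) + (\<Sum>i\<le>?n. \<Sum>j\<le>?m. C (Suc i) j)"
    by (simp only: sum.atMost_Suc_shift C0)
  also have "coeff f [] * shuffle_coeff g (x # w) (y # v) = S 0 0"
    by (simp add: S_def)
  also have "(\<Sum>i\<le>?n. S (Suc i) 0) + (\<Sum>i\<le>?n. \<Sum>j\<le>?m. A i (Suc j))
     + ((\<Sum>j\<le>?m. S 0 (Suc j)) + (\<Sum>i\<le>?n. \<Sum>j\<le>?m. C (Suc i) j)) + S 0 0 =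
     (S 0 0 + (\<Sum>j\<le>?m. S 0 (Suc j))) + (\<Sum>i\<le>?n. S (Suc i) 0 + (\<Sum>j\<le>?m. S (Suc i) (Suc j)))"
    by (simp add: AC sum.distrib)
  also have "\<dots> = (\<Sum>i\<le>Suc ?n. \<Sum>j\<le>Suc ?m. S i j)"
    by (simp only: sum.atMost_Suc_shift)
  finally show ?case by (simp add: S_def del: sum.atMost_Suc)
qed (simp_all add: coeff_times)

definition primitive :: "('a, 'k::field_char_0) nc_series \<Rightarrow> bool" where
  "primitive f \<longleftrightarrow> coeff f [] = 0 \<and> (\<forall>w v. w \<noteq> [] \<longrightarrow> v \<noteq> [] \<longrightarrow> shuffle_coeff f w v = 0)"

lemma shuffle_coeff_primitive_mult:
  assumes "primitive f"
  shows "shuffle_coeff (f * g) w v =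
    (\<Sum>i\<le>length w. coeff f (take i w) * shuffle_coeff g (drop i w) v)
    + (\<Sum>j\<le>length v. coeff f (take j v) * shuffle_coeff g w (drop j v))"
proof -
  let ?S = "\<lambda>i j. shuffle_coeff f (take i w) (take j v) * shuffle_coeff g (drop i w) (drop j v)"
  have "(\<Sum>j\<le>length v. ?S (Suc i) j) = coeff f (take (Suc i) w) * shuffle_coeff g (drop (Suc i) w) v"
    if "i < length w" for i
  proof -
    have "shuffle_coeff f (take (Suc i) w) (take (Suc j) v) = 0" if "j < length v" for j
    proof -
      have "take (Suc i) w \<noteq> []" "take (Suc j) v \<noteq> []" using \<open>i < length w\<close> that by auto
      then show ?thesis using assms unfolding primitive_def by blast
    qed
    then have "(\<Sum>j<length v. ?S (Suc i) (Suc j)) = 0" by (intro sum.neutral) simp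
    then show ?thesis by (simp add: sum.atMost_shift)
  qed
  then have "shuffle_coeff (f * g) w v = (\<Sum>j\<le>length v. ?S 0 j)
     + (\<Sum>i<length w. coeff f (take (Suc i) w) * shuffle_coeff g (drop (Suc i) w) v)"
    unfolding shuffle_coeff_mult by (subst sum.atMost_shift) simp
  moreover have "(\<Sum>i\<le>length w. coeff f (take i w) * shuffle_coeff g (drop i w) v) =
     (\<Sum>i<length w. coeff f (take (Suc i) w) * shuffle_coeff g (drop (Suc i) w) v)"
    using assms by (subst sum.atMost_shift) (simp add: primitive_def)
  ultimately show ?thesis by simp
qed

lemma primitive_lie_poly:
  fixes u :: "('a, 'k::field_char_0) nc_series"
  shows "u \<in> lie_poly A \<Longrightarrow> primitive u"
proof (induction rule: lie_poly.induct)
  case 1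
  then show ?case by (simp add: primitive_def shuffle_coeff_zero)
next
  case (2 a)
  have "shuffle_coeff (nc_var a :: ('a, 'k) nc_series) w v = shuffle_coeff 0 w v" if "w \<noteq> []" "v \<noteq> []" for w v
  proof (rule shuffle_coeff_cong)
    fix s :: "'a list" assume "length s = length w + length v"
    moreover have "0 < length w" "0 < length v" using that by simp_all
    ultimately have "length s \<noteq> 1" by linarith
    then have "s \<noteq> [a]" by auto
    then show "coeff (nc_var a :: ('a, 'k) nc_series) s = coeff 0 s" by (simp add: coeff_var)
  qed
  then show ?case by (simp add: primitive_def shuffle_coeff_zero coeff_var)
next
  case (3 u v)
  then show ?case by (simp add: primitive_def shuffle_coeff_add)
next
  case (4 u c)
  then show ?case by (simp add: primitive_def shuffle_coeff_scale)
next
  case (5 f g)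
  have prod: "shuffle_coeff (f * g) w v = coeff f w * coeff g v + coeff f v * coeff g w"
    if "primitive f" "primitive g" "w \<noteq> []" "v \<noteq> []" for f g :: "('a, 'k) nc_series" and w v
  proof -
    have "(\<Sum>i\<le>length w. coeff f (take i w) * shuffle_coeff g (drop i w) v) =
        (\<Sum>i\<in>{length w}. coeff f (take i w) * shuffle_coeff g (drop i w) v)"
      by (rule sum.mono_neutral_right) (use that in \<open>auto simp: primitive_def\<close>)
    moreover have "(\<Sum>j\<le>length v. coeff f (take j v) * shuffle_coeff g w (drop j v)) =
        (\<Sum>j\<in>{length v}. coeff f (take j v) * shuffle_coeff g w (drop j v))"
      by (rule sum.mono_neutral_right) (use that in \<open>auto simp: primitive_def\<close>)
    ultimately show ?thesis using that by (simp add: shuffle_coeff_primitive_mult)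
  qed
  have "shuffle_coeff (commutator f g) w v = 0" if "w \<noteq> []" "v \<noteq> []" for w v
    using prod[OF 5(3,4) that] prod[OF 5(4,3) that] by (simp add: commutator_def shuffle_coeff_diff)
  then show ?case using 5 by (simp add: primitive_def commutator_def coeff_times_Nil)
qed

lemma primitive_lie_series:
  assumes "u \<in> lie_series A" shows "primitive u"
  unfolding primitive_def
proof (intro conjI allI impI)
  have p: "primitive (nc_part d u)" for d
    using assms primitive_lie_poly by (auto simp: lie_series_def)
  have "coeff u [] = coeff (nc_part 0 u) []" by (simp add: coeff_part)
  then show "coeff u [] = 0" using p[of 0] by (simp add: primitive_def)
  fix w v :: "'a list" assume "w \<noteq> []" "v \<noteq> []"
  moreover have "shuffle_coeff u w v = shuffle_coeff (nc_part (length w + length v) u) w v"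
    by (rule shuffle_coeff_cong) (simp add: coeff_part)
  ultimately show "shuffle_coeff u w v = 0" using p by (simp add: primitive_def)
qed

lemma lie_series_dexp: "u \<in> lie_series A \<Longrightarrow> nc_dexp u \<in> lie_series A"
  using free_lie.congr_dexp[OF free_lie.congr_refl, of u A] by (simp add: free_lie.congr_def lie_series_hat)

text \<open>Exponentials of Lie series are group-like. The two sides satisfy the same differential equation
  \<open>N a = D a\<close> with \<open>D\<close> primitive, which determines them degree by degree.\<close>

theorem shuffle_coeff_exp:
  fixes u :: "('a, 'k::field_char_0) nc_series"
  assumes u: "u \<in> lie_series A"
  shows "shuffle_coeff (nc_exp u) w v = coeff (nc_exp u) w * coeff (nc_exp u) v"
proof (induction "length w + length v" arbitrary: w v rule: less_induct)
  case less
  let ?a = "nc_exp u" and ?D = "nc_dexp u" and ?n = "length w + length v"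
  have ord: "order_ge 1 u" by (rule lie_series_order[OF u])
  have D: "primitive ?D" by (rule primitive_lie_series[OF lie_series_dexp[OF u]])
  have N: "nc_euler ?a = ?D * ?a" by (rule euler_exp_eq_dexp[OF ord])
  show ?case
  proof (cases "?n = 0")
    case True
    then have "w = []" "v = []" by simp_all
    moreover have "coeff ?a [] = 1"
      using order_ge_exp[OF ord] by (simp add: order_ge_1 coeff_one)
    ultimately show ?thesis by simp
  next
    case False
    have "of_nat ?n * shuffle_coeff ?a w v = shuffle_coeff (nc_scale (of_nat ?n) ?a) w v"
      by (simp add: shuffle_coeff_scale)
    also have "\<dots> = shuffle_coeff (nc_euler ?a) w v"
      by (rule shuffle_coeff_cong) simp
    also have "\<dots> = (\<Sum>i\<le>length w. coeff ?D (take i w) * shuffle_coeff ?a (drop i w) v)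
        + (\<Sum>j\<le>length v. coeff ?D (take j v) * shuffle_coeff ?a w (drop j v))"
      unfolding N by (rule shuffle_coeff_primitive_mult[OF D])
    also have "(\<Sum>i\<le>length w. coeff ?D (take i w) * shuffle_coeff ?a (drop i w) v) =
        (\<Sum>i\<le>length w. coeff ?D (take i w) * coeff ?a (drop i w)) * coeff ?a v"
      unfolding sum_distrib_right
    proof (rule sum.cong[OF HOL.refl])
      fix i assume i: "i \<in> {..length w}"
      show "coeff ?D (take i w) * shuffle_coeff ?a (drop i w) v =
          coeff ?D (take i w) * coeff ?a (drop i w) * coeff ?a v"
      proof (cases "i = 0")
        case False
        then have "length (drop i w) + length v < ?n" using i by auto
        from less[OF this] show ?thesis by simp
      qed (use D in \<open>simp add: primitive_def\<close>)
    qed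
    also have "(\<Sum>j\<le>length v. coeff ?D (take j v) * shuffle_coeff ?a w (drop j v)) =
        coeff ?a w * (\<Sum>j\<le>length v. coeff ?D (take j v) * coeff ?a (drop j v))"
      unfolding sum_distrib_left
    proof (rule sum.cong[OF HOL.refl])
      fix j assume j: "j \<in> {..length v}"
      show "coeff ?D (take j v) * shuffle_coeff ?a w (drop j v) =
          coeff ?a w * (coeff ?D (take j v) * coeff ?a (drop j v))"
      proof (cases "j = 0")
        case False
        then have "length w + length (drop j v) < ?n" using j by auto
        from less[OF this] show ?thesis by simp
      qed (use D in \<open>simp add: primitive_def\<close>)
    qed
    also have "(\<Sum>i\<le>length w. coeff ?D (take i w) * coeff ?a (drop i w)) = coeff (nc_euler ?a) w"
      unfolding N coeff_times ..
    also have "(\<Sum>j\<le>length v. coeff ?D (take j v) * coeff ?a (drop j v)) = coeff (nc_euler ?a) v"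
      unfolding N coeff_times ..
    also have "coeff (nc_euler ?a) w * coeff ?a v + coeff ?a w * coeff (nc_euler ?a) v =
        of_nat ?n * (coeff ?a w * coeff ?a v)"
      by (simp add: algebra_simps)
    finally have "of_nat ?n * shuffle_coeff ?a w v = of_nat ?n * (coeff ?a w * coeff ?a v)" .
    moreover have "(of_nat ?n :: 'k) \<noteq> 0" using False by (simp only: of_nat_eq_0_iff not_False_eq_True)
    ultimately show ?thesis using mult_left_cancel by blast
  qed
qed

section \<open>Polynomial functions on a group\<close>

text \<open>Iterated differences of order \<open>j \<le> d\<close> of the series-valued function \<open>T\<close> have values of order at
  least \<open>e + j\<close>. The linear extension of such a function maps powers of the augmentation ideal to series of
  high order. The class is closed under products and contains multiplicative functions with values in
  \<open>1 + \<dots>\<close>, so this applies to expressions such as \<open>N(\<rho> x) (\<rho> x)\<^sup>-\<^sup>1 \<rho> y\<close>.\<close>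

primrec pf :: "('g, 'b) monoid_scheme \<Rightarrow> nat \<Rightarrow> nat \<Rightarrow> ('g \<Rightarrow> ('a, 'k::field_char_0) nc_series) \<Rightarrow> bool" where
  "pf K 0 e T \<longleftrightarrow> (\<forall>x\<in>carrier K. order_ge e (T x))"
| "pf K (Suc d) e T \<longleftrightarrow> (\<forall>x\<in>carrier K. order_ge e (T x)) \<and>
     (\<forall>g\<in>carrier K. pf K d (Suc e) (\<lambda>x. T (g \<otimes>\<^bsub>K\<^esub> x) - T x))"

lemma pf_mono: "pf K d e T \<Longrightarrow> e' \<le> e \<Longrightarrow> pf K d e' T"
proof (induction d arbitrary: e e' T)
  case 0
  then show ?case by (auto intro: order_ge_mono)
next
  case (Suc d)
  have "pf K d (Suc e') (\<lambda>x. T (g \<otimes>\<^bsub>K\<^esub> x) - T x)" if "g \<in> carrier K" for g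
    by (rule Suc.IH[of "Suc e"]) (use Suc.prems that in simp_all)
  then show ?case using Suc.prems by (auto intro: order_ge_mono)
qed

lemma pf_Suc: "pf K (Suc d) e T \<Longrightarrow> pf K d e T"
proof (induction d arbitrary: e T)
  case (Suc d)
  have "pf K d (Suc e) (\<lambda>x. T (g \<otimes>\<^bsub>K\<^esub> x) - T x)" if "g \<in> carrier K" for g
    by (rule Suc.IH) (use Suc.prems that in simp)
  then show ?case using Suc.prems by simp
qed simp

lemma pf_cong:
  assumes "group K" "\<And>x. x \<in> carrier K \<Longrightarrow> T x = T' x"
  shows "pf K d e T \<longleftrightarrow> pf K d e T'"
  using assms(2)
proof (induction d arbitrary: e T T')
  case (Suc d)
  have "pf K d (Suc e) (\<lambda>x. T (g \<otimes>\<^bsub>K\<^esub> x) - T x) = pf K d (Suc e) (\<lambda>x. T' (g \<otimes>\<^bsub>K\<^esub> x) - T' x)"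
    if "g \<in> carrier K" for g
    by (rule Suc.IH) (use Suc.prems that monoid.m_closed[OF group.is_monoid[OF assms(1)]] in simp)
  then show ?case using Suc.prems by simp
qed simp

lemma pf_add: "pf K d e T \<Longrightarrow> pf K d e T' \<Longrightarrow> pf K d e (\<lambda>x. T x + T' x)"
proof (induction d arbitrary: e T T')
  case 0
  then show ?case by (simp add: order_ge_add)
next
  case (Suc d)
  have "pf K d (Suc e) (\<lambda>x. T (g \<otimes>\<^bsub>K\<^esub> x) + T' (g \<otimes>\<^bsub>K\<^esub> x) - (T x + T' x))" if "g \<in> carrier K" for g
    unfolding add_diff_add by (rule Suc.IH) (use Suc.prems that in simp_all)
  then show ?case using Suc.prems by (simp add: order_ge_add)
qed

lemma pf_mult:
  "pf K d e T \<Longrightarrow> pf K d e' T' \<Longrightarrow> pf K d (e + e') (\<lambda>x. T x * T' x)"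
proof (induction d arbitrary: e e' T T')
  case 0
  then show ?case by (simp add: order_ge_mult)
next
  case (Suc d)
  have "pf K d (Suc (e + e')) (\<lambda>x. T (g \<otimes>\<^bsub>K\<^esub> x) * T' (g \<otimes>\<^bsub>K\<^esub> x) - T x * T' x)" if g: "g \<in> carrier K" for g
  proof -
    let ?dT = "\<lambda>x. T (g \<otimes>\<^bsub>K\<^esub> x) - T x" and ?dT' = "\<lambda>x. T' (g \<otimes>\<^bsub>K\<^esub> x) - T' x"
    have d: "pf K d (Suc e) ?dT" "pf K d (Suc e') ?dT'" using Suc.prems g by simp_all
    have "pf K d (Suc e + e') (\<lambda>x. ?dT x * T' x)" by (rule Suc.IH[OF d(1) pf_Suc[OF Suc.prems(2)]])
    moreover have "pf K d (e + Suc e') (\<lambda>x. T x * ?dT' x)" by (rule Suc.IH[OF pf_Suc[OF Suc.prems(1)] d(2)])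
    moreover have "pf K d (Suc (e + e')) (\<lambda>x. ?dT x * ?dT' x)"
      by (rule pf_mono[OF Suc.IH[OF d]]) simp
    ultimately have "pf K d (Suc (e + e')) (\<lambda>x. ?dT x * T' x + T x * ?dT' x + ?dT x * ?dT' x)"
      by (intro pf_add) simp_all
    moreover have "(\<lambda>x. ?dT x * T' x + T x * ?dT' x + ?dT x * ?dT' x) =
        (\<lambda>x. T (g \<otimes>\<^bsub>K\<^esub> x) * T' (g \<otimes>\<^bsub>K\<^esub> x) - T x * T' x)"
      by (simp add: fun_eq_iff algebra_simps)
    ultimately show ?thesis by simp
  qed
  then show ?case using Suc.prems by (simp add: order_ge_mult)
qed

lemma pf_const: "order_ge e a \<Longrightarrow> pf K d e (\<lambda>x. a)"
proof (induction d arbitrary: e a)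
  case (Suc d)
  then show ?case using Suc.IH[of "Suc e" 0] by simp
qed simp

lemma pf_euler: "pf K d e T \<Longrightarrow> pf K d e (\<lambda>x. nc_euler (T x))"
proof (induction d arbitrary: e T)
  case 0
  then show ?case by (simp add: order_ge_euler)
next
  case (Suc d)
  have "pf K d (Suc e) (\<lambda>x. nc_euler (T (g \<otimes>\<^bsub>K\<^esub> x)) - nc_euler (T x))" if "g \<in> carrier K" for g
    unfolding nc_euler_diff[symmetric] by (rule Suc.IH) (use Suc.prems that in simp)
  then show ?case using Suc.prems by (simp add: order_ge_euler)
qed

lemma pf_mult_hom:
  assumes K: "group K" and T: "\<And>g x. g \<in> carrier K \<Longrightarrow> x \<in> carrier K \<Longrightarrow> T (g \<otimes>\<^bsub>K\<^esub> x) = T g * T x"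
    and o: "\<And>g. g \<in> carrier K \<Longrightarrow> order_ge 1 (T g - 1)"
  shows "pf K d 0 T"
proof (induction d)
  case (Suc d)
  have "pf K d (Suc 0) (\<lambda>x. T (g \<otimes>\<^bsub>K\<^esub> x) - T x)" if g: "g \<in> carrier K" for g
  proof -
    have "pf K d (1 + 0) (\<lambda>x. (T g - 1) * T x)"
      by (rule pf_mult[OF pf_const[OF o[OF g]] Suc])
    then show ?thesis
      by (subst pf_cong[OF K, where T' = "\<lambda>x. (T g - 1) * T x"])
        (simp_all add: T g left_diff_distrib One_nat_def)
  qed
  then show ?case by simp
qed simp

lemma pf_mult_antihom:
  assumes K: "group K" and T: "\<And>g x. g \<in> carrier K \<Longrightarrow> x \<in> carrier K \<Longrightarrow> T (g \<otimes>\<^bsub>K\<^esub> x) = T x * T g"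
    and o: "\<And>g. g \<in> carrier K \<Longrightarrow> order_ge 1 (T g - 1)"
  shows "pf K d 0 T"
proof (induction d)
  case (Suc d)
  have "pf K d (Suc 0) (\<lambda>x. T (g \<otimes>\<^bsub>K\<^esub> x) - T x)" if g: "g \<in> carrier K" for g
  proof -
    have "pf K d (0 + 1) (\<lambda>x. T x * (T g - 1))"
      by (rule pf_mult[OF Suc pf_const[OF o[OF g]]])
    then show ?thesis
      by (subst pf_cong[OF K, where T' = "\<lambda>x. T x * (T g - 1)"])
        (simp_all add: T g right_diff_distrib One_nat_def)
  qed
  then show ?case by simp
qed simp

definition lin :: "('g \<Rightarrow> ('a, 'k::field_char_0) nc_series) \<Rightarrow> ('g \<Rightarrow>\<^sub>0 'k) \<Rightarrow> ('a, 'k) nc_series" where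
  "lin T f = (\<Sum>x\<in>supp f. nc_scale (gcoeff f x) (T x))"

lemma coeff_lin: "coeff (lin T f) w = ext (\<lambda>x. coeff (T x) w) f"
  by (simp add: lin_def coeff_sum ext_def)

lemma lin_add: "lin T (f + h) = lin T f + lin T h"
  and lin_diff: "lin T (f - h) = lin T f - lin T h"
  and lin_scale: "lin T (gscale c f) = nc_scale c (lin T f)"
  and lin_sum: "lin T (sum F I) = (\<Sum>i\<in>I. lin T (F i))"
  by (rule nc_series_eqI; simp add: coeff_lin ext_add ext_diff ext_scale ext_sum coeff_sum)+

lemma order_ge_lin: "f \<in> galg K \<Longrightarrow> (\<And>x. x \<in> carrier K \<Longrightarrow> order_ge e (T x)) \<Longrightarrow> order_ge e (lin T f)"
  unfolding lin_def by (intro order_ge_sum order_ge_scale) (auto dest: galg_supp)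

lemma (in group) pf_aug_pow:
  assumes "in_aug_pow G m f" "pf G m e T" shows "order_ge (e + m) (lin T f)"
  using assms
proof (induction arbitrary: e T rule: in_aug_pow.induct)
  case (base f)
  then show ?case by (simp add: order_ge_lin[OF base(1)])
next
  case (zero m)
  then show ?case by (simp add: lin_def)
next
  case (add m f h)
  then show ?case by (simp add: lin_add order_ge_add)
next
  case (mult f m h)
  have h: "h \<in> galg G" using in_aug_pow_galg[OF mult(3)] .
  have "order_ge (e + Suc m) (lin T (gdiff x h))" if x: "x \<in> carrier G" for x
  proof -
    have "lin T (gdiff x h) = lin (\<lambda>y. T (x \<otimes> y) - T y) h"
      by (rule nc_series_eqI) (simp add: coeff_lin ext_gdiff[OF h])
    moreover have "order_ge (Suc e + m) (lin (\<lambda>y. T (x \<otimes> y) - T y) h)"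
      by (rule mult(4)) (use mult(5) x in simp)
    ultimately show ?thesis by simp
  qed
  then show ?case
    unfolding gconv_aug_0_eq_sum[OF mult(1,2) h] lin_sum lin_scale
    by (intro order_ge_sum order_ge_scale) (auto dest: galg_supp[OF mult(1)])
qed

section \<open>Isomorphisms of prounipotent groups\<close>

text \<open>A Lie series stands for its exponential.\<close>

definition exp_lie :: "'a set \<Rightarrow> (('a, 'k::field_char_0) nc_series, 'k) prounip" where
  "exp_lie B = \<lparr>carrier = lie_series B, monoid.mult = bch, one = 0, kpow = nc_scale,
     fil = (\<lambda>N. {u \<in> lie_series B. order_ge N u})\<rparr>"

lemma exp_lie_simps [simp]:
  "carrier (exp_lie B) = lie_series B" "u \<otimes>\<^bsub>exp_lie B\<^esub> v = bch u v"
  "kpow (exp_lie B) c u = nc_scale c u" "fil (exp_lie B) N = {u \<in> lie_series B. order_ge N u}"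
  by (simp_all add: exp_lie_def)

text \<open>A morphism is determined by its values on the carrier only; under this condition it may be changed
  elsewhere, so that any inverse can be compared with \<open>the_inv_into\<close>.\<close>

definition prounip_closed :: "('g, 'k) prounip \<Rightarrow> bool" where
  "prounip_closed H \<longleftrightarrow> (\<forall>x\<in>carrier H. \<forall>y\<in>carrier H. x \<otimes>\<^bsub>H\<^esub> y \<in> carrier H) \<and>
     (\<forall>c. \<forall>x\<in>carrier H. kpow H c x \<in> carrier H) \<and> (\<forall>N. fil H N \<subseteq> carrier H)"

lemma prounip_hom_cong:
  assumes G: "prounip_closed G" and eq: "\<And>x. x \<in> carrier G \<Longrightarrow> f x = g x" and g: "g \<in> prounip_hom G H"
  shows "f \<in> prounip_hom G H"
  unfolding prounip_hom_def
proof (intro CollectI conjI allI ballI)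
  show "f \<in> hom G H"
    using G g eq unfolding prounip_closed_def prounip_hom_def hom_def Pi_def by auto
  show "f (kpow G c x) = kpow H c (f x)" if "x \<in> carrier G" for c x
    using G g eq that unfolding prounip_closed_def prounip_hom_def by auto
  fix N
  obtain M where M: "g ` fil G M \<subseteq> fil H N" using g unfolding prounip_hom_def by blast
  have "fil G M \<subseteq> carrier G" using G unfolding prounip_closed_def by blast
  then have "f ` fil G M \<subseteq> fil H N" using M eq by (auto simp: image_subset_iff subset_iff)
  then show "\<exists>M. f ` fil G M \<subseteq> fil H N" by (rule exI[of _ M])
qed

lemma prounip_isoI:
  assumes f: "f \<in> prounip_hom G H" and g: "g \<in> prounip_hom H G" and H: "prounip_closed H"
    and gf: "\<And>x. x \<in> carrier G \<Longrightarrow> g (f x) = x" and fg: "\<And>y. y \<in> carrier H \<Longrightarrow> f (g y) = y"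
  shows "f \<in> prounip_iso G H"
proof -
  have fc: "f x \<in> carrier H" if "x \<in> carrier G" for x
    using f that by (auto simp: prounip_hom_def hom_def)
  have gc: "g y \<in> carrier G" if "y \<in> carrier H" for y
    using g that by (auto simp: prounip_hom_def hom_def)
  have bij: "bij_betw f (carrier G) (carrier H)"
    by (rule bij_betw_byWitness[where f' = g]) (use gf fg fc gc in auto)
  have "the_inv_into (carrier G) f y = g y" if "y \<in> carrier H" for y
    by (rule the_inv_into_f_eq) (use bij that fg gc in \<open>auto simp: bij_betw_def\<close>)
  then have "the_inv_into (carrier G) f \<in> prounip_hom H G"
    by (rule prounip_hom_cong[OF H _ g])
  then show ?thesis using f bij by (simp add: prounip_iso_def)
qed

lemma prounip_iso_bijI:
  assumes f: "f \<in> prounip_hom G H" and inj: "inj_on f (carrier G)"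
    and surj: "\<And>y. y \<in> carrier H \<Longrightarrow> \<exists>x\<in>carrier G. f x = y"
    and fil: "\<And>N. \<exists>M. \<forall>x\<in>carrier G. f x \<in> fil H M \<longrightarrow> x \<in> fil G N"
    and G: "prounip_closed G" and H: "prounip_closed H"
  shows "f \<in> prounip_iso G H"
proof (rule prounip_isoI[OF f])
  let ?g = "the_inv_into (carrier G) f"
  have hom: "\<And>x y. x \<in> carrier G \<Longrightarrow> y \<in> carrier G \<Longrightarrow> f (x \<otimes>\<^bsub>G\<^esub> y) = f x \<otimes>\<^bsub>H\<^esub> f y"
    "\<And>c x. x \<in> carrier G \<Longrightarrow> f (kpow G c x) = kpow H c (f x)"
    using f by (auto simp: prounip_hom_def hom_def)
  have gf: "?g (f x) = x" if "x \<in> carrier G" for x by (rule the_inv_into_f_f[OF inj that])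
  have pre: "\<exists>x\<in>carrier G. y = f x \<and> ?g y = x" if "y \<in> carrier H" for y
    using surj[OF that] gf by auto
  show "?g (f x) = x" if "x \<in> carrier G" for x using gf that .
  show "f (?g y) = y" if "y \<in> carrier H" for y using pre[OF that] by auto
  show "?g \<in> prounip_hom H G"
    unfolding prounip_hom_def
  proof (intro CollectI conjI allI ballI)
    show "?g \<in> hom H G"
    proof (rule homI)
      fix y y' assume "y \<in> carrier H" "y' \<in> carrier H"
      then obtain x x' where *: "x \<in> carrier G" "y = f x" "x' \<in> carrier G" "y' = f x'" using surj by metis
      have "x \<otimes>\<^bsub>G\<^esub> x' \<in> carrier G" using G * by (auto simp: prounip_closed_def)
      from gf[OF this] show "?g (y \<otimes>\<^bsub>H\<^esub> y') = ?g y \<otimes>\<^bsub>G\<^esub> ?g y'" using * by (simp add: hom(1) gf)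
      show "?g y \<in> carrier G" using * gf by simp
    qed
    fix c y assume "y \<in> carrier H"
    then obtain x where *: "x \<in> carrier G" "y = f x" using surj by metis
    have "kpow G c x \<in> carrier G" using G * by (auto simp: prounip_closed_def)
    from gf[OF this] show "?g (kpow H c y) = kpow G c (?g y)" using * by (simp add: hom(2) gf)
  next
    fix N
    obtain M where M: "\<forall>x\<in>carrier G. f x \<in> fil H M \<longrightarrow> x \<in> fil G N" using fil by blast
    have "?g y \<in> fil G N" if "y \<in> fil H M" for y
    proof -
      have "y \<in> carrier H" using H that by (auto simp: prounip_closed_def)
      then obtain x where "x \<in> carrier G" "y = f x" using surj by metis
      then show ?thesis using M that gf by auto
    qed
    then show "\<exists>M. ?g ` fil H M \<subseteq> fil G N" by (intro exI[of _ M]) blast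
  qed
qed (rule H)

lemma prounip_hom_comp:
  assumes "f \<in> prounip_hom G H" "g \<in> prounip_hom H K" shows "g \<circ> f \<in> prounip_hom G K"
  unfolding prounip_hom_def
proof (intro CollectI conjI allI ballI)
  show "g \<circ> f \<in> hom G K" using assms unfolding prounip_hom_def hom_def Pi_def by auto
  show "(g \<circ> f) (kpow G c x) = kpow K c ((g \<circ> f) x)" if "x \<in> carrier G" for c x
    using assms that unfolding prounip_hom_def hom_def Pi_def by auto
  fix N
  obtain M where M: "g ` fil H M \<subseteq> fil K N" using assms(2) unfolding prounip_hom_def by blast
  obtain L where "f ` fil G L \<subseteq> fil H M" using assms(1) unfolding prounip_hom_def by blast
  then have "(g \<circ> f) ` fil G L \<subseteq> fil K N" using M by (auto simp: image_subset_iff)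
  then show "\<exists>M. (g \<circ> f) ` fil G M \<subseteq> fil K N" by (rule exI[of _ L])
qed

lemma prounip_iso_inverse:
  assumes f: "f \<in> prounip_iso G H" and G: "prounip_closed G"
  shows "the_inv_into (carrier G) f \<in> prounip_iso H G"
    and "x \<in> carrier G \<Longrightarrow> the_inv_into (carrier G) f (f x) = x"
    and "y \<in> carrier H \<Longrightarrow> f (the_inv_into (carrier G) f y) = y"
proof -
  have bij: "bij_betw f (carrier G) (carrier H)" using f by (simp add: prounip_iso_def)
  show 1: "the_inv_into (carrier G) f (f x) = x" if "x \<in> carrier G" for x
    using bij that by (simp add: bij_betw_def the_inv_into_f_f)
  show 2: "f (the_inv_into (carrier G) f y) = y" if "y \<in> carrier H" for y
    using bij that by (auto simp: bij_betw_def f_the_inv_into_f)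
  show "the_inv_into (carrier G) f \<in> prounip_iso H G"
    by (rule prounip_isoI[where g = f]) (use f G 1 2 in \<open>auto simp: prounip_iso_def\<close>)
qed

lemma prounip_iso_comp:
  assumes f: "f \<in> prounip_iso G H" and g: "g \<in> prounip_iso H K"
    and cl: "prounip_closed G" "prounip_closed H" "prounip_closed K"
  shows "g \<circ> f \<in> prounip_iso G K"
proof (rule prounip_isoI)
  let ?f = "the_inv_into (carrier G) f" and ?g = "the_inv_into (carrier H) g"
  note fi = prounip_iso_inverse[OF f cl(1)] and gi = prounip_iso_inverse[OF g cl(2)]
  show "g \<circ> f \<in> prounip_hom G K" using f g by (intro prounip_hom_comp) (auto simp: prounip_iso_def)
  show "?f \<circ> ?g \<in> prounip_hom K G" using fi(1) gi(1) by (intro prounip_hom_comp) (auto simp: prounip_iso_def)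
  have "f x \<in> carrier H" if "x \<in> carrier G" for x
    using f that by (auto simp: prounip_iso_def prounip_hom_def hom_def)
  then show "(?f \<circ> ?g) ((g \<circ> f) x) = x" if "x \<in> carrier G" for x using that fi(2) gi(2) by simp
  have "?g y \<in> carrier H" if "y \<in> carrier K" for y
    using gi(1) that by (auto simp: prounip_iso_def prounip_hom_def hom_def)
  then show "(g \<circ> f) ((?f \<circ> ?g) y) = y" if "y \<in> carrier K" for y using that fi(3) gi(3) by simp
qed (rule cl)

lemma prounip_closed_exp_lie: "prounip_closed (exp_lie B)"
  by (auto simp: prounip_closed_def lie_series_bch lie_series_scale)

section \<open>The completion of a group with a Magnus expansion\<close>

context magnus
begin

lemma lin_gconv:
  assumes f: "f \<in> galg G" and h: "h \<in> galg G"
  shows "lin \<rho> (gconv G f h) = lin \<rho> f * lin \<rho> h"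
proof (rule nc_series_eqI)
  fix w
  have "ext (\<lambda>x. ext (\<lambda>y. coeff (\<rho> (x \<otimes> y)) w) h) f =
      ext (\<lambda>x. ext (\<lambda>y. \<Sum>i\<le>length w. coeff (\<rho> x) (take i w) * coeff (\<rho> y) (drop i w)) h) f"
    by (intro ext_cong[OF f] ext_cong[OF h]) (simp add: \<rho>_mult coeff_times)
  then show "coeff (lin \<rho> (gconv G f h)) w = coeff (lin \<rho> f * lin \<rho> h) w"
    by (simp add: coeff_lin ext_gconv coeff_times ext_fun_sum ext_fun_mult ext_fun_mult_right)
qed

lemma lin_gone: "lin \<rho> (gone G) = 1"
  by (rule nc_series_eqI) (simp add: coeff_lin ext_gone \<rho>_one)

lemma lin_mon: "lin \<rho> (gmon x 1) = \<rho> x"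
  by (rule nc_series_eqI) (simp add: coeff_lin ext_mon)

lemma coeff_lin_Nil: "f \<in> galg G \<Longrightarrow> coeff (lin \<rho> f) [] = aug f"
  unfolding coeff_lin aug_eq_ext by (rule ext_cong) (auto simp: \<rho>_Nil)

lemma supported_lin: "f \<in> galg G \<Longrightarrow> supported B (lin \<rho> f)"
  unfolding supported_def
proof (intro allI impI)
  fix w assume f: "f \<in> galg G" and w: "\<not> set w \<subseteq> B"
  have "coeff (lin \<rho> f) w = ext (\<lambda>_. 0) f"
    unfolding coeff_lin by (rule ext_cong[OF f]) (use \<rho>_supported w in \<open>auto simp: supported_def\<close>)
  then show "coeff (lin \<rho> f) w = 0" by (simp add: ext_def)
qed

lemma in_aug_pow_order: "in_aug_pow G m f \<Longrightarrow> order_ge m (lin \<rho> f)"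
proof (induction rule: in_aug_pow.induct)
  case (base f)
  show ?case by simp
next
  case (zero m)
  show ?case by (simp add: lin_def)
next
  case (add m f h)
  then show ?case by (simp add: lin_add order_ge_add)
next
  case (mult f m h)
  have "order_ge 1 (lin \<rho> f)" using mult(1,2) by (simp add: order_ge_1 coeff_lin_Nil)
  then show ?case
    unfolding lin_gconv[OF mult(1) in_aug_pow_galg[OF mult(3)]]
    by (rule order_ge_mult'[OF _ mult(4)]) simp
qed

theorem aug_pow_iff: "f \<in> aug_pow G m \<longleftrightarrow> f \<in> galg G \<and> order_ge m (lin \<rho> f)"
proof
  assume "f \<in> aug_pow G m"
  then show "f \<in> galg G \<and> order_ge m (lin \<rho> f)"
    using in_aug_pow_galg in_aug_pow_order by (auto simp: aug_pow_def)
next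
  assume *: "f \<in> galg G \<and> order_ge m (lin \<rho> f)"
  let ?j = "\<lambda>x. (x, \<one>)"
  have j: "gpush ?j f \<in> galg H" using * by (intro galg_gpush) auto
  have "\<tau> w v (gpush ?j f) = coeff (lin \<rho> f) w * coeff 1 v" for w v
    by (simp add: \<tau>_def ext_gpush ext_fun_mult_right coeff_lin \<rho>_one)
  then have "vanish m (gpush ?j f)"
    using * by (auto simp: vanish_def coeff_one order_ge_def)
  then have "in_aug_pow H m (gpush ?j f)" using j aug_pow_H_iff by blast
  moreover have "fst \<in> hom H G" by (auto simp: hom_def)
  ultimately have "in_aug_pow G m (gpush fst (gpush ?j f))"
    by (rule gpush_in_aug_pow[OF H.is_group is_group, rotated])
  moreover have "gpush fst (gpush ?j f) = f"
    by (rule ext_eqI) (simp add: ext_gpush)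
  ultimately show "f \<in> aug_pow G m" by (simp add: aug_pow_def)
qed

lemma mem_gclass:
  assumes "f \<in> galg G"
  shows "h \<in> gclass G m f \<longleftrightarrow> h \<in> galg G \<and> eq_upto m (lin \<rho> h) (lin \<rho> f)"
  using assms by (auto simp: gclass_def aug_pow_iff lin_diff eq_upto_iff galg_diff)

text \<open>In degree \<open>m\<close>, the coefficient of the error at a word \<open>w\<close> is corrected by a multiple of the product of
  the elements \<open>X b - 1\<close> along \<open>w\<close>, whose expansion begins with \<open>w\<close>.\<close>

lemma ex_galg_upto: "supported B a \<Longrightarrow> \<exists>f\<in>galg G. eq_upto m (lin \<rho> f) a"
proof (induction m)
  case 0
  show ?case using galg_gone by auto
next
  case (Suc m)
  then obtain f where f: "f \<in> galg G" "eq_upto m (lin \<rho> f) a" by blast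
  define e where "e = a - lin \<rho> f"
  have e: "supported B e" "order_ge m e"
    using Suc.prems supported_lin[OF f(1)] f(2) unfolding e_def
    by (auto simp: supported_def eq_upto_def order_ge_def)
  define s where "s b = \<rho> (X b) - 1" for b
  have s: "eq_upto 2 (s b) (nc_var b)" if "b \<in> B" for b
    using \<rho>_X[OF that] unfolding s_def eq_upto_def by auto
  define y :: "'a list \<Rightarrow> ('g \<Rightarrow>\<^sub>0 'k)" where "y w = foldr (\<lambda>b. gdiff (X b)) w (gone G)" for w
  have y: "y w \<in> galg G \<and> lin \<rho> (y w) = word_prod s w" if "set w \<subseteq> B" for w
    using that
  proof (induction w)
    case Nil
    then show ?case by (simp add: y_def galg_gone lin_gone)
  next
    case (Cons b w)
    have g: "gmon (X b) (1::'k) - gone G \<in> galg G"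
      using Cons by (intro galg_diff galg_mon galg_gone) (simp add: X_closed)
    have "y (b # w) = gconv G (gmon (X b) 1 - gone G) (y w)" by (simp add: y_def gdiff_def)
    then show ?case
      using Cons g by (simp add: galg_gconv lin_gconv lin_diff lin_mon lin_gone s_def)
  qed
  let ?W = "{w. set w \<subseteq> B \<and> length w = m}"
  have fin: "finite ?W" using finite_lists_length_eq[OF finB] by simp
  define f' where "f' = f + (\<Sum>w\<in>?W. gscale (coeff e w) (y w))"
  have "f' \<in> galg G"
    unfolding f'_def using f(1) y by (intro galg_add galg_sum galg_scale) auto
  moreover have "eq_upto (Suc m) (lin \<rho> f') a"
  proof -
    have l: "lin \<rho> f' = lin \<rho> f + (\<Sum>w\<in>?W. nc_scale (coeff e w) (word_prod s w))"
      unfolding f'_def lin_add lin_sum lin_scale using y by (auto intro!: sum.cong)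
    have 2: "eq_upto (Suc m) (\<Sum>w\<in>?W. nc_scale (coeff e w) (word_prod s w))
       (\<Sum>w\<in>?W. nc_scale (coeff e w) (word_prod nc_var w))"
      by (intro eq_upto_sum eq_upto_scale) (use word_prod_upto[of B s] s in auto)
    have 3: "eq_upto (Suc m) (\<Sum>w\<in>?W. nc_scale (coeff e w) (word_prod nc_var w)) e"
      unfolding eq_upto_def
    proof (intro allI impI)
      fix v :: "'a list" assume v: "length v < Suc m"
      have "coeff (\<Sum>w\<in>?W. nc_scale (coeff e w) (word_prod nc_var w)) v = (\<Sum>w\<in>?W. if w = v then coeff e w else 0)"
        by (auto simp: coeff_sum coeff_word intro!: sum.cong)
      also have "\<dots> = coeff e v"
        using fin v e by (auto simp: supported_def order_ge_def less_Suc_eq)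
      finally show "coeff (\<Sum>w\<in>?W. nc_scale (coeff e w) (word_prod nc_var w)) v = coeff e v" .
    qed
    have "eq_upto (Suc m) (lin \<rho> f') (lin \<rho> f + e)"
      unfolding l by (rule eq_upto_add[OF eq_upto_refl eq_upto_trans[OF 2 3]])
    then show ?thesis by (simp add: e_def)
  qed
  ultimately show ?case by blast
qed

text \<open>The expansion identifies the completed group algebra with the series in the letters \<open>B\<close>:
  \<open>of_series\<close> maps a series to its residue classes and \<open>to_series\<close> is the inverse map.\<close>

definition of_series :: "('a, 'k) nc_series \<Rightarrow> nat \<Rightarrow> ('g \<Rightarrow>\<^sub>0 'k) set" where
  "of_series a = (\<lambda>m. {h \<in> galg G. eq_upto (Suc m) (lin \<rho> h) a})"

definition to_series :: "(nat \<Rightarrow> ('g \<Rightarrow>\<^sub>0 'k) set) \<Rightarrow> ('a, 'k) nc_series" where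
  "to_series S = Nc_series (\<lambda>w. coeff (lin \<rho> (SOME f. f \<in> S (length w))) w)"

lemma gclass_of_series:
  "f \<in> galg G \<Longrightarrow> eq_upto (Suc m) (lin \<rho> f) a \<Longrightarrow> gclass G (Suc m) f = of_series a m"
  by (auto simp: mem_gclass of_series_def eq_upto_def)

lemma of_series_nonempty: "supported B a \<Longrightarrow> \<exists>f. f \<in> of_series a m"
  using ex_galg_upto[of a "Suc m"] by (auto simp: of_series_def)

lemma to_of_series:
  assumes "supported B a" shows "to_series (of_series a) = a"
proof (rule nc_series_eqI)
  fix w :: "'a list"
  have "(SOME f. f \<in> of_series a (length w)) \<in> of_series a (length w)"
    by (rule someI_ex[OF of_series_nonempty[OF assms]])
  then show "coeff (to_series (of_series a)) w = coeff a w"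
    by (simp add: to_series_def of_series_def eq_upto_def)
qed

lemma to_series_upto:
  assumes X: "\<And>m. S m \<in> gclass G (Suc m) ` galg G" "\<And>m. S (Suc m) \<subseteq> S m" and f: "f \<in> S m"
  shows "f \<in> galg G \<and> eq_upto (Suc m) (to_series S) (lin \<rho> f)"
proof -
  have cls: "g \<in> galg G \<and> eq_upto (Suc k) (lin \<rho> g) (lin \<rho> g')" if "g \<in> S k" "g' \<in> S k" for g g' k
  proof -
    obtain f0 where "f0 \<in> galg G" "S k = gclass G (Suc k) f0" using X(1)[of k] by auto
    then show ?thesis using that by (auto simp: mem_gclass eq_upto_def)
  qed
  have "coeff (to_series S) w = coeff (lin \<rho> f) w" if w: "length w < Suc m" for w
  proof -
    have "S m \<subseteq> S (length w)"
      by (rule lift_Suc_antimono_le[of S, OF X(2)]) (use w in simp)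
    then have f': "f \<in> S (length w)" using f by blast
    then have "(SOME f. f \<in> S (length w)) \<in> S (length w)" by (rule someI)
    from cls[OF this f'] show ?thesis by (simp add: to_series_def eq_upto_def)
  qed
  then show ?thesis using cls[OF f f] by (simp add: eq_upto_def)
qed

lemma of_to_series:
  assumes X: "\<And>m. S m \<in> gclass G (Suc m) ` galg G" "\<And>m. S (Suc m) \<subseteq> S m"
  shows "S = of_series (to_series S)" "supported B (to_series S)"
proof -
  have ne: "\<exists>f. f \<in> S m" for m
  proof -
    obtain f where "f \<in> galg G" "S m = gclass G (Suc m) f" using X(1)[of m] by auto
    then show ?thesis by (auto simp: mem_gclass)
  qed
  have "S m = of_series (to_series S) m" for m
  proof -
    obtain f where f: "f \<in> galg G" "S m = gclass G (Suc m) f" using X(1)[of m] by auto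
    then have "f \<in> S m" by (simp add: mem_gclass)
    then have "eq_upto (Suc m) (lin \<rho> f) (to_series S)"
      by (intro eq_upto_sym[OF conjunct2[OF to_series_upto[OF X]]])
    then show ?thesis using f gclass_of_series by simp
  qed
  then show "S = of_series (to_series S)" by (rule HOL.ext)
  show "supported B (to_series S)"
    unfolding supported_def
  proof (intro allI impI)
    fix w assume w: "\<not> set w \<subseteq> B"
    obtain f where f: "f \<in> S (length w)" using ne by blast
    have "coeff (to_series S) w = coeff (lin \<rho> f) w"
      using to_series_upto[OF X f] by (simp add: eq_upto_def)
    also have "\<dots> = 0" using supported_lin to_series_upto[OF X f] w by (simp add: supported_def)
    finally show "coeff (to_series S) w = 0" .
  qed
qed

lemma \<rho>_inv: "x \<in> carrier G \<Longrightarrow> \<rho> (inv x) * \<rho> x = 1" "x \<in> carrier G \<Longrightarrow> \<rho> x * \<rho> (inv x) = 1"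
  using \<rho>_mult[of "inv x" x] \<rho>_mult[of x "inv x"] by (simp_all add: \<rho>_one)

lemma \<rho>_log_derivative: "x \<in> carrier G \<Longrightarrow> nc_euler (\<rho> x) * \<rho> (inv x) \<in> lie_series B"
proof -
  assume x: "x \<in> carrier G"
  obtain u where u: "u \<in> lie_series B" "\<rho> x = nc_exp u" using \<rho>_exp[OF x] by blast
  have "nc_euler (\<rho> x) * \<rho> (inv x) = nc_dexp u * (\<rho> x * \<rho> (inv x))"
    using euler_exp_eq_dexp[OF lie_series_order[OF u(1)]] u(2) by (simp add: mult.assoc)
  then show ?thesis using \<rho>_inv(2)[OF x] lie_series_dexp[OF u(1)] by simp
qed

lemma euler_lin: "nc_euler (lin T f) = lin (\<lambda>x. nc_euler (T x)) f"
  by (rule nc_series_eqI) (simp add: coeff_lin ext_fun_mult)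

text \<open>The linear extension of \<open>(x, y) \<mapsto> N(\<rho> x) (\<rho> x)\<^sup>-\<^sup>1 \<rho> y\<close>, with \<open>N\<close> the Euler derivation, is small on
  powers of the augmentation ideal, so its values on the coproduct of \<open>f\<close> and on \<open>f \<otimes> f\<close> agree up to
  the given order. These values are the two sides below.\<close>

lemma group_like_euler:
  assumes f: "f \<in> galg G" and gl: "gcoprod f - gtensor f f \<in> aug_pow H m"
  shows "eq_upto m (nc_euler (lin \<rho> f)) (lin (\<lambda>x. nc_euler (\<rho> x) * \<rho> (inv x)) f * lin \<rho> f)"
proof -
  define T where "T = (\<lambda>(x, y). nc_euler (\<rho> x) * \<rho> (inv x) * \<rho> y)"
  let ?L = "\<lambda>x. nc_euler (\<rho> x) * \<rho> (inv x)"
  have "pf H m (0 + 0 + 0) (\<lambda>z. nc_euler (\<rho> (fst z)) * \<rho> (inv (fst z)) * \<rho> (snd z))"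
    by (intro pf_mult pf_euler pf_mult_hom pf_mult_antihom H.is_group)
      (auto simp: \<rho>_mult inv_mult_group \<rho>_const)
  then have "pf H m 0 T" by (simp add: T_def split_def)
  then have "order_ge (0 + m) (lin T (gcoprod f - gtensor f f))"
    using gl by (intro H.pf_aug_pow) (simp_all add: aug_pow_def)
  then have "eq_upto m (lin T (gcoprod f)) (lin T (gtensor f f))"
    by (simp add: lin_diff eq_upto_iff)
  moreover have "lin T (gcoprod f) = nc_euler (lin \<rho> f)"
  proof (rule nc_series_eqI)
    fix w
    have "ext (\<lambda>x. coeff (T (x, x)) w) f = ext (\<lambda>x. coeff (nc_euler (\<rho> x)) w) f"
      by (rule ext_cong[OF f]) (simp add: T_def mult.assoc \<rho>_inv)
    then show "coeff (lin T (gcoprod f)) w = coeff (nc_euler (lin \<rho> f)) w"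
      unfolding euler_lin coeff_lin ext_gcoprod .
  qed
  moreover have "lin T (gtensor f f) = lin ?L f * lin \<rho> f"
  proof (rule nc_series_eqI)
    fix w
    have "ext (\<lambda>x. ext (\<lambda>y. coeff (?L x * \<rho> y) w) f) f =
        (\<Sum>i\<le>length w. ext (\<lambda>x. coeff (?L x) (take i w)) f * ext (\<lambda>y. coeff (\<rho> y) (drop i w)) f)"
      by (simp only: coeff_times[of "?L _" "\<rho> _"] ext_fun_sum ext_fun_mult ext_fun_mult_right)
    then show "coeff (lin T (gtensor f f)) w = coeff (lin ?L f * lin \<rho> f) w"
      unfolding coeff_times[of "lin ?L f"] coeff_lin ext_gtensor T_def prod.case .
  qed
  ultimately show ?thesis by simp
qed

text \<open>The series \<open>Y = N a a\<^sup>-\<^sup>1\<close> agrees up to every degree with a linear combination of logarithmic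
  derivatives \<open>N(\<rho> x) (\<rho> x)\<^sup>-\<^sup>1\<close>, hence is a Lie series; then so is \<open>log a\<close>.\<close>

lemma completion_carrier_imp_exp:
  assumes S: "S \<in> completion_carrier G"
  obtains u where "u \<in> lie_series B" "S = of_series (nc_exp u)"
proof -
  have X: "S m \<in> gclass G (Suc m) ` galg G" "S (Suc m) \<subseteq> S m" for m
    using S by (auto simp: completion_carrier_def)
  have gl: "aug f = 1" "gcoprod f - gtensor f f \<in> aug_pow H (Suc m)" if "f \<in> S m" for f m
    using S that by (auto simp: completion_carrier_def)
  define a where "a = to_series S"
  have a: "S = of_series a" "supported B a" using of_to_series[OF X] by (auto simp: a_def)
  have ex: "\<exists>f. f \<in> S m" for m using of_series_nonempty[OF a(2)] a(1) by simp
  have aS: "f \<in> galg G" "eq_upto (Suc m) a (lin \<rho> f)" if "f \<in> S m" for f m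
    using to_series_upto[OF X that] by (auto simp: a_def)
  have "coeff a [] = 1"
  proof -
    obtain f where f: "f \<in> S 0" using ex by blast
    have "coeff a [] = coeff (lin \<rho> f) []" using aS(2)[OF f] by (simp add: eq_upto_def)
    then show ?thesis using gl(1)[OF f] aS(1)[OF f] by (simp add: coeff_lin_Nil)
  qed
  then have a1: "order_ge 1 (a - 1)" by (simp add: order_ge_1 coeff_one)
  define u where "u = nc_log a"
  have u: "order_ge 1 u" "nc_exp u = a"
    using order_ge_log[OF a1] nc_exp_log[OF a1] by (simp_all add: u_def)
  define Y where "Y = nc_euler a * nc_exp (- u)"
  have Ya: "nc_euler (nc_exp u) = Y * nc_exp u"
    using nc_exp_minus(2)[OF u(1)] by (simp add: Y_def u(2) mult.assoc)
  have "Y \<in> lie_series B"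
    unfolding lie_series_def
  proof (intro CollectI allI)
    fix d
    obtain f where f: "f \<in> S d" using ex by blast
    define D where "D = lin (\<lambda>x. nc_euler (\<rho> x) * \<rho> (inv x)) f"
    have "D \<in> lie_series B"
      unfolding D_def lin_def using aS(1)[OF f]
      by (intro lie_series_sum lie_series_scale \<rho>_log_derivative) (auto dest: galg_supp)
    have "eq_upto (Suc d) (nc_euler a) (nc_euler (lin \<rho> f))"
      using aS(2)[OF f] by (simp add: eq_upto_def)
    also have "eq_upto (Suc d) (nc_euler (lin \<rho> f)) (D * lin \<rho> f)"
      unfolding D_def by (rule group_like_euler[OF aS(1)[OF f] gl(2)[OF f]])
    also have "eq_upto (Suc d) (D * lin \<rho> f) (D * a)"
      by (intro eq_upto_mult eq_upto_refl eq_upto_sym[OF aS(2)[OF f]])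
    finally have "eq_upto (Suc d) Y (D * a * nc_exp (- u))"
      unfolding Y_def by (intro eq_upto_mult eq_upto_refl)
    also have "D * a * nc_exp (- u) = D"
      using nc_exp_minus(1)[OF u(1)] by (simp add: u(2)[symmetric] mult.assoc)
    finally have "nc_part d Y = nc_part d D" by (rule part_eq_upto) simp
    then show "nc_part d Y \<in> lie_poly B" using \<open>D \<in> lie_series B\<close> by (simp add: lie_series_def)
  qed
  then have "u \<in> lie_series B"
    using free_lie.hat_log[OF u(1) _ Ya] by (simp add: lie_series_hat)
  then show ?thesis using that a(1) u(2) by blast
qed

lemma exp_in_completion_carrier:
  assumes u: "u \<in> lie_series B"
  shows "of_series (nc_exp u) \<in> completion_carrier G"
  unfolding completion_carrier_def
proof (intro CollectI conjI allI ballI)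
  let ?a = "nc_exp u"
  have sup: "supported B ?a" by (intro supported_exp supported_lie_series u)
  have gl: "shuffle_coeff ?a w v = coeff ?a w * coeff ?a v" for w v
    by (rule shuffle_coeff_exp[OF u])
  fix m
  obtain f where "f \<in> galg G" "eq_upto (Suc m) (lin \<rho> f) ?a" using ex_galg_upto[OF sup] by blast
  then show "of_series ?a m \<in> gclass G (Suc m) ` galg G"
    using gclass_of_series[of f m ?a] by blast
  show "of_series ?a (Suc m) \<subseteq> of_series ?a m"
    by (auto simp: of_series_def eq_upto_def)
  fix f assume "f \<in> of_series ?a m"
  then have f: "f \<in> galg G" "eq_upto (Suc m) (lin \<rho> f) ?a" by (auto simp: of_series_def)
  have "aug f = coeff ?a []" using f by (simp add: coeff_lin_Nil[symmetric] eq_upto_def)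
  then show "aug f = 1"
    using order_ge_exp[OF lie_series_order[OF u]] by (simp add: order_ge_1 coeff_one)
  have "vanish (Suc m) (gcoprod f - gtensor f f)"
    unfolding vanish_def
  proof (intro allI impI)
    fix w v :: "'a list" assume l: "length w + length v < Suc m"
    have "\<tau> w v (gcoprod f) = ext (\<lambda>x. shuffle_coeff (\<rho> x) w v) f"
      unfolding \<tau>_def ext_gcoprod prod.case
    proof (rule ext_cong[OF f(1)])
      fix x assume "x \<in> carrier G"
      from \<rho>_exp[OF this] obtain u' where "u' \<in> lie_series B" "\<rho> x = nc_exp u'" by blast
      then show "coeff (\<rho> x) w * coeff (\<rho> x) v = shuffle_coeff (\<rho> x) w v"
        using shuffle_coeff_exp[of u' B w v] by simp
    qed
    also have "\<dots> = shuffle_coeff (lin \<rho> f) w v"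
      by (simp add: lin_def shuffle_coeff_sum shuffle_coeff_scale ext_def)
    also have "\<dots> = shuffle_coeff ?a w v"
      by (rule shuffle_coeff_cong) (use f(2) l in \<open>simp add: eq_upto_def\<close>)
    also have "\<dots> = coeff (lin \<rho> f) w * coeff (lin \<rho> f) v"
      unfolding gl using f(2) l by (simp add: eq_upto_def)
    also have "\<dots> = \<tau> w v (gtensor f f)"
      by (simp add: \<tau>_def ext_gtensor ext_fun_mult ext_fun_mult_right coeff_lin)
    finally show "\<tau> w v (gcoprod f - gtensor f f) = 0" by (simp add: \<tau>_diff)
  qed
  then show "gcoprod f - gtensor f f \<in> aug_pow H (Suc m)"
    using f(1) by (simp add: aug_pow_def aug_pow_H_iff galg_diff galg_gcoprod galg_gtensor)
qed

lemma completion_simps: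
  "carrier (completion G) = completion_carrier G"
  "Z \<otimes>\<^bsub>completion G\<^esub> Z' = (\<lambda>m. \<Union>f\<in>Z m. \<Union>h\<in>Z' m. gclass G (Suc m) (gconv G f h))"
  "kpow (completion G) c Z = (\<lambda>m. \<Union>f\<in>Z m. gclass G (Suc m)
     (\<Sum>j\<le>m. gscale (c gchoose j) ((gconv G (f - gone G) ^^ j) (gone G))))"
  "fil (completion G) N = {Z \<in> completion_carrier G. \<forall>m<N. Z m = gclass G (Suc m) (gone G)}"
  by (simp_all add: completion_def gscale_def)

lemma of_series_mult:
  assumes "supported B a" "supported B b"
  shows "of_series a \<otimes>\<^bsub>completion G\<^esub> of_series b = of_series (a * b)"
proof (rule HOL.ext)
  fix m
  have "gclass G (Suc m) (gconv G f h) = of_series (a * b) m"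
    if "f \<in> of_series a m" "h \<in> of_series b m" for f h
    using that
    by (intro gclass_of_series) (auto simp: of_series_def lin_gconv galg_gconv intro!: eq_upto_mult)
  then show "(of_series a \<otimes>\<^bsub>completion G\<^esub> of_series b) m = of_series (a * b) m"
    using of_series_nonempty[OF assms(1), of m] of_series_nonempty[OF assms(2), of m]
    unfolding completion_simps by auto
qed

lemma of_series_kpow:
  assumes a: "supported B a" "order_ge 1 (a - 1)"
  shows "kpow (completion G) c (of_series a) = of_series (nc_exp (nc_scale c (nc_log a)))"
proof (rule HOL.ext)
  fix m
  have "gclass G (Suc m) (\<Sum>j\<le>m. gscale (c gchoose j) ((gconv G (f - gone G) ^^ j) (gone G))) =
      of_series (nc_exp (nc_scale c (nc_log a))) m" if "f \<in> of_series a m" for f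
  proof (rule gclass_of_series)
    have f: "f \<in> galg G" "eq_upto (Suc m) (lin \<rho> f) a" using that by (auto simp: of_series_def)
    have fg: "f - gone G \<in> galg G" by (intro galg_diff f galg_gone)
    have pow: "(gconv G (f - gone G) ^^ j) (gone G) \<in> galg G \<and>
        lin \<rho> ((gconv G (f - gone G) ^^ j) (gone G)) = (lin \<rho> f - 1) ^ j" for j
    proof (induction j)
      case 0
      then show ?case by (simp add: galg_gone lin_gone)
    next
      case (Suc j)
      then show ?case using fg by (simp add: galg_gconv lin_gconv lin_diff lin_gone)
    qed
    show "(\<Sum>j\<le>m. gscale (c gchoose j) ((gconv G (f - gone G) ^^ j) (gone G))) \<in> galg G"
      using pow by (intro galg_sum galg_scale) blast
    have "lin \<rho> (\<Sum>j\<le>m. gscale (c gchoose j) ((gconv G (f - gone G) ^^ j) (gone G))) =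
      (\<Sum>j<Suc m. nc_scale (fps_nth (fps_binomial c) j) ((lin \<rho> f - 1) ^ j))"
      unfolding lin_sum lin_scale lessThan_Suc_atMost using pow by simp
    also have "eq_upto (Suc m) \<dots> (\<Sum>j<Suc m. nc_scale (fps_nth (fps_binomial c) j) ((a - 1) ^ j))"
    proof (intro eq_upto_sum eq_upto_scale)
      fix j
      have d: "eq_upto (Suc m) (lin \<rho> f - 1) (a - 1)" using f(2) by (simp add: eq_upto_def)
      show "eq_upto (Suc m) ((lin \<rho> f - 1) ^ j) ((a - 1) ^ j)"
        by (induction j) (simp_all add: eq_upto_mult d)
    qed
    also have "eq_upto (Suc m) \<dots> (ev (fps_binomial c) (a - 1))"
      by (rule eq_upto_sym[OF ev_upto[OF a(2)]])
    also have "ev (fps_binomial c) (a - 1) = nc_exp (nc_scale c (nc_log a))"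
      by (rule nc_pow_binomial[OF a(2), symmetric])
    finally show "eq_upto (Suc m) (lin \<rho> (\<Sum>j\<le>m. gscale (c gchoose j) ((gconv G (f - gone G) ^^ j) (gone G))))
       (nc_exp (nc_scale c (nc_log a)))" .
  qed
  then show "kpow (completion G) c (of_series a) m = of_series (nc_exp (nc_scale c (nc_log a))) m"
    using of_series_nonempty[OF a(1), of m] unfolding completion_simps by blast
qed

lemma of_series_fil:
  assumes a: "supported B a"
  shows "(\<forall>m<N. of_series a m = gclass G (Suc m) (gone G)) \<longleftrightarrow> order_ge N (a - 1)"
proof -
  have "of_series a m = gclass G (Suc m) (gone G) \<longleftrightarrow> eq_upto (Suc m) a 1" for m
  proof
    assume eq: "of_series a m = gclass G (Suc m) (gone G)"
    have "gone G \<in> gclass G (Suc m) (gone G :: 'g \<Rightarrow>\<^sub>0 'k)" by (simp add: mem_gclass galg_gone)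
    then have "gone G \<in> of_series a m" using eq by simp
    then show "eq_upto (Suc m) a 1" by (auto simp: of_series_def lin_gone eq_upto_def)
  next
    assume "eq_upto (Suc m) a 1"
    then show "of_series a m = gclass G (Suc m) (gone G)"
      by (intro gclass_of_series[symmetric] galg_gone) (simp add: lin_gone eq_upto_sym)
  qed
  moreover have "(\<forall>m<N. eq_upto (Suc m) a 1) \<longleftrightarrow> order_ge N (a - 1)"
  proof
    assume *: "\<forall>m<N. eq_upto (Suc m) a 1"
    show "order_ge N (a - 1)"
      unfolding eq_upto_iff[symmetric] eq_upto_def using * unfolding eq_upto_def by blast
  next
    assume "order_ge N (a - 1)"
    then show "\<forall>m<N. eq_upto (Suc m) a 1"
      unfolding eq_upto_iff[symmetric] by (auto simp: eq_upto_def)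
  qed
  ultimately show ?thesis by simp
qed

lemma to_completion_of_series: "x \<in> carrier G \<Longrightarrow> to_completion G x = of_series (\<rho> x)"
  unfolding to_completion_def
  by (rule HOL.ext) (simp add: gclass_of_series galg_mon lin_mon)

lemma exp_supported: "u \<in> lie_series B \<Longrightarrow> supported B (nc_exp u)"
  by (intro supported_exp supported_lie_series)

lemma prounip_closed_completion:
  "prounip_closed (completion G :: (nat \<Rightarrow> ('g \<Rightarrow>\<^sub>0 'k) set, 'k) prounip)"
  unfolding prounip_closed_def
proof (intro conjI allI ballI)
  fix x y :: "nat \<Rightarrow> ('g \<Rightarrow>\<^sub>0 'k) set" and c :: 'k
  assume "x \<in> carrier (completion G)"
  then obtain u where u: "u \<in> lie_series B" "x = of_series (nc_exp u)"
    using completion_carrier_imp_exp by (auto simp: completion_simps)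
  have ord: "order_ge 1 u" by (rule lie_series_order[OF u(1)])
  have "kpow (completion G) c x = of_series (nc_exp (nc_scale c u))"
    unfolding u(2) of_series_kpow[OF exp_supported[OF u(1)] order_ge_exp[OF ord order_refl]]
    by (simp add: nc_log_exp[OF ord])
  then show "kpow (completion G) c x \<in> carrier (completion G)"
    by (simp add: completion_simps exp_in_completion_carrier lie_series_scale u)
  assume "y \<in> carrier (completion G)"
  then obtain v where v: "v \<in> lie_series B" "y = of_series (nc_exp v)"
    using completion_carrier_imp_exp by (auto simp: completion_simps)
  have "x \<otimes>\<^bsub>completion G\<^esub> y = of_series (nc_exp (bch u v))"
    unfolding u(2) v(2) of_series_mult[OF exp_supported[OF u(1)] exp_supported[OF v(1)]]
    by (simp add: exp_bch ord lie_series_order[OF v(1)])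
  then show "x \<otimes>\<^bsub>completion G\<^esub> y \<in> carrier (completion G)"
    by (simp add: completion_simps exp_in_completion_carrier lie_series_bch u v)
qed (auto simp: completion_simps)

text \<open>Under the expansion, the filtration of the completion and the binomial powers become the order
  filtration and the scaling of logarithms.\<close>

theorem completion_iso: "(\<lambda>u. of_series (nc_exp u)) \<in> prounip_iso (exp_lie B) (completion G)"
proof (rule prounip_isoI[where g = "\<lambda>S. nc_log (to_series S)"])
  have log: "nc_log (to_series (of_series (nc_exp u))) = u" if "u \<in> lie_series B" for u
    using that by (simp add: to_of_series exp_supported nc_log_exp lie_series_order)
  have mult: "of_series (nc_exp u) \<otimes>\<^bsub>completion G\<^esub> of_series (nc_exp v) = of_series (nc_exp (bch u v))"
    if "u \<in> lie_series B" "v \<in> lie_series B" for u v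
    using that by (simp add: of_series_mult exp_supported exp_bch lie_series_order)
  have kpow: "kpow (completion G) c (of_series (nc_exp u)) = of_series (nc_exp (nc_scale c u))"
    if "u \<in> lie_series B" for c u
    unfolding of_series_kpow[OF exp_supported[OF that] order_ge_exp[OF lie_series_order[OF that] order_refl]]
    by (simp add: nc_log_exp[OF lie_series_order[OF that]])
  have fil: "of_series (nc_exp u) \<in> fil (completion G) N \<longleftrightarrow> order_ge N (nc_exp u - 1)"
    if "u \<in> lie_series B" for u N
    using that of_series_fil[OF exp_supported[OF that]]
    by (simp add: completion_simps exp_in_completion_carrier)
  have car: "S \<in> carrier (completion G) \<Longrightarrow> \<exists>u\<in>lie_series B. S = of_series (nc_exp u)" for S
    using completion_carrier_imp_exp by (simp add: completion_simps) blast
  show "prounip_closed (completion G :: (nat \<Rightarrow> ('g \<Rightarrow>\<^sub>0 'k) set, 'k) prounip)" by (rule prounip_closed_completion)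
  show "(\<lambda>u. of_series (nc_exp u)) \<in> prounip_hom (exp_lie B) (completion G)"
    unfolding prounip_hom_def
  proof (intro CollectI conjI allI ballI)
    show "(\<lambda>u. of_series (nc_exp u)) \<in> hom (exp_lie B) (completion G)"
      by (rule homI) (simp_all add: mult completion_simps(1) exp_in_completion_carrier)
    show "of_series (nc_exp (kpow (exp_lie B) c u)) = kpow (completion G) c (of_series (nc_exp u))"
      if "u \<in> carrier (exp_lie B)" for c u
      using that kpow by simp
    fix N
    have "of_series (nc_exp u) \<in> fil (completion G) N" if "u \<in> lie_series B" "order_ge (Suc N) u" for u
      unfolding fil[OF that(1)] by (rule order_ge_mono[OF order_ge_exp[OF that(2)]]) simp_all
    then have "(\<lambda>u. of_series (nc_exp u)) ` fil (exp_lie B) (Suc N) \<subseteq> fil (completion G) N" by auto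
    then show "\<exists>M. (\<lambda>u. of_series (nc_exp u)) ` fil (exp_lie B) M \<subseteq> fil (completion G) N" by blast
  qed
  show "(\<lambda>S. nc_log (to_series S)) \<in> prounip_hom (completion G) (exp_lie B)"
    unfolding prounip_hom_def
  proof (intro CollectI conjI allI ballI)
    show "(\<lambda>S. nc_log (to_series S)) \<in> hom (completion G) (exp_lie B)"
    proof (rule homI)
      fix S S' :: "nat \<Rightarrow> ('g \<Rightarrow>\<^sub>0 'k) set"
      assume "S \<in> carrier (completion G)" "S' \<in> carrier (completion G)"
      then obtain u v where "u \<in> lie_series B" "S = of_series (nc_exp u)"
        "v \<in> lie_series B" "S' = of_series (nc_exp v)" using car by blast
      then show "nc_log (to_series S) \<in> carrier (exp_lie B)"
        "nc_log (to_series (S \<otimes>\<^bsub>completion G\<^esub> S')) = nc_log (to_series S) \<otimes>\<^bsub>exp_lie B\<^esub> nc_log (to_series S')"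
        by (simp_all add: mult log lie_series_bch)
    qed
    fix c :: 'k and S :: "nat \<Rightarrow> ('g \<Rightarrow>\<^sub>0 'k) set"
    assume "S \<in> carrier (completion G)"
    then obtain u where "u \<in> lie_series B" "S = of_series (nc_exp u)" using car by blast
    then show "nc_log (to_series (kpow (completion G) c S)) = kpow (exp_lie B) c (nc_log (to_series S))"
      by (simp add: kpow log lie_series_scale)
  next
    fix N
    have "nc_log (to_series S) \<in> fil (exp_lie B) N" if S: "S \<in> fil (completion G) (Suc N)" for S
    proof -
      have "S \<in> carrier (completion G)" using S by (simp add: completion_simps)
      then obtain u where u: "u \<in> lie_series B" "S = of_series (nc_exp u)" using car by blast
      then have "order_ge (Suc N) (nc_exp u - 1)" using S fil by simp
      then have "order_ge (Suc N) (nc_log (nc_exp u))" by (rule order_ge_log) simp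
      then have "order_ge (Suc N) u" using u(1) by (simp add: nc_log_exp lie_series_order)
      then have "order_ge N u" by (rule order_ge_mono) simp
      then show ?thesis using u by (simp add: log)
    qed
    then have "(\<lambda>S. nc_log (to_series S)) ` fil (completion G) (Suc N) \<subseteq> fil (exp_lie B) N" by blast
    then show "\<exists>M. (\<lambda>S. nc_log (to_series S)) ` fil (completion G) M \<subseteq> fil (exp_lie B) N" by blast
  qed
  show "nc_log (to_series (of_series (nc_exp x))) = x" if "x \<in> carrier (exp_lie B)" for x
    using that log by simp
  fix S :: "nat \<Rightarrow> ('g \<Rightarrow>\<^sub>0 'k) set" assume "S \<in> carrier (completion G)"
  then obtain u where "u \<in> lie_series B" "S = of_series (nc_exp u)" using car by blast
  then show "of_series (nc_exp (nc_log (to_series S))) = S" by (simp add: log)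
qed

end

section \<open>Automorphisms of the group of exponentials of Lie series\<close>

lemma eq_upto_power: "eq_upto d f g \<Longrightarrow> eq_upto d (f ^ m) (g ^ m)"
  by (induction m) (simp_all add: eq_upto_mult)

lemma eq_upto_exp: "eq_upto d f g \<Longrightarrow> eq_upto d (nc_exp f) (nc_exp g)"
  using eq_upto_power[of d f g] by (simp add: eq_upto_def nc_exp_def)

lemma eq_upto_log: "eq_upto d f g \<Longrightarrow> eq_upto d (nc_log f) (nc_log g)"
  using eq_upto_power[OF eq_upto_diff[OF _ eq_upto_refl[of d 1]], of f g]
  by (simp add: eq_upto_def nc_log_def)

lemma eq_upto_bch: "eq_upto d u u' \<Longrightarrow> eq_upto d v v' \<Longrightarrow> eq_upto d (bch u v) (bch u' v')"
  unfolding bch_def by (intro eq_upto_log eq_upto_mult eq_upto_exp)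

lemma exp_leading:
  assumes d: "1 \<le> d" and u: "order_ge d u"
  shows "eq_upto (Suc d) (nc_exp u - 1) u"
  unfolding eq_upto_def
proof (intro allI impI)
  fix w :: "'a list" assume w: "length w < Suc d"
  have pow: "coeff (u ^ m) w = 0" if "m \<noteq> 0" "m \<noteq> 1" for m
  proof -
    have "m = m - 2 + 2" using that by arith
    then obtain l where "m = Suc (Suc l)" by (metis add_2_eq_Suc')
    then have "u ^ m = u * u * u ^ l" by (simp add: mult.assoc)
    moreover have "order_ge (Suc d) (u * u * u ^ l)"
      by (intro order_ge_mult_right order_ge_mult'[OF u u]) (use d in simp)
    ultimately show ?thesis using w by (simp add: order_ge_def)
  qed
  have "coeff (nc_exp u) w = (\<Sum>m\<le>length w. coeff (u ^ m) w / fact m)" by (simp add: nc_exp_def Nc_series_inverse)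
  also have "\<dots> = (\<Sum>m\<in>{0, 1}. coeff (u ^ m) w / fact m)"
  proof (cases "w = []")
    case True
    then show ?thesis using order_ge_mono[OF u d] by (simp add: order_ge_1)
  next
    case False
    then have "1 \<le> length w" by (cases w) simp_all
    then show ?thesis by (intro sum.mono_neutral_right) (auto simp: pow)
  qed
  finally show "coeff (nc_exp u - 1) w = coeff u w" by simp
qed

lemma order_ge_cong: "eq_upto d f g \<Longrightarrow> order_ge d g \<Longrightarrow> order_ge d f"
  by (simp add: eq_upto_def order_ge_def)

lemma eq_upto_of_exp:
  assumes d: "1 \<le> d" and u: "order_ge 1 u" and e: "eq_upto (Suc d) (nc_exp u - 1) p" and p: "order_ge d p"
  shows "eq_upto (Suc d) u p"
proof -
  have "order_ge d (nc_exp u - 1)" by (rule order_ge_cong[OF eq_upto_mono[OF e] p]) simp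
  then have "order_ge d (nc_log (nc_exp u))" by (rule order_ge_log[OF _ d])
  then have "order_ge d u" by (simp add: nc_log_exp[OF u])
  then show ?thesis using eq_upto_trans[OF eq_upto_sym[OF exp_leading[OF d]] e] by blast
qed

lemma bch_leading:
  assumes d: "1 \<le> d" and u: "order_ge d u" and v: "order_ge d v"
  shows "eq_upto (Suc d) (bch u v) (u + v)"
proof (rule eq_upto_of_exp[OF d])
  have 1: "order_ge 1 u" "order_ge 1 v" using order_ge_mono[OF u d] order_ge_mono[OF v d] .
  show "order_ge 1 (bch u v)" "order_ge d (u + v)" by (intro exp_bch 1, intro order_ge_add u v)
  let ?E = "nc_exp u - 1" and ?F = "nc_exp v - 1"
  have "nc_exp (bch u v) - 1 = (?E + ?F) + ?E * ?F" by (simp add: exp_bch[OF 1] algebra_simps)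
  moreover have "eq_upto (Suc d) ((?E + ?F) + ?E * ?F) ((u + v) + 0)"
  proof (intro eq_upto_add exp_leading d u v)
    have "order_ge (Suc d) (?E * ?F)"
      by (rule order_ge_mult'[OF order_ge_exp[OF u d] order_ge_exp[OF v d]]) (use d in simp)
    then show "eq_upto (Suc d) (?E * ?F) 0" by (simp add: order_ge_iff)
  qed
  ultimately show "eq_upto (Suc d) (nc_exp (bch u v) - 1) (u + v)" by (simp only: add_0_right)
qed

text \<open>With \<open>E = exp k - 1\<close> and \<open>F = exp l - 1\<close>, the exponential of the group commutator is
  \<open>1 + [E, F] exp (- k) exp (- l)\<close>, and \<open>[E, F]\<close> has the same leading term as \<open>[k, l]\<close>.\<close>

lemma group_commutator_leading:
  assumes d: "1 \<le> d" "1 \<le> e" and k: "order_ge d k" "eq_upto (Suc d) k p"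
    and l: "order_ge e l" "eq_upto (Suc e) l q"
  shows "eq_upto (Suc (d + e)) (bch (bch k l) (bch (- k) (- l))) (commutator p q)"
proof (rule eq_upto_of_exp)
  have 1: "order_ge 1 k" "order_ge 1 l" using order_ge_mono[OF k(1) d(1)] order_ge_mono[OF l(1) d(2)] .
  note m1 = order_ge_minus[OF 1(1)] and m2 = order_ge_minus[OF 1(2)]
  note b = exp_bch[OF 1] and b' = exp_bch[OF m1 m2]
  note c = exp_bch[OF b(1) b'(1)]
  show "1 \<le> d + e" using d by simp
  show "order_ge 1 (bch (bch k l) (bch (- k) (- l)))" by (rule c(1))
  have p: "order_ge d p" by (rule order_ge_cong[OF eq_upto_sym[OF eq_upto_mono[OF k(2)]] k(1)]) simp
  have q: "order_ge e q" by (rule order_ge_cong[OF eq_upto_sym[OF eq_upto_mono[OF l(2)]] l(1)]) simp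
  show pq: "order_ge (d + e) (commutator p q)" by (rule order_ge_commutator[OF p q])
  let ?E = "nc_exp k - 1" and ?F = "nc_exp l - 1" and ?W = "nc_exp (- k) * nc_exp (- l)"
  have E: "order_ge d ?E" "order_ge (Suc d) (?E - p)"
    using order_ge_exp[OF k(1) d(1)] eq_upto_trans[OF exp_leading[OF d(1) k(1)] k(2)] by (simp_all add: eq_upto_iff)
  have F: "order_ge e ?F" "order_ge (Suc e) (?F - q)"
    using order_ge_exp[OF l(1) d(2)] eq_upto_trans[OF exp_leading[OF d(2) l(1)] l(2)] by (simp_all add: eq_upto_iff)
  have EF: "order_ge (d + e) (commutator ?E ?F)" by (rule order_ge_commutator[OF E(1) F(1)])
  have W: "order_ge 1 (?W - 1)" using order_ge_exp[OF b'(1) order_refl] by (simp add: b'(2))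
  have "nc_exp l * nc_exp k * ?W = nc_exp l * (nc_exp k * nc_exp (- k)) * nc_exp (- l)"
    by (simp only: mult.assoc)
  then have "nc_exp l * nc_exp k * ?W = 1" using nc_exp_minus[OF 1(1)] nc_exp_minus[OF 1(2)] by simp
  then have "nc_exp (bch (bch k l) (bch (- k) (- l))) - 1 = nc_exp k * nc_exp l * ?W - nc_exp l * nc_exp k * ?W"
    by (simp add: c(2) b(2) b'(2))
  also have "\<dots> = commutator ?E ?F * ?W" by (simp add: commutator_def algebra_simps)
  also have "\<dots> - commutator p q =
      commutator ?E ?F * (?W - 1) + (commutator (?E - p) ?F + commutator p (?F - q))"
    by (simp add: commutator_diff_left commutator_diff_right right_diff_distrib)
  finally have eq: "nc_exp (bch (bch k l) (bch (- k) (- l))) - 1 - commutator p q = \<dots>" .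
  have "order_ge (Suc (d + e)) (commutator (?E - p) ?F)" "order_ge (Suc (d + e)) (commutator p (?F - q))"
    using order_ge_commutator[OF E(2) F(1)] order_ge_commutator[OF p F(2)] by simp_all
  moreover have "order_ge (Suc (d + e)) (commutator ?E ?F * (?W - 1))"
    by (rule order_ge_mult'[OF EF W]) simp
  ultimately show "eq_upto (Suc (d + e)) (nc_exp (bch (bch k l) (bch (- k) (- l))) - 1) (commutator p q)"
    unfolding eq_upto_iff eq by (intro order_ge_add)
qed

text \<open>The letters generate the group of exponentials of Lie series topologically, because every
  bracket of letters is the leading term of a group commutator. Continuous morphisms that are
  compatible with powers are therefore determined by the images of the letters.\<close>

theorem prounip_hom_unique:
  fixes \<theta> \<eta> :: "('a, 'k::field_char_0) nc_series \<Rightarrow> ('b, 'k) nc_series"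
  assumes \<theta>: "\<theta> \<in> prounip_hom (exp_lie B) (exp_lie C)" and \<eta>: "\<eta> \<in> prounip_hom (exp_lie B) (exp_lie C)"
    and eq: "\<And>b. b \<in> B \<Longrightarrow> \<theta> (nc_var b) = \<eta> (nc_var b)" and u: "u \<in> lie_series B"
  shows "\<theta> u = \<eta> u"
proof -
  have hom: "f (bch v w) = bch (f v) (f w)" "f (nc_scale c v) = nc_scale c (f v)" "f v \<in> lie_series C"
    if "f \<in> {\<theta>, \<eta>}" "v \<in> lie_series B" "w \<in> lie_series B" for f v w c
    using \<theta> \<eta> that by (auto simp: prounip_hom_def hom_def)
  define K where "K = {v \<in> lie_series B. \<theta> v = \<eta> v}"
  have K_bch: "bch v w \<in> K" if "v \<in> K" "w \<in> K" for v w
    using that hom[of \<theta> v w] hom[of \<eta> v w] by (auto simp: K_def lie_series_bch)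
  have K_scale: "nc_scale c v \<in> K" if "v \<in> K" for c v
    using that hom(2)[of \<theta> v v c] hom(2)[of \<eta> v v c] by (auto simp: K_def lie_series_scale)
  have K_minus: "- v \<in> K" if "v \<in> K" for v using K_scale[OF that, of "- 1"] by simp
  have K_0: "0 \<in> K" using hom(2)[of \<theta> 0 0 0] hom(2)[of \<eta> 0 0 0] by (simp add: K_def)
  \<comment> \<open>leading terms of degree \<open>d\<close> of elements of \<open>K\<close>\<close>
  define S where "S d = {p. \<exists>k\<in>K. order_ge d k \<and> eq_upto (Suc d) k p}" for d
  have S_0: "0 \<in> S d" for d unfolding S_def using K_0 by (intro CollectI bexI[of _ 0]) simp_all
  have S_add: "p + q \<in> S d" if d: "1 \<le> d" and p: "p \<in> S d" and q: "q \<in> S d" for p q d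
  proof -
    obtain k l where kl: "k \<in> K" "order_ge d k" "eq_upto (Suc d) k p" "l \<in> K" "order_ge d l" "eq_upto (Suc d) l q"
      using p q by (auto simp: S_def)
    have b: "eq_upto (Suc d) (bch k l) (k + l)" by (rule bch_leading[OF d kl(2,5)])
    have "order_ge d (bch k l)"
      by (rule order_ge_cong[OF eq_upto_mono[OF b] order_ge_add[OF kl(2,5)]]) simp
    then show ?thesis
      unfolding S_def using K_bch[OF kl(1,4)] eq_upto_trans[OF b eq_upto_add[OF kl(3,6)]] by blast
  qed
  have S_scale: "nc_scale c p \<in> S d" if "p \<in> S d" for c p d
    using that K_scale order_ge_scale eq_upto_scale unfolding S_def by blast
  have S_comm: "commutator p q \<in> S (d + e)" if d: "1 \<le> d" "1 \<le> e" and p: "p \<in> S d" and q: "q \<in> S e" for p q d e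
  proof -
    obtain k l where kl: "k \<in> K" "order_ge d k" "eq_upto (Suc d) k p" "l \<in> K" "order_ge e l" "eq_upto (Suc e) l q"
      using p q by (auto simp: S_def)
    let ?c = "bch (bch k l) (bch (- k) (- l))"
    have b: "eq_upto (Suc (d + e)) ?c (commutator p q)"
      by (rule group_commutator_leading[OF d kl(2,3,5,6)])
    have p: "order_ge d p" by (rule order_ge_cong[OF eq_upto_sym[OF eq_upto_mono[OF kl(3)]] kl(2)]) simp
    have q: "order_ge e q" by (rule order_ge_cong[OF eq_upto_sym[OF eq_upto_mono[OF kl(6)]] kl(5)]) simp
    have "order_ge (d + e) ?c"
      by (rule order_ge_cong[OF eq_upto_mono[OF b] order_ge_commutator[OF p q]]) simp
    then show ?thesis unfolding S_def using b K_bch[OF K_bch[OF kl(1,4)] K_bch[OF K_minus[OF kl(1)] K_minus[OF kl(4)]]]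
      by blast
  qed
  have S_sum: "sum f I \<in> S d" if "1 \<le> d" "\<And>i. i \<in> I \<Longrightarrow> f i \<in> S d" for f d and I :: "nat set"
    using that by (induction I rule: infinite_finite_induct) (simp_all add: S_0 S_add)
  have part_0: "nc_part 0 p = 0" if "p \<in> lie_poly B" for p :: "('a, 'k) nc_series"
    using lie_poly_const[OF that] by (intro nc_series_eqI) (simp add: nc_part.rep_eq zero_nc_series.rep_eq)
  have S_lie: "1 \<le> d \<Longrightarrow> nc_part d p \<in> S d" if "p \<in> lie_poly B" for p d
    using that
  proof (induction arbitrary: d rule: lie_poly.induct)
    case 1
    then show ?case by (simp add: S_0)
  next
    case (2 b)
    have v: "nc_part d (nc_var b :: ('a, 'k) nc_series) = (if d = 1 then nc_var b else 0)"
      by (rule nc_series_eqI) (auto simp: nc_part.rep_eq nc_var.rep_eq zero_nc_series.rep_eq One_nat_def)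
    have K: "nc_var b \<in> K" using 2(1) eq by (simp add: K_def lie_series_var)
    have "nc_var b \<in> S 1"
      unfolding S_def by (intro CollectI bexI[of _ "nc_var b"] conjI order_ge_var eq_upto_refl K)
    then show ?case unfolding v by (simp add: S_0)
  next
    case (3 p q)
    then show ?case by (simp add: part_add S_add)
  next
    case (4 p c)
    then show ?case by (simp add: part_scale S_scale)
  next
    case (5 p q)
    show ?case
      unfolding part_commutator
    proof (rule S_sum[OF 5(5)])
      fix i assume i: "i \<in> {..d}"
      show "commutator (nc_part i p) (nc_part (d - i) q) \<in> S d"
      proof (cases "i = 0 \<or> i = d")
        case True
        then show ?thesis using part_0[OF 5(1)] part_0[OF 5(2)] by (auto simp: S_0)
      next
        case False
        then have "1 \<le> i" "1 \<le> d - i" "i + (d - i) = d" using i by auto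
        from S_comm[OF this(1,2) 5(3)[OF this(1)] 5(4)[OF this(2)]] this(3) show ?thesis by (simp only:)
      qed
    qed
  qed
  \<comment> \<open>split off on the left elements on which the two morphisms agree, leaving a factor of high order\<close>
  have approx: "\<exists>k\<in>K. \<exists>w\<in>lie_series B. u = bch k w \<and> order_ge (Suc d) w" for d
  proof (induction d)
    case 0
    show ?case using K_0 u lie_series_order[OF u] by (intro bexI[of _ 0] bexI[of _ u]) (simp_all add: One_nat_def)
  next
    case (Suc d)
    then obtain k w where kw: "k \<in> K" "w \<in> lie_series B" "u = bch k w" "order_ge (Suc d) w" by blast
    have "nc_part (Suc d) w \<in> lie_poly B" using kw(2) by (simp add: lie_series_def)
    from S_lie[OF this, of "Suc d"] have "nc_part (Suc d) w \<in> S (Suc d)" by (simp add: part_part)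
    then obtain k' where k': "k' \<in> K" "order_ge (Suc d) k'" "eq_upto (Suc (Suc d)) k' (nc_part (Suc d) w)"
      by (auto simp: S_def)
    have "eq_upto (Suc (Suc d)) (nc_part (Suc d) w) w"
      using kw(4) by (auto simp: eq_upto_def order_ge_def nc_part.rep_eq less_Suc_eq)
    from eq_upto_trans[OF k'(3) this] have e: "eq_upto (Suc (Suc d)) k' w" .
    define w' where "w' = bch (- k') w"
    have L: "k \<in> lie_series B" "k' \<in> lie_series B" "w' \<in> lie_series B"
      using kw k' by (auto simp: K_def w'_def lie_series_bch lie_series_minus)
    note o = lie_series_order[OF L(1)] lie_series_order[OF L(2)] lie_series_order[OF L(3)]
      lie_series_order[OF kw(2)]
    have "bch k' w' = bch (bch k' (- k')) w"
      unfolding w'_def by (rule bch_assoc[symmetric]) (intro o order_ge_minus)+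
    then have "w = bch k' w'" using o by (simp add: bch_minus)
    then have "u = bch (bch k k') w'" unfolding kw(3) using bch_assoc[OF o(1-3)] by simp
    moreover have "eq_upto (Suc (Suc d)) w' (- k' + w)"
      unfolding w'_def by (intro bch_leading order_ge_minus k'(2) kw(4)) (simp add: One_nat_def)
    then have "order_ge (Suc (Suc d)) w'"
      by (rule order_ge_cong) (use e in \<open>simp add: eq_upto_def order_ge_def\<close>)
    ultimately show ?case using K_bch[OF kw(1) k'(1)] L(3) by blast
  qed
  show ?thesis
  proof (rule eq_upto_eqI)
    fix N
    obtain M where M: "\<theta> ` fil (exp_lie B) M \<subseteq> fil (exp_lie C) N" using \<theta> unfolding prounip_hom_def by blast
    obtain M' where M': "\<eta> ` fil (exp_lie B) M' \<subseteq> fil (exp_lie C) N" using \<eta> unfolding prounip_hom_def by blast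
    obtain k w where kw: "k \<in> K" "w \<in> lie_series B" "u = bch k w" "order_ge (Suc (max M M')) w"
      using approx by blast
    have "order_ge M w" "order_ge M' w" by (rule order_ge_mono[OF kw(4)]; simp)+
    then have "\<theta> w \<in> fil (exp_lie C) N" "\<eta> w \<in> fil (exp_lie C) N" using M M' kw(2) by auto
    then have z: "eq_upto N (\<theta> w) (\<eta> w)" by (auto simp: eq_upto_def order_ge_def)
    have k: "k \<in> lie_series B" "\<theta> k = \<eta> k" using kw(1) by (auto simp: K_def)
    have "\<theta> u = bch (\<eta> k) (\<theta> w)" "\<eta> u = bch (\<eta> k) (\<eta> w)"
      unfolding kw(3) using hom(1)[of \<theta> k w] hom(1)[of \<eta> k w] k kw(2) by simp_all
    then show "eq_upto N (\<theta> u) (\<eta> u)" using eq_upto_bch[OF eq_upto_refl z] by simp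
  qed
qed

text \<open>A substitution that fixes the letters modulo order two changes no leading term, so it can be
  inverted degree by degree.\<close>

locale near_identity =
  fixes B :: "'a set" and r :: "'a \<Rightarrow> ('a, 'k::field_char_0) nc_series"
  assumes finB: "finite B" and r_lie: "b \<in> B \<Longrightarrow> r b \<in> lie_series B"
    and r_upto: "b \<in> B \<Longrightarrow> eq_upto 2 (r b) (nc_var b)"
begin

sublocale substitution B r
  by (rule substitution.intro[OF finB lie_series_order[OF r_lie]])

abbreviation \<alpha> :: "('a, 'k) nc_series \<Rightarrow> ('a, 'k) nc_series" where "\<alpha> \<equiv> nc_subst B r"

lemma \<alpha>_lie: "u \<in> lie_series B \<Longrightarrow> \<alpha> u \<in> lie_series B"
  by (rule subst_lie_series[OF r_lie])

lemma \<alpha>_leading: "u \<in> lie_series B \<Longrightarrow> order_ge d u \<Longrightarrow> eq_upto (Suc d) (\<alpha> u) u"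
  by (rule subst_leading[OF finB r_upto supported_lie_series])

lemma \<alpha>_order: "u \<in> lie_series B \<Longrightarrow> order_ge d (\<alpha> u) \<Longrightarrow> order_ge d u"
proof (induction d)
  case (Suc d)
  then have "order_ge d u" using order_ge_mono[of "Suc d" "\<alpha> u" d] by simp
  from order_ge_cong[OF eq_upto_sym[OF \<alpha>_leading[OF Suc(2) this]] Suc(3)] show ?case .
qed simp

text \<open>The leading part of the error is not changed by \<open>\<alpha>\<close>, so adding it to the approximation removes it.\<close>

primrec approx :: "('a, 'k) nc_series \<Rightarrow> nat \<Rightarrow> ('a, 'k) nc_series" where
  "approx y 0 = 0"
| "approx y (Suc d) = approx y d + nc_part d (y - \<alpha> (approx y d))"

lemma approx:
  assumes y: "y \<in> lie_series B"
  shows "approx y d \<in> lie_series B \<and> eq_upto d (\<alpha> (approx y d)) y"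
proof (induction d)
  case (Suc d)
  let ?e = "y - \<alpha> (approx y d)"
  have e: "?e \<in> lie_series B" "order_ge d ?e"
    using Suc y \<alpha>_lie by (simp_all add: lie_series_diff eq_upto_def order_ge_def)
  have p: "nc_part d ?e \<in> lie_series B" using e(1) lie_poly_subset_series by (auto simp: lie_series_def)
  have pe: "eq_upto (Suc d) (nc_part d ?e) ?e"
    using e(2) by (auto simp: eq_upto_def order_ge_def nc_part.rep_eq less_Suc_eq)
  have "order_ge d (nc_part d ?e)" by (simp add: order_ge_def nc_part.rep_eq)
  from eq_upto_trans[OF \<alpha>_leading[OF p this] pe] have "eq_upto (Suc d) (\<alpha> (nc_part d ?e)) ?e" .
  from eq_upto_add[OF eq_upto_refl[of _ "\<alpha> (approx y d)"] this]
  have "eq_upto (Suc d) (\<alpha> (approx y (Suc d))) y" by (simp add: subst_add)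
  then show ?case using Suc p by (simp add: lie_series_add)
qed simp

lemma \<alpha>_surj: assumes y: "y \<in> lie_series B" shows "\<exists>u\<in>lie_series B. \<alpha> u = y"
proof -
  let ?F = "\<lambda>d. nc_part d (y - \<alpha> (approx y d))"
  have o: "order_ge d (?F d)" for d by (simp add: order_ge_def nc_part.rep_eq)
  have F: "?F d \<in> lie_series B" for d
    using lie_series_diff[OF y \<alpha>_lie[OF conjunct1[OF approx[OF y, of d]]]] lie_poly_subset_series
    by (auto simp: lie_series_def)
  define u where "u = nc_sum ?F"
  have "u \<in> lie_series B"
    unfolding u_def lie_series_hat by (rule hat_nc_sum[OF subspace_lie_poly o F[unfolded lie_series_hat]])
  moreover have "\<alpha> u = y"
  proof (rule eq_upto_eqI)
    fix d
    have "approx y d = (\<Sum>i<d. ?F i)" by (induction d) simp_all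
    then have "eq_upto d u (approx y d)" unfolding u_def using nc_sum_upto[of ?F d, OF o] by simp
    then show "eq_upto d (\<alpha> u) y"
      by (rule eq_upto_trans[OF subst_cong_upto conjunct2[OF approx[OF y]]])
  qed
  ultimately show ?thesis by blast
qed

theorem subst_prounip_iso: "\<alpha> \<in> prounip_iso (exp_lie B) (exp_lie B)"
proof (rule prounip_iso_bijI)
  show "\<alpha> \<in> prounip_hom (exp_lie B) (exp_lie B)"
    unfolding prounip_hom_def
  proof (intro CollectI conjI allI ballI)
    show "\<alpha> \<in> hom (exp_lie B) (exp_lie B)"
      by (rule homI) (simp_all add: \<alpha>_lie subst_bch lie_series_order)
    show "\<alpha> (kpow (exp_lie B) c u) = kpow (exp_lie B) c (\<alpha> u)" for c u by (simp add: subst_scale)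
    show "\<exists>M. \<alpha> ` fil (exp_lie B) M \<subseteq> fil (exp_lie B) N" for N
      by (rule exI[of _ N]) (auto simp: \<alpha>_lie subst_order)
  qed
  show "inj_on \<alpha> (carrier (exp_lie B))"
  proof (rule inj_onI)
    fix u v assume uv: "u \<in> carrier (exp_lie B)" "v \<in> carrier (exp_lie B)" "\<alpha> u = \<alpha> v"
    then have "order_ge d (\<alpha> (u - v))" for d by (simp add: subst_diff)
    then have "order_ge d (u - v)" for d using uv \<alpha>_order[of "u - v" d] by (simp add: lie_series_diff)
    then have "eq_upto d u v" for d by (simp add: eq_upto_iff)
    then show "u = v" by (rule eq_upto_eqI)
  qed
  show "\<exists>u\<in>carrier (exp_lie B). \<alpha> u = y" if "y \<in> carrier (exp_lie B)" for y using \<alpha>_surj that by simp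
  show "\<exists>M. \<forall>u\<in>carrier (exp_lie B). \<alpha> u \<in> fil (exp_lie B) M \<longrightarrow> u \<in> fil (exp_lie B) N" for N
    by (rule exI[of _ N]) (auto simp: \<alpha>_order)
qed (rule prounip_closed_exp_lie)+

end

section \<open>The group of exponentials of the free ideal\<close>

lemma exp_f_simps [simp]:
  "carrier (exp_f n) = f_hat n" "X \<otimes>\<^bsub>exp_f n\<^esub> Y = X \<otimes>\<^bsub>exp_t {0..n}\<^esub> Y"
  "kpow (exp_f n) c X = kpow (exp_t {0..n}) c X" "fil (exp_f n) N = fil (exp_t {0..n}) N \<inter> f_hat n"
  by (simp_all add: exp_f_def)

lemma f_hat_eq: "f_hat n = kd_class {0..n} ` lie_series (fgens n)"
  by (simp add: f_hat_def)

lemma lie_series_fgens: "u \<in> lie_series (fgens n) \<Longrightarrow> u \<in> lie_t {0..n}"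
  by (rule lie_series_mono[OF fgens_subset])

lemma prounip_closed_exp_f: "prounip_closed (exp_f n :: ('k::field_char_0 kd, 'k) prounip)"
  by (auto simp: prounip_closed_def f_hat_eq exp_t_mult exp_t_kpow lie_series_fgens lie_series_bch lie_series_scale)

lemma kd_class_inj:
  assumes "u \<in> lie_series (fgens n)" "v \<in> lie_series (fgens n)" "kd_class {0..n} u = kd_class {0..n} v"
  shows "u = v"
proof -
  have "kd.congr {0..n} u v" using assms kd_class_eq lie_series_fgens by blast
  then have "u - v \<in> kd_ideal_hat {0..n}" by (simp add: kd_congr_iff)
  then show ?thesis using kd_free[OF lie_series_diff[OF assms(1,2)]] by simp
qed

text \<open>No nonzero Lie series in the \<open>x\<^sub>i\<close> is a relation; applied to homogeneous parts, this shows that a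
  class has order at least \<open>N\<close> only if its representative in the \<open>x\<^sub>i\<close> has.\<close>

theorem kd_class_prounip_iso:
  "(kd_class {0..n} :: (nat \<times> nat, 'k::field_char_0) nc_series \<Rightarrow> 'k kd) \<in> prounip_iso (exp_lie (fgens n)) (exp_f n)"
  (is "?c \<in> _")
proof (rule prounip_iso_bijI)
  have fil: "?c u \<in> fil (exp_f n) N \<longleftrightarrow> order_ge N u" if u: "u \<in> lie_series (fgens n)" for u N
  proof
    assume "order_ge N u"
    moreover have "u \<in> ?c u" using kd_congr_refl[OF lie_series_fgens[OF u]] by (simp add: mem_kd_class)
    ultimately show "?c u \<in> fil (exp_f n) N"
      using u lie_series_fgens[OF u] by (auto simp: exp_t_fil f_hat_eq)
  next
    assume "?c u \<in> fil (exp_f n) N"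
    then obtain w where w: "w \<in> ?c u" "order_ge N w" by (auto simp: exp_t_fil)
    have "nc_part d u = 0" if "d < N" for d
    proof (rule kd_free)
      show "nc_part d u \<in> lie_series (fgens n)" using u lie_poly_subset_series by (auto simp: lie_series_def)
      have "u - w \<in> kd_ideal_hat {0..n}" using w(1) by (simp add: mem_kd_class kd_congr_iff)
      then have "nc_part d (u - w) \<in> kd_ideal {0..n}" by (simp add: kd_ideal_hat_def)
      then have "nc_part d u \<in> kd_ideal {0..n}" using w(2) that by (simp add: part_diff order_ge_parts)
      then show "nc_part d u \<in> kd_ideal_hat {0..n}" by (simp add: kd_ideal_hat_def part_part kd_ideal.zero)
    qed
    then show "order_ge N u" by (simp add: order_ge_parts)
  qed
  show "?c \<in> prounip_hom (exp_lie (fgens n)) (exp_f n)"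
    unfolding prounip_hom_def
  proof (intro CollectI conjI allI ballI)
    show "?c \<in> hom (exp_lie (fgens n)) (exp_f n)"
      by (rule homI) (auto simp: f_hat_eq exp_t_mult lie_series_fgens)
    show "?c (kpow (exp_lie (fgens n)) c u) = kpow (exp_f n) c (?c u)" if "u \<in> carrier (exp_lie (fgens n))" for c u
      using that by (simp add: exp_t_kpow lie_series_fgens)
    show "\<exists>M. ?c ` fil (exp_lie (fgens n)) M \<subseteq> fil (exp_f n) N" for N
      using fil[of _ N] by (intro exI[of _ N]) (auto simp del: exp_f_simps)
  qed
  show "inj_on ?c (carrier (exp_lie (fgens n)))" by (rule inj_onI) (simp add: kd_class_inj)
  show "\<exists>u\<in>carrier (exp_lie (fgens n)). ?c u = Y" if "Y \<in> carrier (exp_f n)" for Y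
    using that by (auto simp: f_hat_eq)
  show "\<exists>M. \<forall>u\<in>carrier (exp_lie (fgens n)). ?c u \<in> fil (exp_f n) M \<longrightarrow> u \<in> fil (exp_lie (fgens n)) N" for N
    using fil[of _ N] by (intro exI[of _ N]) (auto simp del: exp_f_simps)
qed (rule prounip_closed_exp_lie prounip_closed_exp_f)+

section \<open>The free subgroup of the pure braid group\<close>

lemma group_pure_braid: "group (pure_braid_group n)"
  unfolding pure_braid_group_def by (rule braid.subgroup_imp_group[OF pure_subgroup])

lemma pure_gen_in_pure_braid:
  assumes k: "k \<in> {1..n}" shows "pure_gen n 0 k \<in> carrier (pure_braid_group n)"
proof -
  let ?L = "lists ({0..<n} \<times> UNIV)"
  let ?u = "map (\<lambda>k. (k, True)) (rev [0..<k - 1])" and ?s = "[(k - 1, True), (k - 1, True)]"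
  have u: "?u \<in> ?L" "?s \<in> ?L" "word_inv ?u \<in> ?L"
    using k by (auto intro!: word_inv_lists)
  note e = pres_eq_word_inv[OF u(1), of "braid_rels n"]
  have "braid_class n (word_inv ?u) \<otimes>\<^bsub>braid_group n\<^esub> braid_class n ?u = \<one>\<^bsub>braid_group n\<^esub>"
    unfolding braid_class_mult[OF u(3,1)] using pres_class_eqI[OF e]
    by (simp add: braid_class_def braid_group_def)
  then have inv: "inv\<^bsub>braid_group n\<^esub> (braid_class n ?u) = braid_class n (word_inv ?u)"
    by (rule braid.inv_equality) (intro braid_class_carrier u)+
  have sq: "sigma n (k - 1) \<otimes>\<^bsub>braid_group n\<^esub> sigma n (k - 1) = braid_class n ?s"
    unfolding sigma_def using k by (subst braid_class_mult) auto
  have pg: "pure_gen n 0 k = braid_class n (word_inv ?u @ ?s @ ?u)"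
    unfolding pure_gen_def Let_def inv sq using u by (simp add: braid_class_mult del: map_eq_Cons_conv)
  have "word_perm (word_inv ?u) \<circ> word_perm ?u = id"
    using word_perm_pres_eq[OF e] by (simp only: word_perm_append) (simp add: word_perm_def)
  moreover have "word_perm ?s = id" by (simp add: word_perm_def)
  ultimately have perm: "word_perm (word_inv ?u @ ?s @ ?u) = id"
    by (simp only: word_perm_append id_comp)
  have mem: "word_inv ?u @ ?s @ ?u \<in> ?L" using u by simp
  have "word_perm w = id" if "w \<in> braid_class n (word_inv ?u @ ?s @ ?u)" for w
  proof -
    have "pres_eq {0..<n} (braid_rels n) (word_inv ?u @ ?s @ ?u) w"
      using that by (simp add: braid_class_def pres_class_def)
    from word_perm_pres_eq[OF this] show ?thesis using perm by simp
  qed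
  then show ?thesis
    unfolding pg pure_braid_group_def using braid_class_carrier[OF mem] by simp
qed

lemma pure_gens_subset: "pure_gen n 0 ` {1..n} \<subseteq> carrier (pure_braid_group n)"
  using pure_gen_in_pure_braid by blast

lemma free_subgroup_subgroup: "subgroup (carrier (free_subgroup n)) (pure_braid_group n)"
  unfolding free_subgroup_def
  using group.generate_is_subgroup[OF group_pure_braid pure_gens_subset] by simp

lemma group_free_subgroup: "group (free_subgroup n)"
  using group.subgroup_imp_group[OF group_pure_braid free_subgroup_subgroup[of n]]
  by (simp add: free_subgroup_def)

lemma free_subgroup_simps:
  "carrier (free_subgroup n) = generate (pure_braid_group n) (pure_gen n 0 ` {1..n})"
  "x \<otimes>\<^bsub>free_subgroup n\<^esub> y = x \<otimes>\<^bsub>braid_group n\<^esub> y"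
  "\<one>\<^bsub>free_subgroup n\<^esub> = \<one>\<^bsub>braid_group n\<^esub>"
  by (simp_all add: free_subgroup_def pure_braid_group_def)

lemma free_subgroup_generated:
  "carrier (free_subgroup n) = generate (free_subgroup n) (pure_gen n 0 ` {1..n})"
proof -
  let ?K = "pure_gen n 0 ` {1..n}"
  have "?K \<subseteq> carrier (free_subgroup n)" unfolding free_subgroup_simps by (auto intro: generate.incl)
  from group.generate_consistent[OF group_pure_braid this free_subgroup_subgroup]
  have "generate (free_subgroup n) ?K = generate (pure_braid_group n) ?K"
    by (simp add: free_subgroup_def)
  then show ?thesis by (simp only: free_subgroup_simps(1))
qed

lemma Ad_upto:
  assumes u: "order_ge 1 u" and x: "order_ge 1 x" shows "eq_upto 2 (nc_Ad u x) x"
proof -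
  let ?E = "nc_exp u - 1" and ?F = "nc_exp (- u) - 1"
  have o: "order_ge 1 ?E" "order_ge 1 ?F"
    using order_ge_exp[OF u order_refl] order_ge_exp[OF order_ge_minus[OF u] order_refl] .
  have "nc_Ad u x - x = ?E * (x * nc_exp (- u)) + x * ?F"
    unfolding exp_conj_eq_Ad[OF u, symmetric] by (simp add: algebra_simps)
  moreover have "order_ge 2 (?E * (x * nc_exp (- u)) + x * ?F)"
    by (intro order_ge_add order_ge_mult'[OF o(1) order_ge_mult_right[OF x]] order_ge_mult'[OF x o(2)]) simp_all
  ultimately show ?thesis by (simp only: eq_upto_iff)
qed

section \<open>The morphism defined by an associator\<close>

context braid_representation
begin

definition conj_log :: "nat \<Rightarrow> (nat \<times> nat, 'k) nc_series" where
  "conj_log k = (SOME u. u \<in> lie_series (fgens n) \<and>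
     mu_tilde n F \<mu>R P (pure_gen n 0 k) = (kd_class {0..n} (nc_Ad u (tgen 0 k)), id))"

lemma conj_log:
  assumes k: "k \<in> {1..n}"
  shows "conj_log k \<in> lie_series (fgens n)"
    and "mu_tilde n F \<mu>R P (pure_gen n 0 k) = (kd_class {0..n} (nc_Ad (conj_log k) (tgen 0 k)), id)"
proof -
  obtain v :: "(nat \<times> nat, 'k) nc_series" where v: "v \<in> lie_t {0..n}"
    "mu_tilde n F \<mu>R P (pure_gen n 0 k) = (kd_class {0..n} (nc_Ad v (tgen 0 k)), id)"
    using mu_tilde_pure_gen(2)[OF k] by blast
  obtain u where u: "u \<in> lie_series (fgens n)" "kd.congr {0..n} (nc_Ad v (tgen 0 k)) (nc_Ad u (tgen 0 k))"
    using tangential_conjugation[OF k v(1)] by blast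
  have "\<exists>u. u \<in> lie_series (fgens n) \<and>
     mu_tilde n F \<mu>R P (pure_gen n 0 k) = (kd_class {0..n} (nc_Ad u (tgen 0 k)), id)"
    using u v(2) kd_class_eqI[OF u(2)] by auto
  from someI_ex[OF this] show "conj_log k \<in> lie_series (fgens n)"
    "mu_tilde n F \<mu>R P (pure_gen n 0 k) = (kd_class {0..n} (nc_Ad (conj_log k) (tgen 0 k)), id)"
    unfolding conj_log_def by blast+
qed

text \<open>The image of a generator is \<open>exp\<close> of a conjugate of \<open>x\<^sub>k\<close>; this is its logarithm.\<close>

definition image_log :: "nat \<times> nat \<Rightarrow> (nat \<times> nat, 'k) nc_series" where
  "image_log b = nc_Ad (conj_log (snd b)) (nc_var b)"

lemma image_log:
  assumes b: "b \<in> fgens n"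
  shows "image_log b \<in> lie_series (fgens n)" and "eq_upto 2 (image_log b) (nc_var b)"
    and "mu_tilde n F \<mu>R P (pure_gen n 0 (snd b)) = (kd_class {0..n} (image_log b), id)"
proof -
  obtain k where k: "k \<in> {1..n}" "b = (0, k)" using b by auto
  have x: "(nc_var b :: (nat \<times> nat, 'k) nc_series) \<in> lie_series (fgens n)" by (rule lie_series_var[OF b])
  show "image_log b \<in> lie_series (fgens n)"
    unfolding image_log_def using k conj_log(1)[OF k(1)] x by (simp add: lie_series_Ad)
  show "eq_upto 2 (image_log b) (nc_var b)"
    unfolding image_log_def using k conj_log(1)[OF k(1)] by (intro Ad_upto order_ge_var lie_series_order) simp
  show "mu_tilde n F \<mu>R P (pure_gen n 0 (snd b)) = (kd_class {0..n} (image_log b), id)"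
    using conj_log(2)[OF k(1)] by (simp add: image_log_def k(2) tgen_def)
qed

sublocale \<mu>: group_hom "braid_group n" \<Gamma> "mu_tilde n F \<mu>R P"
  by unfold_locales (rule mu_tilde_hom)

lemma image_subgroup: "subgroup (f_hat n \<times> {id}) \<Gamma>"
proof (rule exp_t_sym.subgroupI)
  have sub: "f_hat n \<subseteq> kd_hat {0..n}" by (auto simp: f_hat_eq lie_series_fgens)
  show "f_hat n \<times> {id} \<subseteq> carrier \<Gamma>" using sub by (auto simp: permutes_id)
  have "kd_class {0..n} 0 \<in> (f_hat n :: 'k kd set)" by (simp add: f_hat_eq)
  then show "(f_hat n :: 'k kd set) \<times> {id :: nat \<Rightarrow> nat} \<noteq> {}" by blast
  fix a :: "'k kd \<times> (nat \<Rightarrow> nat)" assume "a \<in> f_hat n \<times> {id}"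
  then obtain u where u: "u \<in> lie_series (fgens n)" "a = (kd_class {0..n} u, id)" by (auto simp: f_hat_eq)
  have m: "kd_class {0..n} (- u) \<in> f_hat n" using u by (simp add: f_hat_eq lie_series_minus)
  have "inv\<^bsub>\<Gamma>\<^esub> a = (kd_class {0..n} (- u), id)"
  proof (rule exp_t_sym.inv_equality)
    have "kd_class {0..n} (- u) \<otimes>\<^bsub>E\<^esub> kd_class {0..n} u = kd_class {0..n} (0 :: (nat \<times> nat, 'k) nc_series)"
      using u by (simp add: exp_t_mult lie_series_fgens lie_series_minus bch_minus lie_series_order)
    moreover have "perm_act {0..n} id (kd_class {0..n} u) = kd_class {0..n} u"
      using u by (intro perm_act_id) (simp_all add: lie_series_fgens)
    ultimately show "(kd_class {0..n} (- u), id) \<otimes>\<^bsub>\<Gamma>\<^esub> a = \<one>\<^bsub>\<Gamma>\<^esub>"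
      unfolding u(2) exp_t_sym_simps by simp
  qed (use u m sub in \<open>auto simp: permutes_id lie_series_fgens\<close>)
  then show "inv\<^bsub>\<Gamma>\<^esub> a \<in> f_hat n \<times> {id}" using m by simp
  fix a' :: "'k kd \<times> (nat \<Rightarrow> nat)" assume "a' \<in> f_hat n \<times> {id}"
  then obtain v where v: "v \<in> lie_series (fgens n)" "a' = (kd_class {0..n} v, id)" by (auto simp: f_hat_eq)
  have "perm_act {0..n} id (kd_class {0..n} v) = kd_class {0..n} v"
    using v by (intro perm_act_id) (simp_all add: lie_series_fgens)
  then have "a \<otimes>\<^bsub>\<Gamma>\<^esub> a' = (kd_class {0..n} (bch u v), id)"
    unfolding u(2) v(2) exp_t_sym_simps using u(1) v(1) by (simp add: exp_t_mult lie_series_fgens)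
  then show "a \<otimes>\<^bsub>\<Gamma>\<^esub> a' \<in> f_hat n \<times> {id}" using u(1) v(1) by (simp add: f_hat_eq lie_series_bch)
qed

lemma gen_in_image:
  assumes k: "k \<in> {1..n}" shows "mu_tilde n F \<mu>R P (pure_gen n 0 k) \<in> f_hat n \<times> {id}"
proof -
  have b: "(0, k) \<in> fgens n" using k by simp
  have "(kd_class {0..n} (image_log (0, k)), id) \<in> f_hat n \<times> {id :: nat \<Rightarrow> nat}"
    unfolding f_hat_eq by (intro SigmaI imageI image_log(1)[OF b] singletonI)
  then show ?thesis using image_log(3)[OF b] by (simp only: snd_conv)
qed

lemma free_subgroup_image:
  assumes "g \<in> carrier (free_subgroup n)"
  shows "g \<in> carrier (braid_group n) \<and> mu_tilde n F \<mu>R P g \<in> f_hat n \<times> {id}"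
  using assms unfolding free_subgroup_simps
proof (induction rule: generate.induct)
  case one
  have "\<one>\<^bsub>pure_braid_group n\<^esub> = \<one>\<^bsub>braid_group n\<^esub>" by (simp add: pure_braid_group_def)
  then show ?case
    using subgroup.one_closed[OF image_subgroup] braid.one_closed[of n] \<mu>.hom_one by (simp only: simp_thms)
next
  case (incl h)
  then obtain k where k: "k \<in> {1..n}" "h = pure_gen n 0 k" by blast
  show ?case unfolding k(2) by (intro conjI mu_tilde_pure_gen(1)[OF k(1)] gen_in_image[OF k(1)])
next
  case (inv h)
  then obtain k where k: "k \<in> {1..n}" "h = pure_gen n 0 k" by blast
  have hc: "h \<in> carrier (braid_group n)" using k mu_tilde_pure_gen(1)[OF k(1)] by simp
  have h: "mu_tilde n F \<mu>R P h \<in> f_hat n \<times> {id}" unfolding k(2) by (rule gen_in_image[OF k(1)])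
  have "inv\<^bsub>pure_braid_group n\<^esub> h = inv\<^bsub>braid_group n\<^esub> h"
    unfolding pure_braid_group_def
    by (rule braid.m_inv_consistent[OF pure_subgroup])
      (use k pure_gen_in_pure_braid[OF k(1)] in \<open>simp add: pure_braid_group_def\<close>)
  moreover have "mu_tilde n F \<mu>R P (inv\<^bsub>braid_group n\<^esub> h) = inv\<^bsub>\<Gamma>\<^esub> (mu_tilde n F \<mu>R P h)"
    by (rule \<mu>.hom_inv[OF hc])
  ultimately show ?case
    using subgroup.m_inv_closed[OF image_subgroup h] braid.inv_closed[OF hc] by (simp only: simp_thms)
next
  case (eng g h)
  then have gh: "g \<in> carrier (braid_group n)" "h \<in> carrier (braid_group n)" by blast+
  have "g \<otimes>\<^bsub>pure_braid_group n\<^esub> h = g \<otimes>\<^bsub>braid_group n\<^esub> h" by (simp add: pure_braid_group_def)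
  moreover have "mu_tilde n F \<mu>R P (g \<otimes>\<^bsub>braid_group n\<^esub> h) = mu_tilde n F \<mu>R P g \<otimes>\<^bsub>\<Gamma>\<^esub> mu_tilde n F \<mu>R P h"
    by (rule \<mu>.hom_mult[OF gh])
  ultimately show ?case
    using subgroup.m_closed[OF image_subgroup conjunct2[OF eng(3)] conjunct2[OF eng(4)]] braid.m_closed[OF gh]
    by (simp only: simp_thms)
qed

lemma mu_tilde_eq:
  "g \<in> carrier (free_subgroup n) \<Longrightarrow> mu_tilde n F \<mu>R P g = (mu_pure n F \<mu>R P g, id)"
  using free_subgroup_image[of g] by (cases "mu_tilde n F \<mu>R P g") (auto simp: mu_pure_def)

lemma mu_pure_closed: "g \<in> carrier (free_subgroup n) \<Longrightarrow> mu_pure n F \<mu>R P g \<in> f_hat n"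
  using free_subgroup_image[of g] mu_tilde_eq[of g] by simp

lemma mu_pure_mult:
  assumes g: "g \<in> carrier (free_subgroup n)" and h: "h \<in> carrier (free_subgroup n)"
  shows "mu_pure n F \<mu>R P (g \<otimes>\<^bsub>free_subgroup n\<^esub> h) = mu_pure n F \<mu>R P g \<otimes>\<^bsub>E\<^esub> mu_pure n F \<mu>R P h"
proof -
  have "mu_pure n F \<mu>R P h \<in> kd_hat {0..n}" using mu_pure_closed[OF h] by (auto simp: f_hat_eq lie_series_fgens)
  then have id: "perm_act {0..n} id (mu_pure n F \<mu>R P h) = mu_pure n F \<mu>R P h" by (intro perm_act_id) simp_all
  have "mu_tilde n F \<mu>R P (g \<otimes>\<^bsub>free_subgroup n\<^esub> h) = mu_tilde n F \<mu>R P g \<otimes>\<^bsub>\<Gamma>\<^esub> mu_tilde n F \<mu>R P h"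
    unfolding free_subgroup_simps using free_subgroup_image[OF g] free_subgroup_image[OF h] by (intro \<mu>.hom_mult) blast+
  then show ?thesis
    unfolding mu_tilde_eq[OF g] mu_tilde_eq[OF h] exp_t_sym_simps id by (simp add: mu_pure_def)
qed

lemma mu_pure_hom: "mu_pure n F \<mu>R P \<in> hom (free_subgroup n) (exp_f n)"
  by (rule homI) (simp_all add: mu_pure_closed mu_pure_mult)

definition expansion :: "braid \<Rightarrow> (nat \<times> nat, 'k) nc_series" where
  "expansion g = nc_exp (the_inv_into (lie_series (fgens n)) (kd_class {0..n}) (mu_pure n F \<mu>R P g))"

lemma expansion:
  assumes g: "g \<in> carrier (free_subgroup n)"
  shows "\<exists>u\<in>lie_series (fgens n). mu_pure n F \<mu>R P g = kd_class {0..n} u \<and> expansion g = nc_exp u"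
proof -
  obtain u where u: "u \<in> lie_series (fgens n)" "mu_pure n F \<mu>R P g = kd_class {0..n} u"
    using mu_pure_closed[OF g] by (auto simp: f_hat_eq)
  have "inj_on (kd_class {0..n}) (lie_series (fgens n) :: (nat \<times> nat, 'k) nc_series set)"
    by (rule inj_onI) (rule kd_class_inj)
  from the_inv_into_f_f[OF this u(1)] show ?thesis using u by (auto simp: expansion_def)
qed

lemma expansion_class:
  assumes g: "g \<in> carrier (free_subgroup n)" and u: "u \<in> lie_series (fgens n)"
    and eq: "mu_pure n F \<mu>R P g = kd_class {0..n} u"
  shows "expansion g = nc_exp u"
proof -
  obtain v where v: "v \<in> lie_series (fgens n)" "mu_pure n F \<mu>R P g = kd_class {0..n} v" "expansion g = nc_exp v"
    using expansion[OF g] by blast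
  have "v = u" by (rule kd_class_inj[OF v(1) u]) (simp only: v(2)[symmetric] eq)
  then show ?thesis using v(3) by simp
qed

lemma pure_gen_free: "k \<in> {1..n} \<Longrightarrow> pure_gen n 0 k \<in> carrier (free_subgroup n)"
  unfolding free_subgroup_simps by (auto intro: generate.incl)

lemma expansion_gen:
  assumes b: "b \<in> fgens n" shows "expansion (pure_gen n 0 (snd b)) = nc_exp (image_log b)"
  by (rule expansion_class) (use b image_log[OF b] in \<open>auto intro: pure_gen_free simp: mu_pure_def\<close>)

text \<open>Sending a braid of the free subgroup to its image is a Magnus expansion: the group-like
  series \<open>exp (x\<^sub>k + \<dots>)\<close> attached to the generators are \<open>1 + x\<^sub>k\<close> modulo order two.\<close>

sublocale magnus "free_subgroup n" "fgens n" "\<lambda>b. pure_gen n 0 (snd b)" expansion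
proof -
  interpret group "free_subgroup n" by (rule group_free_subgroup)
  show "magnus (free_subgroup n) (fgens n) (\<lambda>b. pure_gen n 0 (snd b)) expansion"
  proof
    show "finite (fgens n)" by simp
    show "pure_gen n 0 (snd b) \<in> carrier (free_subgroup n)" if "b \<in> fgens n" for b
      using that by (auto intro: pure_gen_free)
    show "carrier (free_subgroup n) = generate (free_subgroup n) ((\<lambda>b. pure_gen n 0 (snd b)) ` fgens n)"
      using free_subgroup_generated[of n] by (simp add: image_image)
    show "expansion (g \<otimes>\<^bsub>free_subgroup n\<^esub> h) = expansion g * expansion h"
      if gh: "g \<in> carrier (free_subgroup n)" "h \<in> carrier (free_subgroup n)" for g h
    proof -
      obtain u v where u: "u \<in> lie_series (fgens n)" "mu_pure n F \<mu>R P g = kd_class {0..n} u" "expansion g = nc_exp u"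
        and v: "v \<in> lie_series (fgens n)" "mu_pure n F \<mu>R P h = kd_class {0..n} v" "expansion h = nc_exp v"
        using expansion[OF gh(1)] expansion[OF gh(2)] by blast
      have "expansion (g \<otimes>\<^bsub>free_subgroup n\<^esub> h) = nc_exp (bch u v)"
      proof (rule expansion_class)
        show "g \<otimes>\<^bsub>free_subgroup n\<^esub> h \<in> carrier (free_subgroup n)" using gh by (rule m_closed)
        show "bch u v \<in> lie_series (fgens n)" by (rule lie_series_bch[OF u(1) v(1)])
        show "mu_pure n F \<mu>R P (g \<otimes>\<^bsub>free_subgroup n\<^esub> h) = kd_class {0..n} (bch u v)"
          unfolding mu_pure_mult[OF gh] u(2) v(2) using u(1) v(1) by (simp add: exp_t_mult lie_series_fgens)
      qed
      then show ?thesis using u v by (simp add: exp_bch lie_series_order)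
    qed
    show "\<exists>u\<in>lie_series (fgens n). expansion g = nc_exp u" if "g \<in> carrier (free_subgroup n)" for g
      using expansion[OF that] by blast
    show "eq_upto 2 (expansion (pure_gen n 0 (snd b))) (1 + nc_var b)" if b: "b \<in> fgens n" for b
    proof -
      have o: "order_ge 1 (image_log b)" by (rule lie_series_order[OF image_log(1)[OF b]])
      have "eq_upto 2 (nc_exp (image_log b) - 1) (image_log b)"
        using exp_leading[OF order_refl o] by (simp add: eq_upto_def less_Suc_eq numeral_2_eq_2 One_nat_def)
      from eq_upto_add[OF eq_upto_refl[of 2 1] eq_upto_trans[OF this image_log(2)[OF b]]]
      show ?thesis unfolding expansion_gen[OF b] by simp
    qed
  qed
qed

sublocale near_identity "fgens n" image_log
  by (rule near_identity.intro) (simp_all only: image_log finite_imageI finite_atLeastAtMost)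

section \<open>The isomorphism with the completion and the tangential automorphism\<close>

abbreviation "FK \<equiv> completion (free_subgroup n) :: (nat \<Rightarrow> (braid \<Rightarrow>\<^sub>0 'k) set, 'k) prounip"
abbreviation "EL \<equiv> exp_lie (fgens n) :: ((nat \<times> nat, 'k) nc_series, 'k) prounip"
abbreviation "EF \<equiv> exp_f n :: ('k kd, 'k) prounip"

definition series_log :: "(nat \<Rightarrow> (braid \<Rightarrow>\<^sub>0 'k) set) \<Rightarrow> (nat \<times> nat, 'k) nc_series" where
  "series_log = the_inv_into (carrier EL) (\<lambda>u. of_series (nc_exp u))"

lemma series_log_iso: "series_log \<in> prounip_iso FK EL"
  and series_log_exp: "u \<in> lie_series (fgens n) \<Longrightarrow> series_log (of_series (nc_exp u)) = u"
  using prounip_iso_inverse[OF completion_iso prounip_closed_exp_lie] by (simp_all add: series_log_def)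

lemma series_log_braid:
  assumes g: "g \<in> carrier (free_subgroup n)"
  shows "kd_class {0..n} (series_log (to_completion (free_subgroup n) g)) = mu_pure n F \<mu>R P g"
proof -
  obtain u where u: "u \<in> lie_series (fgens n)" "mu_pure n F \<mu>R P g = kd_class {0..n} u" "expansion g = nc_exp u"
    using expansion[OF g] by blast
  show ?thesis unfolding to_completion_of_series[OF g] u(2,3) series_log_exp[OF u(1)] ..
qed

theorem completed_iso: "kd_class {0..n} \<circ> series_log \<in> prounip_iso FK EF"
  by (rule prounip_iso_comp[OF series_log_iso kd_class_prounip_iso prounip_closed_completion
        prounip_closed_exp_lie prounip_closed_exp_f])

definition rep :: "'k kd \<Rightarrow> (nat \<times> nat, 'k) nc_series" where
  "rep = the_inv_into (carrier EL) (kd_class {0..n})"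

lemma rep_iso: "rep \<in> prounip_iso EF EL"
  and rep_class: "u \<in> lie_series (fgens n) \<Longrightarrow> rep (kd_class {0..n} u) = u"
  using prounip_iso_inverse[OF kd_class_prounip_iso prounip_closed_exp_lie] by (simp_all add: rep_def)

lemma gen_image:
  assumes i: "i \<in> {1..n}"
  shows "to_completion (free_subgroup n) (pure_gen n 0 i) = of_series (nc_exp (image_log (0, i)))"
  using expansion_gen[of "(0, i)"] i by (simp add: to_completion_of_series[OF pure_gen_free[OF i]])

lemma tgen_fgens: "i \<in> {1..n} \<Longrightarrow> (tgen 0 i :: (nat \<times> nat, 'k) nc_series) \<in> lie_series (fgens n)"
  unfolding tgen_def by (intro lie_series_var) simp

lemma ex_generator_iso:
  "\<exists>\<psi>\<in>prounip_iso EF FK. \<forall>i\<in>{1..n}. \<psi> (kd_exp {0..n} (tgen 0 i)) =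
     to_completion (free_subgroup n) (pure_gen n 0 i)"
proof (intro bexI ballI)
  let ?\<psi> = "(\<lambda>u. of_series (nc_exp u)) \<circ> (\<alpha> \<circ> rep)"
  show "?\<psi> \<in> prounip_iso EF FK"
    by (intro prounip_iso_comp[OF prounip_iso_comp[OF rep_iso subst_prounip_iso] completion_iso]
        prounip_closed_completion prounip_closed_exp_lie prounip_closed_exp_f)
  fix i assume i: "i \<in> {1..n}"
  have "\<alpha> (tgen 0 i) = image_log (0, i)" unfolding tgen_def by (rule subst_var) (use i in simp)
  then show "?\<psi> (kd_exp {0..n} (tgen 0 i)) = to_completion (free_subgroup n) (pure_gen n 0 i)"
    using tgen_fgens[OF i] by (simp add: kd_exp_def rep_class gen_image[OF i])
qed

lemma generator_iso_eq_subst: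
  assumes \<psi>: "\<psi> \<in> prounip_iso EF FK"
    and gens: "\<And>i. i \<in> {1..n} \<Longrightarrow> \<psi> (kd_exp {0..n} (tgen 0 i)) = to_completion (free_subgroup n) (pure_gen n 0 i)"
    and u: "u \<in> lie_series (fgens n)"
  shows "series_log (\<psi> (kd_class {0..n} u)) = \<alpha> u"
proof -
  have "(series_log \<circ> (\<psi> \<circ> kd_class {0..n})) u = \<alpha> u"
  proof (rule prounip_hom_unique[OF _ _ _ u])
    show "series_log \<circ> (\<psi> \<circ> kd_class {0..n}) \<in> prounip_hom EL EL"
    proof (intro prounip_hom_comp[where H = FK] prounip_hom_comp[where H = EF])
      show "series_log \<in> prounip_hom FK EL" using series_log_iso by (simp add: prounip_iso_def)
      show "\<psi> \<in> prounip_hom EF FK" using \<psi> by (simp add: prounip_iso_def)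
      show "kd_class {0..n} \<in> prounip_hom EL EF"
        using kd_class_prounip_iso[where n = n and 'k = 'k] by (simp add: prounip_iso_def)
    qed
    show "\<alpha> \<in> prounip_hom EL EL" using subst_prounip_iso by (simp add: prounip_iso_def)
    fix b assume b: "b \<in> fgens n"
    then obtain i where i: "i \<in> {1..n}" "b = (0, i)" by auto
    have "(series_log \<circ> (\<psi> \<circ> kd_class {0..n})) (nc_var b) = series_log (\<psi> (kd_exp {0..n} (tgen 0 i)))"
      by (simp add: i(2) tgen_def kd_exp_def)
    also have "\<dots> = image_log b"
      unfolding gens[OF i(1)] gen_image[OF i(1)] using image_log(1)[OF b] i(2) by (simp add: series_log_exp)
    also have "\<dots> = \<alpha> (nc_var b)" by (rule subst_var[OF b, symmetric])
    finally show "(series_log \<circ> (\<psi> \<circ> kd_class {0..n})) (nc_var b) = \<alpha> (nc_var b)" .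
  qed
  then show ?thesis by simp
qed

text \<open>Under the identification of \<open>F\<^sub>n(k)\<close> with \<open>exp\<close> of the free Lie algebra, the composite is
  substitution of \<open>U\<^sub>k x\<^sub>k U\<^sub>k\<^sup>-\<^sup>1\<close> for \<open>x\<^sub>k\<close>, hence compatible with the Lie algebra operations.\<close>

theorem composite_TAut:
  assumes \<psi>: "\<psi> \<in> prounip_iso EF FK"
    and gens: "\<And>i. i \<in> {1..n} \<Longrightarrow> \<psi> (kd_exp {0..n} (tgen 0 i)) = to_completion (free_subgroup n) (pure_gen n 0 i)"
  shows "kd_class {0..n} \<circ> series_log \<circ> \<psi> \<in> TAut n"
proof -
  let ?\<theta> = "kd_class {0..n} \<circ> series_log \<circ> \<psi>"
  have iso: "?\<theta> \<in> prounip_iso EF EF"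
    by (rule prounip_iso_comp[OF \<psi> completed_iso prounip_closed_exp_f prounip_closed_completion prounip_closed_exp_f])
  have \<theta>: "?\<theta> (kd_class {0..n} u) = kd_class {0..n} (\<alpha> u)" if "u \<in> lie_series (fgens n)" for u
    using generator_iso_eq_subst[OF \<psi> gens that] by simp
  have lift2: "kd_lift2 {0..n} f (kd_class {0..n} u) (kd_class {0..n} v) = kd_class {0..n} (f u v)"
    if "u \<in> lie_series (fgens n)" "v \<in> lie_series (fgens n)"
      "\<And>u u' v v'. kd.congr {0..n} u u' \<Longrightarrow> kd.congr {0..n} v v' \<Longrightarrow> kd.congr {0..n} (f u v) (f u' v')"
    for f :: "(nat \<times> nat, 'k) nc_series \<Rightarrow> (nat \<times> nat, 'k) nc_series \<Rightarrow> (nat \<times> nat, 'k) nc_series" and u v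
    using that by (intro kd_lift2_class) (simp_all add: lie_series_fgens)
  have lift: "kd_lift {0..n} (nc_scale c) (kd_class {0..n} u) = kd_class {0..n} (nc_scale c u)"
    if "u \<in> lie_series (fgens n)" for c and u :: "(nat \<times> nat, 'k) nc_series"
    using that by (intro kd_lift_class) (simp_all add: lie_series_fgens kd.congr_scale)
  show ?thesis
    unfolding TAut_def
  proof (intro CollectI conjI ballI allI)
    show "bij_betw ?\<theta> (f_hat n) (f_hat n)" using iso by (simp add: prounip_iso_def)
    show "\<exists>M. ?\<theta> ` fil EF M \<subseteq> fil EF N" for N
      using iso unfolding prounip_iso_def prounip_hom_def by blast
    have "the_inv_into (f_hat n) ?\<theta> \<in> prounip_hom EF EF" using iso by (simp add: prounip_iso_def)
    then show "\<exists>M. the_inv_into (f_hat n) ?\<theta> ` fil EF M \<subseteq> fil EF N" for N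
      unfolding prounip_hom_def by blast
  next
    fix X Y :: "'k kd" and c :: 'k assume "X \<in> f_hat n"
    then obtain u where u: "u \<in> lie_series (fgens n)" "X = kd_class {0..n} u" by (auto simp: f_hat_eq)
    show "?\<theta> (kd_lift {0..n} (nc_scale c) X) = kd_lift {0..n} (nc_scale c) (?\<theta> X)"
      using u by (simp only: \<theta> lift lie_series_scale \<alpha>_lie subst_scale)
    assume "Y \<in> f_hat n"
    then obtain v where v: "v \<in> lie_series (fgens n)" "Y = kd_class {0..n} v" by (auto simp: f_hat_eq)
    show "?\<theta> (kd_lift2 {0..n} (+) X Y) = kd_lift2 {0..n} (+) (?\<theta> X) (?\<theta> Y)"
      using u v by (simp only: \<theta> lift2 kd.congr_add lie_series_add \<alpha>_lie subst_add)
    show "?\<theta> (kd_lift2 {0..n} commutator X Y) = kd_lift2 {0..n} commutator (?\<theta> X) (?\<theta> Y)"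
      using u v by (simp only: \<theta> lift2 kd.congr_commutator lie_series_commutator \<alpha>_lie subst_commutator)
  next
    fix k assume k: "k \<in> {1..n}"
    let ?x = "tgen 0 k :: (nat \<times> nat, 'k) nc_series"
    let ?f = "\<lambda>u x :: (nat \<times> nat, 'k) nc_series. nc_exp u * x * nc_exp (- u)"
    have c: "kd.congr {0..n} (?f u x) (?f v y)" if "kd.congr {0..n} u v" "kd.congr {0..n} x y" for u v x y
      using kd.congr_Ad[OF that] kd.congr_order[OF that(1)] by (simp add: exp_conj_eq_Ad)
    have "kd_lift2 {0..n} ?f (kd_class {0..n} (conj_log k)) (kd_class {0..n} ?x) = kd_class {0..n} (?f (conj_log k) ?x)"
      by (rule lift2[OF conj_log(1)[OF k] tgen_fgens[OF k]]) (rule c)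
    also have "?f (conj_log k) ?x = \<alpha> ?x"
      using k lie_series_order[OF conj_log(1)[OF k]] by (simp add: exp_conj_eq_Ad tgen_def subst_var image_log_def)
    finally have "?\<theta> (kd_class {0..n} ?x) = kd_lift2 {0..n} ?f (kd_class {0..n} (conj_log k)) (kd_class {0..n} ?x)"
      using \<theta>[OF tgen_fgens[OF k]] by simp
    moreover have "kd_class {0..n} (conj_log k) \<in> f_hat n" using conj_log(1)[OF k] by (simp add: f_hat_eq)
    ultimately show "\<exists>U\<in>f_hat n. ?\<theta> (kd_class {0..n} ?x) = kd_lift2 {0..n} ?f U (kd_class {0..n} ?x)"
      by blast
  qed
qed

end

theorem proposition3p1:
  fixes \<Phi> :: "'k::field_char_0 kd"
    and n :: nat
    and P :: pword
    and F :: "pword \<Rightarrow> pword \<Rightarrow> 'k kd"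
    and \<mu>R :: "braid \<Rightarrow> 'k kd \<times> (nat \<Rightarrow> nat)"
  assumes "\<Phi> \<in> M1"
    and "P \<in> pwords n"
    and "assoc_family n \<Phi> F"
    and "mu_R_morphism n \<Phi> \<mu>R"
  shows "mu_pure n F \<mu>R P \<in> hom (free_subgroup n) (exp_f n) \<and>
    (\<exists>\<mu> \<in> prounip_iso (completion (free_subgroup n)) (exp_f n).
       (\<forall>g\<in>carrier (free_subgroup n).
          \<mu> (to_completion (free_subgroup n) g) = mu_pure n F \<mu>R P g) \<and>
       (\<exists>\<psi> \<in> prounip_iso (exp_f n :: ('k kd, 'k) prounip) (completion (free_subgroup n)).
          \<forall>i\<in>{1..n}. \<psi> (kd_exp {0..n} (tgen 0 i)) =
            to_completion (free_subgroup n) (pure_gen n 0 i)) \<and>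
       (\<forall>\<psi> \<in> prounip_iso (exp_f n) (completion (free_subgroup n)).
          (\<forall>i\<in>{1..n}. \<psi> (kd_exp {0..n} (tgen 0 i)) =
            to_completion (free_subgroup n) (pure_gen n 0 i)) \<longrightarrow>
          \<mu> \<circ> \<psi> \<in> TAut n))"
proof -
  have "\<Phi> \<in> kd_hat {1..3}" using assms(1) by (simp add: M1_def)
  then interpret braid_representation \<Phi> n P F \<mu>R
    by (rule braid_representation.intro[OF _ assms(2-4)])
  show ?thesis
  proof (intro conjI bexI[of _ "kd_class {0..n} \<circ> series_log"] ballI impI)
    show "mu_pure n F \<mu>R P \<in> hom (free_subgroup n) (exp_f n)" by (rule mu_pure_hom)
    show "kd_class {0..n} \<circ> series_log \<in> prounip_iso FK EF" by (rule completed_iso)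
    show "(kd_class {0..n} \<circ> series_log) (to_completion (free_subgroup n) g) = mu_pure n F \<mu>R P g"
      if "g \<in> carrier (free_subgroup n)" for g
      using series_log_braid[OF that] by simp
    show "\<exists>\<psi>\<in>prounip_iso EF FK. \<forall>i\<in>{1..n}. \<psi> (kd_exp {0..n} (tgen 0 i)) =
        to_completion (free_subgroup n) (pure_gen n 0 i)"
      by (rule ex_generator_iso)
    show "kd_class {0..n} \<circ> series_log \<circ> \<psi> \<in> TAut n"
      if "\<psi> \<in> prounip_iso EF FK"
        "\<forall>i\<in>{1..n}. \<psi> (kd_exp {0..n} (tgen 0 i)) = to_completion (free_subgroup n) (pure_gen n 0 i)" for \<psi>
      using composite_TAut[OF that(1)] that(2) by blast
  qed
qed

end
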